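(* Let $m,n\ge 1$. The commutative superalgebras $k[GL(m|n)]$ and $k[SL(m|n)]$ are (super)bialgebras, with comultiplication $\Delta$ and counit $\epsilon$ the superalgebra homomorphisms given on generators (or, for $k[SL(m|n)]$, on their classes) by $$\Delta(a_{ij})=\sum_{k=1}^{m+n} a_{ik}\otimes a_{kj},$$ $$\Delta(d_1^{-1})=\sum_{i=1}^{2mn+2}(-1)^{i-1}\,(d_1^{-i}\otimes d_1^{-i})\,\bigl(\Delta(d_1)-d_1\otimes d_1\bigr)^{i-1},$$ $$\Delta(d_2^{-1})=\sum_{i=1}^{2mn+2}(-1)^{i-1}\,(d_2^{-i}\otimes d_2^{-i})\,\bigl(\Delta(d_2)-d_2\otimes d_2\bigr)^{i-1},$$ $$\epsilon(a_{ij})=\delta_{ij},\qquad \epsilon(d_1^{-1})=1,\qquad \epsilon(d_2^{-1})=1 ,$$ where $1\le i,j\le m+n$ in the formulas for $a_{ij}$, and $\Delta(d_1),\Delta(d_2)$ are obtained by applying $\Delta$ multiplicatively to the determinants $d_1,d_2$ in the $a_{ij}$.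
   Context: $k$ is an algebraically closed field. A superalgebra is a $\mathbb{Z}_2$-graded algebra; it is commutative if $xy=(-1)^{p(x)p(y)}yx$ for homogeneous $x,y$, $p$ denoting parity. Tensor products of superalgebras carry the product $(a\otimes b)(c\otimes d)=(-1)^{p(b)p(c)}ac\otimes bd$; bialgebra is meant in the super sense (with $\Delta,\epsilon$ parity-preserving superalgebra homomorphisms). Let $a_{ij}$, $1\le i,j\le m+n$, be variables. For $1\le i,j\le m$ or $m+1\le i,j\le m+n$, $a_{ij}=x_{ij}$ is even; otherwise $a_{ij}=\xi_{ij}$ is odd. Even variables are central, odd variables anticommute with each other and square to zero. Put $X_{11}=(x_{ij})_{1\le i,j\le m}$, $X_{22}=(x_{ij})_{m+1\le i,j\le m+n}$, $\Xi_{12}=(\xi_{kl})_{1\le k\le m,\,m+1\le l\le m+n}$, $\Xi_{21}=(\xi_{kl})_{m+1\le k\le m+n,\,1\le l\le m}$, $d_1=\det(X_{11})$, $d_2=\det(X_{22})$. $k[GL(m|n)]=k[x_{ij},\xi_{kl},d_1^{-1},d_2^{-1}]$ is the free commutative superalgebra on the $a_{ij}$ with even inverses $d_1^{-1},d_2^{-1}$ of $d_1,d_2$ adjoined; $d^{-i}$ means $(d^{-1})^i$. In it $X_{11},X_{22}$ are invertible matrices; the Berezinian is $\mathrm{Ber}=\det(X_{22}^{-1})\det(X_{11}-\Xi_{12}X_{22}^{-1}\Xi_{21})$. $k[SL(m|n)]=k[GL(m|n)]/(\mathrm{Ber}-1)$. *)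

theory Defs
  imports
    "HOL-Combinatorics.Permutations"
    "HOL-Computational_Algebra.Polynomial"
    "HOL-Library.Poly_Mapping"
    "HOL-Library.Z2"
    "HOL-Algebra.Module"
    "HOL-Algebra.QuotRing"
begin

section \<open>Superalgebras\<close>

text \<open>
  The scalars are a type \<open>'k\<close> of class \<^class>\<open>field\<close>; algebras are records with an explicit
  carrier.  Parities live in the field \<^typ>\<open>bit\<close>.
\<close>

record ('k, 'a) superalg = "('k, 'a) module" +
  part :: "bit \<Rightarrow> 'a set"

definition koszul_sign :: "bit \<Rightarrow> bit \<Rightarrow> 'k::field" where
  "koszul_sign p q = (if p = 1 \<and> q = 1 then - 1 else 1)"

text \<open>The base field, regarded as a purely even superalgebra over itself.\<close>

definition ground :: "('k::field, 'k) superalg" where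
  "ground = \<lparr>carrier = UNIV, mult = (*), one = 1, zero = 0, add = (+), smult = (*),
    part = (\<lambda>p. if p = 0 then UNIV else {0})\<rparr>"

locale superalgebra = ring A + module "ground :: ('k::field, 'k) superalg" A
  for A :: "('k::field, 'a) superalg" (structure) +
  assumes smult_mult_left:
      "\<lbrakk>x \<in> carrier A; y \<in> carrier A\<rbrakk> \<Longrightarrow> (c \<odot> x) \<otimes> y = c \<odot> (x \<otimes> y)"
    and smult_mult_right:
      "\<lbrakk>x \<in> carrier A; y \<in> carrier A\<rbrakk> \<Longrightarrow> x \<otimes> (c \<odot> y) = c \<odot> (x \<otimes> y)"
    and part_submodule: "submodule (part A p) (ground :: ('k, 'k) superalg) A"
    and part_sum: "x \<in> carrier A \<Longrightarrow> \<exists>y \<in> part A 0. \<exists>z \<in> part A 1. x = y \<oplus> z"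
    and part_Int: "part A 0 \<inter> part A 1 = {\<zero>}"
    and part_mult: "\<lbrakk>x \<in> part A p; y \<in> part A q\<rbrakk> \<Longrightarrow> x \<otimes> y \<in> part A (p + q)"

locale commutative_superalgebra = superalgebra +
  assumes supercomm:
    "\<lbrakk>x \<in> part A p; y \<in> part A q\<rbrakk> \<Longrightarrow> x \<otimes> y = koszul_sign p q \<odot> (y \<otimes> x)"

definition superalg_hom ::
    "('k::field, 'a) superalg \<Rightarrow> ('k, 'b) superalg \<Rightarrow> ('a \<Rightarrow> 'b) set" where
  "superalg_hom A B = {f \<in> ring_hom A B.
     (\<forall>c. \<forall>x \<in> carrier A. f (c \<odot>\<^bsub>A\<^esub> x) = c \<odot>\<^bsub>B\<^esub> f x) \<and>
     (\<forall>p. \<forall>x \<in> part A p. f x \<in> part B p)}"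

text \<open>The homogeneous component of parity \<open>p\<close>.\<close>

definition component :: "('k::field, 'a) superalg \<Rightarrow> bit \<Rightarrow> 'a \<Rightarrow> 'a" where
  "component A p x = (THE y. y \<in> part A p \<and> (\<exists>z \<in> part A (p + 1). x = y \<oplus>\<^bsub>A\<^esub> z))"

text \<open>The quotient by a two-sided ideal; the gradings of interest come from homogeneous ideals.\<close>

definition quotient_superalg ::
    "('k::field, 'a) superalg \<Rightarrow> 'a set \<Rightarrow> ('k, 'a set) superalg" where
  "quotient_superalg A I =
    \<lparr>carrier = carrier (A Quot I), mult = mult (A Quot I), one = one (A Quot I),
     zero = zero (A Quot I), add = add (A Quot I),
     smult = (\<lambda>c X. \<Union>x \<in> X. I +>\<^bsub>A\<^esub> (c \<odot>\<^bsub>A\<^esub> x)),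
     part = (\<lambda>p. (\<lambda>x. I +>\<^bsub>A\<^esub> x) ` part A p)\<rparr>"


section \<open>Tensor products\<close>

text \<open>
  \<open>'x \<Rightarrow>\<^sub>0 'k\<close> is the free vector space on \<open>'x\<close>.
\<close>

definition fscale :: "'k::field \<Rightarrow> ('x \<Rightarrow>\<^sub>0 'k) \<Rightarrow> ('x \<Rightarrow>\<^sub>0 'k)" where
  "fscale c f = Poly_Mapping.map ((*) c) f"

lemma lookup_fscale [simp]: "Poly_Mapping.lookup (fscale c f) x = c * Poly_Mapping.lookup f x"
  by (simp add: fscale_def Poly_Mapping.map.rep_eq when_def)

global_interpretation fvs: vector_space fscale
  by unfold_locales (auto intro!: poly_mapping_eqI simp: lookup_add algebra_simps)

definition tensor_relators ::
    "('k::field, 'a) superalg \<Rightarrow> ('k, 'b) superalg \<Rightarrow> ('a \<times> 'b \<Rightarrow>\<^sub>0 'k) set" where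
  "tensor_relators A B =
     {Poly_Mapping.single (a \<oplus>\<^bsub>A\<^esub> a', b) 1
        - Poly_Mapping.single (a, b) 1 - Poly_Mapping.single (a', b) 1 | a a' b.
        a \<in> carrier A \<and> a' \<in> carrier A \<and> b \<in> carrier B} \<union>
     {Poly_Mapping.single (a, b \<oplus>\<^bsub>B\<^esub> b') 1
        - Poly_Mapping.single (a, b) 1 - Poly_Mapping.single (a, b') 1 | a b b'.
        a \<in> carrier A \<and> b \<in> carrier B \<and> b' \<in> carrier B} \<union>
     {Poly_Mapping.single (c \<odot>\<^bsub>A\<^esub> a, b) 1 - Poly_Mapping.single (a, b) c | c a b.
        a \<in> carrier A \<and> b \<in> carrier B} \<union>
     {Poly_Mapping.single (a, c \<odot>\<^bsub>B\<^esub> b) 1 - Poly_Mapping.single (a, b) c | c a b.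
        a \<in> carrier A \<and> b \<in> carrier B}"

definition tensor_class ::
    "('k::field, 'a) superalg \<Rightarrow> ('k, 'b) superalg \<Rightarrow> ('a \<times> 'b \<Rightarrow>\<^sub>0 'k) \<Rightarrow> ('a \<times> 'b \<Rightarrow>\<^sub>0 'k) set" where
  "tensor_class A B f = {g. g - f \<in> fvs.span (tensor_relators A B)}"

definition tensor_rep :: "('a \<times> 'b \<Rightarrow>\<^sub>0 'k::field) set \<Rightarrow> ('a \<times> 'b \<Rightarrow>\<^sub>0 'k)" where
  "tensor_rep X = (SOME f. f \<in> X)"

definition tens ::
    "('k::field, 'a) superalg \<Rightarrow> ('k, 'b) superalg \<Rightarrow> 'a \<Rightarrow> 'b \<Rightarrow> ('a \<times> 'b \<Rightarrow>\<^sub>0 'k) set" where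
  "tens A B a b = tensor_class A B (Poly_Mapping.single (a, b) 1)"

text \<open>
  The linear map out of the tensor product that is induced by a bilinear map \<open>\<phi>\<close> into \<open>C\<close>.
\<close>

definition tensor_lift ::
    "('k::field, 'c, 'z) module_scheme \<Rightarrow> ('a \<Rightarrow> 'b \<Rightarrow> 'c) \<Rightarrow> ('a \<times> 'b \<Rightarrow>\<^sub>0 'k) set \<Rightarrow> 'c" where
  "tensor_lift C \<phi> X =
     (\<Oplus>\<^bsub>C\<^esub>u \<in> Poly_Mapping.keys (tensor_rep X).
        Poly_Mapping.lookup (tensor_rep X) u \<odot>\<^bsub>C\<^esub> \<phi> (fst u) (snd u))"

text \<open>
  The bilinear extension, on representatives, of
  \<open>(a \<otimes> b)(c \<otimes> d) = (-1)\<^bsup>p(b)p(c)\<^esup> ac \<otimes> bd\<close>, where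
  \<open>b\<close> and \<open>c\<close> are split into their homogeneous components.
\<close>

definition tensor_mult_rep ::
    "('k::field, 'a) superalg \<Rightarrow> ('k, 'b) superalg \<Rightarrow>
      ('a \<times> 'b \<Rightarrow>\<^sub>0 'k) \<Rightarrow> ('a \<times> 'b \<Rightarrow>\<^sub>0 'k) \<Rightarrow> ('a \<times> 'b \<Rightarrow>\<^sub>0 'k)" where
  "tensor_mult_rep A B f g =
     (\<Sum>(a, b) \<in> Poly_Mapping.keys f. \<Sum>(c, d) \<in> Poly_Mapping.keys g. \<Sum>p \<in> UNIV. \<Sum>q \<in> UNIV.
        Poly_Mapping.single (a \<otimes>\<^bsub>A\<^esub> component A q c, component B p b \<otimes>\<^bsub>B\<^esub> d)
          (koszul_sign p q * Poly_Mapping.lookup f (a, b) * Poly_Mapping.lookup g (c, d)))"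

definition tensor ::
    "('k::field, 'a) superalg \<Rightarrow> ('k, 'b) superalg \<Rightarrow> ('k, ('a \<times> 'b \<Rightarrow>\<^sub>0 'k) set) superalg" where
  "tensor A B =
    \<lparr>carrier = tensor_class A B ` {f. Poly_Mapping.keys f \<subseteq> carrier A \<times> carrier B},
     mult = (\<lambda>X Y. tensor_class A B (tensor_mult_rep A B (tensor_rep X) (tensor_rep Y))),
     one = tens A B \<one>\<^bsub>A\<^esub> \<one>\<^bsub>B\<^esub>,
     zero = tensor_class A B 0,
     add = (\<lambda>X Y. tensor_class A B (tensor_rep X + tensor_rep Y)),
     smult = (\<lambda>c X. tensor_class A B (fscale c (tensor_rep X))),
     part = (\<lambda>p. tensor_class A B `
       {f. Poly_Mapping.keys f \<subseteq> (\<Union>q. part A q \<times> part B (p + q))})\<rparr>"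


section \<open>Superbialgebras\<close>

text \<open>
  \<open>f \<otimes> g\<close> on \<open>A \<otimes> B\<close> for even linear maps \<open>f\<close> into \<open>C\<close> and \<open>g\<close> into \<open>D\<close> (so no sign occurs), and
  the isomorphism \<open>(A \<otimes> B) \<otimes> C \<rightarrow> A \<otimes> (B \<otimes> C)\<close>.
\<close>

definition tensor_map ::
    "('k::field, 'c) superalg \<Rightarrow> ('k, 'd) superalg \<Rightarrow> ('a \<Rightarrow> 'c) \<Rightarrow> ('b \<Rightarrow> 'd) \<Rightarrow>
      ('a \<times> 'b \<Rightarrow>\<^sub>0 'k) set \<Rightarrow> ('c \<times> 'd \<Rightarrow>\<^sub>0 'k) set" where
  "tensor_map C D f g = tensor_lift (tensor C D) (\<lambda>a b. tens C D (f a) (g b))"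

definition tensor_assoc ::
    "('k::field, 'a) superalg \<Rightarrow> ('k, 'b) superalg \<Rightarrow> ('k, 'c) superalg \<Rightarrow>
      (('a \<times> 'b \<Rightarrow>\<^sub>0 'k) set \<times> 'c \<Rightarrow>\<^sub>0 'k) set \<Rightarrow> ('a \<times> ('b \<times> 'c \<Rightarrow>\<^sub>0 'k) set \<Rightarrow>\<^sub>0 'k) set" where
  "tensor_assoc A B C =
     tensor_lift (tensor A (tensor B C))
       (\<lambda>X c. tensor_lift (tensor A (tensor B C))
         (\<lambda>a b. tens A (tensor B C) a (tens B C b c)) X)"

locale superbialgebra = superalgebra A
  for A :: "('k::field, 'a) superalg" (structure) +
  fixes \<Delta> :: "'a \<Rightarrow> ('a \<times> 'a \<Rightarrow>\<^sub>0 'k) set" and \<epsilon> :: "'a \<Rightarrow> 'k"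
  assumes comult_hom: "\<Delta> \<in> superalg_hom A (tensor A A)"
    and counit_hom: "\<epsilon> \<in> superalg_hom A ground"
    and coassoc: "x \<in> carrier A \<Longrightarrow>
      tensor_assoc A A A (tensor_map (tensor A A) A \<Delta> (\<lambda>y. y) (\<Delta> x)) =
      tensor_map A (tensor A A) (\<lambda>y. y) \<Delta> (\<Delta> x)"
    and counit_left: "x \<in> carrier A \<Longrightarrow> tensor_lift A (\<lambda>a b. \<epsilon> a \<odot> b) (\<Delta> x) = x"
    and counit_right: "x \<in> carrier A \<Longrightarrow> tensor_lift A (\<lambda>a b. \<epsilon> b \<odot> a) (\<Delta> x) = x"


section \<open>Determinants and the Berezinian\<close>

text \<open>
  Matrices are functions on pairs of indices.  The ring need not be commutative, so the factors of
  each term of the determinant are multiplied in increasing order of the row index; this order is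
  immaterial for the matrices with commuting (even) entries considered below.
\<close>

definition mat_det :: "('k::field, 'a) superalg \<Rightarrow> nat set \<Rightarrow> (nat \<Rightarrow> nat \<Rightarrow> 'a) \<Rightarrow> 'a" where
  "mat_det A I M =
     (\<Oplus>\<^bsub>A\<^esub>\<sigma> \<in> {\<sigma>. \<sigma> permutes I}.
        of_int (sign \<sigma>) \<odot>\<^bsub>A\<^esub>
          foldr (\<lambda>i y. M i (\<sigma> i) \<otimes>\<^bsub>A\<^esub> y) (sorted_list_of_set I) \<one>\<^bsub>A\<^esub>)"

definition is_mat_inv ::
    "('k::field, 'a) superalg \<Rightarrow> nat set \<Rightarrow> (nat \<Rightarrow> nat \<Rightarrow> 'a) \<Rightarrow> (nat \<Rightarrow> nat \<Rightarrow> 'a) \<Rightarrow> bool" where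
  "is_mat_inv A I M Y \<longleftrightarrow>
     (\<forall>i \<in> I. \<forall>j \<in> I. Y i j \<in> carrier A \<and>
        (\<Oplus>\<^bsub>A\<^esub>l \<in> I. M i l \<otimes>\<^bsub>A\<^esub> Y l j) = (if i = j then \<one>\<^bsub>A\<^esub> else \<zero>\<^bsub>A\<^esub>) \<and>
        (\<Oplus>\<^bsub>A\<^esub>l \<in> I. Y i l \<otimes>\<^bsub>A\<^esub> M l j) = (if i = j then \<one>\<^bsub>A\<^esub> else \<zero>\<^bsub>A\<^esub>))"

definition mat_inv ::
    "('k::field, 'a) superalg \<Rightarrow> nat set \<Rightarrow> (nat \<Rightarrow> nat \<Rightarrow> 'a) \<Rightarrow> nat \<Rightarrow> nat \<Rightarrow> 'a" where
  "mat_inv A I M = (SOME Y. is_mat_inv A I M Y)"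

definition berezinian ::
    "nat \<Rightarrow> nat \<Rightarrow> ('k::field, 'a) superalg \<Rightarrow> (nat \<Rightarrow> nat \<Rightarrow> 'a) \<Rightarrow> 'a" where
  "berezinian m n A a =
     (let Y = mat_inv A {m+1..m+n} a in
        mat_det A {m+1..m+n} Y \<otimes>\<^bsub>A\<^esub>
        mat_det A {1..m} (\<lambda>i j. a i j \<ominus>\<^bsub>A\<^esub>
          (\<Oplus>\<^bsub>A\<^esub>l \<in> {m+1..m+n}. \<Oplus>\<^bsub>A\<^esub>s \<in> {m+1..m+n}. a i l \<otimes>\<^bsub>A\<^esub> Y l s \<otimes>\<^bsub>A\<^esub> a s j)))"


section \<open>The coordinate superalgebras of \<open>GL(m|n)\<close> and \<open>SL(m|n)\<close>\<close>

text \<open>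
  Words under concatenation form the free monoid, so \<open>'x word \<Rightarrow>\<^sub>0 'k\<close> with its convolution product
  is the free associative algebra on \<open>'x\<close>.
\<close>

datatype 'x word = Word (letters: "'x list")

instantiation word :: (type) monoid_add
begin

definition zero_word :: "'x word" where "zero_word = Word []"

definition plus_word :: "'x word \<Rightarrow> 'x word \<Rightarrow> 'x word" where
  "plus_word u v = Word (letters u @ letters v)"

instance
  by standard (simp_all add: zero_word_def plus_word_def)

end

definition free_superalg ::
    "'x set \<Rightarrow> ('x \<Rightarrow> bit) \<Rightarrow> ('k::field, 'x word \<Rightarrow>\<^sub>0 'k) superalg" where
  "free_superalg X par =
    \<lparr>carrier = {f. \<forall>w \<in> Poly_Mapping.keys f. set (letters w) \<subseteq> X},
     mult = (*), one = 1, zero = 0, add = (+), smult = fscale,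
     part = (\<lambda>p. {f. \<forall>w \<in> Poly_Mapping.keys f.
       set (letters w) \<subseteq> X \<and> sum_list (map par (letters w)) = p})\<rparr>"

definition letter :: "'x \<Rightarrow> ('x word \<Rightarrow>\<^sub>0 'k::field)" where
  "letter x = Poly_Mapping.single (Word [x]) 1"

text \<open>\<open>DInv1\<close> and \<open>DInv2\<close> stand for \<open>d\<^sub>1\<^bsup>-1\<^esup>\<close> and \<open>d\<^sub>2\<^bsup>-1\<^esup>\<close>.\<close>

datatype gl_gen = Var nat nat | DInv1 | DInv2

definition gl_gens :: "nat \<Rightarrow> nat \<Rightarrow> gl_gen set" where
  "gl_gens m n = {Var i j | i j. i \<in> {1..m+n} \<and> j \<in> {1..m+n}} \<union> {DInv1, DInv2}"

fun gl_parity :: "nat \<Rightarrow> gl_gen \<Rightarrow> bit" where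
  "gl_parity m (Var i j) = (if (i \<le> m) = (j \<le> m) then 0 else 1)"
| "gl_parity m DInv1 = 0"
| "gl_parity m DInv2 = 0"

definition gl_free :: "nat \<Rightarrow> nat \<Rightarrow> ('k::field, gl_gen word \<Rightarrow>\<^sub>0 'k) superalg" where
  "gl_free m n = free_superalg (gl_gens m n) (gl_parity m)"

text \<open>
  Squares of odd generators have to be included: in characteristic 2 they do not follow from the
  supercommutators.
\<close>

definition gl_relators :: "nat \<Rightarrow> nat \<Rightarrow> (gl_gen word \<Rightarrow>\<^sub>0 'k::field) set" where
  "gl_relators m n =
     {letter g * letter h
        - fscale (koszul_sign (gl_parity m g) (gl_parity m h)) (letter h * letter g) | g h.
        g \<in> gl_gens m n \<and> h \<in> gl_gens m n} \<union>
     {letter g * letter g | g. g \<in> gl_gens m n \<and> gl_parity m g = 1} \<union>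
     {letter DInv1 * mat_det (gl_free m n) {1..m} (\<lambda>i j. letter (Var i j)) - 1,
      letter DInv2 * mat_det (gl_free m n) {m+1..m+n} (\<lambda>i j. letter (Var i j)) - 1}"

definition gl_ideal :: "nat \<Rightarrow> nat \<Rightarrow> (gl_gen word \<Rightarrow>\<^sub>0 'k::field) set" where
  "gl_ideal m n = Idl\<^bsub>gl_free m n\<^esub> (gl_relators m n)"

definition kGL :: "nat \<Rightarrow> nat \<Rightarrow> ('k::field, (gl_gen word \<Rightarrow>\<^sub>0 'k) set) superalg" where
  "kGL m n = quotient_superalg (gl_free m n) (gl_ideal m n)"

definition gl_gen_class :: "nat \<Rightarrow> nat \<Rightarrow> gl_gen \<Rightarrow> (gl_gen word \<Rightarrow>\<^sub>0 'k::field) set" where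
  "gl_gen_class m n g = gl_ideal m n +>\<^bsub>gl_free m n\<^esub> letter g"

definition gl_var :: "nat \<Rightarrow> nat \<Rightarrow> nat \<Rightarrow> nat \<Rightarrow> (gl_gen word \<Rightarrow>\<^sub>0 'k::field) set" where
  "gl_var m n i j = gl_gen_class m n (Var i j)"

definition sl_ideal :: "nat \<Rightarrow> nat \<Rightarrow> (gl_gen word \<Rightarrow>\<^sub>0 'k::field) set set" where
  "sl_ideal m n =
     Idl\<^bsub>kGL m n\<^esub> {berezinian m n (kGL m n) (gl_var m n) \<ominus>\<^bsub>kGL m n\<^esub> \<one>\<^bsub>kGL m n\<^esub>}"

definition kSL :: "nat \<Rightarrow> nat \<Rightarrow> ('k::field, (gl_gen word \<Rightarrow>\<^sub>0 'k) set set) superalg" where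
  "kSL m n = quotient_superalg (kGL m n) (sl_ideal m n)"

definition sl_gen_class :: "nat \<Rightarrow> nat \<Rightarrow> gl_gen \<Rightarrow> (gl_gen word \<Rightarrow>\<^sub>0 'k::field) set set" where
  "sl_gen_class m n g = sl_ideal m n +>\<^bsub>kGL m n\<^esub> gl_gen_class m n g"

text \<open>
  Both formulas below refer to a superalgebra \<open>A\<close> together with a family \<open>gen\<close> of elements
  indexed by the generators, so they apply to \<open>kGL\<close> and to the classes in \<open>kSL\<close>.
\<close>

definition dinv_comult ::
    "nat \<Rightarrow> nat \<Rightarrow> ('k::field, 'a) superalg \<Rightarrow> ('a \<Rightarrow> ('a \<times> 'a \<Rightarrow>\<^sub>0 'k) set) \<Rightarrow>
      'a \<Rightarrow> 'a \<Rightarrow> ('a \<times> 'a \<Rightarrow>\<^sub>0 'k) set" where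
  "dinv_comult m n A \<Delta> d e =
     (\<Oplus>\<^bsub>tensor A A\<^esub>i \<in> {1..2*m*n+2}.
        (- 1) ^ (i - 1) \<odot>\<^bsub>tensor A A\<^esub>
          (tens A A (e [^]\<^bsub>A\<^esub> i) (e [^]\<^bsub>A\<^esub> i) \<otimes>\<^bsub>tensor A A\<^esub>
           ((\<Delta> d \<ominus>\<^bsub>tensor A A\<^esub> tens A A d d) [^]\<^bsub>tensor A A\<^esub> (i - 1))))"

definition is_gl_comult ::
    "nat \<Rightarrow> nat \<Rightarrow> ('k::field, 'a) superalg \<Rightarrow> (gl_gen \<Rightarrow> 'a) \<Rightarrow>
      ('a \<Rightarrow> ('a \<times> 'a \<Rightarrow>\<^sub>0 'k) set) \<Rightarrow> bool" where
  "is_gl_comult m n A gen \<Delta> \<longleftrightarrow>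
     \<Delta> \<in> superalg_hom A (tensor A A) \<and>
     (\<forall>i \<in> {1..m+n}. \<forall>j \<in> {1..m+n}.
        \<Delta> (gen (Var i j)) =
          (\<Oplus>\<^bsub>tensor A A\<^esub>l \<in> {1..m+n}. tens A A (gen (Var i l)) (gen (Var l j)))) \<and>
     \<Delta> (gen DInv1) =
       dinv_comult m n A \<Delta> (mat_det A {1..m} (\<lambda>i j. gen (Var i j))) (gen DInv1) \<and>
     \<Delta> (gen DInv2) =
       dinv_comult m n A \<Delta> (mat_det A {m+1..m+n} (\<lambda>i j. gen (Var i j))) (gen DInv2)"

definition is_gl_counit ::
    "nat \<Rightarrow> nat \<Rightarrow> ('k::field, 'a) superalg \<Rightarrow> (gl_gen \<Rightarrow> 'a) \<Rightarrow> ('a \<Rightarrow> 'k) \<Rightarrow> bool" where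
  "is_gl_counit m n A gen \<epsilon> \<longleftrightarrow>
     \<epsilon> \<in> superalg_hom A ground \<and>
     (\<forall>i \<in> {1..m+n}. \<forall>j \<in> {1..m+n}. \<epsilon> (gen (Var i j)) = (if i = j then 1 else 0)) \<and>
     \<epsilon> (gen DInv1) = 1 \<and> \<epsilon> (gen DInv2) = 1"

end

theory Submission
  imports Defs
begin

text \<open>
  A homomorphism out of \<open>k[GL(m|n)]\<close> amounts to homogeneous images of the \<open>a\<^sub>i\<^sub>j\<close> in a commutative
  superalgebra (with vanishing odd squares) for which the images of \<open>d\<^sub>1\<close> and \<open>d\<^sub>2\<close> are invertible.
  For \<open>\<Delta>\<close>, let \<open>I\<close> be one of the two index blocks and \<open>d\<close> its determinant.  The entry \<open>\<Sum>\<^sub>l a\<^sub>i\<^sub>l \<otimes> a\<^sub>l\<^sub>j\<close>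
  with \<open>i, j \<in> I\<close> differs from its part with \<open>l \<in> I\<close> by an even element of the ideal generated by the
  \<open>mn\<close> odd elements \<open>a\<^sub>i\<^sub>l \<otimes> 1\<close>, \<open>l \<notin> I\<close>, and the matrix of these parts has determinant \<open>d \<otimes> d\<close>.  So
  \<open>\<Delta>(d) - d \<otimes> d\<close> is nilpotent, and the formula for \<open>\<Delta>(d\<^bsup>-1\<^esup>)\<close> is the geometric series for the inverse of
  \<open>\<Delta>(d)\<close>.  The bialgebra axioms are equalities of homomorphisms and are checked on the \<open>a\<^sub>i\<^sub>j\<close>.

  \<open>\<Delta>\<close> and \<open>\<epsilon>\<close> descend to \<open>k[SL(m|n)]\<close> because \<open>\<Delta>(Ber) = Ber \<otimes> Ber\<close> and \<open>\<epsilon>(Ber) = 1\<close>.  The former says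
  that the Berezinian is multiplicative.  Writing the Schur complement of a product of block matrices
  through the Schur complements of the factors reduces this to \<open>det(1 + BC) det(1 + CB) = 1\<close> for odd
  blocks \<open>B\<close> and \<open>C\<close>, which follows by building up \<open>B\<close> one entry at a time.
\<close>

section \<open>Superalgebras and homomorphisms\<close>

text \<open>For even blocks the Sylvester identity reads det(1 + BC) = det(1 + CB). For odd blocks
  each elementary factor 1 + wb is matched by 1 + bw = 1 - wb, which is its inverse because b^2 = 0,
  so equality turns into inversion. Working entry by entry avoids logarithms and division, and the
  characteristic is arbitrary. In characteristic 2, vanishing of odd squares does not follow from
  supercommutativity; hence the coordinate superalgebras, their quotients and their tensor squares
  are all shown to be \<open>strict_salg\<close>. Blocks are cut out by two idempotents e and f in
  one ring of supermatrices, so the Schur complement computation becomes a few identities in an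
  arbitrary ring. The formula for \<Delta>(d^{-1}) mentions \<Delta>(d) and so cannot define
  \<Delta>. Its right-hand side is first formed with the determinant of the prescribed matrix of
  values \<Delta>(a_ij). Afterwards every homomorphism with these values satisfies the formula,
  since inverses are unique. That argument needs only \<open>gl_generated\<close>, of which both
  coordinate superalgebras are instances.\<close>

declare add_bit_eq_xor [simp del]

lemma bit_add_self [simp]: "(p::bit) + p = 0" "p + (p + q) = q"
  by (simp_all flip: mult_2 add.assoc)

lemma bit_cases: "(p::bit) = 0 \<or> p = 1"
  by (cases p) auto

text \<open>The sign is (-1)^{pq}, and pq is biadditive in the parities; the sign checks for
  associativity rest on this.\<close>

lemma koszul_sign_add_left: "koszul_sign (p + q) r = (koszul_sign p r * koszul_sign q r :: 'k::field)"
  and koszul_sign_add_right: "koszul_sign r (p + q) = (koszul_sign r p * koszul_sign r q :: 'k::field)"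
  using bit_cases[of p] bit_cases[of q] by (auto simp: koszul_sign_def)

lemma koszul_sign_square [simp]: "koszul_sign p q * koszul_sign p q = (1 :: 'k::field)"
  by (auto simp: koszul_sign_def)

lemma koszul_sign_zero [simp]: "koszul_sign 0 q = 1" "koszul_sign p 0 = 1"
  by (auto simp: koszul_sign_def)

lemma ground_simps [simp]:
  "carrier ground = UNIV" "x \<otimes>\<^bsub>ground\<^esub> y = x * y" "\<one>\<^bsub>ground\<^esub> = 1"
  "\<zero>\<^bsub>ground\<^esub> = 0" "x \<oplus>\<^bsub>ground\<^esub> y = x + y" "x \<odot>\<^bsub>ground\<^esub> y = x * y"
  "part ground p = (if p = 0 then UNIV else {0})"
  by (simp_all add: ground_def)

lemma cring_ground: "cring (ground :: ('k::field, 'k) superalg)"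
proof (rule cringI)
  show "abelian_group (ground :: ('k, 'k) superalg)"
    by (rule abelian_groupI) (auto intro: exI[of _ "- x" for x] simp: add.assoc add.commute
        add_eq_0_iff2)
  show "Group.comm_monoid (ground :: ('k, 'k) superalg)"
    by (rule comm_monoidI) (auto simp: mult.assoc mult.commute)
qed (auto simp: algebra_simps)

text \<open>Only the vector space structure is required, because the tensor product has to serve as
  the target of linear maps before its product is known to make it a ring. The module axioms over
  \<open>ground\<close> are turned into rules for plain field elements.\<close>

locale vspace =
  fixes A :: "('k::field, 'a) superalg" (structure)
  assumes module_ground: "module (ground :: ('k, 'k) superalg) A"

sublocale vspace \<subseteq> abelian_group A
  using module_ground by (rule module.axioms(2))

context vspace
begin

lemma smult_closed [simp, intro]: "x \<in> carrier A \<Longrightarrow> c \<odot> x \<in> carrier A"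
  using module.smult_closed[OF module_ground, of c x] by simp

lemma smult_add_left: "x \<in> carrier A \<Longrightarrow> (c + d) \<odot> x = c \<odot> x \<oplus> d \<odot> x"
  using module.smult_l_distr[OF module_ground, of c d x] by simp

lemma smult_add_right:
  "x \<in> carrier A \<Longrightarrow> y \<in> carrier A \<Longrightarrow> c \<odot> (x \<oplus> y) = c \<odot> x \<oplus> c \<odot> y"
  using module.smult_r_distr[OF module_ground, of c x y] by simp

lemma smult_smult [simp]: "x \<in> carrier A \<Longrightarrow> c \<odot> (d \<odot> x) = (c * d) \<odot> x"
  using module.smult_assoc1[OF module_ground, of c d x] by simp

lemma one_smult [simp]: "x \<in> carrier A \<Longrightarrow> 1 \<odot> x = x"
  using module.smult_one[OF module_ground, of x] by simp

lemma zero_smult [simp]: "x \<in> carrier A \<Longrightarrow> 0 \<odot> x = \<zero>"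
  using module.smult_l_null[OF module_ground, of x] by simp

lemma smult_zero [simp]: "c \<odot> \<zero> = \<zero>"
  using module.smult_r_null[OF module_ground, of c] by simp

lemma uminus_smult: "x \<in> carrier A \<Longrightarrow> (- c) \<odot> x = \<ominus> (c \<odot> x)"
proof -
  assume x: "x \<in> carrier A"
  have "(- c) \<odot> x \<oplus> c \<odot> x = \<zero>"
    using x smult_add_left[of x "- c" c] by simp
  then show ?thesis using x by (metis minus_equality smult_closed)
qed

lemma smult_uminus: "x \<in> carrier A \<Longrightarrow> c \<odot> (\<ominus> x) = \<ominus> (c \<odot> x)"
proof -
  assume x: "x \<in> carrier A"
  have "c \<odot> (\<ominus> x) \<oplus> c \<odot> x = \<zero>"
    using x by (simp add: smult_add_right[symmetric] l_neg)
  then show ?thesis using x by (metis a_inv_closed minus_equality smult_closed)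
qed

lemma finsum_smult:
  assumes "finite S" "f \<in> S \<rightarrow> carrier A"
  shows "c \<odot> finsum A f S = finsum A (\<lambda>s. c \<odot> f s) S"
  using assms
proof (induction S)
  case (insert s S)
  then have "f s \<in> carrier A" "f \<in> S \<rightarrow> carrier A" "(\<lambda>s. c \<odot> f s) \<in> S \<rightarrow> carrier A" by auto
  with insert show ?case by (simp add: smult_add_right)
qed simp

lemma finsum_swap:
  assumes "finite S" "finite T" "\<And>s t. s \<in> S \<Longrightarrow> t \<in> T \<Longrightarrow> f s t \<in> carrier A"
  shows "(\<Oplus>s\<in>S. \<Oplus>t\<in>T. f s t) = (\<Oplus>t\<in>T. \<Oplus>s\<in>S. f s t)"
  using assms(1,3)
proof (induction S)
  case (insert s S)
  then have "(\<lambda>t. f s t) \<in> T \<rightarrow> carrier A" "(\<lambda>t. \<Oplus>s\<in>S. f s t) \<in> T \<rightarrow> carrier A"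
    "(\<lambda>s. \<Oplus>t\<in>T. f s t) \<in> insert s S \<rightarrow> carrier A" by (auto intro!: finsum_closed)
  with insert have "(\<Oplus>s\<in>insert s S. \<Oplus>t\<in>T. f s t) = (\<Oplus>t\<in>T. f s t \<oplus> (\<Oplus>s\<in>S. f s t))"
    by (simp add: finsum_addf Pi_iff)
  also have "\<dots> = (\<Oplus>t\<in>T. \<Oplus>s\<in>insert s S. f s t)"
    using insert by (intro finsum_cong') (auto intro!: finsum_closed a_closed simp: Pi_iff)
  finally show ?case .
qed simp

end

text \<open>Linear extension to the free vector space of a map given on its basis.
  \<open>tensor_lift\<close> is this map applied to a chosen representative, and
  \<open>free_eval\<close> is its instance for products along words.\<close>

definition lin ::
    "('k::field, 'c, 'z) module_scheme \<Rightarrow> ('x \<Rightarrow> 'c) \<Rightarrow> ('x \<Rightarrow>\<^sub>0 'k) \<Rightarrow> 'c" where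
  "lin C \<phi> f = (\<Oplus>\<^bsub>C\<^esub>u \<in> Poly_Mapping.keys f. Poly_Mapping.lookup f u \<odot>\<^bsub>C\<^esub> \<phi> u)"

lemma fscale_single [simp]: "fscale c (Poly_Mapping.single x d) = Poly_Mapping.single x (c * d)"
  by (rule poly_mapping_eqI) (simp add: lookup_single when_def)

lemma keys_fscale: "Poly_Mapping.keys (fscale c f) \<subseteq> Poly_Mapping.keys f"
  by (auto simp: in_keys_iff)

text \<open>A finitely supported function is a sum of single terms. The bound \<open>D\<close> on
  the support is carried through the induction because the maps to which this is applied are
  controlled only on carriers.\<close>

lemma poly_mapping_keys_induct [consumes 1, case_names zero single add]:
  fixes f :: "'x \<Rightarrow>\<^sub>0 'k::field"
  assumes "Poly_Mapping.keys f \<subseteq> D" and "P 0"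
    and "\<And>x c. x \<in> D \<Longrightarrow> P (Poly_Mapping.single x c)"
    and "\<And>f g. Poly_Mapping.keys f \<subseteq> D \<Longrightarrow> Poly_Mapping.keys g \<subseteq> D \<Longrightarrow> P f \<Longrightarrow> P g \<Longrightarrow> P (f + g)"
  shows "P f"
  using assms(1)
proof (induction f rule: update_induct)
  case const
  then show ?case using assms(2) by simp
next
  case (update f x b)
  have eq: "Poly_Mapping.update x b f = f + Poly_Mapping.single x b"
    using update(1) by (intro poly_mapping_eqI)
      (auto simp: lookup_update lookup_add lookup_single when_def in_keys_iff)
  have k: "Poly_Mapping.keys f \<subseteq> D" "x \<in> D"
    using update by (auto simp: keys_update)
  then show ?case unfolding eq using update assms(3,4)
    by (metis bot.extremum insert_subset keys_single)
qed

context vspace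
begin

text \<open>Coefficients off the support are zero, so the sum may run over any larger finite set;
  two functions are then added over the union of their supports.\<close>

lemma lin_superset:
  assumes "finite S" "Poly_Mapping.keys f \<subseteq> S" "S \<subseteq> D" "\<phi> \<in> D \<rightarrow> carrier A"
  shows "lin A \<phi> f = (\<Oplus>u\<in>S. Poly_Mapping.lookup f u \<odot> \<phi> u)"
  unfolding lin_def using assms
  by (intro add.finprod_mono_neutral_cong_left)
    (auto simp: in_keys_iff Pi_iff subset_iff)

lemma lin_closed [intro]:
  "\<phi> \<in> D \<rightarrow> carrier A \<Longrightarrow> Poly_Mapping.keys f \<subseteq> D \<Longrightarrow> lin A \<phi> f \<in> carrier A"
  unfolding lin_def by (intro finsum_closed) auto

lemma lin_zero [simp]: "lin A \<phi> 0 = \<zero>"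
  unfolding lin_def by simp

lemma lin_single [simp]: "\<phi> x \<in> carrier A \<Longrightarrow> lin A \<phi> (Poly_Mapping.single x c) = c \<odot> \<phi> x"
  unfolding lin_def by (cases "c = 0") auto

lemma lin_add:
  assumes "\<phi> \<in> D \<rightarrow> carrier A" "Poly_Mapping.keys f \<subseteq> D" "Poly_Mapping.keys g \<subseteq> D"
  shows "lin A \<phi> (f + g) = lin A \<phi> f \<oplus> lin A \<phi> g"
proof -
  let ?S = "Poly_Mapping.keys f \<union> Poly_Mapping.keys g"
  have S: "finite ?S" "?S \<subseteq> D" "Poly_Mapping.keys (f + g) \<subseteq> ?S"
    using assms keys_add[of f g] by auto
  have "lin A \<phi> (f + g) = (\<Oplus>u\<in>?S. Poly_Mapping.lookup (f + g) u \<odot> \<phi> u)"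
    using S assms by (intro lin_superset)
  also have "\<dots> = (\<Oplus>u\<in>?S. Poly_Mapping.lookup f u \<odot> \<phi> u \<oplus> Poly_Mapping.lookup g u \<odot> \<phi> u)"
    using S assms by (intro finsum_cong') (auto simp: lookup_add smult_add_left Pi_iff subset_iff)
  also have "\<dots> = (\<Oplus>u\<in>?S. Poly_Mapping.lookup f u \<odot> \<phi> u) \<oplus> (\<Oplus>u\<in>?S. Poly_Mapping.lookup g u \<odot> \<phi> u)"
    using S assms by (intro finsum_addf) (auto simp: Pi_iff subset_iff)
  also have "\<dots> = lin A \<phi> f \<oplus> lin A \<phi> g"
    using S assms by (simp add: lin_superset[of ?S _ D \<phi>])
  finally show ?thesis .
qed

lemma lin_fscale:
  assumes "\<phi> \<in> D \<rightarrow> carrier A" "Poly_Mapping.keys f \<subseteq> D"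
  shows "lin A \<phi> (fscale c f) = c \<odot> lin A \<phi> f"
proof -
  have "lin A \<phi> (fscale c f) =
      (\<Oplus>u\<in>Poly_Mapping.keys f. Poly_Mapping.lookup (fscale c f) u \<odot> \<phi> u)"
    using assms keys_fscale[of c f] by (intro lin_superset[of _ _ D]) auto
  also have "\<dots> = (\<Oplus>u\<in>Poly_Mapping.keys f. c \<odot> (Poly_Mapping.lookup f u \<odot> \<phi> u))"
    using assms by (intro finsum_cong') (auto simp: Pi_iff subset_iff)
  also have "\<dots> = c \<odot> lin A \<phi> f"
    unfolding lin_def using assms by (intro finsum_smult[symmetric]) auto
  finally show ?thesis .
qed

lemma lin_diff:
  assumes "\<phi> \<in> D \<rightarrow> carrier A" "Poly_Mapping.keys f \<subseteq> D" "Poly_Mapping.keys g \<subseteq> D"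
  shows "lin A \<phi> (f - g) = lin A \<phi> f \<ominus> lin A \<phi> g"
proof -
  have eq: "f - g = f + fscale (- 1) g" by (rule poly_mapping_eqI) (simp add: lookup_add lookup_minus)
  have k: "Poly_Mapping.keys (fscale (- 1) g) \<subseteq> D" using assms keys_fscale[of "- 1" g] by blast
  have "lin A \<phi> g \<in> carrier A" using assms by auto
  then show ?thesis
    unfolding eq lin_add[OF assms(1,2) k] lin_fscale[OF assms(1,3)] by (simp add: uminus_smult minus_eq)
qed

lemma lin_cong:
  assumes "\<And>x. x \<in> Poly_Mapping.keys f \<Longrightarrow> \<phi> x = \<psi> x" "\<psi> \<in> Poly_Mapping.keys f \<rightarrow> carrier A"
  shows "lin A \<phi> f = lin A \<psi> f"
  unfolding lin_def using assms by (intro finsum_cong') auto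

end

section \<open>Gradings and homogeneous components\<close>

locale salg =
  fixes A :: "('k::field, 'a) superalg" (structure)
  assumes superalgebra_axioms: "superalgebra A"

sublocale salg \<subseteq> ring A
  using superalgebra_axioms by (rule superalgebra.axioms(1))

sublocale salg \<subseteq> vspace A
  by (rule vspace.intro) (rule superalgebra.axioms(2)[OF superalgebra_axioms])

lemma superalgebraI:
  fixes A :: "('k::field, 'a) superalg" (structure)
  assumes "ring A"
    and smult_closed: "\<And>c x. x \<in> carrier A \<Longrightarrow> c \<odot> x \<in> carrier A"
    and "\<And>c d x. x \<in> carrier A \<Longrightarrow> (c + d) \<odot> x = c \<odot> x \<oplus> d \<odot> x"
    and "\<And>c x y. x \<in> carrier A \<Longrightarrow> y \<in> carrier A \<Longrightarrow> c \<odot> (x \<oplus> y) = c \<odot> x \<oplus> c \<odot> y"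
    and "\<And>c d x. x \<in> carrier A \<Longrightarrow> (c * d) \<odot> x = c \<odot> (d \<odot> x)"
    and "\<And>x. x \<in> carrier A \<Longrightarrow> 1 \<odot> x = x"
    and "\<And>c x y. x \<in> carrier A \<Longrightarrow> y \<in> carrier A \<Longrightarrow> (c \<odot> x) \<otimes> y = c \<odot> (x \<otimes> y)"
    and "\<And>c x y. x \<in> carrier A \<Longrightarrow> y \<in> carrier A \<Longrightarrow> x \<otimes> (c \<odot> y) = c \<odot> (x \<otimes> y)"
    and part_carrier: "\<And>p. part A p \<subseteq> carrier A"
    and part_zero: "\<And>p. \<zero> \<in> part A p"
    and part_add: "\<And>p x y. x \<in> part A p \<Longrightarrow> y \<in> part A p \<Longrightarrow> x \<oplus> y \<in> part A p"
    and part_smult: "\<And>p c x. x \<in> part A p \<Longrightarrow> c \<odot> x \<in> part A p"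
    and "\<And>x. x \<in> carrier A \<Longrightarrow> \<exists>y \<in> part A 0. \<exists>z \<in> part A 1. x = y \<oplus> z"
    and part_Int: "\<And>x. x \<in> part A 0 \<Longrightarrow> x \<in> part A 1 \<Longrightarrow> x = \<zero>"
    and "\<And>p q x y. x \<in> part A p \<Longrightarrow> y \<in> part A q \<Longrightarrow> x \<otimes> y \<in> part A (p + q)"
  shows "superalgebra A"
proof -
  interpret ring A by fact
  have m: "module (ground :: ('k, 'k) superalg) A"
    using assms by (intro moduleI cring_ground is_abelian_group) auto
  interpret vspace A by (rule vspace.intro) (rule m)
  show ?thesis
  proof (intro superalgebra.intro superalgebra_axioms.intro)
    fix p
    show "submodule (part A p) (ground :: ('k, 'k) superalg) A"
    proof (rule submodule.intro)
      show "subgroup (part A p) (add_monoid A)"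
      proof (rule add.subgroupI)
        fix x assume x: "x \<in> part A p"
        then have "\<ominus> x = (- 1) \<odot> x" using part_carrier[of p] by (subst uminus_smult) auto
        then show "\<ominus> x \<in> part A p" using x part_smult by simp
      qed (use part_carrier part_zero[of p] part_add in auto)
    qed (use part_smult in \<open>auto simp: submodule_axioms_def\<close>)
  next
    show "part A 0 \<inter> part A 1 = {\<zero>}" using part_Int part_zero by auto
  qed (use assms m in auto)
qed

context salg
begin

lemma smult_mult_left [simp]: "x \<in> carrier A \<Longrightarrow> y \<in> carrier A \<Longrightarrow> (c \<odot> x) \<otimes> y = c \<odot> (x \<otimes> y)"
  using superalgebra.smult_mult_left[OF superalgebra_axioms] by auto

lemma smult_mult_right [simp]: "x \<in> carrier A \<Longrightarrow> y \<in> carrier A \<Longrightarrow> x \<otimes> (c \<odot> y) = c \<odot> (x \<otimes> y)"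
  using superalgebra.smult_mult_right[OF superalgebra_axioms] by auto

lemma part_submodule: "submodule (part A p) (ground :: ('k, 'k) superalg) A"
  using superalgebra.part_submodule[OF superalgebra_axioms] by auto

lemma part_subgroup: "subgroup (part A p) (add_monoid A)"
  using part_submodule by (rule submodule.axioms(1))

lemma part_closed [intro]: "x \<in> part A p \<Longrightarrow> x \<in> carrier A"
  using subgroup.subset[OF part_subgroup] by auto

lemma part_zero [simp, intro]: "\<zero> \<in> part A p"
  using subgroup.one_closed[OF part_subgroup] by simp

lemma part_add: "x \<in> part A p \<Longrightarrow> y \<in> part A p \<Longrightarrow> x \<oplus> y \<in> part A p"
  using subgroup.m_closed[OF part_subgroup] by simp

lemma part_uminus: "x \<in> part A p \<Longrightarrow> \<ominus> x \<in> part A p"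
  using subgroup.m_inv_closed[OF part_subgroup] by (simp add: a_inv_def)

lemma part_minus: "x \<in> part A p \<Longrightarrow> y \<in> part A p \<Longrightarrow> x \<ominus> y \<in> part A p"
  by (simp add: minus_eq part_add part_uminus)

lemma part_smult: "x \<in> part A p \<Longrightarrow> c \<odot> x \<in> part A p"
  using submodule.smult_closed[OF part_submodule, of c x] by simp

lemma part_mult: "x \<in> part A p \<Longrightarrow> y \<in> part A q \<Longrightarrow> x \<otimes> y \<in> part A (p + q)"
  using superalgebra.part_mult[OF superalgebra_axioms] by auto

lemma part_mult':
  "x \<in> part A p \<Longrightarrow> y \<in> part A q \<Longrightarrow> r = p + q \<Longrightarrow> x \<otimes> y \<in> part A r"
  using part_mult by auto

lemma part_finsum: "finite S \<Longrightarrow> (\<And>s. s \<in> S \<Longrightarrow> f s \<in> part A p) \<Longrightarrow> finsum A f S \<in> part A p"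
proof (induction S rule: finite_induct)
  case (insert s S)
  then have "f \<in> S \<rightarrow> carrier A" "f s \<in> carrier A" by auto
  with insert show ?case by (auto intro!: part_add)
qed auto

lemma part_disjoint:
  assumes "x \<in> part A p" "x \<in> part A (p + 1)"
  shows "x = \<zero>"
proof -
  have "x \<in> part A 0 \<inter> part A 1" using bit_cases[of p] assms by (elim disjE) simp_all
  then show ?thesis unfolding superalgebra.part_Int[OF superalgebra_axioms] by simp
qed

lemma part_split:
  assumes "x \<in> carrier A"
  obtains y z where "y \<in> part A p" "z \<in> part A (p + 1)" "x = y \<oplus> z"
proof -
  obtain y z where yz: "y \<in> part A 0" "z \<in> part A 1" "x = y \<oplus> z"
    using superalgebra.part_sum[OF superalgebra_axioms assms] by auto
  then have "x = z \<oplus> y" by (auto intro: a_comm part_closed)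
  with yz bit_cases[of p] that show ?thesis by auto
qed

lemma part_split_unique:
  assumes "y \<in> part A p" "z \<in> part A (p + 1)" "y' \<in> part A p" "z' \<in> part A (p + 1)"
    and "y \<oplus> z = y' \<oplus> z'"
  shows "y = y'" "z = z'"
proof -
  have c: "y \<in> carrier A" "z \<in> carrier A" "y' \<in> carrier A" "z' \<in> carrier A"
    using assms by auto
  have "y \<ominus> y' = (y \<oplus> z) \<ominus> z \<ominus> y'" using c by algebra
  also have "\<dots> = z' \<ominus> z" unfolding assms(5) using c by algebra
  finally have eq: "y \<ominus> y' = z' \<ominus> z" .
  have "y \<ominus> y' \<in> part A p" "z' \<ominus> z \<in> part A (p + 1)"
    using assms by (simp_all add: part_minus)
  then have "y \<ominus> y' = \<zero>" unfolding eq[symmetric] by (rule part_disjoint)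
  moreover from this have "z' \<ominus> z = \<zero>" using eq by simp
  ultimately show "y = y'" "z = z'" using c by (metis minus_eq minus_equality minus_minus a_inv_closed)+
qed

lemma component_eqI: "y \<in> part A p \<Longrightarrow> z \<in> part A (p + 1) \<Longrightarrow> component A p (y \<oplus> z) = y"
  unfolding component_def by (rule the_equality) (auto dest: part_split_unique)

lemma component_in_part [simp]: "x \<in> carrier A \<Longrightarrow> component A p x \<in> part A p"
  by (rule part_split[of x p]) (auto simp: component_eqI)

lemma component_closed [simp, intro]: "x \<in> carrier A \<Longrightarrow> component A p x \<in> carrier A"
  by (rule part_closed[OF component_in_part])

lemma component_part: "x \<in> part A p \<Longrightarrow> component A q x = (if q = p then x else \<zero>)"
  using component_eqI[of x p \<zero>] component_eqI[of \<zero> q x] bit_cases[of p] bit_cases[of q] part_closed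
  by auto

lemma component_sum: "x \<in> carrier A \<Longrightarrow> component A p x \<oplus> component A (p + 1) x = x"
proof (rule part_split[of x p])
  fix y z assume a: "x \<in> carrier A" "y \<in> part A p" "z \<in> part A (p + 1)" "x = y \<oplus> z"
  then have "x = z \<oplus> y" by (auto intro: a_comm part_closed)
  moreover have "y \<in> part A (p + 1 + 1)" using a(2) by (simp add: add.assoc)
  ultimately show ?thesis using a component_eqI[of y p z] component_eqI[of z "p+1" y] by simp
qed

lemma component_add:
  assumes "x \<in> carrier A" "y \<in> carrier A"
  shows "component A p (x \<oplus> y) = component A p x \<oplus> component A p y"
proof -
  have c: "\<And>q. component A q x \<in> carrier A" "\<And>q. component A q y \<in> carrier A" using assms by auto
  have "x \<oplus> y = (component A p x \<oplus> component A (p+1) x) \<oplus> (component A p y \<oplus> component A (p+1) y)"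
    using assms by (simp add: component_sum)
  also have "\<dots> = (component A p x \<oplus> component A p y) \<oplus> (component A (p+1) x \<oplus> component A (p+1) y)"
    using c by (simp add: a_ac)
  finally show ?thesis using assms by (simp add: component_eqI part_add component_in_part)
qed

lemma component_smult:
  assumes "x \<in> carrier A"
  shows "component A p (c \<odot> x) = c \<odot> component A p x"
proof -
  have "c \<odot> x = c \<odot> component A p x \<oplus> c \<odot> component A (p + 1) x"
    using assms by (simp add: component_sum flip: smult_add_right)
  then show ?thesis using assms by (simp add: component_eqI part_smult component_in_part)
qed

text \<open>The grading axioms do not mention the unit, but they force it to be even. Write \<one> =
  y + z with y even and z odd. Comparing even parts in z = \<one> z gives zz = 0, comparing odd
  parts in y = \<one> y gives zy = 0, and so z = z \<one> = 0.\<close>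

lemma part_one [simp, intro]: "\<one> \<in> part A 0"
proof -
  obtain y z where yz: "y \<in> part A 0" "z \<in> part A (0 + 1)" "\<one> = y \<oplus> z"
    using part_split[of \<one> 0] by auto
  then have c: "y \<in> carrier A" "z \<in> carrier A" by auto
  have "z = (y \<oplus> z) \<otimes> z" unfolding yz(3)[symmetric] using c by simp
  then have zz: "z \<otimes> z \<oplus> y \<otimes> z = \<zero> \<oplus> z" using c by (simp add: l_distr a_comm)
  have "z \<otimes> z = \<zero>"
    using part_split_unique[OF _ _ _ _ zz, of 0] yz part_mult[of z 1 z 1] part_mult[of y 0 z 1] by simp
  have "y = (y \<oplus> z) \<otimes> y" unfolding yz(3)[symmetric] using c by simp
  then have yy: "y \<otimes> y \<oplus> z \<otimes> y = y \<oplus> \<zero>" using c by (simp add: l_distr)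
  have "z \<otimes> y = \<zero>"
    using part_split_unique[OF _ _ _ _ yy, of 0] yz part_mult[of y 0 y 0] part_mult[of z 1 y 0] by simp
  have "z = z \<otimes> (y \<oplus> z)" unfolding yz(3)[symmetric] using c by simp
  also have "\<dots> = \<zero>" using c \<open>z \<otimes> z = \<zero>\<close> \<open>z \<otimes> y = \<zero>\<close> by (simp add: r_distr)
  finally show ?thesis using yz c by simp
qed

lemma part_pow: "x \<in> part A 0 \<Longrightarrow> x [^] (k::nat) \<in> part A 0"
  by (induction k) (auto intro!: part_mult')

lemma homogeneous_induct [consumes 1, case_names part add]:
  assumes "x \<in> carrier A"
    and "\<And>p x. x \<in> part A p \<Longrightarrow> P x"
    and "\<And>x y. x \<in> carrier A \<Longrightarrow> y \<in> carrier A \<Longrightarrow> P x \<Longrightarrow> P y \<Longrightarrow> P (x \<oplus> y)"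
  shows "P x"
  using part_split[OF assms(1), of 0] assms(2,3) part_closed by metis

end

text \<open>In characteristic 2, supercommutativity alone does not make odd elements square to zero.\<close>

locale strict_salg = salg +
  assumes supercomm: "x \<in> part A p \<Longrightarrow> y \<in> part A q \<Longrightarrow> x \<otimes> y = koszul_sign p q \<odot> (y \<otimes> x)"
    and odd_square: "x \<in> part A 1 \<Longrightarrow> x \<otimes> x = \<zero>"

lemma (in strict_salg) commutative_superalgebra: "commutative_superalgebra A"
  using superalgebra_axioms supercomm
  by (intro commutative_superalgebra.intro commutative_superalgebra_axioms.intro)

section \<open>Homomorphisms of superalgebras\<close>

lemma superalg_homI:
  fixes A :: "('k::field, 'a) superalg" (structure) and B :: "('k, 'b) superalg"
  assumes "\<And>x. x \<in> carrier A \<Longrightarrow> f x \<in> carrier B"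
    and "\<And>x y. x \<in> carrier A \<Longrightarrow> y \<in> carrier A \<Longrightarrow> f (x \<oplus> y) = f x \<oplus>\<^bsub>B\<^esub> f y"
    and "\<And>x y. x \<in> carrier A \<Longrightarrow> y \<in> carrier A \<Longrightarrow> f (x \<otimes> y) = f x \<otimes>\<^bsub>B\<^esub> f y"
    and "f \<one> = \<one>\<^bsub>B\<^esub>"
    and "\<And>c x. x \<in> carrier A \<Longrightarrow> f (c \<odot> x) = c \<odot>\<^bsub>B\<^esub> f x"
    and "\<And>p x. x \<in> part A p \<Longrightarrow> f x \<in> part B p"
  shows "f \<in> superalg_hom A B"
  using assms unfolding superalg_hom_def ring_hom_def by auto

locale salg_hom = A: salg A + B: salg B
  for A :: "('k::field, 'a) superalg" (structure) and B :: "('k, 'b) superalg" +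
  fixes h
  assumes superalg_hom: "h \<in> superalg_hom A B"
begin

lemma closed [simp, intro]: "x \<in> carrier A \<Longrightarrow> h x \<in> carrier B"
  using superalg_hom unfolding superalg_hom_def ring_hom_def by auto

lemma hom_add [simp]: "x \<in> carrier A \<Longrightarrow> y \<in> carrier A \<Longrightarrow> h (x \<oplus> y) = h x \<oplus>\<^bsub>B\<^esub> h y"
  using superalg_hom unfolding superalg_hom_def ring_hom_def by auto

lemma hom_mult [simp]: "x \<in> carrier A \<Longrightarrow> y \<in> carrier A \<Longrightarrow> h (x \<otimes> y) = h x \<otimes>\<^bsub>B\<^esub> h y"
  using superalg_hom unfolding superalg_hom_def ring_hom_def by auto

lemma hom_one [simp]: "h \<one> = \<one>\<^bsub>B\<^esub>"
  using superalg_hom unfolding superalg_hom_def ring_hom_def by auto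

lemma hom_smult [simp]: "x \<in> carrier A \<Longrightarrow> h (c \<odot> x) = c \<odot>\<^bsub>B\<^esub> h x"
  using superalg_hom unfolding superalg_hom_def by auto

lemma hom_part [simp]: "x \<in> part A p \<Longrightarrow> h x \<in> part B p"
  using superalg_hom unfolding superalg_hom_def by auto

lemma hom_zero [simp]: "h \<zero> = \<zero>\<^bsub>B\<^esub>"
  using hom_smult[of \<zero> 0] by simp

lemma hom_uminus [simp]: "x \<in> carrier A \<Longrightarrow> h (\<ominus> x) = \<ominus>\<^bsub>B\<^esub> h x"
  using hom_smult[of x "- 1"] by (simp add: A.uminus_smult B.uminus_smult)

lemma hom_minus [simp]: "x \<in> carrier A \<Longrightarrow> y \<in> carrier A \<Longrightarrow> h (x \<ominus> y) = h x \<ominus>\<^bsub>B\<^esub> h y"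
  by (simp add: A.minus_eq B.minus_eq)

lemma hom_finsum:
  assumes "finite S" "f \<in> S \<rightarrow> carrier A"
  shows "h (finsum A f S) = finsum B (\<lambda>s. h (f s)) S"
  using assms
proof (induction S)
  case (insert s S)
  then have "f s \<in> carrier A" "f \<in> S \<rightarrow> carrier A" "(\<lambda>s. h (f s)) \<in> S \<rightarrow> carrier B" by auto
  with insert show ?case by simp
qed simp

lemma hom_lin:
  assumes "\<phi> \<in> Poly_Mapping.keys f \<rightarrow> carrier A"
  shows "h (lin A \<phi> f) = lin B (\<lambda>x. h (\<phi> x)) f"
  unfolding lin_def using assms by (subst hom_finsum) (auto intro!: B.finsum_cong' simp: Pi_iff)

lemma hom_mat_det:
  assumes "finite I" "\<And>i j. i \<in> I \<Longrightarrow> j \<in> I \<Longrightarrow> M i j \<in> carrier A"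
  shows "h (mat_det A I M) = mat_det B I (\<lambda>i j. h (M i j))"
proof -
  have step: "foldr (\<lambda>i y. M i (\<sigma> i) \<otimes> y) xs \<one> \<in> carrier A \<and>
      h (foldr (\<lambda>i y. M i (\<sigma> i) \<otimes> y) xs \<one>)
      = foldr (\<lambda>i y. h (M i (\<sigma> i)) \<otimes>\<^bsub>B\<^esub> y) xs \<one>\<^bsub>B\<^esub>"
    if "\<sigma> permutes I" "set xs \<subseteq> I" for \<sigma> xs
    using that(2)
  proof (induction xs)
    case (Cons x xs)
    then have "M x (\<sigma> x) \<in> carrier A" using assms that by (auto simp: permutes_in_image)
    with Cons show ?case by auto
  qed simp
  define t where "t \<sigma> = foldr (\<lambda>i y. M i (\<sigma> i) \<otimes> y) (sorted_list_of_set I) \<one>" for \<sigma>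
  define t' where "t' \<sigma> = foldr (\<lambda>i y. h (M i (\<sigma> i)) \<otimes>\<^bsub>B\<^esub> y) (sorted_list_of_set I) \<one>\<^bsub>B\<^esub>" for \<sigma>
  have t: "t \<sigma> \<in> carrier A" "t' \<sigma> = h (t \<sigma>)" if "\<sigma> permutes I" for \<sigma>
    using step[OF that, of "sorted_list_of_set I"] assms(1) by (simp_all add: t_def t'_def)
  have "finite {\<sigma>. \<sigma> permutes I}" using assms(1) by (rule finite_permutations)
  then show ?thesis unfolding mat_det_def t_def[symmetric] t'_def[symmetric]
    using t by (subst hom_finsum) (auto intro!: B.finsum_cong')
qed

lemma comp:
  assumes "k \<in> superalg_hom B C"
  shows "(\<lambda>x. k (h x)) \<in> superalg_hom A C"
  using assms closed hom_add hom_mult hom_one hom_smult hom_part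
  unfolding superalg_hom_def ring_hom_def by auto

end

section \<open>Quotients and free superalgebras\<close>

context salg
begin

lemma minus_eq_zero_iff:
  "x \<in> carrier A \<Longrightarrow> y \<in> carrier A \<Longrightarrow> x \<ominus> y = \<zero> \<longleftrightarrow> x = y"
  by (metis minus_eq minus_equality minus_minus a_inv_closed r_neg)

lemma component_mult:
  assumes "x \<in> carrier A" "y \<in> carrier A"
  shows "component A p (x \<otimes> y) =
    component A 0 x \<otimes> component A p y \<oplus> component A 1 x \<otimes> component A (p + 1) y"
proof -
  define x0 x1 y0 y1 where d: "x0 = component A 0 x" "x1 = component A 1 x"
    "y0 = component A p y" "y1 = component A (p + 1) y"
  have p: "x0 \<in> part A 0" "x1 \<in> part A 1" "y0 \<in> part A p" "y1 \<in> part A (p + 1)"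
    using assms by (auto simp: d)
  then have c: "x0 \<in> carrier A" "x1 \<in> carrier A" "y0 \<in> carrier A" "y1 \<in> carrier A" by auto
  have "x \<otimes> y = (x0 \<oplus> x1) \<otimes> (y0 \<oplus> y1)"
    using assms component_sum[of x 0] component_sum[of y p] by (simp add: d)
  also have "\<dots> = (x0 \<otimes> y0 \<oplus> x1 \<otimes> y1) \<oplus> (x0 \<otimes> y1 \<oplus> x1 \<otimes> y0)"
    using c by (simp add: l_distr r_distr a_ac)
  finally show ?thesis
    unfolding d[symmetric] using p
    by (auto intro!: component_eqI part_add part_mult' simp: add.commute)
qed

lemma component_uminus: "x \<in> carrier A \<Longrightarrow> component A p (\<ominus> x) = \<ominus> component A p x"
  using component_smult[of x p "- 1"] by (simp add: uminus_smult)

lemma component_zero [simp]: "component A p \<zero> = \<zero>"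
  using component_part[of \<zero> p p] by simp

end

text \<open>Stability under taking components is what makes the images of the even and the odd part
  meet only in zero, so that the quotient is graded.\<close>

locale homogeneous_ideal = salg A + ideal I A for A :: "('k::field, 'a) superalg" (structure) and I +
  assumes component_mem: "x \<in> I \<Longrightarrow> component A p x \<in> I"

text \<open>The elements all of whose components lie in the ideal generated by S form a two-sided
  ideal, because a component of a product is a sum of products of components. It contains the
  homogeneous generators, hence everything they generate.\<close>

lemma (in salg) homogeneous_genideal:
  assumes "\<And>s. s \<in> S \<Longrightarrow> \<exists>p. s \<in> part A p"
  shows "homogeneous_ideal A (Idl S)"
proof -
  have S: "S \<subseteq> carrier A" using assms by blast
  interpret I: ideal "Idl S" A using S by (rule genideal_ideal)
  define I' where "I' = {x \<in> carrier A. \<forall>p. component A p x \<in> Idl S}"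
  have "ideal I' A"
  proof (rule idealI)
    show "ring A" by (rule ring_axioms)
    show "subgroup I' (add_monoid A)"
      by (rule add.subgroupI)
        (auto simp: I'_def component_add component_uminus I.a_closed I.a_inv_closed intro: exI[of _ \<zero>])
    fix a x assume "a \<in> I'" "x \<in> carrier A"
    then show "x \<otimes> a \<in> I'" "a \<otimes> x \<in> I'"
      by (auto simp: I'_def component_mult I.I_l_closed I.I_r_closed I.a_closed)
  qed
  moreover have "S \<subseteq> I'"
  proof
    fix s assume "s \<in> S"
    moreover obtain p where "s \<in> part A p" using assms \<open>s \<in> S\<close> by blast
    ultimately show "s \<in> I'" unfolding I'_def using genideal_self[OF S]
      by (auto simp: component_part)
  qed
  ultimately have "Idl S \<subseteq> I'" by (rule genideal_minimal)
  then show ?thesis by unfold_locales (auto simp: I'_def)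
qed

context homogeneous_ideal
begin

abbreviation Q where "Q \<equiv> quotient_superalg A I"

lemma carrier_quotient: "carrier Q = (\<lambda>x. I +> x) ` carrier A"
  by (auto simp: quotient_superalg_def FactRing_def A_RCOSETS_def')

lemma part_quotient: "part Q p = (\<lambda>x. I +> x) ` part A p"
  by (simp add: quotient_superalg_def)

lemma coset_eq_iff: "x \<in> carrier A \<Longrightarrow> y \<in> carrier A \<Longrightarrow> I +> x = I +> y \<longleftrightarrow> x \<ominus> y \<in> I"
  using quotient_eq_iff_same_a_r_cos[OF is_ideal] by auto

lemma coset_add [simp]: "x \<in> carrier A \<Longrightarrow> y \<in> carrier A \<Longrightarrow> (I +> x) \<oplus>\<^bsub>Q\<^esub> (I +> y) = I +> (x \<oplus> y)"
  using ring_hom_add[OF rcos_ring_hom] by (simp add: quotient_superalg_def)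

lemma coset_mult [simp]: "x \<in> carrier A \<Longrightarrow> y \<in> carrier A \<Longrightarrow> (I +> x) \<otimes>\<^bsub>Q\<^esub> (I +> y) = I +> (x \<otimes> y)"
  using ring_hom_mult[OF rcos_ring_hom] by (simp add: quotient_superalg_def)

lemma coset_one: "\<one>\<^bsub>Q\<^esub> = I +> \<one>"
  using ring_hom_one[OF rcos_ring_hom] by (simp add: quotient_superalg_def)

lemma coset_zero: "\<zero>\<^bsub>Q\<^esub> = I +> \<zero>"
  using ring_hom_zero[OF rcos_ring_hom ring_axioms quotient_is_ring] by (simp add: quotient_superalg_def)

lemma smult_mem: "x \<in> I \<Longrightarrow> c \<odot> x \<in> I"
  using I_l_closed[of x "c \<odot> \<one>"] a_Hcarr[of x] by simp

lemma coset_self: "x \<in> carrier A \<Longrightarrow> x \<in> I +> x"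
  by (rule a_rcos_self)

lemma coset_mem: "x \<in> carrier A \<Longrightarrow> y \<in> I +> x \<Longrightarrow> y \<in> carrier A \<and> I +> y = I +> x"
  using a_repr_independence[OF _ _ a_subgroup, of y x] a_elemrcos_carrier[of x y] by simp

lemma coset_smult [simp]: "x \<in> carrier A \<Longrightarrow> c \<odot>\<^bsub>Q\<^esub> (I +> x) = I +> (c \<odot> x)"
proof -
  assume x: "x \<in> carrier A"
  \<comment> \<open>All representatives of the coset give the same scaled coset, so the union in the
    definition of the scalar action is a single coset.\<close>
  have "I +> (c \<odot> y) = I +> (c \<odot> x)" if "y \<in> I +> x" for y
  proof -
    have y: "y \<in> carrier A" "y \<ominus> x \<in> I" using coset_mem[OF x that] x coset_eq_iff by auto
    then have "c \<odot> (y \<ominus> x) \<in> I" by (intro smult_mem)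
    then show ?thesis using x y by (simp add: coset_eq_iff minus_eq smult_add_right smult_uminus)
  qed
  then have "(\<Union>y\<in>I +> x. I +> (c \<odot> y)) = I +> (c \<odot> x)"
    using coset_self[OF x] by blast
  then show ?thesis by (simp add: quotient_superalg_def)
qed

lemma ring_quotient: "ring Q"
proof -
  interpret q: ring "A Quot I" by (rule quotient_is_ring)
  have e: "carrier Q = carrier (A Quot I)" "mult Q = mult (A Quot I)" "one Q = one (A Quot I)"
    "zero Q = zero (A Quot I)" "add Q = add (A Quot I)" by (simp_all add: quotient_superalg_def)
  show ?thesis
  proof (rule ringI)
    show "abelian_group Q"
      by (intro abelian_groupI) (auto simp: e q.a_assoc q.l_neg q.a_ac intro!: bexI[of _ "\<ominus>\<^bsub>A Quot I\<^esub> x" for x])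
    show "Group.monoid Q"
      by (rule monoidI) (auto simp: e q.m_assoc)
  qed (auto simp: e q.l_distr q.r_distr)
qed

lemma superalgebra_quotient: "superalgebra Q"
proof (rule superalgebraI)
  show "ring Q" by (rule ring_quotient)
  fix x assume "x \<in> carrier Q"
  then obtain a where a: "a \<in> carrier A" "x = I +> a" by (auto simp: carrier_quotient)
  then have "a = component A 0 a \<oplus> component A 1 a" using component_sum[of a 0] by simp
  then have "x = (I +> component A 0 a) \<oplus>\<^bsub>Q\<^esub> (I +> component A 1 a)" using a by simp
  moreover have "I +> component A p a \<in> part Q p" for p using a by (simp add: part_quotient)
  ultimately show "\<exists>y\<in>part Q 0. \<exists>z\<in>part Q 1. x = y \<oplus>\<^bsub>Q\<^esub> z" by blast
next
  fix x assume "x \<in> part Q 0" "x \<in> part Q 1"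
  then obtain a b where ab: "a \<in> part A 0" "b \<in> part A 1" "x = I +> a" "I +> a = I +> b"
    by (auto simp: part_quotient)
  then have c: "a \<in> carrier A" "b \<in> carrier A" by auto
  \<comment> \<open>The even component of \<open>a \<ominus> b\<close> is \<open>a\<close> itself,
    so \<open>a\<close> lies in the ideal and its class vanishes.\<close>
  then have "component A 0 (a \<ominus> b) \<in> I" using ab by (auto intro: component_mem simp: coset_eq_iff)
  moreover have "component A 0 (a \<ominus> b) = a"
    using ab c by (simp add: minus_eq component_add component_uminus component_part)
  ultimately have "I +> a = I +> \<zero>" using c by (simp add: coset_eq_iff minus_eq)
  then show "x = \<zero>\<^bsub>Q\<^esub>" using ab by (simp add: coset_zero)
next
  fix p show "\<zero>\<^bsub>Q\<^esub> \<in> part Q p" by (auto simp: part_quotient coset_zero)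
next
  fix p q x y assume "x \<in> part Q p" "y \<in> part Q q"
  then obtain a b where ab: "a \<in> part A p" "b \<in> part A q" "x = I +> a" "y = I +> b"
    by (auto simp: part_quotient)
  then have c: "a \<in> carrier A" "b \<in> carrier A" by auto
  then show "x \<otimes>\<^bsub>Q\<^esub> y \<in> part Q (p + q)" using ab part_mult[of a p b q] by (auto simp: part_quotient)
next
  fix p x y assume "x \<in> part Q p" "y \<in> part Q p"
  then obtain a b where ab: "a \<in> part A p" "b \<in> part A p" "x = I +> a" "y = I +> b"
    by (auto simp: part_quotient)
  then have c: "a \<in> carrier A" "b \<in> carrier A" by auto
  then show "x \<oplus>\<^bsub>Q\<^esub> y \<in> part Q p" using ab part_add[of a p b] by (auto simp: part_quotient)
next
  fix p c x assume "x \<in> part Q p"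
  then obtain a where ab: "a \<in> part A p" "x = I +> a"
    by (auto simp: part_quotient)
  then have c: "a \<in> carrier A" by auto
  then show "c \<odot>\<^bsub>Q\<^esub> x \<in> part Q p" using ab part_smult[of a p c] by (auto simp: part_quotient)
next
  fix p show "part Q p \<subseteq> carrier Q" by (auto simp: part_quotient carrier_quotient)
qed (auto simp: carrier_quotient smult_add_left smult_add_right)

sublocale Q: salg Q
  by (rule salg.intro) (rule superalgebra_quotient)

lemma coset_hom: "(\<lambda>x. I +> x) \<in> superalg_hom A Q"
  by (rule superalg_homI) (auto simp: carrier_quotient part_quotient coset_one)

sublocale coset: salg_hom A Q "\<lambda>x. I +> x"
  by unfold_locales (rule coset_hom)

declare coset_add [simp del] coset_mult [simp del] coset_smult [simp del]

end

text \<open>The value is read off an arbitrary representative; \<open>lift_coset\<close> shows that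
  the choice does not matter once \<open>f\<close> vanishes on the ideal.\<close>

definition quotient_lift :: "('a \<Rightarrow> 'b) \<Rightarrow> 'a set \<Rightarrow> 'b" where
  "quotient_lift f X = f (SOME x. x \<in> X)"

locale quotient_hom = homogeneous_ideal A I + f: salg_hom A B f
  for A :: "('k::field, 'a) superalg" (structure) and I
    and B :: "('k, 'b) superalg" and f +
  assumes vanishes: "x \<in> I \<Longrightarrow> f x = \<zero>\<^bsub>B\<^esub>"
begin

lemma lift_coset: "x \<in> carrier A \<Longrightarrow> quotient_lift f (I +> x) = f x"
proof -
  assume x: "x \<in> carrier A"
  define y where "y = (SOME y. y \<in> I +> x)"
  have "y \<in> I +> x" unfolding y_def using coset_self[OF x] by (rule someI)
  then have y: "y \<in> carrier A" "y \<ominus> x \<in> I"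
    using coset_mem[OF x, of y] coset_eq_iff[of y x] x by auto
  then have "f y \<ominus>\<^bsub>B\<^esub> f x = \<zero>\<^bsub>B\<^esub>" using x vanishes[OF y(2)] by simp
  then have "f y = f x" using x y by (simp add: f.B.minus_eq_zero_iff)
  then show ?thesis by (simp add: quotient_lift_def y_def)
qed

lemma lift_hom: "quotient_lift f \<in> superalg_hom (quotient_superalg A I) B"
proof (rule superalg_homI)
  fix p x assume "x \<in> part Q p"
  then obtain a where "x = I +> a" "a \<in> part A p" by (auto simp: part_quotient)
  then show "quotient_lift f x \<in> part B p" using part_closed[of a p] by (simp add: lift_coset)
next
  show "quotient_lift f \<one>\<^bsub>Q\<^esub> = \<one>\<^bsub>B\<^esub>" by (subst coset_one, subst lift_coset) simp_all
next
  fix x assume "x \<in> carrier Q"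
  then obtain a where a: "x = I +> a" "a \<in> carrier A" unfolding carrier_quotient by blast
  show "quotient_lift f x \<in> carrier B" unfolding a using a(2) by (simp add: lift_coset)
  show "quotient_lift f (c \<odot>\<^bsub>Q\<^esub> x) = c \<odot>\<^bsub>B\<^esub> quotient_lift f x" for c
    unfolding a(1) coset_smult[OF a(2)] using a(2) smult_closed[of a c] by (simp add: lift_coset del: coset.hom_smult)
  fix y assume "y \<in> carrier Q"
  then obtain b where b: "y = I +> b" "b \<in> carrier A" unfolding carrier_quotient by blast
  show "quotient_lift f (x \<oplus>\<^bsub>Q\<^esub> y) = quotient_lift f x \<oplus>\<^bsub>B\<^esub> quotient_lift f y"
    unfolding a(1) b(1) coset_add[OF a(2) b(2)] using a(2) b(2) by (simp add: lift_coset del: coset.hom_add)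
  show "quotient_lift f (x \<otimes>\<^bsub>Q\<^esub> y) = quotient_lift f x \<otimes>\<^bsub>B\<^esub> quotient_lift f y"
    unfolding a(1) b(1) coset_mult[OF a(2) b(2)] using a(2) b(2) by (simp add: lift_coset del: coset.hom_mult)
qed

end

text \<open>The kernel is a two-sided ideal, so vanishing need only be checked on
  generators.\<close>

lemma (in salg_hom) vanishes_on_genideal:
  assumes "S \<subseteq> carrier A" "\<And>s. s \<in> S \<Longrightarrow> h s = \<zero>\<^bsub>B\<^esub>" "x \<in> Idl\<^bsub>A\<^esub> S"
  shows "h x = \<zero>\<^bsub>B\<^esub>"
proof -
  have "ideal {x \<in> carrier A. h x = \<zero>\<^bsub>B\<^esub>} A"
  proof (rule idealI)
    show "subgroup {x \<in> carrier A. h x = \<zero>\<^bsub>B\<^esub>} (add_monoid A)"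
      by (rule A.add.subgroupI) (auto simp flip: a_inv_def intro: exI[of _ \<zero>])
  qed (auto simp: A.ring_axioms)
  then have "Idl\<^bsub>A\<^esub> S \<subseteq> {x \<in> carrier A. h x = \<zero>\<^bsub>B\<^esub>}"
    using assms(1,2) by (intro A.genideal_minimal) auto
  then show ?thesis using assms(3) by auto
qed

section \<open>Free superalgebras and evaluation\<close>

definition word_parity :: "('x \<Rightarrow> bit) \<Rightarrow> 'x word \<Rightarrow> bit" where
  "word_parity par w = sum_list (map par (letters w))"

lemma letters_plus [simp]: "letters (u + v) = letters u @ letters v"
  and letters_zero [simp]: "letters 0 = []"
  by (simp_all add: plus_word_def zero_word_def)

lemma word_parity_plus [simp]: "word_parity par (u + v) = word_parity par u + word_parity par v"
  and word_parity_zero [simp]: "word_parity par 0 = 0"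
  by (simp_all add: word_parity_def)

lemma free_superalg_simps [simp]:
  "carrier (free_superalg X par) = {f. Poly_Mapping.keys f \<subseteq> {w. set (letters w) \<subseteq> X}}"
  "mult (free_superalg X par) = (*)" "one (free_superalg X par) = 1"
  "zero (free_superalg X par) = 0" "add (free_superalg X par) = (+)"
  "smult (free_superalg X par) = fscale"
  "part (free_superalg X par) p =
    {f. Poly_Mapping.keys f \<subseteq> {w. set (letters w) \<subseteq> X \<and> word_parity par w = p}}"
  by (auto simp: free_superalg_def word_parity_def)

lemma keys_add_subset: "Poly_Mapping.keys f \<subseteq> D \<Longrightarrow> Poly_Mapping.keys g \<subseteq> D \<Longrightarrow>
    Poly_Mapping.keys (f + g) \<subseteq> D"
  using keys_add[of f g] by blast

lemma fscale_conv_mult: "fscale c f = Poly_Mapping.single 0 c * (f :: 'x word \<Rightarrow>\<^sub>0 'k::field)"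
  unfolding fscale_def by (rule mult_map_scale_conv_mult)

lemma fscale_mult_left: "fscale c f * g = fscale c (f * g :: 'x word \<Rightarrow>\<^sub>0 'k::field)"
  by (simp add: fscale_conv_mult mult.assoc)

lemma mult_single_zero_commute:
  "f * Poly_Mapping.single 0 c = Poly_Mapping.single 0 c * (f :: 'x word \<Rightarrow>\<^sub>0 'k::field)"
proof -
  have "Poly_Mapping.keys f \<subseteq> UNIV" by simp
  then show ?thesis
    by (induction f rule: poly_mapping_keys_induct) (auto simp: mult_single algebra_simps)
qed

lemma fscale_mult_right: "f * fscale c g = fscale c (f * g :: 'x word \<Rightarrow>\<^sub>0 'k::field)"
  by (simp add: fscale_conv_mult mult_single_zero_commute flip: mult.assoc)

lemma superalgebra_free: "superalgebra (free_superalg X par :: ('k::field, 'x word \<Rightarrow>\<^sub>0 'k) superalg)"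
    (is "superalgebra ?F")
proof (rule superalgebraI)
  have mult_closed: "x * y \<in> carrier ?F" if "x \<in> carrier ?F" "y \<in> carrier ?F" for x y
    using that keys_mult[of x y] by fastforce
  show "ring ?F"
  proof (rule ringI)
    show "abelian_group ?F"
      by (intro abelian_groupI) (auto simp: keys_add_subset algebra_simps intro!: exI[of _ "- x" for x])
    show "Group.monoid ?F"
      using mult_closed by (intro monoidI) (auto simp: mult.assoc)
  qed (auto simp: algebra_simps)
  show "c \<odot>\<^bsub>?F\<^esub> x \<in> carrier ?F" if "x \<in> carrier ?F" for c x
    using that keys_fscale[of c x] by auto
  show "c \<odot>\<^bsub>?F\<^esub> x \<in> part ?F p" if "x \<in> part ?F p" for c x p
    using that keys_fscale[of c x] by auto
  show "part ?F p \<subseteq> carrier ?F" for p by auto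
  show "x \<otimes>\<^bsub>?F\<^esub> y \<in> part ?F (p + q)" if "x \<in> part ?F p" "y \<in> part ?F q" for x y p q
    using that keys_mult[of x y] by fastforce
  show "x = \<zero>\<^bsub>?F\<^esub>" if "x \<in> part ?F 0" "x \<in> part ?F 1" for x
  proof -
    have "Poly_Mapping.keys x = {}" using that by fastforce
    then show ?thesis by simp
  qed
  fix x assume "x \<in> carrier ?F"
  then have "Poly_Mapping.keys x \<subseteq> {w. set (letters w) \<subseteq> X}" by simp
  then show "\<exists>y\<in>part ?F 0. \<exists>z\<in>part ?F 1. x = y \<oplus>\<^bsub>?F\<^esub> z"
  proof (induction x rule: poly_mapping_keys_induct)
    case zero
    show ?case by (intro bexI[of _ 0]) auto
  next
    case (single w c)
    then show ?case using bit_cases[of "word_parity par w"]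
    proof (elim disjE)
      assume "word_parity par w = 0"
      then show ?thesis using single
        by (intro bexI[of _ "Poly_Mapping.single w c"] bexI[of _ 0]) auto
    next
      assume "word_parity par w = 1"
      then show ?thesis using single
        by (intro bexI[of _ 0] bexI[of _ "Poly_Mapping.single w c"]) auto
    qed
  next
    case (add f g)
    then obtain f0 f1 g0 g1 where "f0 \<in> part ?F 0" "f1 \<in> part ?F 1" "f = f0 + f1"
      "g0 \<in> part ?F 0" "g1 \<in> part ?F 1" "g = g0 + g1" by auto
    then show ?case
      by (intro bexI[of _ "f0 + g0"] bexI[of _ "f1 + g1"])
        (auto simp: keys_add_subset algebra_simps)
  qed
qed (auto simp: keys_add_subset fvs.scale_left_distrib fvs.scale_right_distrib
    fscale_mult_left fscale_mult_right)

global_interpretation free: salg "free_superalg X par"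
  by (rule salg.intro) (rule superalgebra_free)

definition word_prod :: "('k::field, 'b) superalg \<Rightarrow> ('x \<Rightarrow> 'b) \<Rightarrow> 'x word \<Rightarrow> 'b" where
  "word_prod B g w = foldr (\<lambda>x y. g x \<otimes>\<^bsub>B\<^esub> y) (letters w) \<one>\<^bsub>B\<^esub>"

definition free_eval :: "('k::field, 'b) superalg \<Rightarrow> ('x \<Rightarrow> 'b) \<Rightarrow> ('x word \<Rightarrow>\<^sub>0 'k) \<Rightarrow> 'b" where
  "free_eval B g = lin B (word_prod B g)"

context salg
begin

lemma word_prod_foldr_part:
  assumes "\<And>x. x \<in> set xs \<Longrightarrow> g x \<in> part A (par x)"
  shows "foldr (\<lambda>x y. g x \<otimes> y) xs \<one> \<in> part A (sum_list (map par xs))"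
  using assms by (induction xs) (auto intro!: part_mult')

lemma word_prod_part:
  assumes "\<And>x. x \<in> X \<Longrightarrow> g x \<in> part A (par x)" "set (letters w) \<subseteq> X"
  shows "word_prod A g w \<in> part A (word_parity par w)"
  unfolding word_prod_def word_parity_def using assms by (intro word_prod_foldr_part) auto

lemma word_prod_funcset:
  assumes "\<And>x. x \<in> X \<Longrightarrow> g x \<in> part A (par x)"
  shows "word_prod A g \<in> {w. set (letters w) \<subseteq> X} \<rightarrow> carrier A"
proof
  fix w :: "'b word" assume "w \<in> {w. set (letters w) \<subseteq> X}"
  then show "word_prod A g w \<in> carrier A" using part_closed[OF word_prod_part[OF assms]] by simp
qed

lemma word_prod_plus:
  assumes "\<And>x. x \<in> X \<Longrightarrow> g x \<in> part A (par x)" "set (letters u) \<subseteq> X" "set (letters v) \<subseteq> X"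
  shows "word_prod A g (u + v) = word_prod A g u \<otimes> word_prod A g v"
proof -
  have v: "word_prod A g v \<in> carrier A" using word_prod_part[of X g par v] assms by auto
  have step: "foldr (\<lambda>x y. g x \<otimes> y) us b = foldr (\<lambda>x y. g x \<otimes> y) us \<one> \<otimes> b"
    if "b \<in> carrier A" "set us \<subseteq> X" for us b using that(2)
  proof (induction us)
    case (Cons x us)
    then have "g x \<in> carrier A" "foldr (\<lambda>x y. g x \<otimes> y) us \<one> \<in> carrier A"
      using assms(1) word_prod_foldr_part[of us g par] by auto
    with Cons that show ?case by (simp add: m_assoc)
  qed (use that in simp)
  have "word_prod A g (u + v) = foldr (\<lambda>x y. g x \<otimes> y) (letters u) (word_prod A g v)"
    by (simp add: word_prod_def)
  also have "\<dots> = word_prod A g u \<otimes> word_prod A g v"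
    by (subst step[OF v assms(2)]) (simp add: word_prod_def)
  finally show ?thesis .
qed

text \<open>Evaluation is linear by construction. Multiplicativity is bilinear in the two arguments
  and so reduces to words, where concatenation becomes the product of the values.\<close>

lemma free_eval_hom:
  assumes g: "\<And>x. x \<in> X \<Longrightarrow> g x \<in> part A (par x)"
  shows "free_eval A g \<in> superalg_hom (free_superalg X par) A"
proof -
  let ?D = "{w. set (letters w) \<subseteq> X}"
  have wp: "word_prod A g \<in> ?D \<rightarrow> carrier A" using word_prod_funcset[OF g] .
  show ?thesis
  proof (rule superalg_homI)
    fix f h :: "'b word \<Rightarrow>\<^sub>0 'k"
    assume f: "f \<in> carrier (free_superalg X par)" and h: "h \<in> carrier (free_superalg X par)"
    have f': "Poly_Mapping.keys f \<subseteq> ?D" and h': "Poly_Mapping.keys h \<subseteq> ?D" using f h by auto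
    from f' have "Poly_Mapping.keys (f * h) \<subseteq> ?D \<and>
       lin A (word_prod A g) (f * h) = lin A (word_prod A g) f \<otimes> lin A (word_prod A g) h"
    proof (induction f rule: poly_mapping_keys_induct)
      case zero
      then show ?case using lin_closed[OF wp h'] by simp
    next
      case (single u a)
      note wu = funcset_mem[OF wp single]
      from h' show ?case
      proof (induction h rule: poly_mapping_keys_induct)
        case (single v b)
        note wv = funcset_mem[OF wp single]
        have "word_prod A g (u + v) = word_prod A g u \<otimes> word_prod A g v"
          using \<open>u \<in> ?D\<close> \<open>v \<in> ?D\<close> by (intro word_prod_plus[OF g]) auto
        then show ?case using \<open>u \<in> ?D\<close> \<open>v \<in> ?D\<close> wu wv by (simp add: mult_single mult.commute)
      next
        case (add h1 h2)
        then show ?case using wu lin_closed[OF wp add.hyps(1)] lin_closed[OF wp add.hyps(2)]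
          by (simp add: distrib_left keys_add_subset lin_add[OF wp] r_distr del: mult_single)
      qed (use wu in simp)
    next
      case (add f1 f2)
      then show ?case using lin_closed[OF wp h'] lin_closed[OF wp add.hyps(1)] lin_closed[OF wp add.hyps(2)]
        by (simp add: distrib_right keys_add_subset lin_add[OF wp] l_distr)
    qed
    then show "free_eval A g (f \<otimes>\<^bsub>free_superalg X par\<^esub> h) = free_eval A g f \<otimes> free_eval A g h"
      by (simp add: free_eval_def)
    show "free_eval A g (f \<oplus>\<^bsub>free_superalg X par\<^esub> h) = free_eval A g f \<oplus> free_eval A g h"
      using f' h' by (simp add: free_eval_def lin_add[OF wp])
  next
    fix c and f :: "'b word \<Rightarrow>\<^sub>0 'k"
    assume f: "f \<in> carrier (free_superalg X par)"
    then show "free_eval A g (c \<odot>\<^bsub>free_superalg X par\<^esub> f) = c \<odot> free_eval A g f"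
      by (simp add: free_eval_def lin_fscale[OF wp])
    show "free_eval A g f \<in> carrier A"
      using f by (simp add: free_eval_def lin_closed[OF wp])
  next
    have "lin A (word_prod A g) (Poly_Mapping.single 0 1) = \<one>"
      by (subst lin_single) (auto simp: word_prod_def)
    then show "free_eval A g \<one>\<^bsub>free_superalg X par\<^esub> = \<one>" by (simp add: free_eval_def)
  next
    fix p and f :: "'b word \<Rightarrow>\<^sub>0 'k"
    assume "f \<in> part (free_superalg X par) p"
    then have "Poly_Mapping.keys f \<subseteq> {w. set (letters w) \<subseteq> X \<and> word_parity par w = p}" by simp
    then show "free_eval A g f \<in> part A p" unfolding free_eval_def lin_def
      using word_prod_part[of X g par, OF g] by (intro part_finsum part_smult) auto
  qed
qed

lemma free_eval_letter:
  assumes "g x \<in> carrier A"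
  shows "free_eval A g (letter x) = g x"
  using assms unfolding free_eval_def letter_def by (subst lin_single) (auto simp: word_prod_def)

end

lemma letter_part: "x \<in> X \<Longrightarrow> letter x \<in> part (free_superalg X par) (par x)"
  by (simp add: letter_def word_parity_def)

lemma letter_carrier: "x \<in> X \<Longrightarrow> letter x \<in> carrier (free_superalg X par)"
  by (simp add: letter_def)

context salg_hom
begin

lemma hom_word_prod:
  assumes "\<And>x. x \<in> set (letters w) \<Longrightarrow> g x \<in> carrier A"
  shows "word_prod A g w \<in> carrier A" "h (word_prod A g w) = word_prod B (\<lambda>x. h (g x)) w"
proof -
  have "foldr (\<lambda>x y. g x \<otimes> y) xs \<one> \<in> carrier A \<and> h (foldr (\<lambda>x y. g x \<otimes> y) xs \<one>) =
    foldr (\<lambda>x y. h (g x) \<otimes>\<^bsub>B\<^esub> y) xs \<one>\<^bsub>B\<^esub>" if "\<forall>x\<in>set xs. g x \<in> carrier A" for xs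
    using that by (induction xs) auto
  then show "word_prod A g w \<in> carrier A" "h (word_prod A g w) = word_prod B (\<lambda>x. h (g x)) w"
    using assms by (auto simp: word_prod_def)
qed

lemma hom_free_eval:
  assumes "\<And>x. x \<in> X \<Longrightarrow> g x \<in> carrier A" "f \<in> carrier (free_superalg X par)"
  shows "h (free_eval A g f) = free_eval B (\<lambda>x. h (g x)) f"
proof -
  have k: "\<And>w. w \<in> Poly_Mapping.keys f \<Longrightarrow> \<forall>x\<in>set (letters w). g x \<in> carrier A"
    using assms by auto
  have "h (free_eval A g f) = lin B (\<lambda>w. h (word_prod A g w)) f"
    unfolding free_eval_def using k hom_word_prod(1)[of _ g] by (intro hom_lin) auto
  also have "\<dots> = lin B (word_prod B (\<lambda>x. h (g x))) f"
    using k hom_word_prod[of _ g] by (intro B.lin_cong) (auto simp flip: hom_word_prod(2))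
  finally show ?thesis by (simp add: free_eval_def)
qed

end

lemma word_prod_letter: "word_prod (free_superalg X par) letter w = (Poly_Mapping.single w 1 :: _ \<Rightarrow>\<^sub>0 'k::field)"
proof -
  have "foldr (\<lambda>x y. letter x * y) xs 1 = (Poly_Mapping.single (Word xs) 1 :: _ \<Rightarrow>\<^sub>0 'k)" for xs :: "'x list"
  proof (induction xs)
    case Nil
    then show ?case by (simp flip: zero_word_def)
  next
    case (Cons x xs)
    then show ?case by (simp add: letter_def mult_single plus_word_def)
  qed
  from this[of "letters w"] show ?thesis by (simp add: word_prod_def)
qed

lemma free_eval_letter_self:
  "free_eval (free_superalg X par) letter f = f"
  if "f \<in> carrier (free_superalg X par)" for f :: "'x word \<Rightarrow>\<^sub>0 'k::field"
proof -
  let ?D = "{w. set (letters w) \<subseteq> X}"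
  have w: "word_prod (free_superalg X par) letter \<in> ?D \<rightarrow> carrier (free_superalg X par :: ('k, _) superalg)"
    by (auto simp: word_prod_letter)
  have "Poly_Mapping.keys f \<subseteq> ?D" using that by auto
  then show ?thesis unfolding free_eval_def
  proof (induction f rule: poly_mapping_keys_induct)
    case (single u c)
    then show ?case using funcset_mem[OF w single] by (simp add: free.lin_single word_prod_letter)
  next
    case zero
    show ?case using free.lin_zero by simp
  qed (simp add: free.lin_add[OF w])
qed

text \<open>An element of the free superalgebra is its own evaluation at the letters; applying
  \<open>h\<close> to that expression gives the formula.\<close>

lemma free_hom_eq_eval:
  assumes "salg_hom (free_superalg X par) B h" "f \<in> carrier (free_superalg X par)"
  shows "h f = free_eval B (\<lambda>x. h (letter x)) f"
proof -
  interpret salg_hom "free_superalg X par" B h by fact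
  show ?thesis
    using hom_free_eval[of X letter f par] letter_carrier assms(2) free_eval_letter_self[OF assms(2)] by metis
qed

section \<open>The tensor product\<close>

lemma vspaceI:
  fixes C :: "('k::field, 'c) superalg" (structure)
  assumes "abelian_group C"
    and "\<And>c x. x \<in> carrier C \<Longrightarrow> c \<odot> x \<in> carrier C"
    and "\<And>c d x. x \<in> carrier C \<Longrightarrow> (c + d) \<odot> x = c \<odot> x \<oplus> d \<odot> x"
    and "\<And>c x y. x \<in> carrier C \<Longrightarrow> y \<in> carrier C \<Longrightarrow> c \<odot> (x \<oplus> y) = c \<odot> x \<oplus> c \<odot> y"
    and "\<And>c d x. x \<in> carrier C \<Longrightarrow> (c * d) \<odot> x = c \<odot> (d \<odot> x)"
    and "\<And>x. x \<in> carrier C \<Longrightarrow> 1 \<odot> x = x"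
  shows "vspace C"
  using assms by (intro vspace.intro moduleI cring_ground) auto

section \<open>Bilinear maps and the vector space underlying the tensor product\<close>

definition bilinear ::
    "('k::field, 'a) superalg \<Rightarrow> ('k, 'b) superalg \<Rightarrow> ('k, 'c) superalg \<Rightarrow> ('a \<Rightarrow> 'b \<Rightarrow> 'c) \<Rightarrow> bool" where
  "bilinear A B C \<phi> \<longleftrightarrow>
    (\<forall>a \<in> carrier A. \<forall>b \<in> carrier B. \<phi> a b \<in> carrier C) \<and>
    (\<forall>a \<in> carrier A. \<forall>a' \<in> carrier A. \<forall>b \<in> carrier B. \<phi> (a \<oplus>\<^bsub>A\<^esub> a') b = \<phi> a b \<oplus>\<^bsub>C\<^esub> \<phi> a' b) \<and>
    (\<forall>a \<in> carrier A. \<forall>b \<in> carrier B. \<forall>b' \<in> carrier B. \<phi> a (b \<oplus>\<^bsub>B\<^esub> b') = \<phi> a b \<oplus>\<^bsub>C\<^esub> \<phi> a b') \<and>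
    (\<forall>c. \<forall>a \<in> carrier A. \<forall>b \<in> carrier B. \<phi> (c \<odot>\<^bsub>A\<^esub> a) b = c \<odot>\<^bsub>C\<^esub> \<phi> a b) \<and>
    (\<forall>c. \<forall>a \<in> carrier A. \<forall>b \<in> carrier B. \<phi> a (c \<odot>\<^bsub>B\<^esub> b) = c \<odot>\<^bsub>C\<^esub> \<phi> a b)"

lemma bilinearI:
  assumes "\<And>a b. a \<in> carrier A \<Longrightarrow> b \<in> carrier B \<Longrightarrow> \<phi> a b \<in> carrier C"
    and "\<And>a a' b. a \<in> carrier A \<Longrightarrow> a' \<in> carrier A \<Longrightarrow> b \<in> carrier B \<Longrightarrow>
      \<phi> (a \<oplus>\<^bsub>A\<^esub> a') b = \<phi> a b \<oplus>\<^bsub>C\<^esub> \<phi> a' b"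
    and "\<And>a b b'. a \<in> carrier A \<Longrightarrow> b \<in> carrier B \<Longrightarrow> b' \<in> carrier B \<Longrightarrow>
      \<phi> a (b \<oplus>\<^bsub>B\<^esub> b') = \<phi> a b \<oplus>\<^bsub>C\<^esub> \<phi> a b'"
    and "\<And>c a b. a \<in> carrier A \<Longrightarrow> b \<in> carrier B \<Longrightarrow> \<phi> (c \<odot>\<^bsub>A\<^esub> a) b = c \<odot>\<^bsub>C\<^esub> \<phi> a b"
    and "\<And>c a b. a \<in> carrier A \<Longrightarrow> b \<in> carrier B \<Longrightarrow> \<phi> a (c \<odot>\<^bsub>B\<^esub> b) = c \<odot>\<^bsub>C\<^esub> \<phi> a b"
  shows "bilinear A B C \<phi>"
  using assms unfolding bilinear_def by blast

lemma bilinearD: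
  assumes "bilinear A B C \<phi>"
  shows "a \<in> carrier A \<Longrightarrow> b \<in> carrier B \<Longrightarrow> \<phi> a b \<in> carrier C"
    and "a \<in> carrier A \<Longrightarrow> a' \<in> carrier A \<Longrightarrow> b \<in> carrier B \<Longrightarrow>
      \<phi> (a \<oplus>\<^bsub>A\<^esub> a') b = \<phi> a b \<oplus>\<^bsub>C\<^esub> \<phi> a' b"
    and "a \<in> carrier A \<Longrightarrow> b \<in> carrier B \<Longrightarrow> b' \<in> carrier B \<Longrightarrow>
      \<phi> a (b \<oplus>\<^bsub>B\<^esub> b') = \<phi> a b \<oplus>\<^bsub>C\<^esub> \<phi> a b'"
    and "a \<in> carrier A \<Longrightarrow> b \<in> carrier B \<Longrightarrow> \<phi> (c \<odot>\<^bsub>A\<^esub> a) b = c \<odot>\<^bsub>C\<^esub> \<phi> a b"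
    and "a \<in> carrier A \<Longrightarrow> b \<in> carrier B \<Longrightarrow> \<phi> a (c \<odot>\<^bsub>B\<^esub> b) = c \<odot>\<^bsub>C\<^esub> \<phi> a b"
  using assms unfolding bilinear_def by blast+

lemma tensor_simps:
  "carrier (tensor A B) = tensor_class A B ` {f. Poly_Mapping.keys f \<subseteq> carrier A \<times> carrier B}"
  "\<one>\<^bsub>tensor A B\<^esub> = tens A B \<one>\<^bsub>A\<^esub> \<one>\<^bsub>B\<^esub>"
  "\<zero>\<^bsub>tensor A B\<^esub> = tensor_class A B 0"
  "X \<otimes>\<^bsub>tensor A B\<^esub> Y = tensor_class A B (tensor_mult_rep A B (tensor_rep X) (tensor_rep Y))"
  "X \<oplus>\<^bsub>tensor A B\<^esub> Y = tensor_class A B (tensor_rep X + tensor_rep Y)"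
  "c \<odot>\<^bsub>tensor A B\<^esub> X = tensor_class A B (fscale c (tensor_rep X))"
  "part (tensor A B) p = tensor_class A B ` {f. Poly_Mapping.keys f \<subseteq> (\<Union>q. part A q \<times> part B (p + q))}"
  by (simp_all add: tensor_def)

lemma class_eq_iff:
  "tensor_class A B f = tensor_class A B g \<longleftrightarrow> f - g \<in> fvs.span (tensor_relators A B)"
proof
  assume "tensor_class A B f = tensor_class A B g"
  moreover have "f \<in> tensor_class A B f" by (simp add: tensor_class_def fvs.span_zero)
  ultimately show "f - g \<in> fvs.span (tensor_relators A B)" by (simp add: tensor_class_def)
next
  assume fg: "f - g \<in> fvs.span (tensor_relators A B)"
  have "h - f \<in> fvs.span (tensor_relators A B) \<longleftrightarrow> h - g \<in> fvs.span (tensor_relators A B)" for h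
    using fvs.span_add[OF _ fg, of "h - f"] fvs.span_diff[OF _ fg, of "h - g"] by auto
  then show "tensor_class A B f = tensor_class A B g" by (simp add: tensor_class_def)
qed

text \<open>Operations on the tensor product are defined through \<open>tensor_rep\<close>. They do
  not depend on the choice because representatives of one class differ by a combination of
  relators.\<close>

lemma rep_class_diff: "tensor_rep (tensor_class A B f) - f \<in> fvs.span (tensor_relators A B)"
proof -
  have "f \<in> tensor_class A B f" by (simp add: tensor_class_def fvs.span_zero)
  then have "tensor_rep (tensor_class A B f) \<in> tensor_class A B f"
    unfolding tensor_rep_def by (rule someI)
  then show ?thesis by (simp add: tensor_class_def)
qed

lemma class_rep_class [simp]: "tensor_class A B (tensor_rep (tensor_class A B f)) = tensor_class A B f"
  using rep_class_diff by (simp add: class_eq_iff)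

lemma class_add: "tensor_class A B f \<oplus>\<^bsub>tensor A B\<^esub> tensor_class A B g = tensor_class A B (f + g)"
proof -
  have "(tensor_rep (tensor_class A B f) - f) + (tensor_rep (tensor_class A B g) - g)
      \<in> fvs.span (tensor_relators A B)"
    by (intro fvs.span_add rep_class_diff)
  then show ?thesis by (simp add: tensor_simps class_eq_iff algebra_simps)
qed

lemma class_smult: "c \<odot>\<^bsub>tensor A B\<^esub> tensor_class A B f = tensor_class A B (fscale c f)"
proof -
  have "fscale c (tensor_rep (tensor_class A B f) - f) \<in> fvs.span (tensor_relators A B)"
    by (intro fvs.span_scale rep_class_diff)
  then show ?thesis by (simp add: tensor_simps class_eq_iff fvs.scale_right_diff_distrib)
qed

lemma keys_diff_subset: "Poly_Mapping.keys f \<subseteq> D \<Longrightarrow> Poly_Mapping.keys g \<subseteq> D \<Longrightarrow>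
    Poly_Mapping.keys (f - g) \<subseteq> D" for f g :: "'x \<Rightarrow>\<^sub>0 'k::field"
  by (rule order_trans[OF keys_diff]) simp

lemma keys_fscale_subset: "Poly_Mapping.keys f \<subseteq> D \<Longrightarrow> Poly_Mapping.keys (fscale c f) \<subseteq> D"
  by (rule order_trans[OF keys_fscale])

locale tensor_product = A: salg A + B: salg B
  for A :: "('k::field, 'a) superalg" and B :: "('k, 'b) superalg"
begin

abbreviation T where "T \<equiv> tensor A B"
abbreviation D where "D \<equiv> carrier A \<times> carrier B"

lemma carrierE:
  assumes "X \<in> carrier T"
  obtains f where "Poly_Mapping.keys f \<subseteq> D" "X = tensor_class A B f"
  using assms by (auto simp: tensor_simps)

lemma class_closed: "Poly_Mapping.keys f \<subseteq> D \<Longrightarrow> tensor_class A B f \<in> carrier T"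
  by (simp add: tensor_simps)

lemma vspace_tensor: "vspace T"
proof (rule vspaceI)
  show "abelian_group T"
  proof (rule abelian_groupI)
    fix x assume "x \<in> carrier T"
    then obtain f where f: "Poly_Mapping.keys f \<subseteq> D" "x = tensor_class A B f" by (rule carrierE)
    have "Poly_Mapping.keys (- f) \<subseteq> D" using f by (auto simp: in_keys_iff)
    then show "\<exists>y\<in>carrier T. y \<oplus>\<^bsub>T\<^esub> x = \<zero>\<^bsub>T\<^esub>"
      using f by (intro bexI[of _ "tensor_class A B (- f)"] class_closed) (simp_all add: class_add tensor_simps(3))
    show "\<zero>\<^bsub>T\<^esub> \<oplus>\<^bsub>T\<^esub> x = x" using f by (simp add: class_add tensor_simps(3))
    fix y assume "y \<in> carrier T"
    then obtain g where g: "Poly_Mapping.keys g \<subseteq> D" "y = tensor_class A B g" by (rule carrierE)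
    show "x \<oplus>\<^bsub>T\<^esub> y \<in> carrier T" using f g by (simp add: class_add class_closed keys_add_subset)
    show "x \<oplus>\<^bsub>T\<^esub> y = y \<oplus>\<^bsub>T\<^esub> x" using f g by (simp add: class_add add.commute)
    fix z assume "z \<in> carrier T"
    then obtain h where h: "Poly_Mapping.keys h \<subseteq> D" "z = tensor_class A B h" by (rule carrierE)
    show "x \<oplus>\<^bsub>T\<^esub> y \<oplus>\<^bsub>T\<^esub> z = x \<oplus>\<^bsub>T\<^esub> (y \<oplus>\<^bsub>T\<^esub> z)"
      using f g h by (simp add: class_add add.assoc)
  qed (simp add: tensor_simps)
qed (auto elim!: carrierE simp: class_add class_smult class_closed keys_fscale_subset
    fvs.scale_left_distrib fvs.scale_right_distrib)

sublocale V: vspace T by (rule vspace_tensor)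

text \<open>Every relator involves only pairs of carrier elements. The chosen representative of a
  class is therefore supported on the carriers as soon as some representative is.\<close>

lemma span_relators_keys: "f \<in> fvs.span (tensor_relators A B) \<Longrightarrow> Poly_Mapping.keys f \<subseteq> D"
proof -
  have "fvs.subspace {f. Poly_Mapping.keys f \<subseteq> D}"
    by (rule fvs.subspaceI) (auto simp: keys_add_subset keys_fscale_subset)
  moreover have "tensor_relators A B \<subseteq> {f. Poly_Mapping.keys f \<subseteq> D}"
  proof
    fix f assume "f \<in> tensor_relators A B"
    then have "Poly_Mapping.keys f \<subseteq> D"
      unfolding tensor_relators_def
      by (elim UnE CollectE exE conjE) (simp_all add: keys_diff_subset)
    then show "f \<in> {f. Poly_Mapping.keys f \<subseteq> D}" by simp
  qed
  ultimately have "fvs.span (tensor_relators A B) \<subseteq> {f. Poly_Mapping.keys f \<subseteq> D}"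
    by (intro fvs.span_minimal)
  then show "f \<in> fvs.span (tensor_relators A B) \<Longrightarrow> Poly_Mapping.keys f \<subseteq> D" by auto
qed

lemma rep_keys:
  assumes "X \<in> carrier T"
  shows "Poly_Mapping.keys (tensor_rep X) \<subseteq> D" "tensor_class A B (tensor_rep X) = X"
proof -
  obtain f where f: "Poly_Mapping.keys f \<subseteq> D" "X = tensor_class A B f"
    using assms by (rule carrierE)
  have "Poly_Mapping.keys (tensor_rep X - f) \<subseteq> D"
    unfolding f using rep_class_diff by (rule span_relators_keys)
  then have "Poly_Mapping.keys (tensor_rep X - f + f) \<subseteq> D" using f by (intro keys_add_subset)
  then show "Poly_Mapping.keys (tensor_rep X) \<subseteq> D" by simp
  show "tensor_class A B (tensor_rep X) = X" using f by simp
qed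

lemma tens_closed [simp, intro]: "a \<in> carrier A \<Longrightarrow> b \<in> carrier B \<Longrightarrow> tens A B a b \<in> carrier T"
  unfolding tens_def by (rule class_closed) simp

lemma relator_class_eq:
  assumes "f - g \<in> tensor_relators A B"
  shows "tensor_class A B f = tensor_class A B g"
  using assms by (simp add: class_eq_iff fvs.span_base)

lemma tens_add_left:
  assumes "a \<in> carrier A" "a' \<in> carrier A" "b \<in> carrier B"
  shows "tens A B (a \<oplus>\<^bsub>A\<^esub> a') b = tens A B a b \<oplus>\<^bsub>T\<^esub> tens A B a' b"
  unfolding tens_def class_add
  by (rule relator_class_eq) (use assms in \<open>auto simp: tensor_relators_def algebra_simps\<close>)

lemma tens_add_right:
  assumes "a \<in> carrier A" "b \<in> carrier B" "b' \<in> carrier B"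
  shows "tens A B a (b \<oplus>\<^bsub>B\<^esub> b') = tens A B a b \<oplus>\<^bsub>T\<^esub> tens A B a b'"
  unfolding tens_def class_add
  by (rule relator_class_eq) (use assms in \<open>auto simp: tensor_relators_def algebra_simps\<close>)

lemma tens_smult_left:
  assumes "a \<in> carrier A" "b \<in> carrier B"
  shows "tens A B (c \<odot>\<^bsub>A\<^esub> a) b = c \<odot>\<^bsub>T\<^esub> tens A B a b"
  unfolding tens_def class_smult
  by (rule relator_class_eq) (use assms in \<open>auto simp: tensor_relators_def\<close>)

lemma tens_smult_right:
  assumes "a \<in> carrier A" "b \<in> carrier B"
  shows "tens A B a (c \<odot>\<^bsub>B\<^esub> b) = c \<odot>\<^bsub>T\<^esub> tens A B a b"
  unfolding tens_def class_smult
  by (rule relator_class_eq) (use assms in \<open>auto simp: tensor_relators_def\<close>)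

lemma tens_zero_left [simp]: "b \<in> carrier B \<Longrightarrow> tens A B \<zero>\<^bsub>A\<^esub> b = \<zero>\<^bsub>T\<^esub>"
  using tens_smult_left[of "\<zero>\<^bsub>A\<^esub>" b 0] by simp

lemma tens_zero_right [simp]: "a \<in> carrier A \<Longrightarrow> tens A B a \<zero>\<^bsub>B\<^esub> = \<zero>\<^bsub>T\<^esub>"
  using tens_smult_right[of a "\<zero>\<^bsub>B\<^esub>" 0] by simp

lemma class_single: "tensor_class A B (Poly_Mapping.single (a, b) c) = c \<odot>\<^bsub>T\<^esub> tens A B a b"
  by (simp add: tens_def class_smult)

text \<open>Finite sums of pure tensors exhaust the carrier: a scalar is absorbed into the left
  factor, and each factor splits into homogeneous parts.\<close>

lemma tensor_induct [consumes 1, case_names pure add]: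
  assumes "X \<in> carrier T"
    and pure: "\<And>a b p q. a \<in> part A p \<Longrightarrow> b \<in> part B q \<Longrightarrow> P (tens A B a b)"
    and add: "\<And>X Y. X \<in> carrier T \<Longrightarrow> Y \<in> carrier T \<Longrightarrow> P X \<Longrightarrow> P Y \<Longrightarrow> P (X \<oplus>\<^bsub>T\<^esub> Y)"
  shows "P X"
proof -
  have ab: "P (tens A B a b)" if a: "a \<in> carrier A" and b: "b \<in> carrier B" for a b
    using b
  proof (induction b rule: B.homogeneous_induct)
    case (part q b)
    from a show ?case
    proof (induction a rule: A.homogeneous_induct)
      case (add x y)
      then show ?case using part assms(3) B.part_closed[OF part] by (simp add: tens_add_left)
    qed (use part pure in blast)
  next
    case (add x y)
    then show ?case using a assms(3) by (simp add: tens_add_right)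
  qed
  obtain f where f: "Poly_Mapping.keys f \<subseteq> D" "X = tensor_class A B f"
    using assms(1) by (rule carrierE)
  from f(1) show ?thesis unfolding f(2)
  proof (induction f rule: poly_mapping_keys_induct)
    case zero
    then show ?case using pure[of "\<zero>\<^bsub>A\<^esub>" 0 "\<zero>\<^bsub>B\<^esub>" 0] by (simp flip: tensor_simps(3))
  next
    case (single x c)
    then show ?case using ab[of "c \<odot>\<^bsub>A\<^esub> fst x" "snd x"]
      by (cases x) (simp add: class_single tens_smult_left)
  next
    case (add f g)
    then show ?case using assms(3)[OF class_closed class_closed, of f g] by (simp add: class_add)
  qed
qed

text \<open>Parities add modulo 2, so total parity p with a left factor of parity q means that the
  right factor has parity p + q.\<close>

lemma part_induct [consumes 1, case_names pure add]:
  assumes "X \<in> part T p"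
    and pure: "\<And>a b q. a \<in> part A q \<Longrightarrow> b \<in> part B (p + q) \<Longrightarrow> P (tens A B a b)"
    and add: "\<And>X Y. X \<in> part T p \<Longrightarrow> Y \<in> part T p \<Longrightarrow> P X \<Longrightarrow> P Y \<Longrightarrow> P (X \<oplus>\<^bsub>T\<^esub> Y)"
  shows "P X"
proof -
  let ?K = "\<Union>q. part A q \<times> part B (p + q)"
  obtain f where f: "Poly_Mapping.keys f \<subseteq> ?K" "X = tensor_class A B f"
    using assms(1) by (auto simp: tensor_simps)
  from f(1) show ?thesis unfolding f(2)
  proof (induction f rule: poly_mapping_keys_induct)
    case zero
    then show ?case using pure[of "\<zero>\<^bsub>A\<^esub>" 0 "\<zero>\<^bsub>B\<^esub>"] by (simp flip: tensor_simps(3))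
  next
    case (single x c)
    then obtain a b q where x: "x = (a, b)" "a \<in> part A q" "b \<in> part B (p + q)" by auto
    have "a \<in> carrier A" "b \<in> carrier B" using x A.part_closed B.part_closed by blast+
    then show ?case using pure[of "c \<odot>\<^bsub>A\<^esub> a" q b] x A.part_smult[of a q c]
      by (simp add: class_single tens_smult_left)
  next
    case (add f g)
    then show ?case using assms(3)[of "tensor_class A B f" "tensor_class A B g"]
      by (simp add: class_add tensor_simps(7))
  qed
qed

lemma part_subset: "part T p \<subseteq> carrier T"
  using A.part_closed B.part_closed unfolding tensor_simps by blast

lemma part_add: "X \<in> part T p \<Longrightarrow> Y \<in> part T p \<Longrightarrow> X \<oplus>\<^bsub>T\<^esub> Y \<in> part T p"
  unfolding tensor_simps(7) using keys_add_subset by (force simp: class_add)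

lemma part_smult: "X \<in> part T p \<Longrightarrow> c \<odot>\<^bsub>T\<^esub> X \<in> part T p"
  unfolding tensor_simps(7) using keys_fscale_subset by (force simp: class_smult)

lemma tens_part: "a \<in> part A p \<Longrightarrow> b \<in> part B q \<Longrightarrow> tens A B a b \<in> part T (p + q)"
  unfolding tensor_simps(7) tens_def
  by (rule imageI) (auto intro!: exI[of _ p] simp: add.assoc add.left_commute[of q] add.commute[of p])

lemma tens_part': "a \<in> part A p \<Longrightarrow> b \<in> part B q \<Longrightarrow> r = p + q \<Longrightarrow> tens A B a b \<in> part T r"
  using tens_part by simp

lemma part_zero: "\<zero>\<^bsub>T\<^esub> \<in> part T p"
  unfolding tensor_simps(3,7) by (rule imageI) simp

end

section \<open>The universal property of the tensor product\<close>

locale tensor_bilinear = tensor_product A B + C: vspace C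
  for A :: "('k::field, 'a) superalg" and B :: "('k, 'b) superalg" and C :: "('k, 'c) superalg" +
  fixes \<phi>
  assumes bilinear: "bilinear A B C \<phi>"
begin

lemmas bil = bilinearD[OF bilinear]

abbreviation \<phi>' where "\<phi>' \<equiv> \<lambda>u. \<phi> (fst u) (snd u)"

lemma \<phi>_funcset: "\<phi>' \<in> D \<rightarrow> carrier C"
  using bil(1) by auto

text \<open>Each family of relators expresses one bilinearity condition, so the linear extension of
  a bilinear map kills their span. This makes \<open>tensor_lift\<close> independent of the
  representative it uses.\<close>

lemma lin_relators:
  assumes "f \<in> fvs.span (tensor_relators A B)"
  shows "lin C \<phi>' f = \<zero>\<^bsub>C\<^esub>"
proof -
  let ?S = "{f. Poly_Mapping.keys f \<subseteq> D \<and> lin C \<phi>' f = \<zero>\<^bsub>C\<^esub>}"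
  note l = C.lin_diff[OF \<phi>_funcset] C.lin_add[OF \<phi>_funcset] C.lin_fscale[OF \<phi>_funcset]
  have "fvs.subspace ?S"
    by (rule fvs.subspaceI) (auto simp: keys_add_subset keys_fscale_subset l)
  moreover have "f \<in> ?S" if "f \<in> tensor_relators A B" for f
  proof -
    have "Poly_Mapping.keys f \<subseteq> D" using span_relators_keys fvs.span_base that by blast
    moreover have "lin C \<phi>' f = \<zero>\<^bsub>C\<^esub>"
      using that unfolding tensor_relators_def
    proof (elim UnE CollectE exE conjE)
      fix a a' b assume "f = Poly_Mapping.single (a \<oplus>\<^bsub>A\<^esub> a', b) 1
        - Poly_Mapping.single (a, b) 1 - Poly_Mapping.single (a', b) 1"
        "a \<in> carrier A" "a' \<in> carrier A" "b \<in> carrier B"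
      then show ?thesis
        by (simp add: l keys_diff_subset bil) (simp add: C.minus_eq bil C.a_ac C.r_neg C.r_neg1 C.r_neg2 C.minus_add)
    next
      fix a b b' assume "f = Poly_Mapping.single (a, b \<oplus>\<^bsub>B\<^esub> b') 1
        - Poly_Mapping.single (a, b) 1 - Poly_Mapping.single (a, b') 1"
        "a \<in> carrier A" "b \<in> carrier B" "b' \<in> carrier B"
      then show ?thesis
        by (simp add: l keys_diff_subset bil) (simp add: C.minus_eq bil C.a_ac C.r_neg C.r_neg1 C.r_neg2 C.minus_add)
    next
      fix c a b assume "f = Poly_Mapping.single (c \<odot>\<^bsub>A\<^esub> a, b) 1 - Poly_Mapping.single (a, b) c"
        "a \<in> carrier A" "b \<in> carrier B"
      then show ?thesis
        by (simp add: l keys_diff_subset bil) (simp add: C.minus_eq bil C.r_neg)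
    next
      fix c a b assume "f = Poly_Mapping.single (a, c \<odot>\<^bsub>B\<^esub> b) 1 - Poly_Mapping.single (a, b) c"
        "a \<in> carrier A" "b \<in> carrier B"
      then show ?thesis
        by (simp add: l keys_diff_subset bil) (simp add: C.minus_eq bil C.r_neg)
    qed
    ultimately show ?thesis by simp
  qed
  ultimately have "fvs.span (tensor_relators A B) \<subseteq> ?S" by (intro fvs.span_minimal) auto
  then show ?thesis using assms by auto
qed

lemma lift_class:
  assumes "Poly_Mapping.keys f \<subseteq> D"
  shows "tensor_lift C \<phi> (tensor_class A B f) = lin C \<phi>' f"
proof -
  let ?r = "tensor_rep (tensor_class A B f)"
  have "Poly_Mapping.keys ?r \<subseteq> D" by (rule rep_keys) (rule class_closed[OF assms])
  moreover have "lin C \<phi>' (?r - f) = \<zero>\<^bsub>C\<^esub>" by (rule lin_relators) (rule rep_class_diff)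
  moreover have "Poly_Mapping.keys (?r - f) \<subseteq> D" by (rule span_relators_keys) (rule rep_class_diff)
  ultimately have "lin C \<phi>' (?r - f + f) = lin C \<phi>' f"
    using C.lin_add[OF \<phi>_funcset, of "?r - f" f] C.lin_closed[OF \<phi>_funcset assms] assms by simp
  then show ?thesis by (simp add: tensor_lift_def lin_def)
qed

lemma lift_tens [simp]: "a \<in> carrier A \<Longrightarrow> b \<in> carrier B \<Longrightarrow> tensor_lift C \<phi> (tens A B a b) = \<phi> a b"
  unfolding tens_def by (subst lift_class) (auto simp: bil(1))

lemma lift_closed [simp, intro]: "X \<in> carrier T \<Longrightarrow> tensor_lift C \<phi> X \<in> carrier C"
  by (erule carrierE) (simp add: lift_class C.lin_closed[OF \<phi>_funcset])

lemma lift_add [simp]: "X \<in> carrier T \<Longrightarrow> Y \<in> carrier T \<Longrightarrow>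
    tensor_lift C \<phi> (X \<oplus>\<^bsub>T\<^esub> Y) = tensor_lift C \<phi> X \<oplus>\<^bsub>C\<^esub> tensor_lift C \<phi> Y"
  by (elim carrierE) (simp add: class_add lift_class keys_add_subset C.lin_add[OF \<phi>_funcset])

lemma lift_smult [simp]: "X \<in> carrier T \<Longrightarrow> tensor_lift C \<phi> (c \<odot>\<^bsub>T\<^esub> X) = c \<odot>\<^bsub>C\<^esub> tensor_lift C \<phi> X"
  by (elim carrierE) (simp add: class_smult lift_class keys_fscale_subset C.lin_fscale[OF \<phi>_funcset])

end

lemma sum_bit: "(\<Sum>p\<in>(UNIV :: bit set). h p) = h 0 + (h 1 :: 'x::comm_monoid_add)"
proof -
  have u: "(UNIV :: bit set) = {0, 1}" using bit_cases by blast
  show ?thesis unfolding u by simp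
qed

section \<open>The signed product on the tensor product\<close>

context tensor_product
begin

lemma class_sum:
  assumes "finite S" "\<And>u. u \<in> S \<Longrightarrow> Poly_Mapping.keys (h u) \<subseteq> D"
  shows "tensor_class A B (\<Sum>u\<in>S. h u) = finsum T (\<lambda>u. tensor_class A B (h u)) S"
  using assms
proof (induction S)
  case empty
  then show ?case by (simp add: tensor_simps(3))
next
  case (insert u S)
  then have "(\<lambda>u. tensor_class A B (h u)) \<in> S \<rightarrow> carrier T" "tensor_class A B (h u) \<in> carrier T"
    using class_closed by auto
  with insert show ?case by (simp flip: class_add)
qed

text \<open>The product of two pure tensors, split by the parities of \<open>b\<close> and
  \<open>c\<close>; only the odd-odd term carries a sign. It is bilinear in the pair
  \<open>a\<close>, \<open>b\<close> and in the pair \<open>c\<close>, \<open>d\<close>, so the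
  product of arbitrary tensors can be obtained from the universal property.\<close>

definition pure_mult :: "'a \<Rightarrow> 'b \<Rightarrow> 'a \<Rightarrow> 'b \<Rightarrow> ('a \<times> 'b \<Rightarrow>\<^sub>0 'k) set" where
  "pure_mult a b c d =
    (tens A B (a \<otimes>\<^bsub>A\<^esub> component A 0 c) (component B 0 b \<otimes>\<^bsub>B\<^esub> d) \<oplus>\<^bsub>T\<^esub>
     tens A B (a \<otimes>\<^bsub>A\<^esub> component A 1 c) (component B 0 b \<otimes>\<^bsub>B\<^esub> d)) \<oplus>\<^bsub>T\<^esub>
    (tens A B (a \<otimes>\<^bsub>A\<^esub> component A 0 c) (component B 1 b \<otimes>\<^bsub>B\<^esub> d) \<oplus>\<^bsub>T\<^esub>
     (- 1) \<odot>\<^bsub>T\<^esub> tens A B (a \<otimes>\<^bsub>A\<^esub> component A 1 c) (component B 1 b \<otimes>\<^bsub>B\<^esub> d))"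

lemma pure_mult_closed [simp]:
  "\<lbrakk>a \<in> carrier A; b \<in> carrier B; c \<in> carrier A; d \<in> carrier B\<rbrakk> \<Longrightarrow> pure_mult a b c d \<in> carrier T"
  by (simp add: pure_mult_def)

lemma bilinear_pure_mult_right:
  assumes "a \<in> carrier A" "b \<in> carrier B"
  shows "bilinear A B T (pure_mult a b)"
proof (rule bilinearI)
  fix c c' d assume "c \<in> carrier A" "c' \<in> carrier A" "d \<in> carrier B"
  then show "pure_mult a b (c \<oplus>\<^bsub>A\<^esub> c') d = pure_mult a b c d \<oplus>\<^bsub>T\<^esub> pure_mult a b c' d"
    using assms by (simp add: pure_mult_def A.component_add A.r_distr tens_add_left
      V.smult_add_right V.a_ac)
next
  fix c d d' assume "c \<in> carrier A" "d \<in> carrier B" "d' \<in> carrier B"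
  then show "pure_mult a b c (d \<oplus>\<^bsub>B\<^esub> d') = pure_mult a b c d \<oplus>\<^bsub>T\<^esub> pure_mult a b c d'"
    using assms by (simp add: pure_mult_def B.r_distr tens_add_right V.smult_add_right V.a_ac)
next
  fix k c d assume "c \<in> carrier A" "d \<in> carrier B"
  then show "pure_mult a b (k \<odot>\<^bsub>A\<^esub> c) d = k \<odot>\<^bsub>T\<^esub> pure_mult a b c d"
    "pure_mult a b c (k \<odot>\<^bsub>B\<^esub> d) = k \<odot>\<^bsub>T\<^esub> pure_mult a b c d"
    using assms by (simp_all add: pure_mult_def A.component_smult tens_smult_left tens_smult_right
      V.smult_add_right)
qed (use assms in simp)

lemma bilinear_pure_mult_left:
  assumes "c \<in> carrier A" "d \<in> carrier B"
  shows "bilinear A B T (\<lambda>a b. pure_mult a b c d)"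
proof (rule bilinearI)
  fix a a' b assume "a \<in> carrier A" "a' \<in> carrier A" "b \<in> carrier B"
  then show "pure_mult (a \<oplus>\<^bsub>A\<^esub> a') b c d = pure_mult a b c d \<oplus>\<^bsub>T\<^esub> pure_mult a' b c d"
    using assms by (simp add: pure_mult_def A.l_distr tens_add_left V.smult_add_right V.a_ac)
next
  fix a b b' assume "a \<in> carrier A" "b \<in> carrier B" "b' \<in> carrier B"
  then show "pure_mult a (b \<oplus>\<^bsub>B\<^esub> b') c d = pure_mult a b c d \<oplus>\<^bsub>T\<^esub> pure_mult a b' c d"
    using assms by (simp add: pure_mult_def B.component_add B.l_distr tens_add_right
      V.smult_add_right V.a_ac)
next
  fix k a b assume "a \<in> carrier A" "b \<in> carrier B"
  then show "pure_mult (k \<odot>\<^bsub>A\<^esub> a) b c d = k \<odot>\<^bsub>T\<^esub> pure_mult a b c d"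
    "pure_mult a (k \<odot>\<^bsub>B\<^esub> b) c d = k \<odot>\<^bsub>T\<^esub> pure_mult a b c d"
    using assms by (simp_all add: pure_mult_def B.component_smult tens_smult_left tens_smult_right
      V.smult_add_right)
qed (use assms in simp)

lemma tensor_bilinear_T: "bilinear A B T \<phi> \<Longrightarrow> tensor_bilinear A B T \<phi>"
  by (intro tensor_bilinear.intro tensor_bilinear_axioms.intro tensor_product_axioms vspace_tensor)

lemmas right_bilinear = tensor_bilinear_T[OF bilinear_pure_mult_right]
lemmas lift_right = tensor_bilinear.lift_closed[OF right_bilinear]
  tensor_bilinear.lift_add[OF right_bilinear] tensor_bilinear.lift_smult[OF right_bilinear]
  tensor_bilinear.lift_tens[OF right_bilinear]

lemma left_bilinear:
  assumes Y: "Y \<in> carrier T"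
  shows "tensor_bilinear A B T (\<lambda>a b. tensor_lift T (pure_mult a b) Y)"
proof (rule tensor_bilinear_T, rule bilinearI)
  fix a a' b assume ab: "a \<in> carrier A" "a' \<in> carrier A" "b \<in> carrier B"
  from Y show "tensor_lift T (pure_mult (a \<oplus>\<^bsub>A\<^esub> a') b) Y =
    tensor_lift T (pure_mult a b) Y \<oplus>\<^bsub>T\<^esub> tensor_lift T (pure_mult a' b) Y"
  proof (induction Y rule: tensor_induct)
    case (pure c d p q)
    then have "c \<in> carrier A" "d \<in> carrier B" by auto
    then show ?case using ab bilinearD(2)[OF bilinear_pure_mult_left] by (simp add: lift_right)
  next
    case (add X Y)
    then show ?case using ab by (simp add: lift_right V.a_ac)
  qed
next
  fix a b b' assume ab: "a \<in> carrier A" "b \<in> carrier B" "b' \<in> carrier B"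
  from Y show "tensor_lift T (pure_mult a (b \<oplus>\<^bsub>B\<^esub> b')) Y =
    tensor_lift T (pure_mult a b) Y \<oplus>\<^bsub>T\<^esub> tensor_lift T (pure_mult a b') Y"
  proof (induction Y rule: tensor_induct)
    case (pure c d p q)
    then have "c \<in> carrier A" "d \<in> carrier B" by auto
    then show ?case using ab bilinearD(3)[OF bilinear_pure_mult_left] by (simp add: lift_right)
  next
    case (add X Y)
    then show ?case using ab by (simp add: lift_right V.a_ac)
  qed
next
  fix k a b assume ab: "a \<in> carrier A" "b \<in> carrier B"
  from Y show "tensor_lift T (pure_mult (k \<odot>\<^bsub>A\<^esub> a) b) Y = k \<odot>\<^bsub>T\<^esub> tensor_lift T (pure_mult a b) Y"
  proof (induction Y rule: tensor_induct)
    case (pure c d p q)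
    then have "c \<in> carrier A" "d \<in> carrier B" by auto
    then show ?case using ab bilinearD(4)[OF bilinear_pure_mult_left] by (simp add: lift_right)
  next
    case (add X Y)
    then show ?case using ab by (simp add: lift_right V.smult_add_right)
  qed
  from Y show "tensor_lift T (pure_mult a (k \<odot>\<^bsub>B\<^esub> b)) Y = k \<odot>\<^bsub>T\<^esub> tensor_lift T (pure_mult a b) Y"
  proof (induction Y rule: tensor_induct)
    case (pure c d p q)
    then have "c \<in> carrier A" "d \<in> carrier B" by auto
    then show ?case using ab bilinearD(5)[OF bilinear_pure_mult_left] by (simp add: lift_right)
  next
    case (add X Y)
    then show ?case using ab by (simp add: lift_right V.smult_add_right)
  qed
qed (use Y in \<open>simp add: lift_right\<close>)

text \<open>Both sides use the same chosen representatives, so this is a rearrangement of finite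
  sums. In return, bilinearity of the product follows from linearity of the lifts.\<close>

lemma mult_eq_lift:
  assumes "X \<in> carrier T" "Y \<in> carrier T"
  shows "X \<otimes>\<^bsub>T\<^esub> Y = tensor_lift T (\<lambda>a b. tensor_lift T (pure_mult a b) Y) X"
proof -
  define f g where "f = tensor_rep X" and "g = tensor_rep Y"
  have k: "Poly_Mapping.keys f \<subseteq> D" "Poly_Mapping.keys g \<subseteq> D"
    unfolding f_def g_def using assms rep_keys by auto
  \<comment> \<open>\<open>E\<close> is the contribution of one pair of basis elements before
    passing to classes; its class is a multiple of \<open>pure_mult\<close>.\<close>
  define E where "E a b c d = (\<Sum>p \<in> UNIV. \<Sum>q \<in> UNIV.
        Poly_Mapping.single (a \<otimes>\<^bsub>A\<^esub> component A q c, component B p b \<otimes>\<^bsub>B\<^esub> d)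
          (koszul_sign p q * Poly_Mapping.lookup f (a, b) * Poly_Mapping.lookup g (c, d)))" for a b c d
  have E: "Poly_Mapping.keys (E a b c d) \<subseteq> D" "tensor_class A B (E a b c d) =
      Poly_Mapping.lookup f (a, b) \<odot>\<^bsub>T\<^esub> (Poly_Mapping.lookup g (c, d) \<odot>\<^bsub>T\<^esub> pure_mult a b c d)"
    if "a \<in> carrier A" "b \<in> carrier B" "c \<in> carrier A" "d \<in> carrier B" for a b c d
  proof -
    show "Poly_Mapping.keys (E a b c d) \<subseteq> D"
      unfolding E_def sum_bit using that by (intro keys_add_subset) simp_all
    show "tensor_class A B (E a b c d) =
      Poly_Mapping.lookup f (a, b) \<odot>\<^bsub>T\<^esub> (Poly_Mapping.lookup g (c, d) \<odot>\<^bsub>T\<^esub> pure_mult a b c d)"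
      unfolding E_def sum_bit pure_mult_def using that
      by (simp add: class_single V.smult_add_right koszul_sign_def flip: class_add)
  qed
  have cE: "tensor_class A B (\<Sum>v\<in>Poly_Mapping.keys g. E a b (fst v) (snd v)) =
      Poly_Mapping.lookup f (a, b) \<odot>\<^bsub>T\<^esub> tensor_lift T (pure_mult a b) Y"
    "Poly_Mapping.keys (\<Sum>v\<in>Poly_Mapping.keys g. E a b (fst v) (snd v)) \<subseteq> D"
    if "a \<in> carrier A" "b \<in> carrier B" for a b
  proof -
    have v: "fst v \<in> carrier A" "snd v \<in> carrier B" if "v \<in> Poly_Mapping.keys g" for v
      using that k by auto
    have "tensor_class A B (\<Sum>v\<in>Poly_Mapping.keys g. E a b (fst v) (snd v)) =
       finsum T (\<lambda>v. tensor_class A B (E a b (fst v) (snd v))) (Poly_Mapping.keys g)"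
      using v E(1) that by (intro class_sum) auto
    also have "\<dots> = finsum T (\<lambda>v. Poly_Mapping.lookup f (a, b) \<odot>\<^bsub>T\<^esub>
        (Poly_Mapping.lookup g v \<odot>\<^bsub>T\<^esub> pure_mult a b (fst v) (snd v))) (Poly_Mapping.keys g)"
      using v that by (intro V.finsum_cong') (auto simp: E(2))
    also have "\<dots> = Poly_Mapping.lookup f (a, b) \<odot>\<^bsub>T\<^esub> tensor_lift T (pure_mult a b) Y"
      unfolding tensor_lift_def g_def[symmetric]
      using v that by (intro V.finsum_smult[symmetric]) auto
    finally show "tensor_class A B (\<Sum>v\<in>Poly_Mapping.keys g. E a b (fst v) (snd v)) =
      Poly_Mapping.lookup f (a, b) \<odot>\<^bsub>T\<^esub> tensor_lift T (pure_mult a b) Y" .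
    have "Poly_Mapping.keys (sum (\<lambda>v. E a b (fst v) (snd v)) S) \<subseteq> D"
      if "S \<subseteq> Poly_Mapping.keys g" "finite S" for S
      using that(2,1)
    proof (induction S)
      case (insert x S)
      then show ?case using E(1)[OF \<open>a \<in> carrier A\<close> \<open>b \<in> carrier B\<close> v[of x]] by (simp add: keys_add_subset)
    qed simp
    then show "Poly_Mapping.keys (\<Sum>v\<in>Poly_Mapping.keys g. E a b (fst v) (snd v)) \<subseteq> D" by simp
  qed
  have u: "fst u \<in> carrier A" "snd u \<in> carrier B" if "u \<in> Poly_Mapping.keys f" for u
    using that k by auto
  have "X \<otimes>\<^bsub>T\<^esub> Y = tensor_class A B (\<Sum>u\<in>Poly_Mapping.keys f. \<Sum>v\<in>Poly_Mapping.keys g.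
      E (fst u) (snd u) (fst v) (snd v))"
    unfolding tensor_simps(4) tensor_mult_rep_def f_def[symmetric] g_def[symmetric] E_def
    by (simp add: case_prod_beta)
  also have "\<dots> = finsum T (\<lambda>u. tensor_class A B (\<Sum>v\<in>Poly_Mapping.keys g.
      E (fst u) (snd u) (fst v) (snd v))) (Poly_Mapping.keys f)"
    using u cE(2) by (intro class_sum) auto
  also have "\<dots> = finsum T (\<lambda>u. Poly_Mapping.lookup f u \<odot>\<^bsub>T\<^esub>
      tensor_lift T (pure_mult (fst u) (snd u)) Y) (Poly_Mapping.keys f)"
    using u assms(2) by (intro V.finsum_cong') (auto simp: cE(1) lift_right)
  also have "\<dots> = tensor_lift T (\<lambda>a b. tensor_lift T (pure_mult a b) Y) X"
    by (simp add: tensor_lift_def[of T _ X] f_def)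
  finally show ?thesis .
qed

lemma mult_closed [simp]: "X \<in> carrier T \<Longrightarrow> Y \<in> carrier T \<Longrightarrow> X \<otimes>\<^bsub>T\<^esub> Y \<in> carrier T"
  by (simp add: mult_eq_lift tensor_bilinear.lift_closed[OF left_bilinear])

lemma mult_add_left:
  "X \<in> carrier T \<Longrightarrow> X' \<in> carrier T \<Longrightarrow> Y \<in> carrier T \<Longrightarrow>
    (X \<oplus>\<^bsub>T\<^esub> X') \<otimes>\<^bsub>T\<^esub> Y = X \<otimes>\<^bsub>T\<^esub> Y \<oplus>\<^bsub>T\<^esub> X' \<otimes>\<^bsub>T\<^esub> Y"
  by (simp add: mult_eq_lift tensor_bilinear.lift_add[OF left_bilinear])

lemma mult_smult_left:
  "X \<in> carrier T \<Longrightarrow> Y \<in> carrier T \<Longrightarrow> (c \<odot>\<^bsub>T\<^esub> X) \<otimes>\<^bsub>T\<^esub> Y = c \<odot>\<^bsub>T\<^esub> (X \<otimes>\<^bsub>T\<^esub> Y)"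
  by (simp add: mult_eq_lift tensor_bilinear.lift_smult[OF left_bilinear])

lemma tens_mult_lift:
  "a \<in> carrier A \<Longrightarrow> b \<in> carrier B \<Longrightarrow> Y \<in> carrier T \<Longrightarrow>
    tens A B a b \<otimes>\<^bsub>T\<^esub> Y = tensor_lift T (pure_mult a b) Y"
  by (simp add: mult_eq_lift tensor_bilinear.lift_tens[OF left_bilinear])

lemma mult_add_right:
  assumes "X \<in> carrier T" "Y \<in> carrier T" "Y' \<in> carrier T"
  shows "X \<otimes>\<^bsub>T\<^esub> (Y \<oplus>\<^bsub>T\<^esub> Y') = X \<otimes>\<^bsub>T\<^esub> Y \<oplus>\<^bsub>T\<^esub> X \<otimes>\<^bsub>T\<^esub> Y'"
  using assms(1)
proof (induction X rule: tensor_induct)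
  case (pure a b p q)
  then have "a \<in> carrier A" "b \<in> carrier B" by auto
  then show ?case using assms by (simp add: tens_mult_lift lift_right)
next
  case (add X X')
  then show ?case using assms by (simp add: mult_add_left V.a_ac)
qed

lemma mult_smult_right:
  assumes "X \<in> carrier T" "Y \<in> carrier T"
  shows "X \<otimes>\<^bsub>T\<^esub> (c \<odot>\<^bsub>T\<^esub> Y) = c \<odot>\<^bsub>T\<^esub> (X \<otimes>\<^bsub>T\<^esub> Y)"
  using assms(1)
proof (induction X rule: tensor_induct)
  case (pure a b p q)
  then have "a \<in> carrier A" "b \<in> carrier B" by auto
  then show ?case using assms by (simp add: tens_mult_lift lift_right)
next
  case (add X X')
  then show ?case using assms by (simp add: mult_add_left V.smult_add_right)
qed

lemma tens_mult:
  assumes "a \<in> carrier A" "b \<in> part B p" "c \<in> part A q" "d \<in> carrier B"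
  shows "tens A B a b \<otimes>\<^bsub>T\<^esub> tens A B c d = koszul_sign p q \<odot>\<^bsub>T\<^esub> tens A B (a \<otimes>\<^bsub>A\<^esub> c) (b \<otimes>\<^bsub>B\<^esub> d)"
proof -
  have "b \<in> carrier B" "c \<in> carrier A" using assms by auto
  then show ?thesis
    using assms bit_cases[of p] bit_cases[of q]
    by (auto simp: tens_mult_lift lift_right pure_mult_def A.component_part B.component_part
        koszul_sign_def)
qed

text \<open>On homogeneous pure tensors both bracketings carry the sign with exponent pb pc + pb pe
  + pd pe.\<close>

lemma mult_assoc:
  assumes "X \<in> carrier T" "Y \<in> carrier T" "Z \<in> carrier T"
  shows "X \<otimes>\<^bsub>T\<^esub> Y \<otimes>\<^bsub>T\<^esub> Z = X \<otimes>\<^bsub>T\<^esub> (Y \<otimes>\<^bsub>T\<^esub> Z)"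
  using assms(1)
proof (induction X rule: tensor_induct)
  case (pure a b pa pb)
  from assms(2) show ?case
  proof (induction Y rule: tensor_induct)
    case (pure c d pc pd)
    from assms(3) show ?case
    proof (induction Z rule: tensor_induct)
      case (pure e f pe pf)
      note h = \<open>a \<in> part A pa\<close> \<open>b \<in> part B pb\<close> \<open>c \<in> part A pc\<close> \<open>d \<in> part B pd\<close> \<open>e \<in> part A pe\<close> \<open>f \<in> part B pf\<close>
      then have cl: "a \<in> carrier A" "b \<in> carrier B" "c \<in> carrier A" "d \<in> carrier B" "e \<in> carrier A" "f \<in> carrier B"
        by auto
      have "tens A B a b \<otimes>\<^bsub>T\<^esub> tens A B c d \<otimes>\<^bsub>T\<^esub> tens A B e f =
        (koszul_sign pb pc * koszul_sign (pb + pd) pe) \<odot>\<^bsub>T\<^esub>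
          tens A B (a \<otimes>\<^bsub>A\<^esub> c \<otimes>\<^bsub>A\<^esub> e) (b \<otimes>\<^bsub>B\<^esub> d \<otimes>\<^bsub>B\<^esub> f)"
        using cl h B.part_mult[OF h(2,4)] by (simp add: tens_mult mult_smult_left)
      also have "\<dots> = tens A B a b \<otimes>\<^bsub>T\<^esub> (tens A B c d \<otimes>\<^bsub>T\<^esub> tens A B e f)"
        using cl h A.part_mult[OF h(3,5)]
        by (simp add: tens_mult mult_smult_right koszul_sign_add_left koszul_sign_add_right A.m_assoc B.m_assoc mult_ac)
      finally show ?case .
    next
      case (add Z Z')
      note ab = A.part_closed[OF \<open>a \<in> part A pa\<close>] B.part_closed[OF \<open>b \<in> part B pb\<close>]
        A.part_closed[OF \<open>c \<in> part A pc\<close>] B.part_closed[OF \<open>d \<in> part B pd\<close>]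
      from add ab show ?case by (simp add: mult_add_right)
    qed
  next
    case (add Y Y')
    note ab = A.part_closed[OF \<open>a \<in> part A pa\<close>] B.part_closed[OF \<open>b \<in> part B pb\<close>]
    from add ab assms(3) show ?case by (simp add: mult_add_left mult_add_right)
  qed
next
  case (add X X')
  then show ?case using assms by (simp add: mult_add_left)
qed

lemma ring_tensor: "ring T"
proof (rule ringI)
  show "abelian_group T" by (rule V.abelian_group_axioms)
  have one: "\<one>\<^bsub>T\<^esub> = tens A B \<one>\<^bsub>A\<^esub> \<one>\<^bsub>B\<^esub>" by (simp add: tensor_simps)
  show "Group.monoid T"
  proof (rule monoidI)
    fix X assume "X \<in> carrier T"
    then have "\<one>\<^bsub>T\<^esub> \<otimes>\<^bsub>T\<^esub> X = X \<and> X \<otimes>\<^bsub>T\<^esub> \<one>\<^bsub>T\<^esub> = X"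
    proof (induction X rule: tensor_induct)
      case (pure a b p q)
      then have "a \<in> carrier A" "b \<in> carrier B" by auto
      then show ?case using pure tens_mult[of "\<one>\<^bsub>A\<^esub>" "\<one>\<^bsub>B\<^esub>" 0 a p b] tens_mult[of a b q "\<one>\<^bsub>A\<^esub>" 0 "\<one>\<^bsub>B\<^esub>"]
        by (simp add: one)
    next
      case (add X X')
      then show ?case by (simp add: one mult_add_left mult_add_right)
    qed
    then show "\<one>\<^bsub>T\<^esub> \<otimes>\<^bsub>T\<^esub> X = X" "X \<otimes>\<^bsub>T\<^esub> \<one>\<^bsub>T\<^esub> = X" by auto
  qed (simp_all add: mult_assoc one)
qed (simp_all add: mult_add_left mult_add_right)

lemma part_mult:
  assumes "X \<in> part T p" "Y \<in> part T q"
  shows "X \<otimes>\<^bsub>T\<^esub> Y \<in> part T (p + q)"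
  using assms(1)
proof (induction X rule: part_induct)
  case (pure a b r)
  note ab = this
  from assms(2) show ?case
  proof (induction Y rule: part_induct)
    case (pure c d s)
    have "a \<otimes>\<^bsub>A\<^esub> c \<in> part A (r + s)" "b \<otimes>\<^bsub>B\<^esub> d \<in> part B (p + r + (q + s))"
      using ab pure by (auto intro: A.part_mult B.part_mult)
    then have "tens A B (a \<otimes>\<^bsub>A\<^esub> c) (b \<otimes>\<^bsub>B\<^esub> d) \<in> part T (p + q)"
      by (rule tens_part') (simp add: ac_simps)
    then show ?case using ab pure by (subst tens_mult) (auto intro: part_smult)
  next
    case (add Y Y')
    have "a \<in> carrier A" "b \<in> carrier B" using ab by auto
    with add show ?case using part_subset by (subst mult_add_right) (auto intro: part_add)
  qed
next
  case (add X X')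
  then show ?case using part_subset assms(2) by (subst mult_add_left) (auto intro: part_add)
qed

lemma superalgebra_tensor: "superalgebra T"
proof (rule superalgebraI)
  show "ring T" by (rule ring_tensor)
  show "\<exists>y\<in>part T 0. \<exists>z\<in>part T 1. X = y \<oplus>\<^bsub>T\<^esub> z" if "X \<in> carrier T" for X
    using that
  proof (induction X rule: tensor_induct)
    case (pure a b p q)
    then have t: "tens A B a b \<in> part T (p + q)" "tens A B a b \<in> carrier T" by (auto intro: tens_part)
    from bit_cases[of "p + q"] show ?case
    proof
      assume "p + q = 0"
      then show ?thesis using t part_zero
        by (intro bexI[of _ "tens A B a b"] bexI[of _ "\<zero>\<^bsub>T\<^esub>"]) auto
    next
      assume "p + q = 1"
      then show ?thesis using t part_zero
        by (intro bexI[of _ "tens A B a b"] bexI[of _ "\<zero>\<^bsub>T\<^esub>"]) auto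
    qed
  next
    case (add X Y)
    then obtain x0 x1 y0 y1 where h: "x0 \<in> part T 0" "x1 \<in> part T 1" "X = x0 \<oplus>\<^bsub>T\<^esub> x1"
      "y0 \<in> part T 0" "y1 \<in> part T 1" "Y = y0 \<oplus>\<^bsub>T\<^esub> y1" by auto
    then have "x0 \<in> carrier T" "x1 \<in> carrier T" "y0 \<in> carrier T" "y1 \<in> carrier T"
      using part_subset by auto
    then show ?case using h
      by (intro bexI[of _ "x0 \<oplus>\<^bsub>T\<^esub> y0"] bexI[of _ "x1 \<oplus>\<^bsub>T\<^esub> y1"]) (auto intro: part_add simp: V.a_ac)
  qed
  \<comment> \<open>The lift of \<open>\<pi>\<close> is the identity on even tensors and zero on odd
    ones, so a tensor of both parities is zero.\<close>
  define \<pi> where "\<pi> a b = tens A B (component A 0 a) (component B 0 b) \<oplus>\<^bsub>T\<^esub>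
    tens A B (component A 1 a) (component B 1 b)" for a b
  have "bilinear A B T \<pi>"
    by (rule bilinearI) (simp_all add: \<pi>_def A.component_add B.component_add A.component_smult
      B.component_smult tens_add_left tens_add_right tens_smult_left tens_smult_right V.smult_add_right V.a_ac)
  then interpret \<pi>: tensor_bilinear A B T \<pi> by (rule tensor_bilinear_T)
  show "X = \<zero>\<^bsub>T\<^esub>" if X: "X \<in> part T 0" "X \<in> part T 1" for X
  proof -
    have "tensor_lift T \<pi> X = X"
      using X(1)
    proof (induction X rule: part_induct)
      case (pure a b q)
      have "a \<in> carrier A" "b \<in> carrier B" using pure by auto
      then show ?case using pure bit_cases[of q]
        by (elim disjE; subst \<pi>.lift_tens) (simp_all add: \<pi>_def A.component_part B.component_part)
    next
      case (add X Y)
      then have "X \<in> carrier T" "Y \<in> carrier T" using part_subset[of 0] by auto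
      with add show ?case by simp
    qed
    moreover have "tensor_lift T \<pi> X = \<zero>\<^bsub>T\<^esub>"
      using X(2)
    proof (induction X rule: part_induct)
      case (pure a b q)
      have "a \<in> carrier A" "b \<in> carrier B" using pure by auto
      then show ?case using pure bit_cases[of q]
        by (elim disjE; subst \<pi>.lift_tens) (simp_all add: \<pi>_def A.component_part B.component_part)
    next
      case (add X Y)
      then have "X \<in> carrier T" "Y \<in> carrier T" using part_subset[of 1] by auto
      with add show ?case by simp
    qed
    ultimately show ?thesis by simp
  qed
qed (auto simp: mult_smult_left mult_smult_right V.smult_add_left V.smult_add_right
    part_add part_smult part_zero part_mult dest: part_subset[THEN subsetD])

sublocale T: salg T by (rule salg.intro) (rule superalgebra_tensor)

lemma tensor_one: "tens A B \<one>\<^bsub>A\<^esub> \<one>\<^bsub>B\<^esub> = \<one>\<^bsub>T\<^esub>"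
  by (simp add: tensor_simps)

end

section \<open>Strictness of the tensor product\<close>

locale strict_tensor_product = A: strict_salg A + B: strict_salg B
  for A :: "('k::field, 'a) superalg" and B :: "('k, 'b) superalg"

sublocale strict_tensor_product \<subseteq> tensor_product A B ..

text \<open>A pure tensor of odd total parity has an odd factor, whose square vanishes; in a sum the
  two cross terms cancel by anticommutation. Squares are treated separately from supercommutativity
  because of characteristic 2.\<close>

lemma (in strict_tensor_product) strict_tensor: "strict_salg T"
proof (intro strict_salg.intro strict_salg_axioms.intro)
  show "salg T" by (rule T.salg_axioms)
  show comm: "X \<otimes>\<^bsub>T\<^esub> Y = koszul_sign p q \<odot>\<^bsub>T\<^esub> (Y \<otimes>\<^bsub>T\<^esub> X)"
    if X: "X \<in> part T p" and Y: "Y \<in> part T q" for X Y p q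
    using X
  proof (induction X rule: part_induct)
    case (pure a b r)
    note ab = this
    from Y show ?case
    proof (induction Y rule: part_induct)
      case (pure c d s)
      have cl: "a \<in> carrier A" "b \<in> carrier B" "c \<in> carrier A" "d \<in> carrier B"
        using ab pure by auto
      have "tens A B a b \<otimes>\<^bsub>T\<^esub> tens A B c d =
          koszul_sign (p + r) s \<odot>\<^bsub>T\<^esub> tens A B (a \<otimes>\<^bsub>A\<^esub> c) (b \<otimes>\<^bsub>B\<^esub> d)"
        using ab pure cl by (intro tens_mult)
      also have "\<dots> = (koszul_sign (p + r) s * koszul_sign r s * koszul_sign (p + r) (q + s)) \<odot>\<^bsub>T\<^esub>
          tens A B (c \<otimes>\<^bsub>A\<^esub> a) (d \<otimes>\<^bsub>B\<^esub> b)"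
        using A.supercomm[OF ab(1) pure(1)] B.supercomm[OF ab(2) pure(2)] cl
        by (simp add: tens_smult_left tens_smult_right mult_ac)
      \<comment> \<open>Modulo 2 the exponents are (p + r)s + rs + (p + r)(q + s) on the left and pq
        + (q + s)r on the right; both equal pq + qr + rs.\<close>
      also have "koszul_sign (p + r) s * koszul_sign r s * koszul_sign (p + r) (q + s) =
          (koszul_sign p q * koszul_sign (q + s) r :: 'k)"
        using bit_cases[of p] bit_cases[of q] bit_cases[of r] bit_cases[of s]
        by (auto simp: koszul_sign_def)
      also have "\<dots> \<odot>\<^bsub>T\<^esub> tens A B (c \<otimes>\<^bsub>A\<^esub> a) (d \<otimes>\<^bsub>B\<^esub> b) =
          koszul_sign p q \<odot>\<^bsub>T\<^esub> (tens A B c d \<otimes>\<^bsub>T\<^esub> tens A B a b)"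
        using tens_mult[OF cl(3) pure(2) ab(1) cl(2)] cl by simp
      finally show ?case .
    next
      case (add Y Y')
      have "a \<in> carrier A" "b \<in> carrier B" "Y \<in> carrier T" "Y' \<in> carrier T" using ab add by auto
      with add show ?case by (simp add: mult_add_right mult_add_left V.smult_add_right)
    qed
  next
    case (add X X')
    have "Y \<in> carrier T" "X \<in> carrier T" "X' \<in> carrier T" using Y add by auto
    with add show ?case by (simp add: mult_add_right mult_add_left V.smult_add_right)
  qed
  show "X \<otimes>\<^bsub>T\<^esub> X = \<zero>\<^bsub>T\<^esub>" if "X \<in> part T 1" for X
    using that
  proof (induction X rule: part_induct)
    case (pure a b q)
    have cl: "a \<in> carrier A" "b \<in> carrier B" using pure by auto
    have "a \<otimes>\<^bsub>A\<^esub> a = \<zero>\<^bsub>A\<^esub> \<or> b \<otimes>\<^bsub>B\<^esub> b = \<zero>\<^bsub>B\<^esub>"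
      using bit_cases[of q] pure A.odd_square B.odd_square by auto
    then show ?case using tens_mult[OF cl(1) pure(2) pure(1) cl(2)] cl by (elim disjE) simp_all
  next
    case (add X Y)
    have cl: "X \<in> carrier T" "Y \<in> carrier T" using add by auto
    have "X \<otimes>\<^bsub>T\<^esub> Y = \<ominus>\<^bsub>T\<^esub> (Y \<otimes>\<^bsub>T\<^esub> X)"
      using comm[OF add(1,2)] cl by (simp add: koszul_sign_def V.uminus_smult)
    then show ?case using add cl by (simp add: mult_add_left mult_add_right V.r_neg)
  qed
qed

sublocale strict_tensor_product \<subseteq> T: strict_salg T by (rule strict_tensor)

lemma strict_salg_ground: "strict_salg (ground :: ('k::field, 'k) superalg)"
proof -
  interpret cring "ground :: ('k, 'k) superalg" by (rule cring_ground)
  have "salg (ground :: ('k, 'k) superalg)"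
    by (intro salg.intro superalgebraI ring_axioms)
      (auto simp: algebra_simps split: if_splits intro: exI[of _ 0])
  then show ?thesis
    by (rule strict_salg.intro, unfold_locales) (auto split: if_splits simp: koszul_sign_def)
qed

section \<open>Homomorphisms out of tensor products\<close>

context tensor_product
begin

text \<open>Multiplicativity is bilinear in both arguments, so the signed product rule on
  homogeneous pure tensors is enough. Tensor products of maps, the associator and the contractions
  with a counit are all obtained from this criterion.\<close>

lemma lift_superalg_hom:
  assumes "salg C" "bilinear A B C \<phi>" "\<phi> \<one>\<^bsub>A\<^esub> \<one>\<^bsub>B\<^esub> = \<one>\<^bsub>C\<^esub>"
    and part: "\<And>a b p q. a \<in> part A p \<Longrightarrow> b \<in> part B q \<Longrightarrow> \<phi> a b \<in> part C (p + q)"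
    and mult: "\<And>a b c d pa pb pc pd. \<lbrakk>a \<in> part A pa; b \<in> part B pb; c \<in> part A pc; d \<in> part B pd\<rbrakk> \<Longrightarrow>
      \<phi> a b \<otimes>\<^bsub>C\<^esub> \<phi> c d = koszul_sign pb pc \<odot>\<^bsub>C\<^esub> \<phi> (a \<otimes>\<^bsub>A\<^esub> c) (b \<otimes>\<^bsub>B\<^esub> d)"
  shows "tensor_lift C \<phi> \<in> superalg_hom T C"
proof -
  interpret C: salg C by fact
  interpret l: tensor_bilinear A B C \<phi>
    by (intro tensor_bilinear.intro tensor_bilinear_axioms.intro tensor_product_axioms C.vspace_axioms assms)
  show ?thesis
  proof (rule superalg_homI)
    fix X Y assume X: "X \<in> carrier T" and Y: "Y \<in> carrier T"
    from X show "tensor_lift C \<phi> (X \<otimes>\<^bsub>T\<^esub> Y) = tensor_lift C \<phi> X \<otimes>\<^bsub>C\<^esub> tensor_lift C \<phi> Y"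
    proof (induction X rule: tensor_induct)
      case (pure a b pa pb)
      note ab = pure A.part_closed[OF pure(1)] B.part_closed[OF pure(2)]
      from Y show ?case
      proof (induction Y rule: tensor_induct)
        case (pure c d pc pd)
        note cd = pure A.part_closed[OF pure(1)] B.part_closed[OF pure(2)]
        then show ?case using ab mult[OF ab(1,2) cd(1,2)] by (simp add: tens_mult)
      next
        case (add Y Y')
        with ab l.bil(1)[OF ab(3,4)] show ?case by (simp add: mult_add_right C.r_distr)
      qed
    next
      case (add X X')
      with Y show ?case by (simp add: mult_add_left C.l_distr)
    qed
  next
    fix X p assume "X \<in> part T p"
    then show "tensor_lift C \<phi> X \<in> part C p"
    proof (induction X rule: part_induct)
      case (pure a b q)
      then show ?case using part[OF pure] A.part_closed[OF pure(1)] B.part_closed[OF pure(2)]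
        by (simp add: ac_simps)
    next
      case (add X Y)
      then show ?case using T.part_closed[OF add(1)] T.part_closed[OF add(2)]
        by (simp add: C.part_add)
    qed
  qed (use assms(3) in \<open>simp_all flip: tensor_one\<close>)
qed

end

lemma tensor_productI: "salg A \<Longrightarrow> salg B \<Longrightarrow> tensor_product A B"
  by (rule tensor_product.intro)

lemma
  assumes "salg_hom A C f" "salg_hom B D g"
  shows tensor_map_hom: "tensor_map C D f g \<in> superalg_hom (tensor A B) (tensor C D)"
    and tensor_map_tens: "a \<in> carrier A \<Longrightarrow> b \<in> carrier B \<Longrightarrow>
      tensor_map C D f g (tens A B a b) = tens C D (f a) (g b)"
proof -
  interpret f: salg_hom A C f by fact
  interpret g: salg_hom B D g by fact
  interpret AB: tensor_product A B by (intro tensor_productI f.A.salg_axioms g.A.salg_axioms)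
  interpret CD: tensor_product C D by (intro tensor_productI f.B.salg_axioms g.B.salg_axioms)
  let ?\<phi> = "\<lambda>a b. tens C D (f a) (g b)"
  have bil: "bilinear A B (tensor C D) ?\<phi>"
    by (rule bilinearI) (simp_all add: CD.tens_add_left CD.tens_add_right CD.tens_smult_left CD.tens_smult_right)
  show "tensor_map C D f g \<in> superalg_hom (tensor A B) (tensor C D)"
    unfolding tensor_map_def
  proof (rule AB.lift_superalg_hom[OF CD.T.salg_axioms bil])
    fix a b c d pa pb pc pd assume h: "a \<in> part A pa" "b \<in> part B pb" "c \<in> part A pc" "d \<in> part B pd"
    note cl = f.A.part_closed[OF h(1)] g.A.part_closed[OF h(2)] f.A.part_closed[OF h(3)] g.A.part_closed[OF h(4)]
    show "?\<phi> a b \<otimes>\<^bsub>tensor C D\<^esub> ?\<phi> c d =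
        koszul_sign pb pc \<odot>\<^bsub>tensor C D\<^esub> ?\<phi> (a \<otimes>\<^bsub>A\<^esub> c) (b \<otimes>\<^bsub>B\<^esub> d)"
      using CD.tens_mult[OF f.closed[OF cl(1)] g.hom_part[OF h(2)] f.hom_part[OF h(3)] g.closed[OF cl(4)]] cl
      by simp
  qed (simp_all add: CD.tensor_one CD.tens_part)
  interpret l: tensor_bilinear A B "tensor C D" ?\<phi>
    by (intro tensor_bilinear.intro tensor_bilinear_axioms.intro AB.tensor_product_axioms CD.vspace_tensor bil)
  show "a \<in> carrier A \<Longrightarrow> b \<in> carrier B \<Longrightarrow>
      tensor_map C D f g (tens A B a b) = tens C D (f a) (g b)"
    unfolding tensor_map_def by (rule l.lift_tens)
qed

lemma
  fixes A :: "('k::field, 'a) superalg"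
  assumes "salg A" "salg B" "salg C"
  shows tensor_assoc_hom: "tensor_assoc A B C \<in>
      superalg_hom (tensor (tensor A B) C) (tensor A (tensor B C))"
    and tensor_assoc_tens: "\<lbrakk>a \<in> carrier A; b \<in> carrier B; c \<in> carrier C\<rbrakk> \<Longrightarrow>
      tensor_assoc A B C (tens (tensor A B) C (tens A B a b) c) = tens A (tensor B C) a (tens B C b c)"
proof -
  interpret A: salg A by fact
  interpret B: salg B by fact
  interpret C: salg C by fact
  interpret AB: tensor_product A B by unfold_locales
  interpret BC: tensor_product B C by unfold_locales
  interpret W: tensor_product "tensor A B" C by unfold_locales
  interpret U: tensor_product A "tensor B C" by unfold_locales
  let ?U = "tensor A (tensor B C)"
  \<comment> \<open>The third factor comes first: for each fixed \<open>c\<close> the remaining map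
    is bilinear in \<open>a\<close> and \<open>b\<close> and can be lifted, and the lift is then
    bilinear in the tensor and \<open>c\<close>.\<close>
  define \<psi> where "\<psi> c a b = tens A (tensor B C) a (tens B C b c)" for a b c
  have psi: "\<psi> c a b = tens A (tensor B C) a (tens B C b c)" for a b c by (simp add: \<psi>_def)
  have bil: "bilinear A B ?U (\<psi> c)" if "c \<in> carrier C" for c
    using that unfolding \<psi>_def
    by (intro bilinearI) (simp_all add: U.tens_add_left U.tens_add_right U.tens_smult_left
      U.tens_smult_right BC.tens_add_left BC.tens_smult_left)
  have l: "tensor_bilinear A B ?U (\<psi> c)" if "c \<in> carrier C" for c
    by (intro tensor_bilinear.intro tensor_bilinear_axioms.intro AB.tensor_product_axioms U.vspace_tensor bil that)
  note lift = tensor_bilinear.lift_closed[OF l] tensor_bilinear.lift_add[OF l]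
    tensor_bilinear.lift_smult[OF l]
  have psi: "tensor_lift ?U (\<psi> c) (tens A B a b) = tens A (tensor B C) a (tens B C b c)"
    if "c \<in> carrier C" "a \<in> carrier A" "b \<in> carrier B" for a b c
    unfolding tensor_bilinear.lift_tens[OF l, OF that] by (rule psi)
  let ?\<phi> = "\<lambda>X c. tensor_lift ?U (\<psi> c) X"
  have bil2: "bilinear (tensor A B) C ?U ?\<phi>"
  proof (rule bilinearI)
    fix X c c' assume X: "X \<in> carrier (tensor A B)" and c: "c \<in> carrier C" "c' \<in> carrier C"
    from X show "?\<phi> X (c \<oplus>\<^bsub>C\<^esub> c') = ?\<phi> X c \<oplus>\<^bsub>?U\<^esub> ?\<phi> X c'"
    proof (induction X rule: AB.tensor_induct)
      case (pure a b pa pb)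
      then show ?case using c A.part_closed[OF pure(1)] B.part_closed[OF pure(2)]
        by (simp add: lift psi BC.tens_add_right U.tens_add_right)
    next
      case (add X Y)
      then show ?case using c by (simp add: lift U.V.a_ac)
    qed
  next
    fix k X c assume X: "X \<in> carrier (tensor A B)" and c: "c \<in> carrier C"
    from X show "?\<phi> X (k \<odot>\<^bsub>C\<^esub> c) = k \<odot>\<^bsub>?U\<^esub> ?\<phi> X c"
    proof (induction X rule: AB.tensor_induct)
      case (pure a b pa pb)
      then show ?case using c A.part_closed[OF pure(1)] B.part_closed[OF pure(2)]
        by (simp add: lift psi BC.tens_smult_right U.tens_smult_right)
    next
      case (add X Y)
      then show ?case using c by (simp add: lift U.V.smult_add_right)
    qed
  qed (simp_all add: lift)
  have assoc_eq: "tensor_assoc A B C = tensor_lift ?U ?\<phi>"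
    unfolding tensor_assoc_def \<psi>_def ..
  show "tensor_assoc A B C \<in> superalg_hom (tensor (tensor A B) C) ?U"
    unfolding assoc_eq
  proof (rule W.lift_superalg_hom[OF U.T.salg_axioms bil2])
    show "?\<phi> \<one>\<^bsub>tensor A B\<^esub> \<one>\<^bsub>C\<^esub> = \<one>\<^bsub>?U\<^esub>"
      by (simp add: lift psi BC.tensor_one U.tensor_one flip: AB.tensor_one)
  next
    fix X c p q assume X: "X \<in> part (tensor A B) p" and c: "c \<in> part C q"
    note cc = C.part_closed[OF c]
    from X show "?\<phi> X c \<in> part ?U (p + q)"
    proof (induction X rule: AB.part_induct)
      case (pure a b r)
      then show ?case using cc A.part_closed[OF pure(1)] B.part_closed[OF pure(2)]
          U.tens_part[OF pure(1) BC.tens_part[OF pure(2) c]]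
        by (simp add: lift psi ac_simps)
    next
      case (add X Y)
      then show ?case using cc AB.T.part_closed[OF add(1)] AB.T.part_closed[OF add(2)]
        by (simp add: lift U.T.part_add)
    qed
  next
    fix X c Y d pX pc pY pd
    assume X: "X \<in> part (tensor A B) pX" and c: "c \<in> part C pc"
      and Y: "Y \<in> part (tensor A B) pY" and d: "d \<in> part C pd"
    note cd = C.part_closed[OF c] C.part_closed[OF d]
    note XY = AB.T.part_closed[OF X] AB.T.part_closed[OF Y]
    from X show "?\<phi> X c \<otimes>\<^bsub>?U\<^esub> ?\<phi> Y d =
        koszul_sign pc pY \<odot>\<^bsub>?U\<^esub> ?\<phi> (X \<otimes>\<^bsub>tensor A B\<^esub> Y) (c \<otimes>\<^bsub>C\<^esub> d)"
    proof (induction X rule: AB.part_induct)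
      case (pure a b r)
      note ab = pure A.part_closed[OF pure(1)] B.part_closed[OF pure(2)]
      from Y show ?case
      proof (induction Y rule: AB.part_induct)
        case (pure a' b' s)
        note ab' = pure A.part_closed[OF pure(1)] B.part_closed[OF pure(2)]
        let ?z = "tens A (tensor B C) (a \<otimes>\<^bsub>A\<^esub> a') (tens B C (b \<otimes>\<^bsub>B\<^esub> b') (c \<otimes>\<^bsub>C\<^esub> d))"
        have "?\<phi> (tens A B a b) c \<otimes>\<^bsub>?U\<^esub> ?\<phi> (tens A B a' b') d =
          (koszul_sign (pX + r + pc) s * koszul_sign pc (pY + s)) \<odot>\<^bsub>?U\<^esub> ?z"
          using ab ab' cd c d BC.tens_part[OF ab(2) c]
          by (simp add: lift psi U.tens_mult BC.tens_mult U.tens_smult_right)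
        moreover have "?\<phi> (tens A B a b \<otimes>\<^bsub>tensor A B\<^esub> tens A B a' b') (c \<otimes>\<^bsub>C\<^esub> d) =
          koszul_sign (pX + r) s \<odot>\<^bsub>?U\<^esub> ?z"
          using ab ab' cd by (simp add: AB.tens_mult lift psi)
        \<comment> \<open>The factor \<open>koszul_sign pc s\<close> occurs twice on the left and
          cancels: moving \<open>c\<close> past \<open>a'\<close> and past \<open>b'\<close>, of
          parities s and pY + s, leaves pc pY in the exponent.\<close>
        moreover have "koszul_sign (pX + r + pc) s * koszul_sign pc (pY + s) =
            (koszul_sign pc pY * koszul_sign (pX + r) s :: 'k)"
          using koszul_sign_square[of pc s, where 'k='k]
          by (simp add: koszul_sign_add_left koszul_sign_add_right del: koszul_sign_square)
        ultimately show ?case using ab ab' cd by simp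
      next
        case (add Y Y')
        note yy = AB.T.part_closed[OF add(1)] AB.T.part_closed[OF add(2)]
        from add ab cd yy show ?case
          by (simp add: lift AB.mult_add_right U.T.r_distr U.V.smult_add_right)
      qed
    next
      case (add X X')
      note xx = AB.T.part_closed[OF add(1)] AB.T.part_closed[OF add(2)]
      from add cd xx XY show ?case
        by (simp add: lift AB.mult_add_left U.T.l_distr U.V.smult_add_right)
    qed
  qed
  interpret l2: tensor_bilinear "tensor A B" C ?U ?\<phi>
    by (intro tensor_bilinear.intro tensor_bilinear_axioms.intro W.tensor_product_axioms U.vspace_tensor bil2)
  show "tensor_assoc A B C (tens (tensor A B) C (tens A B a b) c) = tens A (tensor B C) a (tens B C b c)"
    if "a \<in> carrier A" "b \<in> carrier B" "c \<in> carrier C"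
    using that unfolding assoc_eq by (subst l2.lift_tens) (simp_all add: lift psi)
qed

text \<open>A homomorphism to the purely even ground field kills odd elements. Whenever the Koszul
  sign would be -1 both sides are zero, so contracting with a counit is multiplicative.\<close>

lemma
  fixes A :: "('k::field, 'a) superalg"
  assumes "salg A" "\<epsilon> \<in> superalg_hom A ground"
  shows counit_left_hom: "tensor_lift A (\<lambda>a b. \<epsilon> a \<odot>\<^bsub>A\<^esub> b) \<in> superalg_hom (tensor A A) A"
    and counit_left_tens: "a \<in> carrier A \<Longrightarrow> b \<in> carrier A \<Longrightarrow>
      tensor_lift A (\<lambda>a b. \<epsilon> a \<odot>\<^bsub>A\<^esub> b) (tens A A a b) = \<epsilon> a \<odot>\<^bsub>A\<^esub> b"
    and counit_right_hom: "tensor_lift A (\<lambda>a b. \<epsilon> b \<odot>\<^bsub>A\<^esub> a) \<in> superalg_hom (tensor A A) A"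
    and counit_right_tens: "a \<in> carrier A \<Longrightarrow> b \<in> carrier A \<Longrightarrow>
      tensor_lift A (\<lambda>a b. \<epsilon> b \<odot>\<^bsub>A\<^esub> a) (tens A A a b) = \<epsilon> b \<odot>\<^bsub>A\<^esub> a"
proof -
  interpret A: salg A by fact
  interpret G: strict_salg "ground :: ('k, 'k) superalg" by (rule strict_salg_ground)
  interpret \<epsilon>: salg_hom A ground \<epsilon> by unfold_locales (rule assms(2))
  interpret AA: tensor_product A A by unfold_locales
  have odd: "\<epsilon> a = 0" if "a \<in> part A 1" for a
    using \<epsilon>.hom_part[OF that] by simp
  note e = \<epsilon>.hom_add \<epsilon>.hom_smult \<epsilon>.hom_mult
  have b1: "bilinear A A A (\<lambda>a b. \<epsilon> a \<odot>\<^bsub>A\<^esub> b)"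
    by (rule bilinearI) (simp_all add: A.smult_add_left A.smult_add_right mult_ac)
  have b2: "bilinear A A A (\<lambda>a b. \<epsilon> b \<odot>\<^bsub>A\<^esub> a)"
    by (rule bilinearI) (simp_all add: A.smult_add_left A.smult_add_right mult_ac)
  show "tensor_lift A (\<lambda>a b. \<epsilon> a \<odot>\<^bsub>A\<^esub> b) \<in> superalg_hom (tensor A A) A"
  proof (rule AA.lift_superalg_hom[OF A.salg_axioms b1])
    fix a b p q assume ab: "a \<in> part A p" "b \<in> part A q"
    note cl = A.part_closed[OF ab(1)] A.part_closed[OF ab(2)]
    then show "\<epsilon> a \<odot>\<^bsub>A\<^esub> b \<in> part A (p + q)"
      using bit_cases[of p] ab odd[of a] by (elim disjE) (simp_all add: A.part_smult)
    fix c d pc pd assume cd: "c \<in> part A pc" "d \<in> part A pd"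
    note cl = cl A.part_closed[OF cd(1)] A.part_closed[OF cd(2)]
    then show "(\<epsilon> a \<odot>\<^bsub>A\<^esub> b) \<otimes>\<^bsub>A\<^esub> (\<epsilon> c \<odot>\<^bsub>A\<^esub> d) =
        koszul_sign q pc \<odot>\<^bsub>A\<^esub> (\<epsilon> (a \<otimes>\<^bsub>A\<^esub> c) \<odot>\<^bsub>A\<^esub> (b \<otimes>\<^bsub>A\<^esub> d))"
      using bit_cases[of pc] cd odd[of c] by (elim disjE) (simp_all add: mult_ac)
  qed simp
  show "tensor_lift A (\<lambda>a b. \<epsilon> b \<odot>\<^bsub>A\<^esub> a) \<in> superalg_hom (tensor A A) A"
  proof (rule AA.lift_superalg_hom[OF A.salg_axioms b2])
    fix a b p q assume ab: "a \<in> part A p" "b \<in> part A q"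
    note cl = A.part_closed[OF ab(1)] A.part_closed[OF ab(2)]
    then show "\<epsilon> b \<odot>\<^bsub>A\<^esub> a \<in> part A (p + q)"
      using bit_cases[of q] ab odd[of b] by (elim disjE) (simp_all add: A.part_smult)
    fix c d pc pd assume cd: "c \<in> part A pc" "d \<in> part A pd"
    note cl = cl A.part_closed[OF cd(1)] A.part_closed[OF cd(2)]
    then show "(\<epsilon> b \<odot>\<^bsub>A\<^esub> a) \<otimes>\<^bsub>A\<^esub> (\<epsilon> d \<odot>\<^bsub>A\<^esub> c) =
        koszul_sign q pc \<odot>\<^bsub>A\<^esub> (\<epsilon> (b \<otimes>\<^bsub>A\<^esub> d) \<odot>\<^bsub>A\<^esub> (a \<otimes>\<^bsub>A\<^esub> c))"
      using bit_cases[of q] ab odd[of b] by (elim disjE) (simp_all add: mult_ac)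
  qed simp
  have "tensor_bilinear A A A (\<lambda>a b. \<epsilon> a \<odot>\<^bsub>A\<^esub> b)" "tensor_bilinear A A A (\<lambda>a b. \<epsilon> b \<odot>\<^bsub>A\<^esub> a)"
    by (intro tensor_bilinear.intro tensor_bilinear_axioms.intro AA.tensor_product_axioms A.vspace_axioms b1 b2)+
  then show "a \<in> carrier A \<Longrightarrow> b \<in> carrier A \<Longrightarrow>
      tensor_lift A (\<lambda>a b. \<epsilon> a \<odot>\<^bsub>A\<^esub> b) (tens A A a b) = \<epsilon> a \<odot>\<^bsub>A\<^esub> b"
    "a \<in> carrier A \<Longrightarrow> b \<in> carrier A \<Longrightarrow>
      tensor_lift A (\<lambda>a b. \<epsilon> b \<odot>\<^bsub>A\<^esub> a) (tens A A a b) = \<epsilon> b \<odot>\<^bsub>A\<^esub> a"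
    by (simp_all add: tensor_bilinear.lift_tens)
qed

section \<open>Determinants over commutative rings\<close>

definition ring_sign :: "('a, 'm) ring_scheme \<Rightarrow> (nat \<Rightarrow> nat) \<Rightarrow> 'a" where
  "ring_sign R \<sigma> = (if sign \<sigma> = 1 then \<one>\<^bsub>R\<^esub> else \<ominus>\<^bsub>R\<^esub> \<one>\<^bsub>R\<^esub>)"

text \<open>\<open>mat_det\<close> multiplies in row order because its algebra need not commute. The
  theory is developed for this unordered version over an abstract commutative ring;
  \<open>mat_det_eq_det\<close> connects the two for even matrices.\<close>

definition det :: "('a, 'm) ring_scheme \<Rightarrow> nat set \<Rightarrow> (nat \<Rightarrow> nat \<Rightarrow> 'a) \<Rightarrow> 'a" where
  "det R I M = (\<Oplus>\<^bsub>R\<^esub>\<sigma>\<in>{\<sigma>. \<sigma> permutes I}. ring_sign R \<sigma> \<otimes>\<^bsub>R\<^esub> (\<Otimes>\<^bsub>R\<^esub>i\<in>I. M i (\<sigma> i)))"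

lemma sign_cases: "sign \<sigma> = 1 \<or> sign \<sigma> = -1"
  by (simp add: sign_def)

lemma permutes_compose_image:
  fixes \<tau> :: "nat \<Rightarrow> nat" and S :: "(nat \<Rightarrow> 'x) set"
  assumes "\<tau> permutes I"
  shows "(\<lambda>\<sigma>. \<sigma> \<circ> \<tau>) ` {\<sigma>. \<sigma> permutes I} = {\<sigma>. \<sigma> permutes I}"
    and "inj_on (\<lambda>\<sigma>. \<sigma> \<circ> \<tau>) S"
proof -
  show "(\<lambda>\<sigma>. \<sigma> \<circ> \<tau>) ` {\<sigma>. \<sigma> permutes I} = {\<sigma>. \<sigma> permutes I}"
  proof (intro equalityI subsetI)
    fix \<sigma> assume "\<sigma> \<in> {\<sigma>. \<sigma> permutes I}"
    then have "\<sigma> \<circ> inv_into UNIV \<tau> permutes I" using assms by (auto intro: permutes_compose permutes_inv)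
    moreover have "\<sigma> = (\<sigma> \<circ> inv_into UNIV \<tau>) \<circ> \<tau>" using permutes_inv_o[OF assms] by (simp add: comp_assoc)
    ultimately show "\<sigma> \<in> (\<lambda>\<sigma>. \<sigma> \<circ> \<tau>) ` {\<sigma>. \<sigma> permutes I}" by blast
  qed (use assms in \<open>auto intro: permutes_compose\<close>)
  show "inj_on (\<lambda>\<sigma>. \<sigma> \<circ> \<tau>) S"
  proof (rule inj_onI, rule ext)
    fix f g :: "nat \<Rightarrow> 'x" and x assume "f \<circ> \<tau> = g \<circ> \<tau>"
    moreover obtain y where "x = \<tau> y" using permutes_surj[OF assms] by blast
    ultimately show "f x = g x" by (metis comp_apply)
  qed
qed

context cring
begin

lemma finsum_exchange:
  assumes "finite S" "finite T" "\<And>s t. s \<in> S \<Longrightarrow> t \<in> T \<Longrightarrow> f s t \<in> carrier R"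
  shows "(\<Oplus>s\<in>S. \<Oplus>t\<in>T. f s t) = (\<Oplus>t\<in>T. \<Oplus>s\<in>S. f s t)"
  using assms(1,3)
proof (induction S)
  case (insert s S)
  then have "(\<lambda>t. f s t) \<in> T \<rightarrow> carrier R" "(\<lambda>t. \<Oplus>s\<in>S. f s t) \<in> T \<rightarrow> carrier R"
    "(\<lambda>s. \<Oplus>t\<in>T. f s t) \<in> insert s S \<rightarrow> carrier R" by (auto intro!: finsum_closed)
  with insert have "(\<Oplus>s\<in>insert s S. \<Oplus>t\<in>T. f s t) = (\<Oplus>t\<in>T. f s t \<oplus> (\<Oplus>s\<in>S. f s t))"
    by (simp add: finsum_addf Pi_iff)
  also have "\<dots> = (\<Oplus>t\<in>T. \<Oplus>s\<in>insert s S. f s t)"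
    using insert by (intro finsum_cong') (auto intro!: finsum_closed a_closed simp: Pi_iff)
  finally show ?case .
qed simp

lemma finsum_times:
  assumes "finite S" "finite T" "\<And>s t. s \<in> S \<Longrightarrow> t \<in> T \<Longrightarrow> f (s, t) \<in> carrier R"
  shows "finsum R f (S \<times> T) = (\<Oplus>s\<in>S. \<Oplus>t\<in>T. f (s, t))"
  using assms(1,3)
proof (induction S)
  case (insert s S)
  have "insert s S \<times> T = Pair s ` T \<union> S \<times> T" by auto
  moreover have "Pair s ` T \<inter> S \<times> T = {}" using insert by auto
  moreover have "f \<in> Pair s ` T \<rightarrow> carrier R" "f \<in> S \<times> T \<rightarrow> carrier R" using insert by auto
  ultimately have "finsum R f (insert s S \<times> T) = finsum R f (Pair s ` T) \<oplus> finsum R f (S \<times> T)"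
    using insert assms(2) by (simp add: finsum_Un_disjoint)
  also have "finsum R f (Pair s ` T) = (\<Oplus>t\<in>T. f (s, t))"
    using insert by (intro finsum_reindex) (auto simp: inj_on_def)
  finally show ?case using insert by (simp add: Pi_iff finsum_closed)
qed simp

text \<open>A term of the expanded product picks one summand k for every factor i, hence the sum
  over functions from I to K.\<close>

lemma finprod_finsum:
  assumes "finite I" "finite K" "\<And>i k. i \<in> I \<Longrightarrow> k \<in> K \<Longrightarrow> F i k \<in> carrier R"
  shows "(\<Otimes>i\<in>I. \<Oplus>k\<in>K. F i k) = (\<Oplus>f\<in>I \<rightarrow>\<^sub>E K. \<Otimes>i\<in>I. F i (f i))"
  using assms(1,3)
proof (induction I)
  case (insert x I)
  let ?P = "I \<rightarrow>\<^sub>E K"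
  have fin: "finite ?P" using insert assms by (simp add: finite_PiE)
  have c: "(\<lambda>i. F i (f i)) \<in> I \<rightarrow> carrier R" if "f \<in> ?P" for f
    using that insert by (auto simp: PiE_iff)
  have upd: "(\<Otimes>i\<in>insert x I. F i ((f(x := k)) i)) = F x k \<otimes> (\<Otimes>i\<in>I. F i (f i))"
    if "f \<in> ?P" "k \<in> K" for f k
  proof -
    have "(\<Otimes>i\<in>I. F i ((f(x := k)) i)) = (\<Otimes>i\<in>I. F i (f i))"
      using insert c[OF that(1)] by (intro finprod_cong') auto
    moreover have "(\<lambda>i. F i ((f(x := k)) i)) \<in> I \<rightarrow> carrier R" using c[OF that(1)] insert by auto
    ultimately show ?thesis using insert that by (simp add: finprod_insert)
  qed
  have "(\<Oplus>f\<in>insert x I \<rightarrow>\<^sub>E K. \<Otimes>i\<in>insert x I. F i (f i)) =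
      (\<Oplus>p\<in>K \<times> ?P. \<Otimes>i\<in>insert x I. F i (((snd p)(x := fst p)) i))"
    unfolding PiE_insert_eq
    using insert inj_combinator[OF insert(2), of "\<lambda>_. K"]
    by (subst finsum_reindex) (auto simp: case_prod_beta PiE_iff intro!: finprod_closed)
  also have "\<dots> = (\<Oplus>k\<in>K. \<Oplus>f\<in>?P. \<Otimes>i\<in>insert x I. F i ((f(x := k)) i))"
    using assms(2) fin insert by (subst finsum_times) (auto simp: PiE_iff intro!: finprod_closed)
  also have "\<dots> = (\<Oplus>k\<in>K. \<Oplus>f\<in>?P. F x k \<otimes> (\<Otimes>i\<in>I. F i (f i)))"
    using upd insert c by (intro finsum_cong' finsum_closed) (auto simp: Pi_iff)
  also have "\<dots> = (\<Oplus>k\<in>K. F x k \<otimes> (\<Oplus>f\<in>?P. \<Otimes>i\<in>I. F i (f i)))"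
    using insert c fin by (intro finsum_cong' finsum_rdistr[symmetric] m_closed finsum_closed) (auto simp: Pi_iff)
  also have "\<dots> = (\<Oplus>k\<in>K. F x k) \<otimes> (\<Oplus>f\<in>?P. \<Otimes>i\<in>I. F i (f i))"
    using insert c fin assms(2) by (intro finsum_ldistr[symmetric] finsum_closed) (auto simp: Pi_iff)
  also have "\<dots> = (\<Otimes>i\<in>insert x I. \<Oplus>k\<in>K. F i k)"
    using insert by (subst finprod_insert) (auto intro!: finsum_closed)
  finally show ?case by simp
qed simp

lemma ring_sign_closed [simp]: "ring_sign R \<sigma> \<in> carrier R"
  by (simp add: ring_sign_def)

lemma ring_sign_id [simp]: "ring_sign R id = \<one>"
  by (simp add: ring_sign_def sign_id)

lemma ring_sign_comp:
  assumes "finite I" "\<sigma> permutes I" "\<tau> permutes I"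
  shows "ring_sign R (\<sigma> \<circ> \<tau>) = ring_sign R \<sigma> \<otimes> ring_sign R \<tau>"
proof -
  have "permutation \<sigma>" "permutation \<tau>" using assms permutation_permutes by blast+
  then have "sign (\<sigma> \<circ> \<tau>) = sign \<sigma> * sign \<tau>" by (rule sign_compose)
  then show ?thesis using sign_cases[of \<sigma>] sign_cases[of \<tau>]
    by (auto simp: ring_sign_def l_minus r_minus)
qed

end

section \<open>The Leibniz determinant: multiplicativity and inverses\<close>

locale finite_det = cring R for R (structure) + fixes I :: "nat set" assumes finite_I: "finite I"
begin

lemma finite_perms: "finite {\<sigma>. \<sigma> permutes I}"
  using finite_I by (rule finite_permutations)

lemma row_funcset:
  assumes "\<And>i j. i \<in> I \<Longrightarrow> j \<in> I \<Longrightarrow> M i j \<in> carrier R" "\<sigma> permutes I"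
  shows "(\<lambda>i. M i (\<sigma> i)) \<in> I \<rightarrow> carrier R"
  using assms by (auto simp: permutes_in_image)

lemma det_closed [intro]:
  assumes "\<And>i j. i \<in> I \<Longrightarrow> j \<in> I \<Longrightarrow> M i j \<in> carrier R"
  shows "det R I M \<in> carrier R"
  unfolding det_def using row_funcset[of M] assms by (intro finsum_closed) (auto intro!: finprod_closed)

lemma det_cong:
  assumes "\<And>i j. i \<in> I \<Longrightarrow> j \<in> I \<Longrightarrow> M i j = N i j"
    "\<And>i j. i \<in> I \<Longrightarrow> j \<in> I \<Longrightarrow> N i j \<in> carrier R"
  shows "det R I M = det R I N"
  unfolding det_def
proof (rule finsum_cong')
  fix \<sigma> assume "\<sigma> \<in> {\<sigma>. \<sigma> permutes I}"
  then have "(\<Otimes>i\<in>I. M i (\<sigma> i)) = (\<Otimes>i\<in>I. N i (\<sigma> i))"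
    using assms by (intro finprod_cong') (auto simp: permutes_in_image)
  then show "ring_sign R \<sigma> \<otimes> (\<Otimes>i\<in>I. M i (\<sigma> i)) = ring_sign R \<sigma> \<otimes> (\<Otimes>i\<in>I. N i (\<sigma> i))" by simp
qed (use row_funcset[of N] assms in \<open>auto intro!: finprod_closed\<close>)

lemma det_permute_rows:
  assumes M: "\<And>i j. i \<in> I \<Longrightarrow> j \<in> I \<Longrightarrow> M i j \<in> carrier R" and \<tau>: "\<tau> permutes I"
  shows "det R I (\<lambda>i. M (\<tau> i)) = ring_sign R \<tau> \<otimes> det R I M"
proof -
  let ?P = "{\<sigma>. \<sigma> permutes I}"
  let ?F = "\<lambda>\<sigma>. ring_sign R \<sigma> \<otimes> (\<Otimes>i\<in>I. M (\<tau> i) (\<sigma> i))"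
  have F: "?F \<in> ?P \<rightarrow> carrier R"
    using M \<tau> by (auto intro!: m_closed finprod_closed simp: permutes_in_image)
  have "det R I (\<lambda>i. M (\<tau> i)) = finsum R ?F ((\<lambda>\<sigma>. \<sigma> \<circ> \<tau>) ` ?P)"
    by (simp add: det_def permutes_compose_image(1)[OF \<tau>])
  also have "\<dots> = (\<Oplus>\<sigma>\<in>?P. ?F (\<sigma> \<circ> \<tau>))"
    using F by (intro finsum_reindex permutes_compose_image(2)[OF \<tau>])
      (simp add: permutes_compose_image(1)[OF \<tau>])
  also have "\<dots> = (\<Oplus>\<sigma>\<in>?P. ring_sign R \<tau> \<otimes> (ring_sign R \<sigma> \<otimes> (\<Otimes>i\<in>I. M i (\<sigma> i))))"
  proof (rule finsum_cong')
    fix \<sigma> assume \<sigma>: "\<sigma> \<in> ?P"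
    have c: "(\<Otimes>i\<in>I. M i (\<sigma> i)) \<in> carrier R" using row_funcset[of M, OF M] \<sigma> by (auto intro!: finprod_closed)
    have "(\<Otimes>i\<in>I. M i (\<sigma> i)) = (\<Otimes>i\<in>\<tau> ` I. M i (\<sigma> i))" by (simp add: permutes_image[OF \<tau>])
    also have "\<dots> = (\<Otimes>i\<in>I. M (\<tau> i) (\<sigma> (\<tau> i)))"
      using row_funcset[of M, OF M] \<sigma> permutes_image[OF \<tau>] permutes_inj_on[OF \<tau>]
      by (intro finprod_reindex) auto
    finally show "?F (\<sigma> \<circ> \<tau>) = ring_sign R \<tau> \<otimes> (ring_sign R \<sigma> \<otimes> (\<Otimes>i\<in>I. M i (\<sigma> i)))"
      using \<sigma> c \<tau> by (simp add: ring_sign_comp[OF finite_I] m_ac)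
  qed (use row_funcset[of M, OF M] in \<open>auto intro!: finprod_closed\<close>)
  also have "\<dots> = ring_sign R \<tau> \<otimes> det R I M"
    unfolding det_def using row_funcset[of M, OF M]
    by (intro finsum_rdistr[symmetric] finite_perms) (auto intro!: finprod_closed)
  finally show ?thesis .
qed

text \<open>Pairing \<open>\<sigma>\<close> with \<open>\<sigma> \<circ> (i j)\<close> avoids a division by 2.\<close>

lemma det_equal_rows:
  assumes M: "\<And>i j. i \<in> I \<Longrightarrow> j \<in> I \<Longrightarrow> M i j \<in> carrier R"
    and ij: "i \<in> I" "j \<in> I" "i \<noteq> j" "\<And>k. k \<in> I \<Longrightarrow> M i k = M j k"
  shows "det R I M = \<zero>"
proof -
  let ?P = "{\<sigma>. \<sigma> permutes I}"
  let ?E = "{\<sigma>. \<sigma> permutes I \<and> sign \<sigma> = 1}"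
  let ?t = "\<lambda>\<sigma>. \<Otimes>k\<in>I. M k (\<sigma> k)"
  define \<tau> where "\<tau> = transpose i j"
  have \<tau>: "\<tau> permutes I" unfolding \<tau>_def using ij by (intro permutes_swap_id)
  have s\<tau>: "sign (\<sigma> \<circ> \<tau>) = - sign \<sigma>" if "\<sigma> permutes I" for \<sigma>
  proof -
    have "permutation \<sigma>" "permutation \<tau>" using that \<tau> finite_I permutation_permutes by blast+
    then have "sign (\<sigma> \<circ> \<tau>) = sign \<sigma> * sign \<tau>" by (rule sign_compose)
    then show ?thesis using ij by (simp add: \<tau>_def sign_swap_id)
  qed
  have \<tau>\<tau>: "\<tau> \<circ> \<tau> = id" by (simp add: \<tau>_def)
  have P: "?P = ?E \<union> (\<lambda>\<sigma>. \<sigma> \<circ> \<tau>) ` ?E"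
  proof (intro equalityI subsetI)
    fix \<sigma> assume \<sigma>: "\<sigma> \<in> ?P"
    show "\<sigma> \<in> ?E \<union> (\<lambda>\<sigma>. \<sigma> \<circ> \<tau>) ` ?E"
    proof (cases "sign \<sigma> = 1")
      case False
      then have "\<sigma> \<circ> \<tau> \<in> ?E" using \<sigma> s\<tau> sign_cases[of \<sigma>] \<tau> by (auto intro: permutes_compose)
      moreover have "\<sigma> = (\<sigma> \<circ> \<tau>) \<circ> \<tau>" by (simp add: comp_assoc \<tau>\<tau>)
      ultimately show ?thesis by blast
    qed (use \<sigma> in auto)
  qed (use \<tau> in \<open>auto intro: permutes_compose\<close>)
  have disj: "?E \<inter> (\<lambda>\<sigma>. \<sigma> \<circ> \<tau>) ` ?E = {}" using s\<tau> by auto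
  have fin: "finite ?E" by (rule finite_subset[OF _ finite_perms]) auto
  have t: "?t \<sigma> \<in> carrier R" if "\<sigma> permutes I" for \<sigma>
    using row_funcset[of M, OF M that] by (auto intro!: finprod_closed)
  have eq: "?t (\<sigma> \<circ> \<tau>) = ?t \<sigma>" if \<sigma>: "\<sigma> permutes I" for \<sigma>
  proof -
    have "?t \<sigma> = (\<Otimes>k\<in>\<tau> ` I. M k (\<sigma> k))" by (simp add: permutes_image[OF \<tau>])
    also have "\<dots> = (\<Otimes>k\<in>I. M (\<tau> k) (\<sigma> (\<tau> k)))"
      using row_funcset[of M, OF M] \<sigma> permutes_image[OF \<tau>] permutes_inj_on[OF \<tau>]
      by (intro finprod_reindex) auto
    also have "\<dots> = ?t (\<sigma> \<circ> \<tau>)"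
    proof (rule finprod_cong')
      fix k assume k: "k \<in> I"
      then have "\<sigma> (\<tau> k) \<in> I" using \<sigma> \<tau> by (simp add: permutes_in_image)
      then show "M (\<tau> k) (\<sigma> (\<tau> k)) = M k ((\<sigma> \<circ> \<tau>) k)"
        using ij(4) by (auto simp: \<tau>_def transpose_def)
    qed (use row_funcset[of M, OF M permutes_compose[OF \<tau> \<sigma>]] in auto)
    finally show ?thesis by simp
  qed
  have fE: "(\<lambda>\<sigma>. ring_sign R \<sigma> \<otimes> ?t \<sigma>) \<in> ?E \<rightarrow> carrier R" using t by simp
  have fE': "(\<lambda>\<sigma>. ring_sign R \<sigma> \<otimes> ?t \<sigma>) \<in> (\<lambda>\<sigma>. \<sigma> \<circ> \<tau>) ` ?E \<rightarrow> carrier R"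
  proof
    fix \<rho> assume "\<rho> \<in> (\<lambda>\<sigma>. \<sigma> \<circ> \<tau>) ` ?E"
    then have "\<rho> permutes I" using \<tau> by (auto intro: permutes_compose)
    then show "ring_sign R \<rho> \<otimes> ?t \<rho> \<in> carrier R" using t by simp
  qed
  have "det R I M = (\<Oplus>\<sigma>\<in>?E. ring_sign R \<sigma> \<otimes> ?t \<sigma>) \<oplus>
      (\<Oplus>\<sigma>\<in>(\<lambda>\<sigma>. \<sigma> \<circ> \<tau>) ` ?E. ring_sign R \<sigma> \<otimes> ?t \<sigma>)"
    unfolding det_def by (subst P, rule finsum_Un_disjoint[OF fin _ disj fE fE']) (rule finite_imageI[OF fin])
  also have "(\<Oplus>\<sigma>\<in>(\<lambda>\<sigma>. \<sigma> \<circ> \<tau>) ` ?E. ring_sign R \<sigma> \<otimes> ?t \<sigma>) =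
      (\<Oplus>\<sigma>\<in>?E. ring_sign R (\<sigma> \<circ> \<tau>) \<otimes> ?t (\<sigma> \<circ> \<tau>))"
    by (rule finsum_reindex[OF fE' permutes_compose_image(2)[OF \<tau>]])
  also have "\<dots> = (\<Oplus>\<sigma>\<in>?E. \<ominus> \<one> \<otimes> ?t \<sigma>)"
  proof (rule finsum_cong')
    fix \<sigma> assume "\<sigma> \<in> ?E"
    then show "ring_sign R (\<sigma> \<circ> \<tau>) \<otimes> ?t (\<sigma> \<circ> \<tau>) = \<ominus> \<one> \<otimes> ?t \<sigma>"
      using s\<tau>[of \<sigma>] eq[of \<sigma>] by (simp add: ring_sign_def)
  qed (use t in auto)
  also have "(\<Oplus>\<sigma>\<in>?E. ring_sign R \<sigma> \<otimes> ?t \<sigma>) = (\<Oplus>\<sigma>\<in>?E. ?t \<sigma>)"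
    using t by (intro finsum_cong') (auto simp: ring_sign_def)
  also have "(\<Oplus>\<sigma>\<in>?E. ?t \<sigma>) \<oplus> (\<Oplus>\<sigma>\<in>?E. \<ominus> \<one> \<otimes> ?t \<sigma>) = (\<Oplus>\<sigma>\<in>?E. ?t \<sigma> \<oplus> \<ominus> \<one> \<otimes> ?t \<sigma>)"
    using t by (intro finsum_addf[symmetric]) auto
  also have "\<dots> = (\<Oplus>\<sigma>\<in>?E. \<zero>)"
    using t by (intro finsum_cong') (auto simp: l_minus r_neg)
  finally show ?thesis by simp
qed

text \<open>Expanding every row gives a sum over all functions f from I to I. If f is not injective,
  the determinant with rows N (f i) has two equal rows and vanishes; the remaining f are
  permutations and contribute their sign times det N.\<close>

lemma det_mult:
  assumes M: "\<And>i j. i \<in> I \<Longrightarrow> j \<in> I \<Longrightarrow> M i j \<in> carrier R"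
    and N: "\<And>i j. i \<in> I \<Longrightarrow> j \<in> I \<Longrightarrow> N i j \<in> carrier R"
  shows "det R I (\<lambda>i j. \<Oplus>k\<in>I. M i k \<otimes> N k j) = det R I M \<otimes> det R I N"
proof -
  let ?P = "{\<sigma>. \<sigma> permutes I}" and ?F = "I \<rightarrow>\<^sub>E I"
  let ?m = "\<lambda>f. \<Otimes>i\<in>I. M i (f i)" and ?n = "\<lambda>f \<sigma>. \<Otimes>i\<in>I. N (f i) (\<sigma> i)"
  have sub: "(\<lambda>\<sigma>. restrict \<sigma> I) ` ?P \<subseteq> ?F" by (auto simp: permutes_in_image)
  have finF: "finite ?F" using finite_I by (simp add: finite_PiE)
  have m: "?m f \<in> carrier R" if "f \<in> ?F" for f
    using that M by (auto intro!: finprod_closed simp: PiE_iff)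
  have n: "?n f \<sigma> \<in> carrier R" if "f \<in> ?F" "\<sigma> \<in> ?P" for f \<sigma>
    using that N by (auto intro!: finprod_closed simp: PiE_iff permutes_in_image)
  have dn: "det R I (\<lambda>i. N (f i)) \<in> carrier R" if "f \<in> ?F" for f
    using that N by (intro det_closed) (auto simp: PiE_iff)
  have "det R I (\<lambda>i j. \<Oplus>k\<in>I. M i k \<otimes> N k j) =
      (\<Oplus>\<sigma>\<in>?P. \<Oplus>f\<in>?F. ?m f \<otimes> (ring_sign R \<sigma> \<otimes> ?n f \<sigma>))"
    unfolding det_def
  proof (rule finsum_cong')
    fix \<sigma> assume \<sigma>: "\<sigma> \<in> ?P"
    have "(\<Otimes>i\<in>I. \<Oplus>k\<in>I. M i k \<otimes> N k (\<sigma> i)) = (\<Oplus>f\<in>?F. \<Otimes>i\<in>I. M i (f i) \<otimes> N (f i) (\<sigma> i))"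
      using M N \<sigma> by (intro finprod_finsum finite_I) (auto simp: permutes_in_image)
    also have "\<dots> = (\<Oplus>f\<in>?F. ?m f \<otimes> ?n f \<sigma>)"
      using M N \<sigma> m n by (intro finsum_cong' finprod_multf) (auto simp: PiE_iff permutes_in_image)
    finally have "ring_sign R \<sigma> \<otimes> (\<Otimes>i\<in>I. \<Oplus>k\<in>I. M i k \<otimes> N k (\<sigma> i)) =
        (\<Oplus>f\<in>?F. ring_sign R \<sigma> \<otimes> (?m f \<otimes> ?n f \<sigma>))"
      using m n \<sigma> finF by (simp add: finsum_rdistr Pi_iff)
    also have "\<dots> = (\<Oplus>f\<in>?F. ?m f \<otimes> (ring_sign R \<sigma> \<otimes> ?n f \<sigma>))"
      using m n \<sigma> by (intro finsum_cong') (auto simp: m_ac)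
    finally show "ring_sign R \<sigma> \<otimes> (\<Otimes>i\<in>I. \<Oplus>k\<in>I. M i k \<otimes> N k (\<sigma> i)) =
       (\<Oplus>f\<in>?F. ?m f \<otimes> (ring_sign R \<sigma> \<otimes> ?n f \<sigma>))" .
  qed (use m n in \<open>auto intro!: finsum_closed\<close>)
  also have "\<dots> = (\<Oplus>f\<in>?F. \<Oplus>\<sigma>\<in>?P. ?m f \<otimes> (ring_sign R \<sigma> \<otimes> ?n f \<sigma>))"
    using m n by (intro finsum_exchange finite_perms finF) auto
  also have "\<dots> = (\<Oplus>f\<in>?F. ?m f \<otimes> det R I (\<lambda>i. N (f i)))"
    using m n dn by (intro finsum_cong') (auto simp: det_def finsum_rdistr[OF finite_perms] Pi_iff)
  \<comment> \<open>Functions in \<open>?F\<close> are \<open>undefined\<close> off I, whereas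
    permutations are the identity there; the surviving terms are therefore indexed by restricted
    permutations.\<close>
  also have "\<dots> = (\<Oplus>f\<in>(\<lambda>\<sigma>. restrict \<sigma> I) ` ?P. ?m f \<otimes> det R I (\<lambda>i. N (f i)))"
  proof (rule add.finprod_mono_neutral_cong_right[OF finF])
    show "(\<lambda>\<sigma>. restrict \<sigma> I) ` ?P \<subseteq> ?F" by (rule sub)
    fix f assume f: "f \<in> ?F - (\<lambda>\<sigma>. restrict \<sigma> I) ` ?P"
    have "\<not> inj_on f I"
    proof
      assume inj: "inj_on f I"
      have "f ` I \<subseteq> I" using f by (auto simp: PiE_iff)
      then have "bij_betw f I I" using inj finite_I by (simp add: bij_betw_def endo_inj_surj)
      then have "bij_betw (\<lambda>x. if x \<in> I then f x else x) I I" by (rule bij_betw_cong[THEN iffD1, rotated]) simp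
      then have "(\<lambda>x. if x \<in> I then f x else x) permutes I" by (rule bij_imp_permutes) simp
      moreover have "f = restrict (\<lambda>x. if x \<in> I then f x else x) I"
        using f by (auto simp: PiE_iff extensional_def fun_eq_iff)
      ultimately show False using f by blast
    qed
    then obtain i j where "i \<in> I" "j \<in> I" "i \<noteq> j" "f i = f j" by (auto simp: inj_on_def)
    then have "det R I (\<lambda>i. N (f i)) = \<zero>"
      using f N by (intro det_equal_rows[of _ i j]) (auto simp: PiE_iff)
    then show "?m f \<otimes> det R I (\<lambda>i. N (f i)) = \<zero>" using m f by simp
  qed (use m dn in auto)
  also have "\<dots> = (\<Oplus>\<sigma>\<in>?P. ?m (restrict \<sigma> I) \<otimes> det R I (\<lambda>i. N (restrict \<sigma> I i)))"
  proof (rule finsum_reindex)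
    show "(\<lambda>f. ?m f \<otimes> det R I (\<lambda>i. N (f i))) \<in> (\<lambda>\<sigma>. restrict \<sigma> I) ` ?P \<rightarrow> carrier R"
    proof
      fix f assume "f \<in> (\<lambda>\<sigma>. restrict \<sigma> I) ` ?P"
      then have "f \<in> ?F" using sub by blast
      then show "?m f \<otimes> det R I (\<lambda>i. N (f i)) \<in> carrier R" using m dn by simp
    qed
    show "inj_on (\<lambda>\<sigma>. restrict \<sigma> I) ?P"
    proof (rule inj_onI)
      fix \<sigma> \<tau> assume h: "\<sigma> \<in> ?P" "\<tau> \<in> ?P" "restrict \<sigma> I = restrict \<tau> I"
      show "\<sigma> = \<tau>"
      proof
        fix x show "\<sigma> x = \<tau> x"
        proof (cases "x \<in> I")
          case True
          then show ?thesis using fun_cong[OF h(3), of x] by simp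
        qed (use h in \<open>auto simp: permutes_not_in\<close>)
      qed
    qed
  qed
  also have "\<dots> = (\<Oplus>\<sigma>\<in>?P. (ring_sign R \<sigma> \<otimes> ?m \<sigma>) \<otimes> det R I N)"
  proof (rule finsum_cong')
    fix \<sigma> assume \<sigma>: "\<sigma> \<in> ?P"
    have "?m (restrict \<sigma> I) = ?m \<sigma>" using row_funcset[of M \<sigma>, OF M] \<sigma> by (intro finprod_cong') auto
    moreover have "det R I (\<lambda>i. N (restrict \<sigma> I i)) = det R I (\<lambda>i. N (\<sigma> i))"
      using N \<sigma> by (intro det_cong) (auto simp: permutes_in_image)
    moreover have "?m \<sigma> \<in> carrier R" using row_funcset[of M \<sigma>, OF M] \<sigma> by (auto intro!: finprod_closed)
    ultimately show "?m (restrict \<sigma> I) \<otimes> det R I (\<lambda>i. N (restrict \<sigma> I i)) =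
        (ring_sign R \<sigma> \<otimes> ?m \<sigma>) \<otimes> det R I N"
      using \<sigma> det_permute_rows[of N \<sigma>, OF N] det_closed[of N, OF N] by (simp add: m_ac)
  qed (use row_funcset[of M, OF M] det_closed[of N, OF N] in \<open>auto intro!: m_closed finprod_closed\<close>)
  also have "\<dots> = det R I M \<otimes> det R I N"
    unfolding det_def[of R I M] using row_funcset[of M, OF M] det_closed[of N, OF N]
    by (intro finsum_ldistr[symmetric] finite_perms) (auto intro!: finprod_closed)
  finally show ?thesis .
qed

lemma det_eq_diagonal:
  assumes M: "\<And>i j. i \<in> I \<Longrightarrow> j \<in> I \<Longrightarrow> M i j \<in> carrier R"
    and "\<And>\<sigma>. \<sigma> permutes I \<Longrightarrow> \<sigma> \<noteq> id \<Longrightarrow> \<exists>k\<in>I. M k (\<sigma> k) = \<zero>"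
  shows "det R I M = (\<Otimes>k\<in>I. M k k)"
proof -
  have z: "(\<Otimes>i\<in>I. M i (\<sigma> i)) = \<zero>" if \<sigma>: "\<sigma> permutes I" "\<sigma> \<noteq> id" for \<sigma>
  proof -
    obtain k where k: "k \<in> I" "M k (\<sigma> k) = \<zero>" using assms(2) \<sigma> by blast
    have "(\<Otimes>i\<in>insert k (I - {k}). M i (\<sigma> i)) = M k (\<sigma> k) \<otimes> (\<Otimes>i\<in>I - {k}. M i (\<sigma> i))"
      using row_funcset[of M, OF M \<sigma>(1)] finite_I k by (intro finprod_insert) auto
    moreover have "(\<Otimes>i\<in>I - {k}. M i (\<sigma> i)) \<in> carrier R"
      using row_funcset[of M, OF M \<sigma>(1)] by (intro finprod_closed) auto
    ultimately show ?thesis using k by (simp add: insert_absorb)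
  qed
  have "det R I M = (\<Oplus>\<sigma>\<in>{id}. ring_sign R \<sigma> \<otimes> (\<Otimes>i\<in>I. M i (\<sigma> i)))"
    unfolding det_def using row_funcset[of M, OF M] z
    by (intro add.finprod_mono_neutral_cong_right finite_perms)
      (auto simp: permutes_id intro!: m_closed finprod_closed)
  also have "\<dots> = (\<Otimes>k\<in>I. M k k)"
    using row_funcset[of M, OF M permutes_id] by (subst finsum_insert) (auto intro!: finprod_closed simp: Pi_iff)
  finally show ?thesis .
qed

text \<open>If \<sigma> moves k, injectivity shows that it also moves \<sigma> k. Two points are
  moved, and at most one of them is i.\<close>

lemma permutes_moves:
  assumes "\<sigma> permutes I" "\<sigma> \<noteq> id"
  obtains k where "k \<in> I" "\<sigma> k \<noteq> k" "k \<noteq> i"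
proof -
  obtain k where k: "\<sigma> k \<noteq> k" using assms(2) by (auto simp: fun_eq_iff)
  then have kI: "k \<in> I" "\<sigma> k \<in> I" using assms(1) by (metis permutes_not_in, metis permutes_not_in permutes_in_image)
  have "\<sigma> (\<sigma> k) \<noteq> \<sigma> k" using k permutes_inj[OF assms(1)] by (auto dest: injD)
  then show ?thesis using that k kI by (cases "k = i") auto
qed

lemma det_one: "det R I (\<lambda>i j. if i = j then \<one> else \<zero>) = \<one>"
proof (subst det_eq_diagonal)
  fix \<sigma> assume "\<sigma> permutes I" "\<sigma> \<noteq> id"
  from permutes_moves[OF this] obtain k where "k \<in> I" "\<sigma> k \<noteq> k" by metis
  then show "\<exists>k\<in>I. (if k = \<sigma> k then \<one> else \<zero>) = \<zero>" by (intro bexI[of _ k]) auto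
qed simp_all

text \<open>\<open>cof i j\<close> sums the Leibniz terms with \<sigma> i = j, leaving out the
  factor from row i. Pairing it with row k gives the determinant with row i replaced by row k, which
  is det M for k = i and has two equal rows otherwise. So u times the adjugate is a right
  inverse.\<close>

lemma right_inverse_exists:
  assumes M: "\<And>i j. i \<in> I \<Longrightarrow> j \<in> I \<Longrightarrow> M i j \<in> carrier R"
    and u: "u \<in> carrier R" "u \<otimes> det R I M = \<one>"
  obtains Y where "\<And>i j. i \<in> I \<Longrightarrow> j \<in> I \<Longrightarrow> Y i j \<in> carrier R"
    "\<And>i j. i \<in> I \<Longrightarrow> j \<in> I \<Longrightarrow> (\<Oplus>l\<in>I. M i l \<otimes> Y l j) = (if i = j then \<one> else \<zero>)"
proof -
  let ?P = "{\<sigma>. \<sigma> permutes I}"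
  define W where "W i \<sigma> = ring_sign R \<sigma> \<otimes> (\<Otimes>k\<in>I - {i}. M k (\<sigma> k))" for i \<sigma>
  have W: "W i \<sigma> \<in> carrier R" if "\<sigma> \<in> ?P" for i :: nat and \<sigma>
    using that row_funcset[of M \<sigma>, OF M] unfolding W_def by (intro m_closed finprod_closed) auto
  define cof where "cof i j = (\<Oplus>\<sigma>\<in>?P. if \<sigma> i = j then W i \<sigma> else \<zero>)" for i j
  have cof: "cof i j \<in> carrier R" for i j
    unfolding cof_def using W by (intro finsum_closed) auto
  have expand: "(\<Oplus>j\<in>I. M k j \<otimes> cof i j) = det R I (M(i := M k))" if ki: "k \<in> I" "i \<in> I" for k i
  proof -
    have "(\<Oplus>j\<in>I. M k j \<otimes> cof i j) =
        (\<Oplus>j\<in>I. \<Oplus>\<sigma>\<in>?P. M k j \<otimes> (if \<sigma> i = j then W i \<sigma> else \<zero>))"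
      using M ki W by (intro finsum_cong') (auto simp: cof_def finsum_rdistr[OF finite_perms] Pi_iff
        intro!: finsum_closed)
    also have "\<dots> = (\<Oplus>\<sigma>\<in>?P. \<Oplus>j\<in>I. M k j \<otimes> (if \<sigma> i = j then W i \<sigma> else \<zero>))"
      using M ki W by (intro finsum_exchange finite_I finite_perms) auto
    also have "\<dots> = (\<Oplus>\<sigma>\<in>?P. ring_sign R \<sigma> \<otimes> (\<Otimes>l\<in>I. (M(i := M k)) l (\<sigma> l)))"
    proof (rule finsum_cong')
      fix \<sigma> assume \<sigma>: "\<sigma> \<in> ?P"
      then have \<sigma>i: "\<sigma> i \<in> I" using ki by (auto simp: permutes_in_image)
      have "(\<Oplus>j\<in>I. M k j \<otimes> (if \<sigma> i = j then W i \<sigma> else \<zero>)) =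
          (\<Oplus>j\<in>I. if \<sigma> i = j then M k j \<otimes> W i \<sigma> else \<zero>)"
        using M ki W \<sigma> by (intro finsum_cong') auto
      also have "\<dots> = M k (\<sigma> i) \<otimes> W i \<sigma>"
        using M ki W \<sigma> \<sigma>i finite_I by (intro finsum_singleton) auto
      also have "\<dots> = ring_sign R \<sigma> \<otimes> (M k (\<sigma> i) \<otimes> (\<Otimes>l\<in>I - {i}. M l (\<sigma> l)))"
        unfolding W_def using row_funcset[of M \<sigma>, OF M] \<sigma> M ki \<sigma>i
        by (intro m_lcomm) (auto intro!: finprod_closed)
      also have "M k (\<sigma> i) \<otimes> (\<Otimes>l\<in>I - {i}. M l (\<sigma> l)) = (\<Otimes>l\<in>insert i (I - {i}). (M(i := M k)) l (\<sigma> l))"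
      proof -
        have "(\<Otimes>l\<in>I - {i}. (M(i := M k)) l (\<sigma> l)) = (\<Otimes>l\<in>I - {i}. M l (\<sigma> l))"
          using row_funcset[of M \<sigma>, OF M] \<sigma> by (intro finprod_cong') auto
        moreover have "(\<lambda>l. (M(i := M k)) l (\<sigma> l)) \<in> (I - {i}) \<rightarrow> carrier R"
          using row_funcset[of M \<sigma>, OF M] \<sigma> by (auto simp: Pi_iff)
        ultimately show ?thesis using M ki \<sigma>i finite_I by (subst finprod_insert) auto
      qed
      finally show "(\<Oplus>j\<in>I. M k j \<otimes> (if \<sigma> i = j then W i \<sigma> else \<zero>)) =
        ring_sign R \<sigma> \<otimes> (\<Otimes>l\<in>I. (M(i := M k)) l (\<sigma> l))" using ki by (simp add: insert_absorb)
    qed (use M ki in \<open>auto intro!: finprod_closed simp: permutes_in_image\<close>)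
    finally show ?thesis by (simp add: det_def)
  qed
  define Y where "Y j i = u \<otimes> cof i j" for i j
  show ?thesis
  proof (rule that)
    show "Y i j \<in> carrier R" for i j unfolding Y_def using u cof by simp
    fix i j assume ij: "i \<in> I" "j \<in> I"
    have "(\<Oplus>l\<in>I. M i l \<otimes> Y l j) = (\<Oplus>l\<in>I. u \<otimes> (M i l \<otimes> cof j l))"
      unfolding Y_def using M cof u ij by (intro finsum_cong') (auto simp: m_ac)
    also have "\<dots> = u \<otimes> (\<Oplus>l\<in>I. M i l \<otimes> cof j l)"
      using M cof u ij by (intro finsum_rdistr[symmetric] finite_I) auto
    also have "\<dots> = u \<otimes> det R I (M(j := M i))" using expand ij by simp
    also have "\<dots> = (if i = j then \<one> else \<zero>)"
    proof (cases "i = j")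
      case False
      then have "det R I (M(j := M i)) = \<zero>" using M ij by (intro det_equal_rows[of _ i j]) auto
      then show ?thesis using False u by simp
    qed (use u in simp)
    finally show "(\<Oplus>l\<in>I. M i l \<otimes> Y l j) = (if i = j then \<one> else \<zero>)" .
  qed
qed

end

lemma (in ring_hom_cring) hom_det:
  assumes "finite I" "\<And>i j. i \<in> I \<Longrightarrow> j \<in> I \<Longrightarrow> M i j \<in> carrier R"
  shows "h (det R I M) = det S I (\<lambda>i j. h (M i j))"
proof -
  interpret d: finite_det R I by unfold_locales (rule assms(1))
  interpret e: finite_det S I by unfold_locales (rule assms(1))
  have s: "h (ring_sign R \<sigma>) = ring_sign S \<sigma>" for \<sigma> by (simp add: ring_sign_def)
  show ?thesis unfolding det_def
    using d.row_funcset[of M, OF assms(2)] e.row_funcset[of "\<lambda>i j. h (M i j)"] assms(2)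
    by (subst hom_finsum) (auto intro!: S.finsum_cong' S.finprod_closed R.finprod_closed simp: s hom_finprod Pi_iff)
qed

section \<open>Determinants of even matrices\<close>

text \<open>In a strict superalgebra the even elements form a commutative ring under the same
  operations. Keeping the operations lets determinants, sums and powers be moved between the two
  structures.\<close>

definition even_part :: "('k::field, 'a) superalg \<Rightarrow> ('k, 'a) superalg" where
  "even_part A = A\<lparr>carrier := part A 0\<rparr>"

lemma even_part_simps [simp]:
  "carrier (even_part A) = part A 0" "mult (even_part A) = mult A" "one (even_part A) = one A"
  "zero (even_part A) = zero A" "add (even_part A) = add A"
  by (simp_all add: even_part_def)

context strict_salg
begin

abbreviation E where "E \<equiv> even_part A"

lemma cring_even_part: "cring E"
proof (rule cringI)
  note c = part_closed[of _ 0]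
  show "abelian_group E"
  proof (rule abelian_groupI)
    fix x assume x: "x \<in> carrier E"
    then have "\<ominus> x \<in> part A 0" "\<ominus> x \<oplus> x = \<zero>" using c by (simp_all add: part_uminus l_neg)
    then show "\<exists>y\<in>carrier E. y \<oplus>\<^bsub>E\<^esub> x = \<zero>\<^bsub>E\<^esub>" unfolding even_part_simps by blast
  qed (simp_all add: part_add a_ac c)
  show "Group.comm_monoid E"
  proof (rule comm_monoidI)
    fix x y assume "x \<in> carrier E" "y \<in> carrier E"
    then show "x \<otimes>\<^bsub>E\<^esub> y = y \<otimes>\<^bsub>E\<^esub> x" using supercomm[of x 0 y 0] c by simp
  qed (simp_all add: c m_assoc part_mult'[of _ 0 _ 0])
qed (simp add: l_distr part_closed[of _ 0])

sublocale E: cring E by (rule cring_even_part)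

lemma even_uminus: "x \<in> part A 0 \<Longrightarrow> \<ominus>\<^bsub>E\<^esub> x = \<ominus> x"
  using E.minus_equality[of "\<ominus> x" x] by (simp add: part_uminus l_neg part_closed)

lemma even_finsum: "finite S \<Longrightarrow> f \<in> S \<rightarrow> part A 0 \<Longrightarrow> finsum E f S = finsum A f S"
proof (induction S rule: finite_induct)
  case (insert s S)
  have "f \<in> S \<rightarrow> carrier A" "f s \<in> carrier A" using insert by (auto intro: part_closed)
  with insert show ?case by simp
qed simp

lemma even_finprod:
  assumes "distinct xs" "f \<in> set xs \<rightarrow> part A 0"
  shows "foldr (\<lambda>i y. f i \<otimes> y) xs \<one> = finprod E f (set xs)"
  using assms by (induction xs) simp_all

text \<open>Even entries commute, so the product in row order is the unordered one. The field scalar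
  \<open>of_int (sign \<sigma>)\<close> becomes the ring element \<one> or its negative.\<close>

lemma mat_det_eq_det:
  assumes "finite I" "\<And>i j. i \<in> I \<Longrightarrow> j \<in> I \<Longrightarrow> M i j \<in> part A 0"
  shows "mat_det A I M = det E I M"
proof -
  interpret d: finite_det E I by unfold_locales (rule assms(1))
  have row: "(\<lambda>i. M i (\<sigma> i)) \<in> I \<rightarrow> part A 0" if "\<sigma> permutes I" for \<sigma>
    using d.row_funcset[of M \<sigma>] assms(2) that by simp
  let ?t = "\<lambda>\<sigma>. finprod E (\<lambda>i. M i (\<sigma> i)) I"
  have t: "?t \<sigma> \<in> part A 0" if "\<sigma> permutes I" for \<sigma>
    using E.finprod_closed[of "\<lambda>i. M i (\<sigma> i)" I] row[OF that] by simp
  have "mat_det A I M = (\<Oplus>\<sigma>\<in>{\<sigma>. \<sigma> permutes I}. ring_sign E \<sigma> \<otimes> ?t \<sigma>)"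
    unfolding mat_det_def
  proof (rule finsum_cong')
    fix \<sigma> assume "\<sigma> \<in> {\<sigma>. \<sigma> permutes I}"
    then have \<sigma>: "\<sigma> permutes I" by simp
    have f: "foldr (\<lambda>i y. M i (\<sigma> i) \<otimes> y) (sorted_list_of_set I) \<one> = ?t \<sigma>"
      using even_finprod[of "sorted_list_of_set I" "\<lambda>i. M i (\<sigma> i)"] row[OF \<sigma>] assms(1) by simp
    show "of_int (sign \<sigma>) \<odot> foldr (\<lambda>i y. M i (\<sigma> i) \<otimes> y) (sorted_list_of_set I) \<one> =
        ring_sign E \<sigma> \<otimes> ?t \<sigma>"
      unfolding f using sign_cases[of \<sigma>] part_closed[OF t[OF \<sigma>]]
      by (auto simp: ring_sign_def even_uminus uminus_smult l_minus)
  qed (use t E.ring_sign_closed in \<open>auto intro!: m_closed intro: part_closed\<close>)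
  also have "\<dots> = det E I M"
    unfolding det_def using t E.ring_sign_closed E.m_closed d.finite_perms
    by (subst even_finsum) auto
  finally show ?thesis .
qed

context
  fixes I :: "nat set"
  assumes fin: "finite I"
begin

interpretation d: finite_det E I by unfold_locales (rule fin)

lemma mat_det_even [intro]:
  assumes "\<And>i j. i \<in> I \<Longrightarrow> j \<in> I \<Longrightarrow> M i j \<in> part A 0"
  shows "mat_det A I M \<in> part A 0"
  using d.det_closed[of M] assms by (simp add: mat_det_eq_det[OF fin])

lemma mat_det_cong:
  assumes "\<And>i j. i \<in> I \<Longrightarrow> j \<in> I \<Longrightarrow> M i j = N i j" "\<And>i j. i \<in> I \<Longrightarrow> j \<in> I \<Longrightarrow> N i j \<in> part A 0"
  shows "mat_det A I M = mat_det A I N"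
  using d.det_cong[of M N] assms by (simp add: mat_det_eq_det[OF fin])

lemma mat_det_mult:
  assumes "\<And>i j. i \<in> I \<Longrightarrow> j \<in> I \<Longrightarrow> M i j \<in> part A 0" "\<And>i j. i \<in> I \<Longrightarrow> j \<in> I \<Longrightarrow> N i j \<in> part A 0"
  shows "mat_det A I (\<lambda>i j. \<Oplus>k\<in>I. M i k \<otimes> N k j) = mat_det A I M \<otimes> mat_det A I N"
proof -
  have p: "M i k \<otimes> N k j \<in> part A 0" if "i \<in> I" "k \<in> I" "j \<in> I" for i j k
    using that assms by (auto intro!: part_mult')
  have "mat_det A I (\<lambda>i j. \<Oplus>k\<in>I. M i k \<otimes> N k j) = det E I (\<lambda>i j. \<Oplus>k\<in>I. M i k \<otimes> N k j)"
    using p by (intro mat_det_eq_det fin part_finsum) auto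
  also have "\<dots> = det E I (\<lambda>i j. \<Oplus>\<^bsub>E\<^esub>k\<in>I. M i k \<otimes> N k j)"
    using p by (intro d.det_cong) (auto simp: even_finsum[OF fin] intro!: part_finsum fin)
  also have "\<dots> = mat_det A I M \<otimes> mat_det A I N"
    using d.det_mult[of M N] assms by (simp add: mat_det_eq_det[OF fin])
  finally show ?thesis .
qed

lemma mat_det_one: "mat_det A I (\<lambda>i j. if i = j then \<one> else \<zero>) = \<one>"
  using d.det_one[unfolded even_part_simps] by (subst mat_det_eq_det[OF fin]) auto

lemma mat_det_single:
  assumes "\<And>i j. i \<in> I \<Longrightarrow> j \<in> I \<Longrightarrow> M i j \<in> part A 0"
    and "\<And>\<sigma>. \<sigma> permutes I \<Longrightarrow> \<sigma> \<noteq> id \<Longrightarrow> \<exists>k\<in>I. M k (\<sigma> k) = \<zero>"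
    and "i \<in> I" "\<And>k. k \<in> I \<Longrightarrow> k \<noteq> i \<Longrightarrow> M k k = \<one>"
  shows "mat_det A I M = M i i"
proof -
  have "mat_det A I M = finprod E (\<lambda>k. M k k) I"
    using d.det_eq_diagonal[of M] assms by (simp add: mat_det_eq_det[OF fin])
  also have "\<dots> = finprod E (\<lambda>k. if i = k then M k k else \<one>) I"
    using assms by (intro E.finprod_cong') auto
  also have "\<dots> = M i i"
    using E.finprod_singleton[of i I "\<lambda>k. M k k", unfolded even_part_simps] assms fin by simp
  finally show ?thesis .
qed

lemma permutes_moves_avoiding:
  assumes "\<sigma> permutes I" "\<sigma> \<noteq> id"
  obtains k where "k \<in> I" "\<sigma> k \<noteq> k" "k \<noteq> i"
  using d.permutes_moves assms by metis

text \<open>A left inverse Y and a right inverse Z agree, since Y = Y(MZ) = (YM)Z. Entries range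
  over the whole carrier because the inverse picked by \<open>mat_inv\<close> is only known to lie
  there.\<close>

lemma mat_inv_unique:
  assumes M: "\<And>i j. i \<in> I \<Longrightarrow> j \<in> I \<Longrightarrow> M i j \<in> carrier A"
    and Y: "\<And>i j. i \<in> I \<Longrightarrow> j \<in> I \<Longrightarrow> Y i j \<in> carrier A"
    and Z: "\<And>i j. i \<in> I \<Longrightarrow> j \<in> I \<Longrightarrow> Z i j \<in> carrier A"
    and YM: "\<And>i j. i \<in> I \<Longrightarrow> j \<in> I \<Longrightarrow> (\<Oplus>l\<in>I. Y i l \<otimes> M l j) = (if i = j then \<one> else \<zero>)"
    and MZ: "\<And>i j. i \<in> I \<Longrightarrow> j \<in> I \<Longrightarrow> (\<Oplus>l\<in>I. M i l \<otimes> Z l j) = (if i = j then \<one> else \<zero>)"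
    and ij: "i \<in> I" "j \<in> I"
  shows "Y i j = Z i j"
proof -
  have "Y i j = (\<Oplus>k\<in>I. if j = k then Y i k else \<zero>)"
    using Y ij fin by (intro add.finprod_singleton[symmetric]) auto
  also have "\<dots> = (\<Oplus>k\<in>I. Y i k \<otimes> (\<Oplus>l\<in>I. M k l \<otimes> Z l j))"
    using Y ij by (intro finsum_cong') (auto simp: MZ)
  also have "\<dots> = (\<Oplus>k\<in>I. \<Oplus>l\<in>I. Y i k \<otimes> M k l \<otimes> Z l j)"
  proof (rule finsum_cong')
    fix k assume k: "k \<in> I"
    have "Y i k \<otimes> (\<Oplus>l\<in>I. M k l \<otimes> Z l j) = (\<Oplus>l\<in>I. Y i k \<otimes> (M k l \<otimes> Z l j))"
      using M Y Z ij k by (intro finsum_rdistr fin) auto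
    also have "\<dots> = (\<Oplus>l\<in>I. Y i k \<otimes> M k l \<otimes> Z l j)"
      using M Y Z ij k by (intro finsum_cong') (auto simp: m_assoc)
    finally show "Y i k \<otimes> (\<Oplus>l\<in>I. M k l \<otimes> Z l j) = (\<Oplus>l\<in>I. Y i k \<otimes> M k l \<otimes> Z l j)" .
  qed (use M Y Z ij in \<open>auto intro!: finsum_closed\<close>)
  also have "\<dots> = (\<Oplus>l\<in>I. \<Oplus>k\<in>I. Y i k \<otimes> M k l \<otimes> Z l j)"
    using M Y Z ij by (intro finsum_swap fin) auto
  also have "\<dots> = (\<Oplus>l\<in>I. (\<Oplus>k\<in>I. Y i k \<otimes> M k l) \<otimes> Z l j)"
    using M Y Z ij fin by (intro finsum_cong') (auto simp: finsum_ldistr Pi_iff intro!: finsum_closed)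
  also have "\<dots> = (\<Oplus>l\<in>I. if i = l then Z l j else \<zero>)"
    using Z ij by (intro finsum_cong') (auto simp: YM)
  also have "\<dots> = Z i j"
    using Z ij fin by (intro add.finprod_singleton) auto
  finally show ?thesis .
qed

text \<open>The adjugate gives a right inverse Y of M. Then det M inverts det Y, so Y has a right
  inverse Z as well, and M = Z because M is a left and Z a right inverse of Y. Thus Y is
  two-sided.\<close>

lemma even_inverse_exists:
  assumes M: "\<And>i j. i \<in> I \<Longrightarrow> j \<in> I \<Longrightarrow> M i j \<in> part A 0"
    and u: "u \<in> part A 0" "u \<otimes> mat_det A I M = \<one>"
  obtains Y where "\<And>i j. i \<in> I \<Longrightarrow> j \<in> I \<Longrightarrow> Y i j \<in> part A 0" "is_mat_inv A I M Y"
proof -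
  have right: "\<exists>Y. (\<forall>i\<in>I. \<forall>j\<in>I. Y i j \<in> part A 0 \<and>
      (\<Oplus>l\<in>I. M i l \<otimes> Y l j) = (if i = j then \<one> else \<zero>))"
    if M: "\<And>i j. i \<in> I \<Longrightarrow> j \<in> I \<Longrightarrow> M i j \<in> part A 0"
      and u: "u \<in> part A 0" "u \<otimes> mat_det A I M = \<one>" for M u
  proof -
    obtain Y where Y: "\<And>i j. i \<in> I \<Longrightarrow> j \<in> I \<Longrightarrow> Y i j \<in> part A 0"
      "\<And>i j. i \<in> I \<Longrightarrow> j \<in> I \<Longrightarrow> (\<Oplus>\<^bsub>E\<^esub>l\<in>I. M i l \<otimes> Y l j) = (if i = j then \<one> else \<zero>)"
    proof (rule d.right_inverse_exists[of M u, unfolded even_part_simps])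
      show "u \<otimes> det E I M = \<one>" using u(2) by (subst mat_det_eq_det[OF fin M, symmetric])
      fix Y assume "\<And>i j. i \<in> I \<Longrightarrow> j \<in> I \<Longrightarrow> Y i j \<in> part A 0"
        "\<And>i j. i \<in> I \<Longrightarrow> j \<in> I \<Longrightarrow> (\<Oplus>\<^bsub>E\<^esub>l\<in>I. M i l \<otimes> Y l j) = (if i = j then \<one> else \<zero>)"
      then show thesis by (rule that)
    qed (use M u in simp_all)
    have "(\<Oplus>\<^bsub>E\<^esub>l\<in>I. M i l \<otimes> Y l j) = (\<Oplus>l\<in>I. M i l \<otimes> Y l j)" if "i \<in> I" "j \<in> I" for i j
      using that M Y by (intro even_finsum fin) (auto intro!: part_mult')
    with Y show ?thesis by (intro exI[of _ Y]) auto
  qed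
  obtain Y where Y: "\<And>i j. i \<in> I \<Longrightarrow> j \<in> I \<Longrightarrow> Y i j \<in> part A 0"
    "\<And>i j. i \<in> I \<Longrightarrow> j \<in> I \<Longrightarrow> (\<Oplus>l\<in>I. M i l \<otimes> Y l j) = (if i = j then \<one> else \<zero>)"
    using right[OF M u] by auto
  have "mat_det A I M \<otimes> mat_det A I Y = mat_det A I (\<lambda>i j. \<Oplus>l\<in>I. M i l \<otimes> Y l j)"
    using M Y(1) by (intro mat_det_mult[symmetric])
  also have "\<dots> = mat_det A I (\<lambda>i j. if i = j then \<one> else \<zero>)"
    using Y(2) by (intro mat_det_cong) auto
  finally have "mat_det A I M \<otimes> mat_det A I Y = \<one>" by (simp add: mat_det_one)
  note d1 = this
  have d0: "mat_det A I M \<in> part A 0" using M by (rule mat_det_even)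
  have "\<exists>Z. \<forall>i\<in>I. \<forall>j\<in>I. Z i j \<in> part A 0 \<and>
      (\<Oplus>l\<in>I. Y i l \<otimes> Z l j) = (if i = j then \<one> else \<zero>)"
    by (rule right[OF Y(1) d0 d1])
  then obtain Z where "\<forall>i\<in>I. \<forall>j\<in>I. Z i j \<in> part A 0 \<and>
      (\<Oplus>l\<in>I. Y i l \<otimes> Z l j) = (if i = j then \<one> else \<zero>)" by blast
  then have Z: "\<And>i j. i \<in> I \<Longrightarrow> j \<in> I \<Longrightarrow> Z i j \<in> part A 0"
    "\<And>i j. i \<in> I \<Longrightarrow> j \<in> I \<Longrightarrow> (\<Oplus>l\<in>I. Y i l \<otimes> Z l j) = (if i = j then \<one> else \<zero>)"
    by blast+
  have MZ: "M i j = Z i j" if "i \<in> I" "j \<in> I" for i j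
    by (rule mat_inv_unique[OF part_closed[OF Y(1)] part_closed[OF M] part_closed[OF Z(1)] Y(2) Z(2) that])
  show ?thesis
  proof (rule that[OF Y(1)])
    show "is_mat_inv A I M Y"
      unfolding is_mat_inv_def
    proof (intro ballI conjI)
      fix i j assume ij: "i \<in> I" "j \<in> I"
      show "Y i j \<in> carrier A" using Y ij by (auto intro: part_closed)
      show "(\<Oplus>l\<in>I. M i l \<otimes> Y l j) = (if i = j then \<one> else \<zero>)" using Y ij by auto
      have "(\<Oplus>l\<in>I. Y i l \<otimes> M l j) = (\<Oplus>l\<in>I. Y i l \<otimes> Z l j)"
        using MZ ij part_closed[OF Y(1)] part_closed[OF Z(1)] by (intro finsum_cong') auto
      then show "(\<Oplus>l\<in>I. Y i l \<otimes> M l j) = (if i = j then \<one> else \<zero>)" using Z ij by auto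
    qed
  qed
qed

text \<open>By uniqueness the choice made in \<open>mat_inv\<close> is immaterial on the index
  set.\<close>

lemma mat_inv_eqI:
  assumes M: "\<And>i j. i \<in> I \<Longrightarrow> j \<in> I \<Longrightarrow> M i j \<in> carrier A" and Y: "is_mat_inv A I M Y"
    and ij: "i \<in> I" "j \<in> I"
  shows "mat_inv A I M i j = Y i j"
proof -
  have "is_mat_inv A I M (mat_inv A I M)" unfolding mat_inv_def by (rule someI[where P = "is_mat_inv A I M"]) (rule Y)
  then have 1: "\<And>i j. i \<in> I \<Longrightarrow> j \<in> I \<Longrightarrow> mat_inv A I M i j \<in> carrier A"
    "\<And>i j. i \<in> I \<Longrightarrow> j \<in> I \<Longrightarrow> (\<Oplus>l\<in>I. mat_inv A I M i l \<otimes> M l j) = (if i = j then \<one> else \<zero>)"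
    unfolding is_mat_inv_def by blast+
  have 2: "\<And>i j. i \<in> I \<Longrightarrow> j \<in> I \<Longrightarrow> Y i j \<in> carrier A"
    "\<And>i j. i \<in> I \<Longrightarrow> j \<in> I \<Longrightarrow> (\<Oplus>l\<in>I. M i l \<otimes> Y l j) = (if i = j then \<one> else \<zero>)"
    using Y unfolding is_mat_inv_def by blast+
  show ?thesis by (rule mat_inv_unique[OF M 1(1) 2(1) 1(2) 2(2) ij])
qed

end

end

section \<open>The ring of supermatrices\<close>

text \<open>The even supermatrices over K; the parities pr i + pr j are compatible with matrix
  products. Entries outside K are zero, so that equal matrices are equal functions and rectangular
  blocks are elements of the same ring, cut out by the idempotents \<open>idm J\<close>.\<close>

definition smat_ring ::
    "('k::field, 'a) superalg \<Rightarrow> nat set \<Rightarrow> (nat \<Rightarrow> bit) \<Rightarrow> (nat \<Rightarrow> nat \<Rightarrow> 'a) ring" where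
  "smat_ring A K pr =
    \<lparr>carrier = {M. \<forall>i j. M i j \<in> part A (pr i + pr j) \<and> (i \<notin> K \<or> j \<notin> K \<longrightarrow> M i j = \<zero>\<^bsub>A\<^esub>)},
     mult = (\<lambda>M N i j. \<Oplus>\<^bsub>A\<^esub>k\<in>K. M i k \<otimes>\<^bsub>A\<^esub> N k j),
     one = (\<lambda>i j. if i = j \<and> i \<in> K then \<one>\<^bsub>A\<^esub> else \<zero>\<^bsub>A\<^esub>),
     zero = (\<lambda>i j. \<zero>\<^bsub>A\<^esub>),
     add = (\<lambda>M N i j. M i j \<oplus>\<^bsub>A\<^esub> N i j)\<rparr>"

locale supermatrices = strict_salg A for A :: "('k::field, 'a) superalg" (structure) +
  fixes K :: "nat set" and pr :: "nat \<Rightarrow> bit"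
  assumes fin_K: "finite K"
begin

abbreviation SM where "SM \<equiv> smat_ring A K pr"

definition idm :: "nat set \<Rightarrow> nat \<Rightarrow> nat \<Rightarrow> 'a" where
  "idm J = (\<lambda>i j. if i = j \<and> i \<in> J then \<one> else \<zero>)"

lemma smat_simps:
  "(M \<otimes>\<^bsub>SM\<^esub> N) i j = (\<Oplus>k\<in>K. M i k \<otimes> N k j)" "\<one>\<^bsub>SM\<^esub> = idm K" "\<zero>\<^bsub>SM\<^esub> i j = \<zero>"
  "(M \<oplus>\<^bsub>SM\<^esub> N) i j = M i j \<oplus> N i j"
  by (simp_all add: smat_ring_def idm_def)

lemma smatI:
  assumes "\<And>i j. i \<in> K \<Longrightarrow> j \<in> K \<Longrightarrow> M i j \<in> part A (pr i + pr j)"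
    and "\<And>i j. i \<notin> K \<or> j \<notin> K \<Longrightarrow> M i j = \<zero>"
  shows "M \<in> carrier SM"
proof -
  have "M i j \<in> part A (pr i + pr j)" for i j
    using assms by (cases "i \<in> K \<and> j \<in> K") auto
  then show ?thesis using assms(2) by (simp add: smat_ring_def)
qed

lemma smat_part: "M \<in> carrier SM \<Longrightarrow> M i j \<in> part A (pr i + pr j)"
  by (simp add: smat_ring_def)

lemma smat_entry [simp]: "M \<in> carrier SM \<Longrightarrow> M i j \<in> carrier A"
  using smat_part part_closed by blast

lemma smat_outside: "M \<in> carrier SM \<Longrightarrow> i \<notin> K \<or> j \<notin> K \<Longrightarrow> M i j = \<zero>"
  by (simp add: smat_ring_def)

lemma smat_even:
  assumes "M \<in> carrier SM" "\<And>i. i \<in> J \<Longrightarrow> pr i = p" "i \<in> J" "j \<in> J"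
  shows "M i j \<in> part A 0"
  using smat_part[OF assms(1), of i j] assms by simp

lemma smat_eqI: "(\<And>i j. M i j = N i j) \<Longrightarrow> M = N"
  by (intro ext)

lemma idm_closed [simp]: "J \<subseteq> K \<Longrightarrow> idm J \<in> carrier SM"
  by (rule smatI) (auto simp: idm_def)

lemma finsum_delta_left:
  assumes "finite S" "i \<in> S" "\<And>k. k \<in> S \<Longrightarrow> f k \<in> carrier A" "\<And>k. k \<in> S \<Longrightarrow> k \<noteq> i \<Longrightarrow> f k = \<zero>"
  shows "finsum A f S = f i"
proof -
  have "finsum A f S = (\<Oplus>k\<in>S. if i = k then f k else \<zero>)"
    using assms by (intro finsum_cong') auto
  also have "\<dots> = f i" using assms by (intro add.finprod_singleton) auto
  finally show ?thesis .
qed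

lemma finsum_zeroI:
  assumes "\<And>k. k \<in> S \<Longrightarrow> f k = \<zero>"
  shows "finsum A f S = \<zero>"
proof -
  have "finsum A f S = (\<Oplus>k\<in>S. \<zero>)" using assms by (intro finsum_cong') auto
  then show ?thesis by simp
qed

lemma idm_mult_left:
  assumes "J \<subseteq> K" "M \<in> carrier SM"
  shows "(idm J \<otimes>\<^bsub>SM\<^esub> M) i j = (if i \<in> J then M i j else \<zero>)"
proof (cases "i \<in> J")
  case True
  have "(\<Oplus>k\<in>K. idm J i k \<otimes> M k j) = idm J i i \<otimes> M i j"
    using assms True fin_K by (intro finsum_delta_left) (auto simp: idm_def)
  then show ?thesis using assms True by (simp add: smat_simps idm_def)
next
  case False
  have "(\<Oplus>k\<in>K. idm J i k \<otimes> M k j) = \<zero>"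
    using assms False by (intro finsum_zeroI) (auto simp: idm_def)
  then show ?thesis using False by (simp add: smat_simps)
qed

lemma idm_mult_right:
  assumes "J \<subseteq> K" "M \<in> carrier SM"
  shows "(M \<otimes>\<^bsub>SM\<^esub> idm J) i j = (if j \<in> J then M i j else \<zero>)"
proof (cases "j \<in> J")
  case True
  have "(\<Oplus>k\<in>K. M i k \<otimes> idm J k j) = M i j \<otimes> idm J j j"
    using assms True fin_K by (intro finsum_delta_left) (auto simp: idm_def)
  then show ?thesis using assms True by (simp add: smat_simps idm_def)
next
  case False
  have "(\<Oplus>k\<in>K. M i k \<otimes> idm J k j) = \<zero>"
    using assms False by (intro finsum_zeroI) (auto simp: idm_def)
  then show ?thesis using False by (simp add: smat_simps)
qed

lemma smat_mult_closed:
  assumes "M \<in> carrier SM" "N \<in> carrier SM"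
  shows "M \<otimes>\<^bsub>SM\<^esub> N \<in> carrier SM"
proof (rule smatI)
  fix i j
  have "M i k \<otimes> N k j \<in> part A (pr i + pr j)" for k
    using part_mult[OF smat_part[OF assms(1), of i k] smat_part[OF assms(2), of k j]]
    by (simp add: add.assoc)
  then show "(M \<otimes>\<^bsub>SM\<^esub> N) i j \<in> part A (pr i + pr j)"
    by (simp add: smat_simps part_finsum fin_K)
  assume "i \<notin> K \<or> j \<notin> K"
  then show "(M \<otimes>\<^bsub>SM\<^esub> N) i j = \<zero>"
    unfolding smat_simps(1)
    using assms smat_outside[OF assms(1), of i] smat_outside[OF assms(2), of _ j]
    by (intro finsum_zeroI) auto
qed

lemma ring_smat: "ring SM"
proof (rule ringI)
  show "abelian_group SM"
  proof (rule abelian_groupI)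
    fix M assume M: "M \<in> carrier SM"
    have "(\<lambda>i j. \<ominus> M i j) \<in> carrier SM"
    proof (rule smatI)
      fix i j assume "i \<notin> K \<or> j \<notin> K"
      then show "\<ominus> M i j = \<zero>" using smat_outside[OF M] by simp
    qed (use M in \<open>simp add: part_uminus smat_part\<close>)
    moreover have "(\<lambda>i j. \<ominus> M i j) \<oplus>\<^bsub>SM\<^esub> M = \<zero>\<^bsub>SM\<^esub>"
      by (rule smat_eqI) (use M in \<open>simp add: smat_simps l_neg\<close>)
    ultimately show "\<exists>N\<in>carrier SM. N \<oplus>\<^bsub>SM\<^esub> M = \<zero>\<^bsub>SM\<^esub>" by blast
  next
    fix M N assume M: "M \<in> carrier SM" and N: "N \<in> carrier SM"
    show "M \<oplus>\<^bsub>SM\<^esub> N \<in> carrier SM"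
    proof (rule smatI)
      fix i j assume "i \<notin> K \<or> j \<notin> K"
      then show "(M \<oplus>\<^bsub>SM\<^esub> N) i j = \<zero>" using smat_outside[OF M] smat_outside[OF N] by (simp add: smat_simps)
    qed (use M N in \<open>simp add: smat_simps part_add smat_part\<close>)
    show "M \<oplus>\<^bsub>SM\<^esub> N = N \<oplus>\<^bsub>SM\<^esub> M"
      by (rule smat_eqI) (use M N in \<open>simp add: smat_simps a_comm\<close>)
    fix L assume L: "L \<in> carrier SM"
    show "M \<oplus>\<^bsub>SM\<^esub> N \<oplus>\<^bsub>SM\<^esub> L = M \<oplus>\<^bsub>SM\<^esub> (N \<oplus>\<^bsub>SM\<^esub> L)"
      by (rule smat_eqI) (use M N L in \<open>simp add: smat_simps a_assoc\<close>)
  next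
    show "\<zero>\<^bsub>SM\<^esub> \<in> carrier SM" by (rule smatI) (auto simp: smat_simps)
    fix M assume M: "M \<in> carrier SM"
    show "\<zero>\<^bsub>SM\<^esub> \<oplus>\<^bsub>SM\<^esub> M = M"
      by (rule smat_eqI) (use M in \<open>simp add: smat_simps\<close>)
  qed
  show "Group.monoid SM"
  proof (rule monoidI)
    show "\<one>\<^bsub>SM\<^esub> \<in> carrier SM" by (simp add: smat_simps)
    fix M assume M: "M \<in> carrier SM"
    show "\<one>\<^bsub>SM\<^esub> \<otimes>\<^bsub>SM\<^esub> M = M"
      by (rule smat_eqI) (use M smat_outside[OF M] in \<open>auto simp: smat_simps(2) idm_mult_left\<close>)
    show "M \<otimes>\<^bsub>SM\<^esub> \<one>\<^bsub>SM\<^esub> = M"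
      by (rule smat_eqI) (use M smat_outside[OF M] in \<open>auto simp: smat_simps(2) idm_mult_right\<close>)
    fix N assume N: "N \<in> carrier SM"
    show "M \<otimes>\<^bsub>SM\<^esub> N \<in> carrier SM" using M N by (rule smat_mult_closed)
    fix L assume L: "L \<in> carrier SM"
    show "M \<otimes>\<^bsub>SM\<^esub> N \<otimes>\<^bsub>SM\<^esub> L = M \<otimes>\<^bsub>SM\<^esub> (N \<otimes>\<^bsub>SM\<^esub> L)"
    proof (rule smat_eqI)
      fix i j
      have "(M \<otimes>\<^bsub>SM\<^esub> N \<otimes>\<^bsub>SM\<^esub> L) i j = (\<Oplus>l\<in>K. (\<Oplus>k\<in>K. M i k \<otimes> N k l) \<otimes> L l j)"
        by (simp add: smat_simps)
      also have "\<dots> = (\<Oplus>l\<in>K. \<Oplus>k\<in>K. M i k \<otimes> N k l \<otimes> L l j)"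
        using M N L by (intro finsum_cong' finsum_ldistr fin_K) (auto intro!: finsum_closed)
      also have "\<dots> = (\<Oplus>k\<in>K. \<Oplus>l\<in>K. M i k \<otimes> N k l \<otimes> L l j)"
        using M N L by (intro finsum_swap fin_K) auto
      also have "\<dots> = (\<Oplus>k\<in>K. \<Oplus>l\<in>K. M i k \<otimes> (N k l \<otimes> L l j))"
        using M N L by (intro finsum_cong') (auto simp: m_assoc intro!: finsum_closed)
      also have "\<dots> = (\<Oplus>k\<in>K. M i k \<otimes> (\<Oplus>l\<in>K. N k l \<otimes> L l j))"
        using M N L by (intro finsum_cong' finsum_rdistr[symmetric] fin_K) (auto intro!: finsum_closed)
      also have "\<dots> = (M \<otimes>\<^bsub>SM\<^esub> (N \<otimes>\<^bsub>SM\<^esub> L)) i j"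
        by (simp add: smat_simps)
      finally show "(M \<otimes>\<^bsub>SM\<^esub> N \<otimes>\<^bsub>SM\<^esub> L) i j = (M \<otimes>\<^bsub>SM\<^esub> (N \<otimes>\<^bsub>SM\<^esub> L)) i j" .
    qed
  qed
  fix M N L assume M: "M \<in> carrier SM" and N: "N \<in> carrier SM" and L: "L \<in> carrier SM"
  show "(M \<oplus>\<^bsub>SM\<^esub> N) \<otimes>\<^bsub>SM\<^esub> L = M \<otimes>\<^bsub>SM\<^esub> L \<oplus>\<^bsub>SM\<^esub> N \<otimes>\<^bsub>SM\<^esub> L"
  proof (rule smat_eqI)
    fix i j
    have "((M \<oplus>\<^bsub>SM\<^esub> N) \<otimes>\<^bsub>SM\<^esub> L) i j = (\<Oplus>k\<in>K. M i k \<otimes> L k j \<oplus> N i k \<otimes> L k j)"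
      unfolding smat_simps using M N L by (intro finsum_cong') (auto simp: l_distr)
    also have "\<dots> = (M \<otimes>\<^bsub>SM\<^esub> L \<oplus>\<^bsub>SM\<^esub> N \<otimes>\<^bsub>SM\<^esub> L) i j"
      unfolding smat_simps using M N L by (intro finsum_addf) auto
    finally show "((M \<oplus>\<^bsub>SM\<^esub> N) \<otimes>\<^bsub>SM\<^esub> L) i j = (M \<otimes>\<^bsub>SM\<^esub> L \<oplus>\<^bsub>SM\<^esub> N \<otimes>\<^bsub>SM\<^esub> L) i j" .
  qed
  show "L \<otimes>\<^bsub>SM\<^esub> (M \<oplus>\<^bsub>SM\<^esub> N) = L \<otimes>\<^bsub>SM\<^esub> M \<oplus>\<^bsub>SM\<^esub> L \<otimes>\<^bsub>SM\<^esub> N"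
  proof (rule smat_eqI)
    fix i j
    have "(L \<otimes>\<^bsub>SM\<^esub> (M \<oplus>\<^bsub>SM\<^esub> N)) i j = (\<Oplus>k\<in>K. L i k \<otimes> M k j \<oplus> L i k \<otimes> N k j)"
      unfolding smat_simps using M N L by (intro finsum_cong') (auto simp: r_distr)
    also have "\<dots> = (L \<otimes>\<^bsub>SM\<^esub> M \<oplus>\<^bsub>SM\<^esub> L \<otimes>\<^bsub>SM\<^esub> N) i j"
      unfolding smat_simps using M N L by (intro finsum_addf) auto
    finally show "(L \<otimes>\<^bsub>SM\<^esub> (M \<oplus>\<^bsub>SM\<^esub> N)) i j = (L \<otimes>\<^bsub>SM\<^esub> M \<oplus>\<^bsub>SM\<^esub> L \<otimes>\<^bsub>SM\<^esub> N) i j" .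
  qed
qed

sublocale R: ring SM by (rule ring_smat)

lemma smat_uminus: "M \<in> carrier SM \<Longrightarrow> (\<ominus>\<^bsub>SM\<^esub> M) i j = \<ominus> M i j"
proof -
  assume M: "M \<in> carrier SM"
  have "(\<ominus>\<^bsub>SM\<^esub> M \<oplus>\<^bsub>SM\<^esub> M) i j = \<zero>" using M by (simp add: R.l_neg smat_simps)
  then show ?thesis using M by (simp add: smat_simps minus_equality)
qed

lemma smat_minus: "M \<in> carrier SM \<Longrightarrow> N \<in> carrier SM \<Longrightarrow> (M \<ominus>\<^bsub>SM\<^esub> N) i j = M i j \<ominus> N i j"
  by (simp add: R.minus_eq minus_eq smat_simps smat_uminus)

lemma idm_idem [simp]: "J \<subseteq> K \<Longrightarrow> idm J \<otimes>\<^bsub>SM\<^esub> idm J = idm J"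
  by (rule smat_eqI) (simp add: idm_mult_left, simp add: idm_def)

text \<open>The shape of a block becomes an equation between ring elements; in this form it enters
  purely algebraic identities.\<close>

lemma idm_fixes_left: "J \<subseteq> K \<Longrightarrow> M \<in> carrier SM \<Longrightarrow>
    idm J \<otimes>\<^bsub>SM\<^esub> M = M \<longleftrightarrow> (\<forall>i j. i \<notin> J \<longrightarrow> M i j = \<zero>)"
  by (auto simp: fun_eq_iff idm_mult_left split: if_splits)

lemma idm_fixes_right: "J \<subseteq> K \<Longrightarrow> M \<in> carrier SM \<Longrightarrow>
    M \<otimes>\<^bsub>SM\<^esub> idm J = M \<longleftrightarrow> (\<forall>i j. j \<notin> J \<longrightarrow> M i j = \<zero>)"
  by (auto simp: fun_eq_iff idm_mult_right split: if_splits)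

lemma smat_mult_restrict:
  assumes "J \<subseteq> K" "M \<in> carrier SM" "N \<in> carrier SM"
    and "M \<otimes>\<^bsub>SM\<^esub> idm J = M \<or> idm J \<otimes>\<^bsub>SM\<^esub> N = N"
  shows "(M \<otimes>\<^bsub>SM\<^esub> N) i j = (\<Oplus>k\<in>J. M i k \<otimes> N k j)"
proof -
  have "M i k \<otimes> N k j = \<zero>" if "k \<notin> J" for k
    using assms that by (auto simp: idm_fixes_left idm_fixes_right)
  then show ?thesis unfolding smat_simps using assms fin_K
    by (intro add.finprod_mono_neutral_cong_right) auto
qed

section \<open>Determinants and inverses of a diagonal block\<close>

context
  fixes J :: "nat set" and p :: bit
  assumes J: "J \<subseteq> K" and prJ: "\<And>i. i \<in> J \<Longrightarrow> pr i = p"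
begin

lemma finite_J: "finite J"
  using J fin_K by (rule finite_subset)

lemma block_det_even: "M \<in> carrier SM \<Longrightarrow> mat_det A J M \<in> part A 0"
  using smat_even[OF _ prJ, of M J] by (intro mat_det_even finite_J) auto

text \<open>The block of a product is the product of the blocks once the inner summation stays in J;
  one factor with inner index supported there is enough.\<close>

lemma block_det_mult:
  assumes "M \<in> carrier SM" "N \<in> carrier SM"
    and "M \<otimes>\<^bsub>SM\<^esub> idm J = M \<or> idm J \<otimes>\<^bsub>SM\<^esub> N = N"
  shows "mat_det A J (M \<otimes>\<^bsub>SM\<^esub> N) = mat_det A J M \<otimes> mat_det A J N"
proof -
  have "M \<otimes>\<^bsub>SM\<^esub> N = (\<lambda>i j. \<Oplus>k\<in>J. M i k \<otimes> N k j)"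
    by (intro ext smat_mult_restrict J assms)
  then show ?thesis
    using mat_det_mult[OF finite_J, of M N] smat_even[OF assms(1) prJ, of J] smat_even[OF assms(2) prJ, of J]
    by simp
qed

lemma block_det_one: "mat_det A J (idm J) = \<one>"
proof -
  have "mat_det A J (idm J) = mat_det A J (\<lambda>i j. if i = j then \<one> else \<zero>)"
    by (intro mat_det_cong finite_J) (auto simp: idm_def)
  then show ?thesis by (simp add: mat_det_one[OF finite_J])
qed

text \<open>The inverse lives in the corner ring with unit \<open>idm J\<close>: the block is
  inverted as an even matrix and extended by zero.\<close>

lemma block_inverse_exists:
  assumes M: "M \<in> carrier SM" "idm J \<otimes>\<^bsub>SM\<^esub> M = M" "M \<otimes>\<^bsub>SM\<^esub> idm J = M"
    and u: "u \<in> part A 0" "u \<otimes> mat_det A J M = \<one>"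
  obtains Y where "Y \<in> carrier SM" "idm J \<otimes>\<^bsub>SM\<^esub> Y = Y" "Y \<otimes>\<^bsub>SM\<^esub> idm J = Y"
    "M \<otimes>\<^bsub>SM\<^esub> Y = idm J" "Y \<otimes>\<^bsub>SM\<^esub> M = idm J"
proof -
  have ev: "\<And>i j. i \<in> J \<Longrightarrow> j \<in> J \<Longrightarrow> M i j \<in> part A 0"
    using smat_even[OF M(1) prJ, of J] by blast
  obtain Z where Z: "\<And>i j. i \<in> J \<Longrightarrow> j \<in> J \<Longrightarrow> Z i j \<in> part A 0" "is_mat_inv A J M Z"
    using even_inverse_exists[OF finite_J ev u] by blast
  define Y where "Y i j = (if i \<in> J \<and> j \<in> J then Z i j else \<zero>)" for i j
  have Y: "Y \<in> carrier SM"
    using Z(1) J prJ by (intro smatI) (auto simp: Y_def)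
  have Yf: "idm J \<otimes>\<^bsub>SM\<^esub> Y = Y" "Y \<otimes>\<^bsub>SM\<^esub> idm J = Y"
    using Y J by (auto simp: idm_fixes_left idm_fixes_right Y_def)
  have cZ: "\<And>i j. i \<in> J \<Longrightarrow> j \<in> J \<Longrightarrow> Z i j \<in> carrier A" using Z(1) part_closed by blast
  have MY: "(\<Oplus>k\<in>J. M i k \<otimes> Y k j) = idm J i j" for i j
  proof (cases "i \<in> J \<and> j \<in> J")
    case True
    then have "(\<Oplus>k\<in>J. M i k \<otimes> Y k j) = (\<Oplus>k\<in>J. M i k \<otimes> Z k j)"
      using M cZ by (intro finsum_cong') (auto simp: Y_def)
    also have "\<dots> = idm J i j" using Z(2) True unfolding is_mat_inv_def by (simp add: idm_def)
    finally show ?thesis .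
  next
    case False
    then have "(\<Oplus>k\<in>J. M i k \<otimes> Y k j) = \<zero>"
      using M J by (intro finsum_zeroI) (auto simp: idm_fixes_left Y_def cZ)
    then show ?thesis using False by (auto simp: idm_def)
  qed
  have YM: "(\<Oplus>k\<in>J. Y i k \<otimes> M k j) = idm J i j" for i j
  proof (cases "i \<in> J \<and> j \<in> J")
    case True
    then have "(\<Oplus>k\<in>J. Y i k \<otimes> M k j) = (\<Oplus>k\<in>J. Z i k \<otimes> M k j)"
      using M cZ by (intro finsum_cong') (auto simp: Y_def)
    also have "\<dots> = idm J i j" using Z(2) True unfolding is_mat_inv_def by (simp add: idm_def)
    finally show ?thesis .
  next
    case False
    then have "(\<Oplus>k\<in>J. Y i k \<otimes> M k j) = \<zero>"
      using M J by (intro finsum_zeroI) (auto simp: idm_fixes_right Y_def cZ)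
    then show ?thesis using False by (auto simp: idm_def)
  qed
  show ?thesis
  proof (rule that[OF Y Yf])
    show "M \<otimes>\<^bsub>SM\<^esub> Y = idm J"
      using MY smat_mult_restrict[OF J M(1) Y] M(3) by (intro smat_eqI) simp
    show "Y \<otimes>\<^bsub>SM\<^esub> M = idm J"
      using YM smat_mult_restrict[OF J Y M(1)] M(2) by (intro smat_eqI) simp
  qed
qed

end

end

text \<open>Changing B to B + X changes P = f + CB by CX = P(pC)X, where p inverts P in the corner
  of f. The change is thereby isolated in the factor f + (pC)X.\<close>

lemma (in ring) sylvester_left:
  assumes "B \<in> carrier R" "C \<in> carrier R" "X \<in> carrier R" "f \<in> carrier R" "p \<in> carrier R"
    and P: "P = f \<oplus> C \<otimes> B" and "P \<otimes> p = f" "P \<otimes> f = P" "f \<otimes> C = C"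
  shows "f \<oplus> C \<otimes> (B \<oplus> X) = P \<otimes> (f \<oplus> (p \<otimes> C) \<otimes> X)"
proof -
  have c: "P \<in> carrier R" using assms by simp
  have "P \<otimes> (f \<oplus> (p \<otimes> C) \<otimes> X) = P \<otimes> f \<oplus> (P \<otimes> p) \<otimes> C \<otimes> X"
    using assms(1-5) c by (simp add: r_distr m_assoc)
  also have "\<dots> = f \<oplus> C \<otimes> B \<oplus> C \<otimes> X" using assms by simp
  finally show ?thesis using assms by (simp add: r_distr a_assoc)
qed

text \<open>From CQ = C + CBC = PC follows pCQ = C, so here Q splits off on the right. The same
  element pC appears as in \<open>sylvester_left\<close>, which makes the determinants of the two
  remaining factors comparable.\<close>

lemma (in ring) sylvester_right:
  assumes "B \<in> carrier R" "C \<in> carrier R" "X \<in> carrier R" "e \<in> carrier R" "f \<in> carrier R" "p \<in> carrier R"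
    and P: "P = f \<oplus> C \<otimes> B" and Q: "Q = e \<oplus> B \<otimes> C" and "p \<otimes> P = f"
    and "e \<otimes> e = e" "e \<otimes> B = B" "f \<otimes> C = C" "C \<otimes> e = C" "X \<otimes> f = X"
  shows "e \<oplus> (B \<oplus> X) \<otimes> C = (e \<oplus> X \<otimes> (p \<otimes> C)) \<otimes> Q"
proof -
  have c: "P \<in> carrier R" "Q \<in> carrier R" using assms by simp_all
  have eQ: "e \<otimes> Q = Q" using assms by (simp add: Q r_distr flip: m_assoc)
  have "C \<otimes> Q = P \<otimes> C" using assms by (simp add: P Q r_distr l_distr m_assoc)
  then have "p \<otimes> C \<otimes> Q = f \<otimes> C" using assms c by (metis m_assoc)
  then have "(e \<oplus> X \<otimes> (p \<otimes> C)) \<otimes> Q = Q \<oplus> X \<otimes> (f \<otimes> C)"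
    using assms(1-6) c eQ by (simp add: l_distr m_assoc)
  also have "\<dots> = e \<oplus> (B \<otimes> C \<oplus> X \<otimes> C)" using assms by (simp add: Q a_assoc)
  finally show ?thesis using assms by (simp add: l_distr)
qed

text \<open>This is the Woodbury formula for the inverse of e + bc: bc(bpc) + bpc = b(cb + f)pc =
  bPpc = bc.\<close>

lemma (in ring) sylvester_inverse:
  assumes "b \<in> carrier R" "c \<in> carrier R" "e \<in> carrier R" "f \<in> carrier R" "p \<in> carrier R"
    and P: "P = f \<oplus> c \<otimes> b" and "P \<otimes> p = f"
    and "e \<otimes> e = e" "e \<otimes> b = b" "b \<otimes> f = b" "c \<otimes> e = c" "f \<otimes> c = c"
  shows "(e \<oplus> b \<otimes> c) \<otimes> (e \<ominus> b \<otimes> p \<otimes> c) = e"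
proof -
  have cl: "P \<in> carrier R" using assms by simp
  have "b \<otimes> c \<otimes> (b \<otimes> p \<otimes> c) \<oplus> b \<otimes> p \<otimes> c = b \<otimes> (P \<otimes> p) \<otimes> c"
    using assms(1-5) \<open>b \<otimes> f = b\<close> by (simp add: P r_distr l_distr m_assoc a_comm flip: m_assoc[of b f])
  then have eq: "b \<otimes> c \<otimes> (b \<otimes> p \<otimes> c) \<oplus> b \<otimes> p \<otimes> c = b \<otimes> c" using assms by simp
  have e1: "e \<otimes> (b \<otimes> p \<otimes> c) = b \<otimes> p \<otimes> c"
    using assms(1-5) \<open>e \<otimes> b = b\<close> by (simp flip: m_assoc)
  have e2: "b \<otimes> c \<otimes> e = b \<otimes> c" using assms(1-5) \<open>c \<otimes> e = c\<close> by (simp add: m_assoc)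
  define t s where "t = b \<otimes> p \<otimes> c" and "s = b \<otimes> c"
  have ts: "t \<in> carrier R" "s \<in> carrier R" using assms unfolding t_def s_def by simp_all
  have eq': "s \<otimes> t \<oplus> t = s" "e \<otimes> t = t" "s \<otimes> e = s" using eq e1 e2 by (simp_all add: t_def s_def)
  have "(e \<oplus> s) \<otimes> (e \<ominus> t) = (e \<oplus> s) \<ominus> (s \<otimes> t \<oplus> t)"
    using ts assms(3,8) eq'(2,3) by (simp add: l_distr r_distr minus_eq r_minus minus_add a_ac)
  also have "\<dots> = e" unfolding eq' using ts assms(3) by (simp add: minus_eq a_assoc r_neg)
  finally show ?thesis unfolding t_def s_def .
qed

text \<open>With \<open>c = Y C\<close> and \<open>b = B' Y'\<close>, this is the Schur complement of a product of block matrices.\<close>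

lemma (in ring) schur_complement_mult:
  assumes "B \<in> carrier R" "b \<in> carrier R" "c \<in> carrier R" "C' \<in> carrier R" "S \<in> carrier R" "S' \<in> carrier R"
    "e \<in> carrier R" "f \<in> carrier R" "p \<in> carrier R"
    and P: "P = f \<oplus> c \<otimes> b" and "P \<otimes> p = f" "p \<otimes> P = f"
    and "B \<otimes> f = B" "f \<otimes> C' = C'" "f \<otimes> c = c" "p \<otimes> f = p" "e \<otimes> S' = S'"
    and A: "A = S \<oplus> B \<otimes> c" and A': "A' = S' \<oplus> b \<otimes> C'"
  shows "(A \<otimes> A' \<oplus> B \<otimes> C') \<ominus> (A \<otimes> b \<oplus> B) \<otimes> p \<otimes> (c \<otimes> A' \<oplus> C') = S \<otimes> (e \<ominus> b \<otimes> p \<otimes> c) \<otimes> S'"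
proof -
  have cl: "P \<in> carrier R" using assms by simp
  have 1: "A \<otimes> b \<oplus> B = S \<otimes> b \<oplus> B \<otimes> P"
    using assms(1-9) \<open>B \<otimes> f = B\<close> by (simp add: A P l_distr r_distr m_assoc a_ac)
  have 2: "c \<otimes> A' \<oplus> C' = c \<otimes> S' \<oplus> P \<otimes> C'"
    using assms(1-9) \<open>f \<otimes> C' = C'\<close> by (simp add: A' P l_distr r_distr m_assoc a_ac)
  have "B \<otimes> P \<otimes> p = B" using assms(1-9) cl \<open>P \<otimes> p = f\<close> \<open>B \<otimes> f = B\<close> by (simp add: m_assoc)
  then have 3: "(A \<otimes> b \<oplus> B) \<otimes> p = S \<otimes> b \<otimes> p \<oplus> B" unfolding 1 using assms(1-9) cl by (simp add: l_distr)
  have 4: "S \<otimes> b \<otimes> p \<otimes> (P \<otimes> C') = S \<otimes> b \<otimes> C'"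
    using assms(1-9) cl \<open>p \<otimes> P = f\<close> \<open>f \<otimes> C' = C'\<close>
    by (metis m_assoc m_closed)
  have 5: "(A \<otimes> b \<oplus> B) \<otimes> p \<otimes> (c \<otimes> A' \<oplus> C') =
      S \<otimes> b \<otimes> p \<otimes> c \<otimes> S' \<oplus> (S \<otimes> b \<otimes> C' \<oplus> (B \<otimes> c \<otimes> S' \<oplus> B \<otimes> P \<otimes> C'))"
    unfolding 3 2 using assms(1-9) cl 4 by (simp add: l_distr r_distr m_assoc a_ac)
  have 6: "A \<otimes> A' \<oplus> B \<otimes> C' = S \<otimes> S' \<oplus> (S \<otimes> b \<otimes> C' \<oplus> (B \<otimes> c \<otimes> S' \<oplus> B \<otimes> P \<otimes> C'))"
    using assms(1-9) \<open>f \<otimes> C' = C'\<close> by (simp add: A A' P l_distr r_distr m_assoc a_ac)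
  have 7: "S \<otimes> (e \<ominus> b \<otimes> p \<otimes> c) \<otimes> S' = S \<otimes> S' \<ominus> S \<otimes> b \<otimes> p \<otimes> c \<otimes> S'"
    using assms(1-9) \<open>e \<otimes> S' = S'\<close> by (simp add: minus_eq l_distr r_distr r_minus l_minus m_assoc)
  define w x y where "w = S \<otimes> S'" and "x = S \<otimes> b \<otimes> p \<otimes> c \<otimes> S'"
    and "y = S \<otimes> b \<otimes> C' \<oplus> (B \<otimes> c \<otimes> S' \<oplus> B \<otimes> P \<otimes> C')"
  have wxy: "w \<in> carrier R" "x \<in> carrier R" "y \<in> carrier R"
    using assms(1-9) cl by (simp_all add: w_def x_def y_def)
  have "(w \<oplus> y) \<ominus> (x \<oplus> y) = w \<ominus> x"
    using wxy by (simp add: minus_eq minus_add a_ac r_neg r_neg1 r_neg2)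
  then show ?thesis unfolding 5 6 7 w_def x_def y_def .
qed

section \<open>The Sylvester identity for odd blocks\<close>

locale block_supermatrices = supermatrices A K pr for A :: "('k::field, 'a) superalg" (structure) and K pr +
  fixes I J :: "nat set"
  assumes K_eq: "K = I \<union> J" and disjoint: "I \<inter> J = {}"
    and prI: "i \<in> I \<Longrightarrow> pr i = 0" and prJ: "j \<in> J \<Longrightarrow> pr j = 1"
begin

lemma IK: "I \<subseteq> K" and JK: "J \<subseteq> K" using K_eq by auto

lemma fin_I: "finite I" and fin_J: "finite J" using K_eq fin_K by auto

abbreviation e where "e \<equiv> idm I"
abbreviation f where "f \<equiv> idm J"

lemma detI:
  "M \<in> carrier SM \<Longrightarrow> mat_det A I M \<in> part A 0"
  "\<lbrakk>M \<in> carrier SM; N \<in> carrier SM; M \<otimes>\<^bsub>SM\<^esub> idm I = M \<or> idm I \<otimes>\<^bsub>SM\<^esub> N = N\<rbrakk> \<Longrightarrow>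
    mat_det A I (M \<otimes>\<^bsub>SM\<^esub> N) = mat_det A I M \<otimes> mat_det A I N"
  "mat_det A I (idm I) = \<one>"
  by (rule block_det_even[OF IK prI] block_det_mult[OF IK prI] block_det_one[OF IK prI]; assumption)+

lemma detJ:
  "M \<in> carrier SM \<Longrightarrow> mat_det A J M \<in> part A 0"
  "\<lbrakk>M \<in> carrier SM; N \<in> carrier SM; M \<otimes>\<^bsub>SM\<^esub> idm J = M \<or> idm J \<otimes>\<^bsub>SM\<^esub> N = N\<rbrakk> \<Longrightarrow>
    mat_det A J (M \<otimes>\<^bsub>SM\<^esub> N) = mat_det A J M \<otimes> mat_det A J N"
  "mat_det A J (idm J) = \<one>"
  by (rule block_det_even[OF JK prJ] block_det_mult[OF JK prJ] block_det_one[OF JK prJ]; assumption)+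

definition elem :: "nat \<Rightarrow> nat \<Rightarrow> 'a \<Rightarrow> nat \<Rightarrow> nat \<Rightarrow> 'a" where
  "elem i j b = (\<lambda>k l. if k = i \<and> l = j then b else \<zero>)"

lemma elem_closed: "i \<in> I \<Longrightarrow> j \<in> J \<Longrightarrow> b \<in> part A 1 \<Longrightarrow> elem i j b \<in> carrier SM"
  using IK JK by (intro smatI) (auto simp: elem_def prI prJ)

lemma mult_elem:
  assumes "W \<in> carrier SM" "i \<in> I" "j \<in> J" "b \<in> part A 1"
  shows "(W \<otimes>\<^bsub>SM\<^esub> elem i j b) k l = (if l = j then W k i \<otimes> b else \<zero>)"
proof -
  have b: "b \<in> carrier A" using assms(4) by (rule part_closed)
  have "(\<Oplus>s\<in>K. W k s \<otimes> elem i j b s l) = W k i \<otimes> elem i j b i l"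
    using assms(1,2) IK b fin_K by (intro finsum_delta_left) (auto simp: elem_def)
  then show ?thesis using assms(1) by (simp add: smat_simps elem_def)
qed

lemma elem_mult:
  assumes "W \<in> carrier SM" "i \<in> I" "j \<in> J" "b \<in> part A 1"
  shows "(elem i j b \<otimes>\<^bsub>SM\<^esub> W) k l = (if k = i then b \<otimes> W j l else \<zero>)"
proof -
  have b: "b \<in> carrier A" using assms(4) by (rule part_closed)
  have "(\<Oplus>s\<in>K. elem i j b k s \<otimes> W s l) = elem i j b k j \<otimes> W j l"
    using assms(1,3) JK b fin_K by (intro finsum_delta_left) (auto simp: elem_def)
  then show ?thesis using assms(1) by (simp add: smat_simps elem_def)
qed

text \<open>Only column j differs from the identity matrix. A non-identity permutation has a moved
  point l other than j; if \<sigma> k = l, the entry in row k and column l is off the diagonal and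
  outside column j, so it is zero.\<close>

lemma det_unit_plus_column:
  assumes W: "W \<in> carrier SM" and ij: "i \<in> I" "j \<in> J" "b \<in> part A 1"
  shows "mat_det A J (f \<oplus>\<^bsub>SM\<^esub> W \<otimes>\<^bsub>SM\<^esub> elem i j b) = \<one> \<oplus> W j i \<otimes> b"
proof -
  let ?M = "f \<oplus>\<^bsub>SM\<^esub> W \<otimes>\<^bsub>SM\<^esub> elem i j b"
  have b: "b \<in> carrier A" using ij by (auto intro: part_closed)
  have M: "?M \<in> carrier SM" using W elem_closed[OF ij] JK by simp
  have Mkl: "?M k l = (if k = l \<and> k \<in> J then \<one> else \<zero>) \<oplus> (if l = j then W k i \<otimes> b else \<zero>)" for k l
    by (simp add: smat_simps(4) mult_elem[OF W ij]) (auto simp: idm_def)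
  have "mat_det A J ?M = ?M j j"
  proof (rule mat_det_single[OF fin_J])
    show "?M k l \<in> part A 0" if "k \<in> J" "l \<in> J" for k l
      using smat_even[OF M prJ, of J] that by simp
    show "\<exists>k\<in>J. ?M k (\<sigma> k) = \<zero>" if \<sigma>: "\<sigma> permutes J" "\<sigma> \<noteq> id" for \<sigma>
    proof -
      obtain l where l: "l \<in> J" "\<sigma> l \<noteq> l" "l \<noteq> j"
        using permutes_moves_avoiding[OF fin_J \<sigma>] by metis
      obtain k where k: "l = \<sigma> k" using permutes_surj[OF \<sigma>(1)] by blast
      then have "k \<in> J" "\<sigma> k \<noteq> k" "\<sigma> k \<noteq> j" using l \<sigma>(1) by (auto simp: permutes_in_image)
      then show ?thesis by (intro bexI[of _ k]) (auto simp: Mkl)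
    qed
    show "?M k k = \<one>" if "k \<in> J" "k \<noteq> j" for k using that by (simp add: Mkl)
  qed (rule ij)
  then show ?thesis using ij W b by (simp add: Mkl)
qed

text \<open>Now only row i differs from the identity matrix. The factors of b \<otimes> W j i stand
  in the opposite order to those in \<open>det_unit_plus_column\<close>; this is where the two
  determinants become inverse to each other instead of equal.\<close>

lemma det_unit_plus_row:
  assumes W: "W \<in> carrier SM" and ij: "i \<in> I" "j \<in> J" "b \<in> part A 1"
  shows "mat_det A I (e \<oplus>\<^bsub>SM\<^esub> elem i j b \<otimes>\<^bsub>SM\<^esub> W) = \<one> \<oplus> b \<otimes> W j i"
proof -
  let ?M = "e \<oplus>\<^bsub>SM\<^esub> elem i j b \<otimes>\<^bsub>SM\<^esub> W"
  have b: "b \<in> carrier A" using ij by (auto intro: part_closed)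
  have M: "?M \<in> carrier SM" using W elem_closed[OF ij] IK by simp
  have Mkl: "?M k l = (if k = l \<and> k \<in> I then \<one> else \<zero>) \<oplus> (if k = i then b \<otimes> W j l else \<zero>)" for k l
    by (simp add: smat_simps(4) elem_mult[OF W ij]) (auto simp: idm_def)
  have "mat_det A I ?M = ?M i i"
  proof (rule mat_det_single[OF fin_I])
    show "?M k l \<in> part A 0" if "k \<in> I" "l \<in> I" for k l
      using smat_even[OF M prI, of I] that by simp
    show "\<exists>k\<in>I. ?M k (\<sigma> k) = \<zero>" if \<sigma>: "\<sigma> permutes I" "\<sigma> \<noteq> id" for \<sigma>
    proof -
      obtain k where k: "k \<in> I" "\<sigma> k \<noteq> k" "k \<noteq> i"
        using permutes_moves_avoiding[OF fin_I \<sigma>] by metis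
      then show ?thesis by (intro bexI[of _ k]) (auto simp: Mkl)
    qed
    show "?M k k = \<one>" if "k \<in> I" "k \<noteq> i" for k using that by (simp add: Mkl)
  qed (rule ij)
  then show ?thesis using ij W b by (simp add: Mkl)
qed

text \<open>Odd elements anticommute, so 1 + wb = 1 - bw, and (bw)^2 vanishes because b^2
  does.\<close>

lemma odd_unit_product:
  assumes "w \<in> part A 1" "b \<in> part A 1"
  shows "(\<one> \<oplus> w \<otimes> b) \<otimes> (\<one> \<oplus> b \<otimes> w) = \<one>"
proof -
  have c: "w \<in> carrier A" "b \<in> carrier A" using assms by (auto intro: part_closed)
  have "w \<otimes> b = \<ominus> (b \<otimes> w)"
    using supercomm[OF assms] c by (simp add: koszul_sign_def uminus_smult)
  moreover have "b \<otimes> w \<otimes> (b \<otimes> w) = \<ominus> (b \<otimes> (b \<otimes> w)) \<otimes> w"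
    using calculation c by (simp add: m_assoc) (metis m_assoc r_minus l_minus m_closed)
  moreover have "b \<otimes> (b \<otimes> w) = \<zero>" using odd_square[OF assms(2)] c by (simp flip: m_assoc)
  ultimately show ?thesis using c
    by (simp add: l_distr r_distr l_minus a_assoc r_neg l_neg)
qed

text \<open>Induction on the support of B. A new entry b at position i, j multiplies the two
  determinants by 1 + wb and 1 + bw with the same odd w, and these are inverse to each other. The
  induction hypothesis also supplies the inverse of f + CB from which w is formed.\<close>

lemma super_sylvester:
  assumes B: "B \<in> carrier SM" "e \<otimes>\<^bsub>SM\<^esub> B = B" "B \<otimes>\<^bsub>SM\<^esub> f = B"
    and C: "C \<in> carrier SM" "f \<otimes>\<^bsub>SM\<^esub> C = C" "C \<otimes>\<^bsub>SM\<^esub> e = C"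
  shows "mat_det A J (f \<oplus>\<^bsub>SM\<^esub> C \<otimes>\<^bsub>SM\<^esub> B) \<otimes> mat_det A I (e \<oplus>\<^bsub>SM\<^esub> B \<otimes>\<^bsub>SM\<^esub> C) = \<one>"
proof -
  \<comment> \<open>The shape conditions on B are replaced by a bound on its support, which can
    shrink in the induction.\<close>
  have "mat_det A J (f \<oplus>\<^bsub>SM\<^esub> C \<otimes>\<^bsub>SM\<^esub> B) \<otimes> mat_det A I (e \<oplus>\<^bsub>SM\<^esub> B \<otimes>\<^bsub>SM\<^esub> C) = \<one>"
    if "finite S" "S \<subseteq> I \<times> J" "B \<in> carrier SM" "\<And>i j. (i, j) \<notin> S \<Longrightarrow> B i j = \<zero>" for S B
    using that
  proof (induction S arbitrary: B rule: finite_induct)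
    case empty
    then have "B = \<zero>\<^bsub>SM\<^esub>" by (intro smat_eqI) (simp add: smat_simps)
    then show ?case using C IK JK by (simp add: detI detJ)
  next
    case (insert s S)
    obtain i j where s: "s = (i, j)" by (cases s)
    have ij: "i \<in> I" "j \<in> J" using insert.prems s by auto
    define b where "b = B i j"
    define X where "X = elem i j b"
    define B0 where "B0 k l = (if (k, l) = (i, j) then \<zero> else B k l)" for k l
    have b: "b \<in> part A 1" using smat_part[OF insert.prems(2), of i j] ij by (simp add: b_def prI prJ)
    have X: "X \<in> carrier SM" unfolding X_def using ij b by (rule elem_closed)
    have B0: "B0 \<in> carrier SM"
      using smat_part[OF insert.prems(2)] smat_outside[OF insert.prems(2)]
      by (intro smatI) (simp_all add: B0_def)
    have split: "B = B0 \<oplus>\<^bsub>SM\<^esub> X"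
      using insert.prems(2) by (intro smat_eqI) (simp add: smat_simps B0_def X_def elem_def b_def)
    have supp: "B0 k l = \<zero>" if "(k, l) \<notin> S" for k l
      using insert.prems(3)[of k l] that s by (auto simp: B0_def)
    have IH: "mat_det A J (f \<oplus>\<^bsub>SM\<^esub> C \<otimes>\<^bsub>SM\<^esub> B0) \<otimes> mat_det A I (e \<oplus>\<^bsub>SM\<^esub> B0 \<otimes>\<^bsub>SM\<^esub> C) = \<one>"
      using insert.prems(1) by (intro insert.IH B0 supp) auto
    define P Q where "P = f \<oplus>\<^bsub>SM\<^esub> C \<otimes>\<^bsub>SM\<^esub> B0" and "Q = e \<oplus>\<^bsub>SM\<^esub> B0 \<otimes>\<^bsub>SM\<^esub> C"
    have PQ: "P \<in> carrier SM" "Q \<in> carrier SM" using B0 C IK JK by (simp_all add: P_def Q_def)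
    have eB0: "e \<otimes>\<^bsub>SM\<^esub> B0 = B0" "B0 \<otimes>\<^bsub>SM\<^esub> f = B0"
    proof -
      have "B0 k l = \<zero>" if "k \<notin> I \<or> l \<notin> J" for k l using supp[of k l] insert.prems(1) that by auto
      then show "e \<otimes>\<^bsub>SM\<^esub> B0 = B0" "B0 \<otimes>\<^bsub>SM\<^esub> f = B0"
        using B0 IK JK by (simp_all add: idm_fixes_left idm_fixes_right)
    qed
    have Xf: "X \<otimes>\<^bsub>SM\<^esub> f = X" using X JK ij by (auto simp: idm_fixes_right) (auto simp: X_def elem_def)
    have Pf: "P \<otimes>\<^bsub>SM\<^esub> f = P" "f \<otimes>\<^bsub>SM\<^esub> P = P"
      using eB0 C B0 JK by (simp_all add: P_def R.l_distr R.r_distr R.m_assoc) (simp flip: R.m_assoc)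
    have "mat_det A I Q \<otimes> mat_det A J P = mat_det A J P \<otimes> mat_det A I Q"
      using supercomm[OF detI(1)[OF PQ(2)] detJ(1)[OF PQ(1)]]
        part_closed[OF detI(1)[OF PQ(2)]] part_closed[OF detJ(1)[OF PQ(1)]] by simp
    \<comment> \<open>By the induction hypothesis det Q inverts det P, which is what inverting P in
      the corner of f requires.\<close>
    then have u: "mat_det A I Q \<otimes> mat_det A J P = \<one>" using IH by (simp add: P_def Q_def)
    obtain p where p: "p \<in> carrier SM" "f \<otimes>\<^bsub>SM\<^esub> p = p" "p \<otimes>\<^bsub>SM\<^esub> f = p"
      "P \<otimes>\<^bsub>SM\<^esub> p = f" "p \<otimes>\<^bsub>SM\<^esub> P = f"
      using block_inverse_exists[OF JK prJ PQ(1) Pf(2) Pf(1) detI(1)[OF PQ(2)] u] by blast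
    define W where "W = p \<otimes>\<^bsub>SM\<^esub> C"
    have W: "W \<in> carrier SM" using p C by (simp add: W_def)
    have "f \<oplus>\<^bsub>SM\<^esub> C \<otimes>\<^bsub>SM\<^esub> B = P \<otimes>\<^bsub>SM\<^esub> (f \<oplus>\<^bsub>SM\<^esub> W \<otimes>\<^bsub>SM\<^esub> X)"
      unfolding split W_def
      by (rule R.sylvester_left[OF B0 C(1) X _ p(1) P_def p(4) Pf(1) C(2)]) (simp add: JK)
    then have 1: "mat_det A J (f \<oplus>\<^bsub>SM\<^esub> C \<otimes>\<^bsub>SM\<^esub> B) = mat_det A J P \<otimes> (\<one> \<oplus> W j i \<otimes> b)"
      using detJ(2)[OF PQ(1), of "f \<oplus>\<^bsub>SM\<^esub> W \<otimes>\<^bsub>SM\<^esub> X"] det_unit_plus_column[OF W ij b] W X JK Pf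
      by (simp add: X_def)
    have "e \<oplus>\<^bsub>SM\<^esub> B \<otimes>\<^bsub>SM\<^esub> C = (e \<oplus>\<^bsub>SM\<^esub> X \<otimes>\<^bsub>SM\<^esub> W) \<otimes>\<^bsub>SM\<^esub> Q"
      unfolding split W_def
      by (rule R.sylvester_right[OF B0 C(1) X _ _ p(1) P_def Q_def p(5) _ eB0(1) C(2) C(3) Xf])
        (simp_all add: IK JK)
    moreover have "e \<otimes>\<^bsub>SM\<^esub> Q = Q" using eB0 B0 C IK by (simp add: Q_def R.r_distr flip: R.m_assoc)
    ultimately have 2: "mat_det A I (e \<oplus>\<^bsub>SM\<^esub> B \<otimes>\<^bsub>SM\<^esub> C) = (\<one> \<oplus> b \<otimes> W j i) \<otimes> mat_det A I Q"
      using detI(2)[OF _ PQ(2), of "e \<oplus>\<^bsub>SM\<^esub> X \<otimes>\<^bsub>SM\<^esub> W"] det_unit_plus_row[OF W ij b] W X IK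
      by (simp add: X_def)
    have w: "W j i \<in> part A 1" using smat_part[OF W, of j i] ij by (simp add: prI prJ)
    have cl: "W j i \<in> carrier A" "b \<in> carrier A" "mat_det A J P \<in> carrier A" "mat_det A I Q \<in> carrier A"
      using w b detI(1)[OF PQ(2)] detJ(1)[OF PQ(1)] by (auto intro: part_closed)
    have "mat_det A J P \<otimes> (\<one> \<oplus> W j i \<otimes> b) \<otimes> ((\<one> \<oplus> b \<otimes> W j i) \<otimes> mat_det A I Q) =
        mat_det A J P \<otimes> ((\<one> \<oplus> W j i \<otimes> b) \<otimes> (\<one> \<oplus> b \<otimes> W j i)) \<otimes> mat_det A I Q"
      using cl by (simp add: m_assoc)
    also have "\<dots> = \<one>" unfolding odd_unit_product[OF w b] using cl IH by (simp add: P_def Q_def)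
    finally show ?case by (simp add: 1 2)
  qed
  note gen = this
  show ?thesis
  proof (rule gen[of "I \<times> J"])
    show "B i j = \<zero>" if "(i, j) \<notin> I \<times> J" for i j
      using B that IK JK by (auto simp: idm_fixes_left idm_fixes_right)
  qed (use B fin_I fin_J in auto)
qed

end

section \<open>Multiplicativity of the Berezinian\<close>

text \<open>Insert \<one> = e + f between M and N. The elements x and y stand for e or f and select
  one of the four blocks of the product.\<close>

lemma (in ring) block_mult:
  assumes "x \<in> carrier R" "M \<in> carrier R" "N \<in> carrier R" "y \<in> carrier R" "e \<in> carrier R" "f \<in> carrier R"
    and "e \<oplus> f = \<one>" "e \<otimes> e = e" "f \<otimes> f = f"
  shows "x \<otimes> (M \<otimes> N) \<otimes> y = (x \<otimes> M \<otimes> e) \<otimes> (e \<otimes> N \<otimes> y) \<oplus> (x \<otimes> M \<otimes> f) \<otimes> (f \<otimes> N \<otimes> y)"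
proof -
  have ee: "e \<otimes> (e \<otimes> z) = e \<otimes> z" and ff: "f \<otimes> (f \<otimes> z) = f \<otimes> z" if "z \<in> carrier R" for z
    using assms that by (simp_all flip: m_assoc)
  have "(x \<otimes> M \<otimes> e) \<otimes> (e \<otimes> N \<otimes> y) \<oplus> (x \<otimes> M \<otimes> f) \<otimes> (f \<otimes> N \<otimes> y) =
      x \<otimes> M \<otimes> (e \<oplus> f) \<otimes> (N \<otimes> y)"
    using assms(1-6) by (simp add: m_assoc ee ff l_distr r_distr)
  also have "\<dots> = x \<otimes> (M \<otimes> N) \<otimes> y" using assms by (simp add: m_assoc)
  finally show ?thesis by simp
qed

context block_supermatrices
begin

definition schur :: "(nat \<Rightarrow> nat \<Rightarrow> 'a) \<Rightarrow> (nat \<Rightarrow> nat \<Rightarrow> 'a) \<Rightarrow> nat \<Rightarrow> nat \<Rightarrow> 'a" where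
  "schur M Y = e \<otimes>\<^bsub>SM\<^esub> M \<otimes>\<^bsub>SM\<^esub> e \<ominus>\<^bsub>SM\<^esub> e \<otimes>\<^bsub>SM\<^esub> M \<otimes>\<^bsub>SM\<^esub> f \<otimes>\<^bsub>SM\<^esub> Y \<otimes>\<^bsub>SM\<^esub> (f \<otimes>\<^bsub>SM\<^esub> M \<otimes>\<^bsub>SM\<^esub> e)"

definition inverse_block :: "(nat \<Rightarrow> nat \<Rightarrow> 'a) \<Rightarrow> (nat \<Rightarrow> nat \<Rightarrow> 'a) \<Rightarrow> bool" where
  "inverse_block M Y \<longleftrightarrow> Y \<in> carrier SM \<and> f \<otimes>\<^bsub>SM\<^esub> Y = Y \<and> Y \<otimes>\<^bsub>SM\<^esub> f = Y \<and>
    f \<otimes>\<^bsub>SM\<^esub> M \<otimes>\<^bsub>SM\<^esub> f \<otimes>\<^bsub>SM\<^esub> Y = f \<and> Y \<otimes>\<^bsub>SM\<^esub> (f \<otimes>\<^bsub>SM\<^esub> M \<otimes>\<^bsub>SM\<^esub> f) = f"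

lemma ef [simp]: "e \<in> carrier SM" "f \<in> carrier SM" "e \<otimes>\<^bsub>SM\<^esub> e = e" "f \<otimes>\<^bsub>SM\<^esub> f = f"
  using IK JK by simp_all

lemma e_plus_f: "e \<oplus>\<^bsub>SM\<^esub> f = \<one>\<^bsub>SM\<^esub>"
proof (rule smat_eqI)
  fix i j
  have "idm I i j \<oplus> idm J i j = idm K i j" using disjoint K_eq by (auto simp: idm_def)
  then show "(e \<oplus>\<^bsub>SM\<^esub> f) i j = \<one>\<^bsub>SM\<^esub> i j" by (simp add: smat_simps)
qed

lemma ef_absorb [simp]:
  assumes "x \<in> carrier SM"
  shows "e \<otimes>\<^bsub>SM\<^esub> (e \<otimes>\<^bsub>SM\<^esub> x) = e \<otimes>\<^bsub>SM\<^esub> x" "f \<otimes>\<^bsub>SM\<^esub> (f \<otimes>\<^bsub>SM\<^esub> x) = f \<otimes>\<^bsub>SM\<^esub> x"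
  using assms by (simp_all flip: R.m_assoc)

lemma schur_closed [simp]: "M \<in> carrier SM \<Longrightarrow> Y \<in> carrier SM \<Longrightarrow> schur M Y \<in> carrier SM"
  by (simp add: schur_def)

lemma schur_fixed:
  assumes "M \<in> carrier SM" "Y \<in> carrier SM"
  shows "e \<otimes>\<^bsub>SM\<^esub> schur M Y = schur M Y" "schur M Y \<otimes>\<^bsub>SM\<^esub> e = schur M Y"
  using assms by (simp_all add: schur_def R.minus_eq R.l_distr R.r_distr R.l_minus R.r_minus R.m_assoc)

text \<open>Let Y, Z invert the lower right blocks D1, D2, and put b = B2 Z, c = Y C1. The lower
  right block of MN is D1 P D2 with P = f + cb, and the Schur complement of MN is S1 q S2, where q
  inverts Q = e + bc. With p the inverse of P, the extra determinants det p and det q cancel because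
  det P det Q = 1.\<close>

lemma schur_mult:
  assumes M: "M \<in> carrier SM" and N: "N \<in> carrier SM"
    and Y: "inverse_block M Y" and Z: "inverse_block N Z"
  obtains W where "inverse_block (M \<otimes>\<^bsub>SM\<^esub> N) W"
    "mat_det A J W \<otimes> mat_det A I (schur (M \<otimes>\<^bsub>SM\<^esub> N) W) =
      (mat_det A J Y \<otimes> mat_det A I (schur M Y)) \<otimes> (mat_det A J Z \<otimes> mat_det A I (schur N Z))"
proof -
  define A1 B1 C1 D1 A2 B2 C2 D2 where
    "A1 = e \<otimes>\<^bsub>SM\<^esub> M \<otimes>\<^bsub>SM\<^esub> e" and "B1 = e \<otimes>\<^bsub>SM\<^esub> M \<otimes>\<^bsub>SM\<^esub> f" and
    "C1 = f \<otimes>\<^bsub>SM\<^esub> M \<otimes>\<^bsub>SM\<^esub> e" and "D1 = f \<otimes>\<^bsub>SM\<^esub> M \<otimes>\<^bsub>SM\<^esub> f" and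
    "A2 = e \<otimes>\<^bsub>SM\<^esub> N \<otimes>\<^bsub>SM\<^esub> e" and "B2 = e \<otimes>\<^bsub>SM\<^esub> N \<otimes>\<^bsub>SM\<^esub> f" and
    "C2 = f \<otimes>\<^bsub>SM\<^esub> N \<otimes>\<^bsub>SM\<^esub> e" and "D2 = f \<otimes>\<^bsub>SM\<^esub> N \<otimes>\<^bsub>SM\<^esub> f"
  note defs = this
  have cl: "A1 \<in> carrier SM" "B1 \<in> carrier SM" "C1 \<in> carrier SM" "D1 \<in> carrier SM"
    "A2 \<in> carrier SM" "B2 \<in> carrier SM" "C2 \<in> carrier SM" "D2 \<in> carrier SM"
    using M N by (simp_all add: defs)
  have fx: "B1 \<otimes>\<^bsub>SM\<^esub> f = B1" "C1 \<otimes>\<^bsub>SM\<^esub> e = C1" "f \<otimes>\<^bsub>SM\<^esub> C1 = C1" "e \<otimes>\<^bsub>SM\<^esub> B2 = B2"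
    "B2 \<otimes>\<^bsub>SM\<^esub> f = B2" "f \<otimes>\<^bsub>SM\<^esub> C2 = C2" "f \<otimes>\<^bsub>SM\<^esub> D1 = D1" "D1 \<otimes>\<^bsub>SM\<^esub> f = D1" "f \<otimes>\<^bsub>SM\<^esub> D2 = D2" "D2 \<otimes>\<^bsub>SM\<^esub> f = D2"
    using M N by (simp_all add: defs R.m_assoc)
  have Y': "Y \<in> carrier SM" "f \<otimes>\<^bsub>SM\<^esub> Y = Y" "Y \<otimes>\<^bsub>SM\<^esub> f = Y" "D1 \<otimes>\<^bsub>SM\<^esub> Y = f" "Y \<otimes>\<^bsub>SM\<^esub> D1 = f"
    using Y by (simp_all add: inverse_block_def defs)
  have Z': "Z \<in> carrier SM" "f \<otimes>\<^bsub>SM\<^esub> Z = Z" "Z \<otimes>\<^bsub>SM\<^esub> f = Z" "D2 \<otimes>\<^bsub>SM\<^esub> Z = f" "Z \<otimes>\<^bsub>SM\<^esub> D2 = f"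
    using Z by (simp_all add: inverse_block_def defs)
  define b c P Q where "b = B2 \<otimes>\<^bsub>SM\<^esub> Z" and "c = Y \<otimes>\<^bsub>SM\<^esub> C1"
    and "P = f \<oplus>\<^bsub>SM\<^esub> c \<otimes>\<^bsub>SM\<^esub> b" and "Q = e \<oplus>\<^bsub>SM\<^esub> b \<otimes>\<^bsub>SM\<^esub> c"
  have bc: "b \<in> carrier SM" "c \<in> carrier SM" "P \<in> carrier SM" "Q \<in> carrier SM"
    using cl Y' Z' by (simp_all add: b_def c_def P_def Q_def)
  have fbc: "e \<otimes>\<^bsub>SM\<^esub> b = b" "b \<otimes>\<^bsub>SM\<^esub> f = b" "c \<otimes>\<^bsub>SM\<^esub> e = c" "f \<otimes>\<^bsub>SM\<^esub> c = c"
    using cl Y' Z' fx by (simp_all add: b_def c_def R.m_assoc) (simp_all flip: R.m_assoc add: fx Y')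
  have syl: "mat_det A J P \<otimes> mat_det A I Q = \<one>"
    unfolding P_def Q_def by (rule super_sylvester) (simp_all add: bc fbc)
  have ev: "mat_det A J P \<in> part A 0" "mat_det A I Q \<in> part A 0"
    using bc by (simp_all add: detI detJ)
  have evc: "x \<otimes> y = y \<otimes> x" if "x \<in> part A 0" "y \<in> part A 0" for x y
    using supercomm[OF that] part_closed[OF that(1)] part_closed[OF that(2)] by simp
  have Pf: "f \<otimes>\<^bsub>SM\<^esub> P = P" "P \<otimes>\<^bsub>SM\<^esub> f = P"
    using bc fbc by (simp_all add: P_def R.l_distr R.r_distr R.m_assoc) (simp flip: R.m_assoc add: fbc)
  have u: "mat_det A I Q \<otimes> mat_det A J P = \<one>" using syl evc[OF ev] by simp
  obtain p where p: "p \<in> carrier SM" "f \<otimes>\<^bsub>SM\<^esub> p = p" "p \<otimes>\<^bsub>SM\<^esub> f = p"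
    "P \<otimes>\<^bsub>SM\<^esub> p = f" "p \<otimes>\<^bsub>SM\<^esub> P = f"
    using block_inverse_exists[OF JK prJ bc(3) Pf ev(2) u] by blast
  \<comment> \<open>\<open>q\<close> is the inverse of \<open>Q\<close> given by
    \<open>sylvester_inverse\<close>, and at the same time the middle factor in
    \<open>schur_complement_mult\<close>.\<close>
  define q where "q = e \<ominus>\<^bsub>SM\<^esub> b \<otimes>\<^bsub>SM\<^esub> p \<otimes>\<^bsub>SM\<^esub> c"
  have q: "q \<in> carrier SM" using bc p by (simp add: q_def)
  have eq: "e \<otimes>\<^bsub>SM\<^esub> q = q"
    using bc p fbc by (simp add: q_def R.minus_eq R.r_distr R.r_minus flip: R.m_assoc)
  have Qq: "Q \<otimes>\<^bsub>SM\<^esub> q = e"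
    unfolding Q_def q_def by (rule R.sylvester_inverse[OF bc(1,2) ef(1,2) p(1) P_def p(4) ef(3) fbc])
  define W where "W = Z \<otimes>\<^bsub>SM\<^esub> (p \<otimes>\<^bsub>SM\<^esub> Y)"
  have W: "W \<in> carrier SM" using Y' Z' p by (simp add: W_def)
  note bm = R.block_mult[OF _ M N _ ef(1,2) e_plus_f ef(3,4)]
  have AA: "e \<otimes>\<^bsub>SM\<^esub> (M \<otimes>\<^bsub>SM\<^esub> N) \<otimes>\<^bsub>SM\<^esub> e = A1 \<otimes>\<^bsub>SM\<^esub> A2 \<oplus>\<^bsub>SM\<^esub> B1 \<otimes>\<^bsub>SM\<^esub> C2"
    and BB: "e \<otimes>\<^bsub>SM\<^esub> (M \<otimes>\<^bsub>SM\<^esub> N) \<otimes>\<^bsub>SM\<^esub> f = A1 \<otimes>\<^bsub>SM\<^esub> B2 \<oplus>\<^bsub>SM\<^esub> B1 \<otimes>\<^bsub>SM\<^esub> D2"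
    and CC: "f \<otimes>\<^bsub>SM\<^esub> (M \<otimes>\<^bsub>SM\<^esub> N) \<otimes>\<^bsub>SM\<^esub> e = C1 \<otimes>\<^bsub>SM\<^esub> A2 \<oplus>\<^bsub>SM\<^esub> D1 \<otimes>\<^bsub>SM\<^esub> C2"
    and DD: "f \<otimes>\<^bsub>SM\<^esub> (M \<otimes>\<^bsub>SM\<^esub> N) \<otimes>\<^bsub>SM\<^esub> f = C1 \<otimes>\<^bsub>SM\<^esub> B2 \<oplus>\<^bsub>SM\<^esub> D1 \<otimes>\<^bsub>SM\<^esub> D2"
    unfolding defs by (rule bm; simp)+
  have DPD: "f \<otimes>\<^bsub>SM\<^esub> (M \<otimes>\<^bsub>SM\<^esub> N) \<otimes>\<^bsub>SM\<^esub> f = D1 \<otimes>\<^bsub>SM\<^esub> (P \<otimes>\<^bsub>SM\<^esub> D2)"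
  proof -
    have "D1 \<otimes>\<^bsub>SM\<^esub> (P \<otimes>\<^bsub>SM\<^esub> D2) = D1 \<otimes>\<^bsub>SM\<^esub> D2 \<oplus>\<^bsub>SM\<^esub> (D1 \<otimes>\<^bsub>SM\<^esub> Y) \<otimes>\<^bsub>SM\<^esub> (C1 \<otimes>\<^bsub>SM\<^esub> B2) \<otimes>\<^bsub>SM\<^esub> (Z \<otimes>\<^bsub>SM\<^esub> D2)"
      using cl bc Y'(1) Z'(1) fx by (simp add: P_def b_def c_def R.l_distr R.r_distr R.m_assoc)
    also have "\<dots> = D1 \<otimes>\<^bsub>SM\<^esub> D2 \<oplus>\<^bsub>SM\<^esub> C1 \<otimes>\<^bsub>SM\<^esub> B2"
      unfolding Y'(4) Z'(5) using cl fx by (simp add: R.m_assoc) (simp flip: R.m_assoc add: fx)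
    finally show ?thesis unfolding DD using cl by (simp add: R.a_comm)
  qed
  have inv: "inverse_block (M \<otimes>\<^bsub>SM\<^esub> N) W"
    unfolding inverse_block_def DPD
  proof (intro conjI)
    show "W \<in> carrier SM" by (rule W)
    show "f \<otimes>\<^bsub>SM\<^esub> W = W" using Y' Z' p by (simp add: W_def flip: R.m_assoc)
    show "W \<otimes>\<^bsub>SM\<^esub> f = W" using Y' Z' p by (simp add: W_def R.m_assoc)
    have "D1 \<otimes>\<^bsub>SM\<^esub> (P \<otimes>\<^bsub>SM\<^esub> D2) \<otimes>\<^bsub>SM\<^esub> W = D1 \<otimes>\<^bsub>SM\<^esub> (P \<otimes>\<^bsub>SM\<^esub> ((D2 \<otimes>\<^bsub>SM\<^esub> Z) \<otimes>\<^bsub>SM\<^esub> p) \<otimes>\<^bsub>SM\<^esub> Y)"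
      using cl bc(3) Y'(1) Z'(1) p(1) by (simp add: W_def R.m_assoc)
    then show "D1 \<otimes>\<^bsub>SM\<^esub> (P \<otimes>\<^bsub>SM\<^esub> D2) \<otimes>\<^bsub>SM\<^esub> W = f" using Z'(4) p(2,4) Y'(2,4) by simp
    have "W \<otimes>\<^bsub>SM\<^esub> (D1 \<otimes>\<^bsub>SM\<^esub> (P \<otimes>\<^bsub>SM\<^esub> D2)) = Z \<otimes>\<^bsub>SM\<^esub> (p \<otimes>\<^bsub>SM\<^esub> ((Y \<otimes>\<^bsub>SM\<^esub> D1) \<otimes>\<^bsub>SM\<^esub> P) \<otimes>\<^bsub>SM\<^esub> D2)"
      using cl bc(3) Y'(1) Z'(1) p(1) by (simp add: W_def R.m_assoc)
    then show "W \<otimes>\<^bsub>SM\<^esub> (D1 \<otimes>\<^bsub>SM\<^esub> (P \<otimes>\<^bsub>SM\<^esub> D2)) = f" using Y'(5) p(5) Pf Z'(5) fx by simp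
  qed
  define S1 S2 where "S1 = schur M Y" and "S2 = schur N Z"
  have S: "S1 \<in> carrier SM" "S2 \<in> carrier SM" "S1 \<otimes>\<^bsub>SM\<^esub> e = S1" "e \<otimes>\<^bsub>SM\<^esub> S2 = S2"
    using M N Y' Z' by (simp_all add: S1_def S2_def schur_fixed)
  have sub_add: "x = (x \<ominus>\<^bsub>SM\<^esub> y) \<oplus>\<^bsub>SM\<^esub> y" if "x \<in> carrier SM" "y \<in> carrier SM" for x y
    using that by (simp add: R.minus_eq R.a_assoc R.l_neg)
  \<comment> \<open>The upper left blocks are recovered from their Schur complements, the form in
    which \<open>schur_complement_mult\<close> takes them.\<close>
  have A1: "A1 = S1 \<oplus>\<^bsub>SM\<^esub> B1 \<otimes>\<^bsub>SM\<^esub> c"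
    using sub_add[of A1 "B1 \<otimes>\<^bsub>SM\<^esub> c"] cl Y' bc
    by (simp add: S1_def schur_def c_def R.m_assoc flip: defs)
  have A2: "A2 = S2 \<oplus>\<^bsub>SM\<^esub> b \<otimes>\<^bsub>SM\<^esub> C2"
    using sub_add[of A2 "b \<otimes>\<^bsub>SM\<^esub> C2"] cl Z' bc
    by (simp add: S2_def schur_def b_def flip: defs)
  have BZ: "(A1 \<otimes>\<^bsub>SM\<^esub> B2 \<oplus>\<^bsub>SM\<^esub> B1 \<otimes>\<^bsub>SM\<^esub> D2) \<otimes>\<^bsub>SM\<^esub> Z = A1 \<otimes>\<^bsub>SM\<^esub> b \<oplus>\<^bsub>SM\<^esub> B1"
    using cl Z' fx by (simp add: b_def R.l_distr R.m_assoc)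
  have YC: "Y \<otimes>\<^bsub>SM\<^esub> (C1 \<otimes>\<^bsub>SM\<^esub> A2 \<oplus>\<^bsub>SM\<^esub> D1 \<otimes>\<^bsub>SM\<^esub> C2) = c \<otimes>\<^bsub>SM\<^esub> A2 \<oplus>\<^bsub>SM\<^esub> C2"
    using cl Y' fx by (simp add: c_def R.r_distr flip: R.m_assoc)
  have "schur (M \<otimes>\<^bsub>SM\<^esub> N) W = (A1 \<otimes>\<^bsub>SM\<^esub> A2 \<oplus>\<^bsub>SM\<^esub> B1 \<otimes>\<^bsub>SM\<^esub> C2) \<ominus>\<^bsub>SM\<^esub>
      ((A1 \<otimes>\<^bsub>SM\<^esub> B2 \<oplus>\<^bsub>SM\<^esub> B1 \<otimes>\<^bsub>SM\<^esub> D2) \<otimes>\<^bsub>SM\<^esub> Z) \<otimes>\<^bsub>SM\<^esub> p \<otimes>\<^bsub>SM\<^esub>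
      (Y \<otimes>\<^bsub>SM\<^esub> (C1 \<otimes>\<^bsub>SM\<^esub> A2 \<oplus>\<^bsub>SM\<^esub> D1 \<otimes>\<^bsub>SM\<^esub> C2))"
  proof -
    let ?B = "A1 \<otimes>\<^bsub>SM\<^esub> B2 \<oplus>\<^bsub>SM\<^esub> B1 \<otimes>\<^bsub>SM\<^esub> D2" and ?C = "C1 \<otimes>\<^bsub>SM\<^esub> A2 \<oplus>\<^bsub>SM\<^esub> D1 \<otimes>\<^bsub>SM\<^esub> C2"
    have "?B \<in> carrier SM" "?C \<in> carrier SM" using cl by simp_all
    then have "?B \<otimes>\<^bsub>SM\<^esub> W \<otimes>\<^bsub>SM\<^esub> ?C = (?B \<otimes>\<^bsub>SM\<^esub> Z) \<otimes>\<^bsub>SM\<^esub> p \<otimes>\<^bsub>SM\<^esub> (Y \<otimes>\<^bsub>SM\<^esub> ?C)"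
      unfolding W_def using Y'(1) Z'(1) p(1) by (simp only: R.m_assoc R.m_closed)
    then show ?thesis unfolding schur_def AA BB CC by simp
  qed
  also have "\<dots> = S1 \<otimes>\<^bsub>SM\<^esub> q \<otimes>\<^bsub>SM\<^esub> S2"
    unfolding BZ YC q_def
    by (rule R.schur_complement_mult[OF cl(2) bc(1,2) cl(7) S(1,2) ef(1,2) p(1) P_def p(4,5)
        fx(1,6) fbc(4) p(3) S(4) A1 A2])
  finally have schur_eq: "schur (M \<otimes>\<^bsub>SM\<^esub> N) W = S1 \<otimes>\<^bsub>SM\<^esub> q \<otimes>\<^bsub>SM\<^esub> S2" .
  have dW: "mat_det A J W = mat_det A J Z \<otimes> (mat_det A J p \<otimes> mat_det A J Y)"
    unfolding W_def using Y' Z' p by (simp add: detJ(2))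
  have dS: "mat_det A I (schur (M \<otimes>\<^bsub>SM\<^esub> N) W) = mat_det A I S1 \<otimes> mat_det A I q \<otimes> mat_det A I S2"
    unfolding schur_eq using S q eq by (simp add: detI(2))
  have dPp: "mat_det A J P \<otimes> mat_det A J p = \<one>"
    using detJ(2)[OF bc(3) p(1)] p Pf by (simp add: detJ(3))
  have dQq: "mat_det A I Q \<otimes> mat_det A I q = \<one>"
    using detI(2)[OF bc(4) q] eq Qq by (simp add: detI(3))
  \<comment> \<open>All these determinants are even, so the final cancellation is done in the
    commutative ring \<open>E\<close>.\<close>
  define x1 x2 y1 y2 zp zq d1 d2 where
    "x1 = mat_det A J Y" and "x2 = mat_det A J Z" and "y1 = mat_det A I S1" and "y2 = mat_det A I S2"
    and "zp = mat_det A J p" and "zq = mat_det A I q" and "d1 = mat_det A J P" and "d2 = mat_det A I Q"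
  note xd = this
  have xe: "x1 \<in> carrier E" "x2 \<in> carrier E" "y1 \<in> carrier E" "y2 \<in> carrier E" "zp \<in> carrier E" "zq \<in> carrier E"
    "d1 \<in> carrier E" "d2 \<in> carrier E"
    using Y' Z' S p q bc by (simp_all add: xd detI(1) detJ(1))
  have "d1 \<otimes>\<^bsub>E\<^esub> zp = \<one>\<^bsub>E\<^esub>" "d2 \<otimes>\<^bsub>E\<^esub> zq = \<one>\<^bsub>E\<^esub>" "d1 \<otimes>\<^bsub>E\<^esub> d2 = \<one>\<^bsub>E\<^esub>"
    using dPp dQq syl by (simp_all add: xd)
  then have "zp \<otimes>\<^bsub>E\<^esub> zq = (zp \<otimes>\<^bsub>E\<^esub> zq) \<otimes>\<^bsub>E\<^esub> (d1 \<otimes>\<^bsub>E\<^esub> d2)" "(d1 \<otimes>\<^bsub>E\<^esub> zp) \<otimes>\<^bsub>E\<^esub> (d2 \<otimes>\<^bsub>E\<^esub> zq) = \<one>\<^bsub>E\<^esub>"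
    using xe by (simp_all del: even_part_simps)
  then have zz: "zp \<otimes>\<^bsub>E\<^esub> zq = \<one>\<^bsub>E\<^esub>" using xe by (simp add: E.m_ac del: even_part_simps)
  have "x2 \<otimes>\<^bsub>E\<^esub> (zp \<otimes>\<^bsub>E\<^esub> x1) \<otimes>\<^bsub>E\<^esub> (y1 \<otimes>\<^bsub>E\<^esub> zq \<otimes>\<^bsub>E\<^esub> y2) = (zp \<otimes>\<^bsub>E\<^esub> zq) \<otimes>\<^bsub>E\<^esub> ((x1 \<otimes>\<^bsub>E\<^esub> y1) \<otimes>\<^bsub>E\<^esub> (x2 \<otimes>\<^bsub>E\<^esub> y2))"
    using xe by (simp add: E.m_ac del: even_part_simps)
  also have "\<dots> = (x1 \<otimes>\<^bsub>E\<^esub> y1) \<otimes>\<^bsub>E\<^esub> (x2 \<otimes>\<^bsub>E\<^esub> y2)" unfolding zz using xe by (simp del: even_part_simps)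
  finally have "mat_det A J W \<otimes> mat_det A I (schur (M \<otimes>\<^bsub>SM\<^esub> N) W) =
      (mat_det A J Y \<otimes> mat_det A I (schur M Y)) \<otimes> (mat_det A J Z \<otimes> mat_det A I (schur N Z))"
    unfolding dW dS by (simp add: xd S1_def S2_def)
  then show ?thesis using that inv by blast
qed

end

declare One_nat_def [simp del]

section \<open>The Berezinian of a matrix of type (m|n)\<close>

locale interval_blocks = strict_salg A for A :: "('k::field, 'a) superalg" (structure) +
  fixes m n :: nat
begin

abbreviation index_parity :: "nat \<Rightarrow> bit" where
  "index_parity i \<equiv> (if i \<le> m then 0 else 1)"

definition supermatrix :: "(nat \<Rightarrow> nat \<Rightarrow> 'a) \<Rightarrow> bool" where
  "supermatrix a \<longleftrightarrow> (\<forall>i\<in>{1..m+n}. \<forall>j\<in>{1..m+n}. a i j \<in> part A (gl_parity m (Var i j)))"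

text \<open>Extension by zero makes a matrix given on the index range an element of the ring of
  supermatrices.\<close>

definition pad :: "(nat \<Rightarrow> nat \<Rightarrow> 'a) \<Rightarrow> nat \<Rightarrow> nat \<Rightarrow> 'a" where
  "pad a i j = (if i \<in> {1..m+n} \<and> j \<in> {1..m+n} then a i j else \<zero>)"

end

sublocale interval_blocks \<subseteq> block_supermatrices A "{1..m+n}" index_parity "{1..m}" "{m+1..m+n}"
  by unfold_locales auto

context interval_blocks
begin

lemma gl_parity_index: "gl_parity m (Var i j) = index_parity i + index_parity j"
  by simp

lemma supermatrix_part:
  "supermatrix a \<Longrightarrow> i \<in> {1..m+n} \<Longrightarrow> j \<in> {1..m+n} \<Longrightarrow> a i j \<in> part A (index_parity i + index_parity j)"
  using gl_parity_index unfolding supermatrix_def by metis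

lemma supermatrix_entry:
  assumes "supermatrix a" "i \<in> {1..m+n}" "j \<in> {1..m+n}"
  shows "a i j \<in> carrier A"
  using supermatrix_part[OF assms] by (rule part_closed)

lemma supermatrix_even:
  assumes "supermatrix a"
  shows "i \<in> {1..m} \<Longrightarrow> j \<in> {1..m} \<Longrightarrow> a i j \<in> part A 0"
    and "i \<in> {m+1..m+n} \<Longrightarrow> j \<in> {m+1..m+n} \<Longrightarrow> a i j \<in> part A 0"
  using supermatrix_part[OF assms, of i j] by simp_all

lemma supermatrix_odd:
  assumes "supermatrix a"
  shows "i \<in> {1..m} \<Longrightarrow> j \<in> {m+1..m+n} \<Longrightarrow> a i j \<in> part A 1"
    and "i \<in> {m+1..m+n} \<Longrightarrow> j \<in> {1..m} \<Longrightarrow> a i j \<in> part A 1"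
  using supermatrix_part[OF assms, of i j] by simp_all

lemma pad_closed: "supermatrix a \<Longrightarrow> pad a \<in> carrier SM"
  using supermatrix_part by (intro smatI) (auto simp: pad_def)

lemma schur_entry_even:
  assumes a: "supermatrix a" and Y: "\<And>l s. l \<in> {m+1..m+n} \<Longrightarrow> s \<in> {m+1..m+n} \<Longrightarrow> Y l s \<in> part A 0"
    and ij: "i \<in> {1..m}" "j \<in> {1..m}"
  shows "(\<Oplus>l\<in>{m+1..m+n}. \<Oplus>s\<in>{m+1..m+n}. a i l \<otimes> Y l s \<otimes> a s j) \<in> part A 0"
    and "a i j \<ominus> (\<Oplus>l\<in>{m+1..m+n}. \<Oplus>s\<in>{m+1..m+n}. a i l \<otimes> Y l s \<otimes> a s j) \<in> part A 0"
proof -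
  have "a i l \<otimes> Y l s \<otimes> a s j \<in> part A 0" if "l \<in> {m+1..m+n}" "s \<in> {m+1..m+n}" for l s
    using part_mult[OF part_mult[OF supermatrix_odd(1)[OF a ij(1) that(1)] Y[OF that]]
        supermatrix_odd(2)[OF a that(2) ij(2)]] by simp
  then show "(\<Oplus>l\<in>{m+1..m+n}. \<Oplus>s\<in>{m+1..m+n}. a i l \<otimes> Y l s \<otimes> a s j) \<in> part A 0"
    by (intro part_finsum) simp_all
  then show "a i j \<ominus> (\<Oplus>l\<in>{m+1..m+n}. \<Oplus>s\<in>{m+1..m+n}. a i l \<otimes> Y l s \<otimes> a s j) \<in> part A 0"
    using supermatrix_even(1)[OF a ij] by (rule part_minus[rotated])
qed

text \<open>The inverse in \<open>berezinian\<close> is some inverse of the lower right block. By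
  uniqueness any even inverse may replace it on that block, and no other entries of it occur in the
  formula.\<close>

lemma berezinian_eq:
  assumes a: "supermatrix a" and Y: "is_mat_inv A {m+1..m+n} a Y"
    and Y0: "\<And>l s. l \<in> {m+1..m+n} \<Longrightarrow> s \<in> {m+1..m+n} \<Longrightarrow> Y l s \<in> part A 0"
  shows "berezinian m n A a = mat_det A {m+1..m+n} Y \<otimes> mat_det A {1..m} (\<lambda>i j. a i j \<ominus>
     (\<Oplus>l\<in>{m+1..m+n}. \<Oplus>s\<in>{m+1..m+n}. a i l \<otimes> Y l s \<otimes> a s j))"
proof -
  have inv: "mat_inv A {m+1..m+n} a i j = Y i j" if "i \<in> {m+1..m+n}" "j \<in> {m+1..m+n}" for i j
    by (rule mat_inv_eqI[OF _ _ Y that]) (simp_all add: part_closed[OF supermatrix_even(2)[OF a]])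
  have 1: "mat_det A {m+1..m+n} (mat_inv A {m+1..m+n} a) = mat_det A {m+1..m+n} Y"
    using inv Y0 by (intro mat_det_cong) auto
  have c: "a i l \<otimes> Y l s \<otimes> a s j \<in> carrier A"
    if "i \<in> {1..m}" "j \<in> {1..m}" "l \<in> {m+1..m+n}" "s \<in> {m+1..m+n}" for i j l s
    using that supermatrix_entry[OF a] part_closed[OF Y0[of l s]] by simp
  have 2: "mat_det A {1..m} (\<lambda>i j. a i j \<ominus> (\<Oplus>l\<in>{m+1..m+n}. \<Oplus>s\<in>{m+1..m+n}.
       a i l \<otimes> mat_inv A {m+1..m+n} a l s \<otimes> a s j)) = mat_det A {1..m} (\<lambda>i j. a i j \<ominus>
     (\<Oplus>l\<in>{m+1..m+n}. \<Oplus>s\<in>{m+1..m+n}. a i l \<otimes> Y l s \<otimes> a s j))"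
  proof (rule mat_det_cong)
    fix i j assume ij: "i \<in> {1..m}" "j \<in> {1..m}"
    have "(\<Oplus>l\<in>{m+1..m+n}. \<Oplus>s\<in>{m+1..m+n}. a i l \<otimes> mat_inv A {m+1..m+n} a l s \<otimes> a s j) =
      (\<Oplus>l\<in>{m+1..m+n}. \<Oplus>s\<in>{m+1..m+n}. a i l \<otimes> Y l s \<otimes> a s j)"
      using c[OF ij] inv by (intro finsum_cong') (auto intro!: finsum_closed finsum_cong')
    then show "a i j \<ominus> (\<Oplus>l\<in>{m+1..m+n}. \<Oplus>s\<in>{m+1..m+n}.
       a i l \<otimes> mat_inv A {m+1..m+n} a l s \<otimes> a s j) = a i j \<ominus>
     (\<Oplus>l\<in>{m+1..m+n}. \<Oplus>s\<in>{m+1..m+n}. a i l \<otimes> Y l s \<otimes> a s j)" by simp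
  qed (use schur_entry_even(2)[OF a Y0] in simp_all)
  show ?thesis unfolding berezinian_def Let_def 1 2 ..
qed

lemma berezinian_even:
  assumes a: "supermatrix a" and Y: "is_mat_inv A {m+1..m+n} a Y"
    and Y0: "\<And>l s. l \<in> {m+1..m+n} \<Longrightarrow> s \<in> {m+1..m+n} \<Longrightarrow> Y l s \<in> part A 0"
  shows "berezinian m n A a \<in> part A 0"
proof -
  have 1: "mat_det A {m+1..m+n} Y \<in> part A 0" using Y0 by (intro mat_det_even) auto
  have 2: "mat_det A {1..m} (\<lambda>i j. a i j \<ominus>
     (\<Oplus>l\<in>{m+1..m+n}. \<Oplus>s\<in>{m+1..m+n}. a i l \<otimes> Y l s \<otimes> a s j)) \<in> part A 0"
    using schur_entry_even(2)[OF a Y0] by (intro mat_det_even) simp_all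
  have "berezinian m n A a = mat_det A {m+1..m+n} Y \<otimes> mat_det A {1..m} (\<lambda>i j. a i j \<ominus>
     (\<Oplus>l\<in>{m+1..m+n}. \<Oplus>s\<in>{m+1..m+n}. a i l \<otimes> Y l s \<otimes> a s j))"
    by (rule berezinian_eq[OF assms])
  then show ?thesis using part_mult[OF 1 2] by simp
qed

lemma corner_pad:
  assumes a: "supermatrix a"
  shows "(f \<otimes>\<^bsub>SM\<^esub> pad a \<otimes>\<^bsub>SM\<^esub> f) i j = (if i \<in> {m+1..m+n} \<and> j \<in> {m+1..m+n} then a i j else \<zero>)"
    "(e \<otimes>\<^bsub>SM\<^esub> pad a \<otimes>\<^bsub>SM\<^esub> e) i j = (if i \<in> {1..m} \<and> j \<in> {1..m} then a i j else \<zero>)"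
    "(e \<otimes>\<^bsub>SM\<^esub> pad a \<otimes>\<^bsub>SM\<^esub> f) i j = (if i \<in> {1..m} \<and> j \<in> {m+1..m+n} then a i j else \<zero>)"
    "(f \<otimes>\<^bsub>SM\<^esub> pad a \<otimes>\<^bsub>SM\<^esub> e) i j = (if i \<in> {m+1..m+n} \<and> j \<in> {1..m} then a i j else \<zero>)"
  using pad_closed[OF a] IK JK ef(1,2)
  by (simp_all only: idm_mult_left idm_mult_right R.m_closed) (auto simp: pad_def)

lemma inverse_block_mat_inv:
  assumes a: "supermatrix a" and Y: "inverse_block (pad a) Y"
  shows "is_mat_inv A {m+1..m+n} a Y"
    and "\<And>l s. l \<in> {m+1..m+n} \<Longrightarrow> s \<in> {m+1..m+n} \<Longrightarrow> Y l s \<in> part A 0"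
proof -
  let ?D = "f \<otimes>\<^bsub>SM\<^esub> pad a \<otimes>\<^bsub>SM\<^esub> f"
  have D: "?D \<in> carrier SM" using pad_closed[OF a] by simp
  have Y': "Y \<in> carrier SM" "f \<otimes>\<^bsub>SM\<^esub> Y = Y" "Y \<otimes>\<^bsub>SM\<^esub> f = Y" "?D \<otimes>\<^bsub>SM\<^esub> Y = f" "Y \<otimes>\<^bsub>SM\<^esub> ?D = f"
    using Y unfolding inverse_block_def by blast+
  show Y0: "Y l s \<in> part A 0" if "l \<in> {m+1..m+n}" "s \<in> {m+1..m+n}" for l s
    using smat_part[OF Y'(1), of l s] that by simp
  show "is_mat_inv A {m+1..m+n} a Y"
    unfolding is_mat_inv_def
  proof (intro ballI conjI)
    fix i j assume ij: "i \<in> {m+1..m+n}" "j \<in> {m+1..m+n}"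
    show "Y i j \<in> carrier A" using Y' by simp
    have id: "f i j = (if i = j then \<one> else \<zero>)" using ij by (auto simp: idm_def)
    have "(\<Oplus>l\<in>{m+1..m+n}. a i l \<otimes> Y l j) = (\<Oplus>l\<in>{m+1..m+n}. ?D i l \<otimes> Y l j)"
      using ij D Y' supermatrix_entry[OF a] by (intro finsum_cong') (auto simp: corner_pad[OF a])
    also have "\<dots> = (?D \<otimes>\<^bsub>SM\<^esub> Y) i j"
      by (rule smat_mult_restrict[OF JK D Y'(1), symmetric]) (simp add: Y')
    finally show "(\<Oplus>l\<in>{m+1..m+n}. a i l \<otimes> Y l j) = (if i = j then \<one> else \<zero>)" by (simp add: Y' id)
    have "(\<Oplus>l\<in>{m+1..m+n}. Y i l \<otimes> a l j) = (\<Oplus>l\<in>{m+1..m+n}. Y i l \<otimes> ?D l j)"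
      using ij D Y' supermatrix_entry[OF a] by (intro finsum_cong') (auto simp: corner_pad[OF a])
    also have "\<dots> = (Y \<otimes>\<^bsub>SM\<^esub> ?D) i j"
      by (rule smat_mult_restrict[OF JK Y'(1) D, symmetric]) (simp add: Y')
    finally show "(\<Oplus>l\<in>{m+1..m+n}. Y i l \<otimes> a l j) = (if i = j then \<one> else \<zero>)" by (simp add: Y' id)
  qed
qed

text \<open>The double sum in \<open>berezinian\<close> is a product of blocks of the padded matrix
  with the inverse block between them. This carries the formula over to the ring of supermatrices,
  where \<open>schur_mult\<close> applies.\<close>

lemma berezinian_eq_schur:
  assumes a: "supermatrix a" and Y: "inverse_block (pad a) Y"
  shows "berezinian m n A a = mat_det A {m+1..m+n} Y \<otimes> mat_det A {1..m} (schur (pad a) Y)"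
proof -
  note Yi = inverse_block_mat_inv[OF a Y]
  have Y': "Y \<in> carrier SM" "f \<otimes>\<^bsub>SM\<^esub> Y = Y" "Y \<otimes>\<^bsub>SM\<^esub> f = Y"
    using Y unfolding inverse_block_def by blast+
  note P = pad_closed[OF a]
  let ?B = "e \<otimes>\<^bsub>SM\<^esub> pad a \<otimes>\<^bsub>SM\<^esub> f" and ?C = "f \<otimes>\<^bsub>SM\<^esub> pad a \<otimes>\<^bsub>SM\<^esub> e"
  have BC: "?B \<in> carrier SM" "?C \<in> carrier SM" using P by simp_all
  have "mat_det A {1..m} (\<lambda>i j. a i j \<ominus>
     (\<Oplus>l\<in>{m+1..m+n}. \<Oplus>s\<in>{m+1..m+n}. a i l \<otimes> Y l s \<otimes> a s j)) = mat_det A {1..m} (schur (pad a) Y)"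
  proof (rule mat_det_cong[symmetric])
    fix i j assume ij: "i \<in> {1..m}" "j \<in> {1..m}"
    show "a i j \<ominus> (\<Oplus>l\<in>{m+1..m+n}. \<Oplus>s\<in>{m+1..m+n}. a i l \<otimes> Y l s \<otimes> a s j) \<in> part A 0"
      by (rule schur_entry_even(2)[OF a Yi(2) ij])
    have c: "a i l \<in> carrier A" "a s j \<in> carrier A" "Y l s \<in> carrier A"
      if "l \<in> {m+1..m+n}" "s \<in> {m+1..m+n}" for l s
      using that ij supermatrix_entry[OF a] Y' by simp_all
    have BY: "?B \<otimes>\<^bsub>SM\<^esub> Y \<in> carrier SM" using BC Y' by simp
    have "(?B \<otimes>\<^bsub>SM\<^esub> Y \<otimes>\<^bsub>SM\<^esub> ?C) i j = (\<Oplus>s\<in>{m+1..m+n}. (?B \<otimes>\<^bsub>SM\<^esub> Y) i s \<otimes> ?C s j)"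
      using BC Y' P by (intro smat_mult_restrict JK BY) (simp_all add: R.m_assoc)
    also have "\<dots> = (\<Oplus>s\<in>{m+1..m+n}. (\<Oplus>l\<in>{m+1..m+n}. a i l \<otimes> Y l s) \<otimes> a s j)"
    proof (rule finsum_cong')
      fix s assume s: "s \<in> {m+1..m+n}"
      have "(?B \<otimes>\<^bsub>SM\<^esub> Y) i s = (\<Oplus>l\<in>{m+1..m+n}. ?B i l \<otimes> Y l s)"
        using BC Y' by (intro smat_mult_restrict JK) simp_all
      also have "\<dots> = (\<Oplus>l\<in>{m+1..m+n}. a i l \<otimes> Y l s)"
        using ij s c by (intro finsum_cong') (auto simp: corner_pad[OF a])
      finally show "(?B \<otimes>\<^bsub>SM\<^esub> Y) i s \<otimes> ?C s j = (\<Oplus>l\<in>{m+1..m+n}. a i l \<otimes> Y l s) \<otimes> a s j"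
        using ij s by (simp add: corner_pad[OF a])
    qed (use c in \<open>auto intro!: finsum_closed\<close>)
    also have "\<dots> = (\<Oplus>s\<in>{m+1..m+n}. \<Oplus>l\<in>{m+1..m+n}. a i l \<otimes> Y l s \<otimes> a s j)"
      using c by (intro finsum_cong' finsum_ldistr) (auto intro!: finsum_closed)
    \<comment> \<open>The matrix product has the sum over s outside, \<open>berezinian\<close> the
      sum over l.\<close>
    also have "\<dots> = (\<Oplus>l\<in>{m+1..m+n}. \<Oplus>s\<in>{m+1..m+n}. a i l \<otimes> Y l s \<otimes> a s j)"
      using c by (intro finsum_swap) auto
    finally have 1: "(?B \<otimes>\<^bsub>SM\<^esub> Y \<otimes>\<^bsub>SM\<^esub> ?C) i j = (\<Oplus>l\<in>{m+1..m+n}. \<Oplus>s\<in>{m+1..m+n}. a i l \<otimes> Y l s \<otimes> a s j)" .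
    have "(e \<otimes>\<^bsub>SM\<^esub> pad a \<otimes>\<^bsub>SM\<^esub> e) i j = a i j" using ij by (simp add: corner_pad[OF a])
    then show "schur (pad a) Y i j = a i j \<ominus> (\<Oplus>l\<in>{m+1..m+n}. \<Oplus>s\<in>{m+1..m+n}. a i l \<otimes> Y l s \<otimes> a s j)"
      unfolding schur_def using P BC BY by (simp add: smat_minus 1)
  qed simp
  note 2 = this
  show ?thesis unfolding 2[symmetric] by (rule berezinian_eq[OF a Yi])
qed

lemma inverse_block_exists:
  assumes a: "supermatrix a" and u: "u \<in> part A 0" "u \<otimes> mat_det A {m+1..m+n} a = \<one>"
  obtains Y where "inverse_block (pad a) Y"
proof -
  let ?D = "f \<otimes>\<^bsub>SM\<^esub> pad a \<otimes>\<^bsub>SM\<^esub> f"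
  have D: "?D \<in> carrier SM" "f \<otimes>\<^bsub>SM\<^esub> ?D = ?D" "?D \<otimes>\<^bsub>SM\<^esub> f = ?D"
    using pad_closed[OF a] by (simp_all add: R.m_assoc)
  have "mat_det A {m+1..m+n} ?D = mat_det A {m+1..m+n} a"
    using supermatrix_even(2)[OF a] by (intro mat_det_cong) (auto simp: corner_pad[OF a])
  then have u': "u \<otimes> mat_det A {m+1..m+n} ?D = \<one>" using u by simp
  obtain Y where "Y \<in> carrier SM" "f \<otimes>\<^bsub>SM\<^esub> Y = Y" "Y \<otimes>\<^bsub>SM\<^esub> f = Y" "?D \<otimes>\<^bsub>SM\<^esub> Y = f" "Y \<otimes>\<^bsub>SM\<^esub> ?D = f"
    using block_inverse_exists[OF JK prJ D u(1) u'] by blast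
  then show ?thesis using that unfolding inverse_block_def by blast
qed

lemma pad_mult:
  assumes a: "supermatrix a" and b: "supermatrix b"
  shows "pad (\<lambda>i j. \<Oplus>k\<in>{1..m+n}. a i k \<otimes> b k j) = pad a \<otimes>\<^bsub>SM\<^esub> pad b"
    and "supermatrix (\<lambda>i j. \<Oplus>k\<in>{1..m+n}. a i k \<otimes> b k j)"
proof -
  have PP: "pad a \<otimes>\<^bsub>SM\<^esub> pad b \<in> carrier SM" using pad_closed a b by simp
  have eq: "(\<Oplus>k\<in>{1..m+n}. a i k \<otimes> b k j) = (pad a \<otimes>\<^bsub>SM\<^esub> pad b) i j"
    if "i \<in> {1..m+n}" "j \<in> {1..m+n}" for i j
    using that supermatrix_entry[OF a] supermatrix_entry[OF b]
    unfolding smat_simps by (intro finsum_cong') (auto simp: pad_def)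
  show "pad (\<lambda>i j. \<Oplus>k\<in>{1..m+n}. a i k \<otimes> b k j) = pad a \<otimes>\<^bsub>SM\<^esub> pad b"
  proof (rule smat_eqI)
    fix i j show "pad (\<lambda>i j. \<Oplus>k\<in>{1..m+n}. a i k \<otimes> b k j) i j = (pad a \<otimes>\<^bsub>SM\<^esub> pad b) i j"
      using eq[of i j] smat_outside[OF PP, of i j] unfolding pad_def[of "\<lambda>i j. \<Oplus>k\<in>{1..m+n}. a i k \<otimes> b k j"]
      by (cases "i \<in> {1..m+n} \<and> j \<in> {1..m+n}") auto
  qed
  show "supermatrix (\<lambda>i j. \<Oplus>k\<in>{1..m+n}. a i k \<otimes> b k j)"
    unfolding supermatrix_def gl_parity_index using eq smat_part[OF PP] by simp
qed

lemma berezinian_mult: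
  assumes a: "supermatrix a" and b: "supermatrix b"
    and u: "u \<in> part A 0" "u \<otimes> mat_det A {m+1..m+n} a = \<one>"
    and v: "v \<in> part A 0" "v \<otimes> mat_det A {m+1..m+n} b = \<one>"
  shows "berezinian m n A (\<lambda>i j. \<Oplus>k\<in>{1..m+n}. a i k \<otimes> b k j) = berezinian m n A a \<otimes> berezinian m n A b"
proof -
  obtain Y where Y: "inverse_block (pad a) Y" using inverse_block_exists[OF a u] .
  obtain Z where Z: "inverse_block (pad b) Z" using inverse_block_exists[OF b v] .
  obtain W where W: "inverse_block (pad a \<otimes>\<^bsub>SM\<^esub> pad b) W"
    "mat_det A {m+1..m+n} W \<otimes> mat_det A {1..m} (schur (pad a \<otimes>\<^bsub>SM\<^esub> pad b) W) =
      (mat_det A {m+1..m+n} Y \<otimes> mat_det A {1..m} (schur (pad a) Y)) \<otimes>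
      (mat_det A {m+1..m+n} Z \<otimes> mat_det A {1..m} (schur (pad b) Z))"
    using schur_mult[OF pad_closed[OF a] pad_closed[OF b] Y Z] .
  show ?thesis
    using berezinian_eq_schur[OF pad_mult(2)[OF a b], of W] W
    by (simp add: pad_mult(1)[OF a b] berezinian_eq_schur[OF a Y] berezinian_eq_schur[OF b Z])
qed

lemma berezinian_one: "berezinian m n A (\<lambda>i j. if i = j then \<one> else \<zero>) = \<one>"
proof -
  let ?a = "\<lambda>i j. if i = j then \<one> else \<zero>"
  have a: "supermatrix ?a" by (simp add: supermatrix_def)
  have Y: "is_mat_inv A {m+1..m+n} ?a ?a"
    unfolding is_mat_inv_def
  proof (intro ballI conjI)
    fix i j assume ij: "i \<in> {m+1..m+n}" "j \<in> {m+1..m+n}"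
    show "(\<Oplus>l\<in>{m+1..m+n}. ?a i l \<otimes> ?a l j) = ?a i j" "(\<Oplus>l\<in>{m+1..m+n}. ?a i l \<otimes> ?a l j) = ?a i j"
      using ij by (subst finsum_delta_left[of _ i]; auto)+
  qed simp
  have z: "(\<Oplus>l\<in>{m+1..m+n}. \<Oplus>s\<in>{m+1..m+n}. ?a i l \<otimes> ?a l s \<otimes> ?a s j) = \<zero>"
    if "i \<in> {1..m}" for i j
    using that by (intro finsum_zeroI) auto
  have "berezinian m n A ?a = mat_det A {m+1..m+n} ?a \<otimes> mat_det A {1..m} (\<lambda>i j. ?a i j \<ominus>
     (\<Oplus>l\<in>{m+1..m+n}. \<Oplus>s\<in>{m+1..m+n}. ?a i l \<otimes> ?a l s \<otimes> ?a s j))"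
    by (rule berezinian_eq[OF a Y]) simp
  also have "mat_det A {1..m} (\<lambda>i j. ?a i j \<ominus>
     (\<Oplus>l\<in>{m+1..m+n}. \<Oplus>s\<in>{m+1..m+n}. ?a i l \<otimes> ?a l s \<otimes> ?a s j)) = mat_det A {1..m} ?a"
    using z by (intro mat_det_cong) (auto simp: minus_eq)
  finally show ?thesis by (simp add: mat_det_one)
qed

end

text \<open>A homomorphism need not respect the choice made by \<open>mat_inv\<close>, but it maps
  an inverse to an inverse, and inverses are unique. The unit u ensures that the lower right block
  has an even inverse.\<close>

lemma hom_berezinian:
  assumes "strict_salg A" "strict_salg B" "salg_hom A B h"
    and a: "interval_blocks.supermatrix A m n a"
    and u: "u \<in> part A 0" "u \<otimes>\<^bsub>A\<^esub> mat_det A {m+1..m+n} a = \<one>\<^bsub>A\<^esub>"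
  shows "h (berezinian m n A a) = berezinian m n B (\<lambda>i j. h (a i j))"
proof -
  interpret A: interval_blocks A m n using assms(1) by (rule interval_blocks.intro)
  interpret B: interval_blocks B m n using assms(2) by (rule interval_blocks.intro)
  interpret h: salg_hom A B h by fact
  obtain Y where "A.inverse_block (A.pad a) Y" using A.inverse_block_exists[OF a u] .
  note Y = A.inverse_block_mat_inv[OF a this]
  have hb: "B.supermatrix (\<lambda>i j. h (a i j))"
    using a by (simp add: A.supermatrix_def B.supermatrix_def)
  have ac: "a i j \<in> carrier A" if "i \<in> {1..m+n}" "j \<in> {1..m+n}" for i j
    using A.supermatrix_entry[OF a that] .
  have Yc: "Y i j \<in> carrier A" if "i \<in> {m+1..m+n}" "j \<in> {m+1..m+n}" for i j
    using A.part_closed[OF Y(2)[OF that]] .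
  have Yh: "is_mat_inv B {m+1..m+n} (\<lambda>i j. h (a i j)) (\<lambda>i j. h (Y i j))"
    unfolding is_mat_inv_def
  proof (intro ballI conjI)
    fix i j assume ij: "i \<in> {m+1..m+n}" "j \<in> {m+1..m+n}"
    show "h (Y i j) \<in> carrier B" using Yc[OF ij] by simp
    have "(\<Oplus>\<^bsub>B\<^esub>l\<in>{m+1..m+n}. h (a i l) \<otimes>\<^bsub>B\<^esub> h (Y l j)) = h (\<Oplus>\<^bsub>A\<^esub>l\<in>{m+1..m+n}. a i l \<otimes>\<^bsub>A\<^esub> Y l j)"
      using ac Yc ij by (subst h.hom_finsum) (auto intro!: B.finsum_cong')
    then show "(\<Oplus>\<^bsub>B\<^esub>l\<in>{m+1..m+n}. h (a i l) \<otimes>\<^bsub>B\<^esub> h (Y l j)) = (if i = j then \<one>\<^bsub>B\<^esub> else \<zero>\<^bsub>B\<^esub>)"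
      using Y(1) ij by (simp add: is_mat_inv_def)
    have "(\<Oplus>\<^bsub>B\<^esub>l\<in>{m+1..m+n}. h (Y i l) \<otimes>\<^bsub>B\<^esub> h (a l j)) = h (\<Oplus>\<^bsub>A\<^esub>l\<in>{m+1..m+n}. Y i l \<otimes>\<^bsub>A\<^esub> a l j)"
      using ac Yc ij by (subst h.hom_finsum) (auto intro!: B.finsum_cong')
    then show "(\<Oplus>\<^bsub>B\<^esub>l\<in>{m+1..m+n}. h (Y i l) \<otimes>\<^bsub>B\<^esub> h (a l j)) = (if i = j then \<one>\<^bsub>B\<^esub> else \<zero>\<^bsub>B\<^esub>)"
      using Y(1) ij by (simp add: is_mat_inv_def)
  qed
  have Yh0: "h (Y l s) \<in> part B 0" if "l \<in> {m+1..m+n}" "s \<in> {m+1..m+n}" for l s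
    using Y(2)[OF that] by simp
  let ?S = "\<lambda>i j. \<Oplus>\<^bsub>A\<^esub>l\<in>{m+1..m+n}. \<Oplus>\<^bsub>A\<^esub>s\<in>{m+1..m+n}. a i l \<otimes>\<^bsub>A\<^esub> Y l s \<otimes>\<^bsub>A\<^esub> a s j"
  let ?T = "\<lambda>i j. \<Oplus>\<^bsub>B\<^esub>l\<in>{m+1..m+n}. \<Oplus>\<^bsub>B\<^esub>s\<in>{m+1..m+n}. h (a i l) \<otimes>\<^bsub>B\<^esub> h (Y l s) \<otimes>\<^bsub>B\<^esub> h (a s j)"
  have S: "?S i j \<in> carrier A" if "i \<in> {1..m}" "j \<in> {1..m}" for i j
    using A.part_closed[OF A.schur_entry_even(1)[OF a Y(2) that]] .
  have hS: "h (?S i j) = ?T i j" if ij: "i \<in> {1..m}" "j \<in> {1..m}" for i j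
  proof -
    have c: "a i l \<otimes>\<^bsub>A\<^esub> Y l s \<otimes>\<^bsub>A\<^esub> a s j \<in> carrier A" "a i l \<in> carrier A" "a s j \<in> carrier A" "Y l s \<in> carrier A"
      if "l \<in> {m+1..m+n}" "s \<in> {m+1..m+n}" for l s
      using that ij ac Yc by simp_all
    have "h (?S i j) = (\<Oplus>\<^bsub>B\<^esub>l\<in>{m+1..m+n}. h (\<Oplus>\<^bsub>A\<^esub>s\<in>{m+1..m+n}. a i l \<otimes>\<^bsub>A\<^esub> Y l s \<otimes>\<^bsub>A\<^esub> a s j))"
      using c by (intro h.hom_finsum) (auto intro!: A.finsum_closed)
    also have "\<dots> = ?T i j"
    proof (rule B.finsum_cong')
      fix l assume l: "l \<in> {m+1..m+n}"
      have "h (\<Oplus>\<^bsub>A\<^esub>s\<in>{m+1..m+n}. a i l \<otimes>\<^bsub>A\<^esub> Y l s \<otimes>\<^bsub>A\<^esub> a s j) =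
        (\<Oplus>\<^bsub>B\<^esub>s\<in>{m+1..m+n}. h (a i l \<otimes>\<^bsub>A\<^esub> Y l s \<otimes>\<^bsub>A\<^esub> a s j))"
        using c l by (intro h.hom_finsum) auto
      also have "\<dots> = (\<Oplus>\<^bsub>B\<^esub>s\<in>{m+1..m+n}. h (a i l) \<otimes>\<^bsub>B\<^esub> h (Y l s) \<otimes>\<^bsub>B\<^esub> h (a s j))"
        using c l by (intro B.finsum_cong') auto
      finally show "h (\<Oplus>\<^bsub>A\<^esub>s\<in>{m+1..m+n}. a i l \<otimes>\<^bsub>A\<^esub> Y l s \<otimes>\<^bsub>A\<^esub> a s j) =
        (\<Oplus>\<^bsub>B\<^esub>s\<in>{m+1..m+n}. h (a i l) \<otimes>\<^bsub>B\<^esub> h (Y l s) \<otimes>\<^bsub>B\<^esub> h (a s j))" .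
    qed (use c in \<open>auto intro!: B.finsum_closed\<close>)
    finally show ?thesis .
  qed
  have c0: "mat_det A {m+1..m+n} Y \<in> carrier A" "mat_det A {1..m} (\<lambda>i j. a i j \<ominus>\<^bsub>A\<^esub> ?S i j) \<in> carrier A"
  proof -
    have "mat_det A {m+1..m+n} Y \<in> part A 0" using Y(2) by (intro A.mat_det_even) auto
    moreover have "mat_det A {1..m} (\<lambda>i j. a i j \<ominus>\<^bsub>A\<^esub> ?S i j) \<in> part A 0"
      using A.schur_entry_even(2)[OF a Y(2)] by (intro A.mat_det_even) simp_all
    ultimately show "mat_det A {m+1..m+n} Y \<in> carrier A" "mat_det A {1..m} (\<lambda>i j. a i j \<ominus>\<^bsub>A\<^esub> ?S i j) \<in> carrier A"
      by (auto intro: A.part_closed)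
  qed
  have d1: "h (mat_det A {m+1..m+n} Y) = mat_det B {m+1..m+n} (\<lambda>i j. h (Y i j))"
    using Yc by (intro h.hom_mat_det) auto
  have "h (mat_det A {1..m} (\<lambda>i j. a i j \<ominus>\<^bsub>A\<^esub> ?S i j)) = mat_det B {1..m} (\<lambda>i j. h (a i j \<ominus>\<^bsub>A\<^esub> ?S i j))"
    using S ac by (intro h.hom_mat_det A.minus_closed) auto
  also have "\<dots> = mat_det B {1..m} (\<lambda>i j. h (a i j) \<ominus>\<^bsub>B\<^esub> ?T i j)"
    using S ac hS B.schur_entry_even(2)[OF hb Yh0]
    by (intro B.mat_det_cong) simp_all
  finally have d2: "h (mat_det A {1..m} (\<lambda>i j. a i j \<ominus>\<^bsub>A\<^esub> ?S i j)) = mat_det B {1..m} (\<lambda>i j. h (a i j) \<ominus>\<^bsub>B\<^esub> ?T i j)" .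
  have "berezinian m n A a = mat_det A {m+1..m+n} Y \<otimes>\<^bsub>A\<^esub> mat_det A {1..m} (\<lambda>i j. a i j \<ominus>\<^bsub>A\<^esub> ?S i j)"
    by (rule A.berezinian_eq[OF a Y])
  then have "h (berezinian m n A a) = mat_det B {m+1..m+n} (\<lambda>i j. h (Y i j)) \<otimes>\<^bsub>B\<^esub>
      mat_det B {1..m} (\<lambda>i j. h (a i j) \<ominus>\<^bsub>B\<^esub> ?T i j)"
    using c0 d1 d2 by simp
  also have "\<dots> = berezinian m n B (\<lambda>i j. h (a i j))"
    by (rule B.berezinian_eq[OF hb Yh Yh0, symmetric])
  finally show ?thesis .
qed

section \<open>Determinants modulo odd elements\<close>

context cring
begin

text \<open>As y^2 = 0, at most one factor y survives in the expansion of (y + z)^{j+1}, which is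
  z^{j+1} + y c z^j for some c. For j = k both terms contain z^k.\<close>

lemma nilpotent_add:
  assumes "y \<in> carrier R" "z \<in> carrier R" "y \<otimes> y = \<zero>" "z [^] (k::nat) = \<zero>"
  shows "(y \<oplus> z) [^] Suc k = \<zero>"
proof -
  have "\<exists>c\<in>carrier R. (y \<oplus> z) [^] Suc j = z [^] Suc j \<oplus> y \<otimes> c \<otimes> z [^] j" for j
  proof (induction j)
    case 0
    show ?case using assms(1,2) by (intro bexI[of _ \<one>]) (simp_all add: a_comm)
  next
    case (Suc j)
    then obtain c where c: "c \<in> carrier R" "(y \<oplus> z) [^] Suc j = z [^] Suc j \<oplus> y \<otimes> c \<otimes> z [^] j" by blast
    define w where "w = z [^] j"
    have w: "w \<in> carrier R" using assms by (simp add: w_def)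
    have "y \<otimes> c \<otimes> w \<otimes> y = (y \<otimes> y) \<otimes> (c \<otimes> w)" using w c(1) assms(1,2) by (simp add: m_ac)
    then have z: "y \<otimes> c \<otimes> w \<otimes> y = \<zero>" using w c(1) assms(3) by simp
    have "(y \<oplus> z) [^] Suc (Suc j) = (z [^] Suc j \<oplus> y \<otimes> c \<otimes> z [^] j) \<otimes> (y \<oplus> z)"
      using c(2) by simp
    also have "\<dots> = (w \<otimes> z \<oplus> y \<otimes> c \<otimes> w) \<otimes> (y \<oplus> z)" by (simp add: w_def)
    also have "\<dots> = w \<otimes> z \<otimes> y \<oplus> w \<otimes> z \<otimes> z \<oplus> y \<otimes> c \<otimes> w \<otimes> z"
      using w c(1) assms(1,2) z by (simp add: l_distr r_distr a_assoc)
    also have "\<dots> = w \<otimes> z \<otimes> z \<oplus> y \<otimes> (\<one> \<oplus> c) \<otimes> (w \<otimes> z)"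
      using w c(1) assms(1,2) by (simp add: l_distr r_distr a_ac m_ac)
    finally show ?case using c(1) by (intro bexI[of _ "\<one> \<oplus> c"]) (simp_all add: w_def)
  qed
  then obtain c where "c \<in> carrier R" "(y \<oplus> z) [^] Suc k = z [^] Suc k \<oplus> y \<otimes> c \<otimes> z [^] k" by blast
  then show ?thesis using assms by simp
qed

text \<open>Each further square-zero summand raises the nilpotency exponent by one.\<close>

lemma nilpotent_finsum:
  assumes "finite S" "\<And>s. s \<in> S \<Longrightarrow> y s \<in> carrier R" "\<And>s. s \<in> S \<Longrightarrow> y s \<otimes> y s = \<zero>"
  shows "finsum R y S [^] Suc (card S) = \<zero>"
  using assms
proof (induction S)
  case (insert s S)
  have "finsum R y (insert s S) = y s \<oplus> finsum R y S"
    using insert by (intro finsum_insert) auto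
  moreover have "finsum R y S \<in> carrier R" using insert by (intro finsum_closed) auto
  ultimately show ?case using insert nilpotent_add[of "y s" "finsum R y S" "Suc (card S)"] by simp
qed simp

lemma nilpotent_mono:
  assumes "x \<in> carrier R" "x [^] (k::nat) = \<zero>" "k \<le> l"
  shows "x [^] l = \<zero>"
proof -
  have "x [^] l = x [^] k \<otimes> x [^] (l - k)" by (subst nat_pow_mult) (use assms in auto)
  then show ?thesis using assms(1) by (simp add: assms(2))
qed

text \<open>The determinant commutes with the quotient map modulo J, under which the two matrices
  have the same entries.\<close>

lemma det_congruent:
  assumes J: "ideal J R" and I: "finite I"
    and M: "\<And>i j. i \<in> I \<Longrightarrow> j \<in> I \<Longrightarrow> M i j \<in> carrier R"
    and N: "\<And>i j. i \<in> I \<Longrightarrow> j \<in> I \<Longrightarrow> N i j \<in> carrier R"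
    and "\<And>i j. i \<in> I \<Longrightarrow> j \<in> I \<Longrightarrow> M i j \<ominus> N i j \<in> J"
  shows "det R I M \<ominus> det R I N \<in> J"
proof -
  interpret d: finite_det R I by unfold_locales (rule I)
  interpret J: ideal J R by fact
  interpret q: ring_hom_cring R "R Quot J" "(+>) J" by (rule J.rcos_ring_hom_cring) (rule is_cring)
  interpret qd: finite_det "R Quot J" I by unfold_locales (rule I)
  have "J +> det R I M = det (R Quot J) I (\<lambda>i j. J +> M i j)" by (rule q.hom_det[OF I M])
  also have "\<dots> = det (R Quot J) I (\<lambda>i j. J +> N i j)"
    using assms q.hom_closed quotient_eq_iff_same_a_r_cos[OF J] by (intro qd.det_cong) auto
  also have "\<dots> = J +> det R I N" by (rule q.hom_det[OF I N, symmetric])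
  finally show ?thesis
    using quotient_eq_iff_same_a_r_cos[OF J d.det_closed d.det_closed, of M N] M N by blast
qed

end

section \<open>Nilpotency from finitely many odd elements\<close>

context strict_salg
begin

lemma even_pow: "x [^]\<^bsub>E\<^esub> (k::nat) = x [^] k"
  by (induction k) simp_all

lemma even_minus: "x \<in> part A 0 \<Longrightarrow> y \<in> part A 0 \<Longrightarrow> x \<ominus>\<^bsub>E\<^esub> y = x \<ominus> y"
  by (simp add: E.minus_eq minus_eq even_uminus)

text \<open>When the elements \<eta> s are odd and S is finite, this is the even part of the ideal
  they generate. It is an ideal of the even ring, as \<open>det_congruent\<close> requires.\<close>

definition odd_span :: "'s set \<Rightarrow> ('s \<Rightarrow> 'a) \<Rightarrow> 'a set" where
  "odd_span S \<eta> = {x. \<exists>t. (\<forall>s\<in>S. t s \<in> part A 1) \<and> x = (\<Oplus>s\<in>S. t s \<otimes> \<eta> s)}"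

context
  fixes S :: "'s set" and \<eta> :: "'s \<Rightarrow> 'a"
  assumes fin_S: "finite S" and \<eta>: "\<And>s. s \<in> S \<Longrightarrow> \<eta> s \<in> part A 1"
begin

lemma odd_mult_even: "s \<in> S \<Longrightarrow> t \<in> part A 1 \<Longrightarrow> t \<otimes> \<eta> s \<in> part A 0"
  using part_mult[OF _ \<eta>, of t 1 s] by simp

lemma odd_span_even: "odd_span S \<eta> \<subseteq> part A 0"
  using odd_mult_even fin_S by (auto simp: odd_span_def intro!: part_finsum)

lemma odd_span_generator: "s \<in> S \<Longrightarrow> t \<in> part A 1 \<Longrightarrow> t \<otimes> \<eta> s \<in> odd_span S \<eta>"
  unfolding odd_span_def
proof (intro CollectI exI conjI)
  assume s: "s \<in> S" and t: "t \<in> part A 1"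
  let ?t = "\<lambda>r. if s = r then t else \<zero>"
  show "\<forall>r\<in>S. ?t r \<in> part A 1" using t by simp
  have c: "t \<in> carrier A" "\<And>r. r \<in> S \<Longrightarrow> \<eta> r \<in> carrier A" using t \<eta> by (auto intro: part_closed)
  have "(\<Oplus>r\<in>S. ?t r \<otimes> \<eta> r) = (\<Oplus>r\<in>S. if s = r then t \<otimes> \<eta> r else \<zero>)"
    using c by (intro finsum_cong') auto
  also have "\<dots> = t \<otimes> \<eta> s" using s c fin_S by (intro add.finprod_singleton) auto
  finally show "t \<otimes> \<eta> s = (\<Oplus>r\<in>S. ?t r \<otimes> \<eta> r)" ..
qed

lemma ideal_odd_span: "ideal (odd_span S \<eta>) E"
proof (rule idealI)
  show "ring E" by (rule E.ring_axioms)
  have c: "\<And>t s. (\<forall>s\<in>S. t s \<in> part A 1) \<Longrightarrow> s \<in> S \<Longrightarrow> t s \<in> carrier A"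
    "\<And>s. s \<in> S \<Longrightarrow> \<eta> s \<in> carrier A" using \<eta> by (auto intro: part_closed)
  show "subgroup (odd_span S \<eta>) (add_monoid E)"
  proof (rule E.add.subgroupI)
    show "odd_span S \<eta> \<subseteq> carrier E" using odd_span_even by simp
    have "\<zero> \<in> odd_span S \<eta>" unfolding odd_span_def
      using c(2) by (intro CollectI exI[of _ "\<lambda>_. \<zero>"]) (simp cong: finsum_cong)
    then show "odd_span S \<eta> \<noteq> {}" by blast
  next
    fix x assume "x \<in> odd_span S \<eta>"
    then obtain t where t: "\<forall>s\<in>S. t s \<in> part A 1" "x = (\<Oplus>s\<in>S. t s \<otimes> \<eta> s)" by (auto simp: odd_span_def)
    have x: "x \<in> part A 0" using \<open>x \<in> odd_span S \<eta>\<close> odd_span_even by blast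
    have "\<ominus> x = (- 1) \<odot> x" using part_closed[OF x] by (simp add: uminus_smult)
    also have "\<dots> = (\<Oplus>s\<in>S. (- 1) \<odot> (t s \<otimes> \<eta> s))"
      unfolding t(2) using c(1)[OF t(1)] c(2) by (intro finsum_smult fin_S) auto
    also have "\<dots> = (\<Oplus>s\<in>S. ((- 1) \<odot> t s) \<otimes> \<eta> s)"
      using c(1)[OF t(1)] c(2) by (intro finsum_cong') auto
    finally have "\<ominus> x \<in> odd_span S \<eta>"
      unfolding odd_span_def using t(1) by (intro CollectI exI[of _ "\<lambda>s. (- 1) \<odot> t s"]) (simp add: part_smult)
    then show "\<ominus>\<^bsub>E\<^esub> x \<in> odd_span S \<eta>" by (simp only: even_uminus[OF x])
  next
    fix x y assume "x \<in> odd_span S \<eta>" "y \<in> odd_span S \<eta>"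
    then obtain t u where t: "\<forall>s\<in>S. t s \<in> part A 1" "x = (\<Oplus>s\<in>S. t s \<otimes> \<eta> s)"
      and u: "\<forall>s\<in>S. u s \<in> part A 1" "y = (\<Oplus>s\<in>S. u s \<otimes> \<eta> s)" by (auto simp: odd_span_def)
    have "x \<oplus> y = (\<Oplus>s\<in>S. t s \<otimes> \<eta> s \<oplus> u s \<otimes> \<eta> s)"
      unfolding t u using c(1)[OF t(1)] c(1)[OF u(1)] c(2) by (intro finsum_addf[symmetric]) auto
    also have "\<dots> = (\<Oplus>s\<in>S. (t s \<oplus> u s) \<otimes> \<eta> s)"
      using c(1)[OF t(1)] c(1)[OF u(1)] c(2) by (intro finsum_cong') (auto simp: l_distr)
    finally have "x \<oplus> y \<in> odd_span S \<eta>"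
      unfolding odd_span_def using t(1) u(1)
      by (intro CollectI exI[of _ "\<lambda>s. t s \<oplus> u s"]) (simp add: part_add)
    then show "x \<oplus>\<^bsub>E\<^esub> y \<in> odd_span S \<eta>" by simp
  qed
  fix x a assume "x \<in> odd_span S \<eta>" and "a \<in> carrier E"
  then obtain t where t: "\<forall>s\<in>S. t s \<in> part A 1" "x = (\<Oplus>s\<in>S. t s \<otimes> \<eta> s)" and a: "a \<in> part A 0"
    by (auto simp: odd_span_def)
  have "a \<otimes> x = (\<Oplus>s\<in>S. a \<otimes> (t s \<otimes> \<eta> s))"
    unfolding t(2) using c(1)[OF t(1)] c(2) part_closed[OF a] by (intro finsum_rdistr fin_S) auto
  also have "\<dots> = (\<Oplus>s\<in>S. (a \<otimes> t s) \<otimes> \<eta> s)"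
    using c(1)[OF t(1)] c(2) part_closed[OF a] by (intro finsum_cong') (auto simp: m_assoc)
  finally have ax: "a \<otimes> x \<in> odd_span S \<eta>"
    unfolding odd_span_def using t(1) part_mult[OF a, of _ 1]
    by (intro CollectI exI[of _ "\<lambda>s. a \<otimes> t s"]) simp
  then show "a \<otimes>\<^bsub>E\<^esub> x \<in> odd_span S \<eta>" by simp
  have "x \<in> part A 0" using \<open>x \<in> odd_span S \<eta>\<close> odd_span_even by blast
  then show "x \<otimes>\<^bsub>E\<^esub> a \<in> odd_span S \<eta>" using ax E.m_comm[of x a] a by simp
qed

text \<open>Every summand t \<eta> is even and squares to -t^2 \<eta>^2 = 0, so a sum of card S of
  them vanishes in every power beyond card S.\<close>

lemma odd_span_nilpotent:
  assumes "x \<in> odd_span S \<eta>" "card S < k"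
  shows "x [^] k = \<zero>"
proof -
  obtain t where t: "\<forall>s\<in>S. t s \<in> part A 1" "x = (\<Oplus>s\<in>S. t s \<otimes> \<eta> s)"
    using assms(1) by (auto simp: odd_span_def)
  have e: "t s \<otimes> \<eta> s \<in> part A 0" if "s \<in> S" for s using odd_mult_even t(1) that by blast
  have x: "x = finsum E (\<lambda>s. t s \<otimes> \<eta> s) S"
    unfolding t(2) using e fin_S by (subst even_finsum) auto
  have sq: "t s \<otimes> \<eta> s \<otimes> (t s \<otimes> \<eta> s) = \<zero>" if s: "s \<in> S" for s
  proof -
    have p: "t s \<in> part A 1" "\<eta> s \<in> part A 1" using t \<eta> s by auto
    then have c: "t s \<in> carrier A" "\<eta> s \<in> carrier A" by (auto intro: part_closed)
    have "t s \<otimes> \<eta> s \<otimes> (t s \<otimes> \<eta> s) = t s \<otimes> (\<eta> s \<otimes> t s) \<otimes> \<eta> s" using c by (simp add: m_assoc)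
    also have "\<eta> s \<otimes> t s = koszul_sign 1 1 \<odot> (t s \<otimes> \<eta> s)" by (rule supercomm[OF p(2,1)])
    also have "t s \<otimes> (koszul_sign 1 1 \<odot> (t s \<otimes> \<eta> s)) \<otimes> \<eta> s =
        koszul_sign 1 1 \<odot> ((t s \<otimes> t s) \<otimes> (\<eta> s \<otimes> \<eta> s))" using c by (simp add: m_assoc)
    also have "\<dots> = \<zero>" using odd_square[OF p(1)] c by simp
    finally show ?thesis .
  qed
  have nil: "x [^]\<^bsub>E\<^esub> Suc (card S) = \<zero>\<^bsub>E\<^esub>"
    unfolding x using e sq by (intro E.nilpotent_finsum fin_S) simp_all
  have "x \<in> carrier E" using assms(1) odd_span_even by auto
  then have "x [^]\<^bsub>E\<^esub> k = \<zero>\<^bsub>E\<^esub>"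
    using nil by (rule E.nilpotent_mono) (use assms(2) in simp)
  then show ?thesis by (simp add: even_pow)
qed

end

lemma det_diff_nilpotent:
  assumes "finite S" "\<And>s. s \<in> S \<Longrightarrow> \<eta> s \<in> part A 1" "finite I"
    and M: "\<And>i j. i \<in> I \<Longrightarrow> j \<in> I \<Longrightarrow> M i j \<in> part A 0"
    and N: "\<And>i j. i \<in> I \<Longrightarrow> j \<in> I \<Longrightarrow> N i j \<in> part A 0"
    and MN: "\<And>i j. i \<in> I \<Longrightarrow> j \<in> I \<Longrightarrow> M i j \<ominus> N i j \<in> odd_span S \<eta>"
    and "card S < k"
  shows "(mat_det A I M \<ominus> mat_det A I N) [^] k = \<zero>"
proof -
  have "det E I M \<ominus>\<^bsub>E\<^esub> det E I N \<in> odd_span S \<eta>"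
    using M N MN assms(1,2) by (intro E.det_congruent ideal_odd_span assms(3)) (simp_all add: even_minus)
  moreover have "det E I M = mat_det A I M" "det E I N = mat_det A I N"
    using M N assms(3) by (simp_all add: mat_det_eq_det)
  moreover have "mat_det A I M \<in> part A 0" "mat_det A I N \<in> part A 0"
    using M N assms(3) by (auto intro!: mat_det_even)
  ultimately have "mat_det A I M \<ominus> mat_det A I N \<in> odd_span S \<eta>" by (simp add: even_minus)
  then show ?thesis using assms by (intro odd_span_nilpotent[of S \<eta>])
qed

text \<open>With z^N = 0 this is the finite geometric series for 1/(w + z) = u/(1 + uz). The partial
  sums telescope: w + z times the first k terms is 1 - (-1)^k u^k z^k.\<close>

lemma geometric_inverse:
  assumes u: "u \<in> part A 0" and w: "w \<in> part A 0" and z: "z \<in> part A 0"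
    and uw: "u \<otimes> w = \<one>" and nil: "z [^] N = \<zero>"
  shows "(\<Oplus>i\<in>{1..N}. (- 1) ^ (i - 1) \<odot> (u [^] i \<otimes> z [^] (i - 1))) \<in> part A 0"
    and "(w \<oplus> z) \<otimes> (\<Oplus>i\<in>{1..N}. (- 1) ^ (i - 1) \<odot> (u [^] i \<otimes> z [^] (i - 1))) = \<one>"
proof -
  let ?t = "\<lambda>i. (- 1) ^ (i - 1) \<odot> (u [^] i \<otimes> z [^] (i - 1))"
  have t: "?t i \<in> part A 0" for i
    using part_mult[OF part_pow[OF u] part_pow[OF z]] by (simp add: part_smult)
  show s: "(\<Oplus>i\<in>{1..N}. ?t i) \<in> part A 0" using t by (intro part_finsum) auto
  have c: "u \<in> carrier A" "w \<in> carrier A" "z \<in> carrier A" using u w z by (auto intro: part_closed)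
  have comm: "x \<otimes> y = y \<otimes> x" if "x \<in> part A 0" "y \<in> part A 0" for x y
    using E.m_comm[of x y] that by simp
  have tc: "?t i \<in> carrier A" for i using t[of i] by (rule part_closed)
  have "(w \<oplus> z) \<otimes> (\<Oplus>i\<in>{1..k}. ?t i) = \<one> \<ominus> (- 1) ^ k \<odot> (u [^] k \<otimes> z [^] k)" for k
  proof (induction k)
    case 0
    then show ?case using c by (simp add: minus_eq r_neg)
  next
    case (Suc k)
    have set: "{1..Suc k} = insert (Suc k) {1..k}" by auto
    have fs: "(\<Oplus>i\<in>{1..k}. ?t i) \<in> carrier A" using tc by (intro finsum_closed) auto
    define a b where "a = u [^] k" and "b = z [^] k"
    have ab: "a \<in> part A 0" "b \<in> part A 0" using u z by (simp_all add: a_def b_def part_pow)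
    then have abc: "a \<in> carrier A" "b \<in> carrier A" by (auto intro: part_closed)
    have "w \<otimes> (a \<otimes> u) = a \<otimes> (u \<otimes> w)"
      using comm[OF w, of "a \<otimes> u"] part_mult[OF ab(1) u] c abc by (simp add: m_assoc)
    then have wau: "w \<otimes> (a \<otimes> u) = a" using abc uw by simp
    have zau: "z \<otimes> (a \<otimes> u \<otimes> b) = a \<otimes> u \<otimes> (b \<otimes> z)"
      using comm[OF z, of "a \<otimes> u \<otimes> b"] part_mult[OF part_mult[OF ab(1) u] ab(2)] c abc by (simp add: m_assoc)
    have "(w \<oplus> z) \<otimes> (a \<otimes> u \<otimes> b) = a \<otimes> b \<oplus> a \<otimes> u \<otimes> (b \<otimes> z)"
      using c abc wau zau by (simp add: l_distr m_assoc[symmetric])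
    then have st: "(w \<oplus> z) \<otimes> ?t (Suc k) = (- 1) ^ k \<odot> (a \<otimes> b) \<oplus> (- 1) ^ k \<odot> (a \<otimes> u \<otimes> (b \<otimes> z))"
      using c abc by (simp add: a_def[symmetric] b_def[symmetric] smult_add_right)
    have ins: "(\<Oplus>i\<in>{1..Suc k}. ?t i) = ?t (Suc k) \<oplus> (\<Oplus>i\<in>{1..k}. ?t i)"
      unfolding set
    proof (rule finsum_insert)
      show "?t (Suc k) \<in> carrier A" by (rule tc)
      show "?t \<in> {1..k} \<rightarrow> carrier A" using tc by blast
    qed auto
    have "(w \<oplus> z) \<otimes> (\<Oplus>i\<in>{1..Suc k}. ?t i) = (w \<oplus> z) \<otimes> ?t (Suc k) \<oplus> (w \<oplus> z) \<otimes> (\<Oplus>i\<in>{1..k}. ?t i)"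
      unfolding ins by (rule r_distr[OF tc[of "Suc k"] fs a_closed[OF c(2,3)]])
    also have "\<dots> = ((- 1) ^ k \<odot> (a \<otimes> b) \<oplus> (- 1) ^ k \<odot> (a \<otimes> u \<otimes> (b \<otimes> z))) \<oplus>
       (\<one> \<ominus> (- 1) ^ k \<odot> (a \<otimes> b))" unfolding st Suc.IH a_def b_def ..
    also have "\<dots> = \<one> \<oplus> (- 1) ^ k \<odot> (a \<otimes> u \<otimes> (b \<otimes> z))"
    proof -
      define x y where "x = (- 1) ^ k \<odot> (a \<otimes> b)" and "y = (- 1) ^ k \<odot> (a \<otimes> u \<otimes> (b \<otimes> z))"
      have xy: "x \<in> carrier A" "y \<in> carrier A" using c abc by (simp_all add: x_def y_def)
      then have "(x \<oplus> y) \<oplus> (\<one> \<ominus> x) = (x \<oplus> \<ominus> x) \<oplus> (\<one> \<oplus> y)" by (simp add: minus_eq a_ac)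
      then show ?thesis unfolding x_def[symmetric] y_def[symmetric] using xy by (simp add: r_neg)
    qed
    also have "\<dots> = \<one> \<ominus> (- 1) ^ Suc k \<odot> (u [^] Suc k \<otimes> z [^] Suc k)"
      using c abc by (simp add: a_def[symmetric] b_def[symmetric] minus_eq uminus_smult)
    finally show ?case .
  qed
  from this[of N] show "(w \<oplus> z) \<otimes> (\<Oplus>i\<in>{1..N}. ?t i) = \<one>"
    using c nil by (simp add: minus_eq)
qed

end

section \<open>The coordinate superalgebras\<close>

context salg
begin

lemma mat_det_part:
  assumes "finite I" "\<And>i j. i \<in> I \<Longrightarrow> j \<in> I \<Longrightarrow> M i j \<in> part A 0"
  shows "mat_det A I M \<in> part A 0"
  unfolding mat_det_def
proof (rule part_finsum)
  show "finite {\<sigma>. \<sigma> permutes I}" using assms(1) by (rule finite_permutations)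
  fix \<sigma> assume "\<sigma> \<in> {\<sigma>. \<sigma> permutes I}"
  then have \<sigma>: "\<sigma> permutes I" by simp
  have "foldr (\<lambda>i y. M i (\<sigma> i) \<otimes> y) xs \<one> \<in> part A 0" if "set xs \<subseteq> I" for xs
    using that
  proof (induction xs)
    case (Cons x xs)
    then have "M x (\<sigma> x) \<in> part A 0" using assms(2) \<sigma> by (simp add: permutes_in_image)
    with Cons show ?case using part_mult[of "M x (\<sigma> x)" 0 _ 0] by simp
  qed simp
  then show "of_int (sign \<sigma>) \<odot> foldr (\<lambda>i y. M i (\<sigma> i) \<otimes> y) (sorted_list_of_set I) \<one> \<in> part A 0"
    using assms(1) by (intro part_smult) simp
qed

text \<open>The sign rule extends from generators to words by moving one letter at a time, and then
  bilinearly to all elements. For an odd word xw, the square is up to sign x^2 w^2, and either x or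
  the shorter word w is odd. Squares of sums reduce to squares of words because the cross terms
  cancel.\<close>

lemma strict_salgI:
  assumes g: "\<And>x. x \<in> X \<Longrightarrow> g x \<in> part A (par x)"
    and comm: "\<And>x y. x \<in> X \<Longrightarrow> y \<in> X \<Longrightarrow> g x \<otimes> g y = koszul_sign (par x) (par y) \<odot> (g y \<otimes> g x)"
    and sq: "\<And>x. x \<in> X \<Longrightarrow> par x = 1 \<Longrightarrow> g x \<otimes> g x = \<zero>"
    and gen: "\<And>p y. y \<in> part A p \<Longrightarrow> \<exists>f\<in>part (free_superalg X par) p. y = free_eval A g f"
  shows "strict_salg A"
proof -
  define w where "w xs = word_prod A g (Word xs)" for xs
  define P where "P xs = sum_list (map par xs)" for xs
  have w: "w [] = \<one>" "w (x # xs) = g x \<otimes> w xs" for x xs by (simp_all add: w_def word_prod_def)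
  have P: "P [] = 0" "P (x # xs) = par x + P xs" for x xs by (simp_all add: P_def)
  have wP: "w xs \<in> part A (P xs)" if "set xs \<subseteq> X" for xs
    using word_prod_part[of X g par "Word xs", OF g] that by (simp add: w_def P_def word_parity_def)
  have wc: "w xs \<in> carrier A" if "set xs \<subseteq> X" for xs using wP[OF that] by (rule part_closed)
  have gc: "g x \<in> carrier A" if "x \<in> X" for x using g[OF that] by (rule part_closed)
  have gw: "g x \<otimes> w xs = koszul_sign (par x) (P xs) \<odot> (w xs \<otimes> g x)" if "x \<in> X" "set xs \<subseteq> X" for x xs
    using that(2)
  proof (induction xs)
    case (Cons y ys)
    then have c: "g x \<in> carrier A" "g y \<in> carrier A" "w ys \<in> carrier A" using that gc wc by auto
    have "g x \<otimes> (g y \<otimes> w ys) = (g x \<otimes> g y) \<otimes> w ys" using c by (simp add: m_assoc)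
    also have "\<dots> = koszul_sign (par x) (par y) \<odot> (g y \<otimes> (g x \<otimes> w ys))"
      using comm[OF that(1), of y] Cons.prems c by (simp add: m_assoc)
    also have "\<dots> = koszul_sign (par x) (P (y # ys)) \<odot> (g y \<otimes> w ys \<otimes> g x)"
      using Cons c by (simp add: P koszul_sign_add_right m_assoc)
    finally show ?case by (simp add: w)
  qed (use gc that in \<open>simp add: w P\<close>)
  have ww: "w xs \<otimes> w ys = koszul_sign (P xs) (P ys) \<odot> (w ys \<otimes> w xs)"
    if "set xs \<subseteq> X" "set ys \<subseteq> X" for xs ys
    using that(1)
  proof (induction xs)
    case (Cons x xs)
    then have c: "g x \<in> carrier A" "w xs \<in> carrier A" "w ys \<in> carrier A" using that gc wc by auto
    have "g x \<otimes> w xs \<otimes> w ys = koszul_sign (P xs) (P ys) \<odot> ((g x \<otimes> w ys) \<otimes> w xs)"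
      using Cons c by (simp add: m_assoc)
    also have "\<dots> = koszul_sign (P (x # xs)) (P ys) \<odot> (w ys \<otimes> (g x \<otimes> w xs))"
      using gw[of x ys] Cons.prems that c by (simp add: P koszul_sign_add_left m_assoc mult.commute)
    finally show ?case by (simp add: w)
  qed (use wc that in \<open>simp add: w P\<close>)
  have wsq: "w xs \<otimes> w xs = \<zero>" if "set xs \<subseteq> X" "P xs = 1" for xs
    using that
  proof (induction xs)
    case (Cons x xs)
    then have c: "g x \<in> carrier A" "w xs \<in> carrier A" "x \<in> X" using gc wc by auto
    have "g x \<otimes> w xs \<otimes> (g x \<otimes> w xs) = g x \<otimes> (w xs \<otimes> g x) \<otimes> w xs" using c by (simp add: m_assoc)
    also have "w xs \<otimes> g x = koszul_sign (P xs) (par x) \<odot> (g x \<otimes> w xs)"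
    proof -
      have "w xs \<otimes> w [x] = koszul_sign (P xs) (P [x]) \<odot> (w [x] \<otimes> w xs)"
        using Cons.prems by (intro ww) auto
      then show ?thesis using c by (simp add: w P)
    qed
    also have "g x \<otimes> (koszul_sign (P xs) (par x) \<odot> (g x \<otimes> w xs)) \<otimes> w xs =
        koszul_sign (P xs) (par x) \<odot> ((g x \<otimes> g x) \<otimes> (w xs \<otimes> w xs))" using c by (simp add: m_assoc)
    also have "\<dots> = \<zero>"
    proof (cases "par x = 1")
      case True
      then show ?thesis using sq[of x] c by simp
    next
      case False
      then have "P xs = 1" using Cons.prems by (simp add: P)
      then show ?thesis using Cons c by simp
    qed
    finally show ?case by (simp add: w)
  qed (simp add: P)
  have word: "word_prod A g u = w (letters u)" for u by (simp add: w_def)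
  have wf: "word_prod A g \<in> {w. set (letters w) \<subseteq> X \<and> word_parity par w = p} \<rightarrow> carrier A" for p
    using wc by (simp add: word)
  have ev: "free_eval A g f \<in> part A p" if "f \<in> part (free_superalg X par) p" for f p
    using free_eval_hom[of X g par, OF g] that unfolding superalg_hom_def by blast
  have evc: "free_eval A g f \<otimes> free_eval A g h = koszul_sign p q \<odot> (free_eval A g h \<otimes> free_eval A g f)"
    if f: "f \<in> part (free_superalg X par) p" and h: "h \<in> part (free_superalg X par) q" for f h p q
  proof -
    let ?D = "\<lambda>p. {w. set (letters w) \<subseteq> X \<and> word_parity par w = p}"
    have f': "Poly_Mapping.keys f \<subseteq> ?D p" and h': "Poly_Mapping.keys h \<subseteq> ?D q" using f h by auto
    note l = lin_closed[OF wf]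
    have eh: "free_eval A g h \<in> carrier A" using ev[OF h] by (rule part_closed)
    from f' show ?thesis unfolding free_eval_def
    proof (induction f rule: poly_mapping_keys_induct)
      case zero
      then show ?case using eh by (simp add: free_eval_def)
    next
      case (single u a)
      then have u: "w (letters u) \<in> carrier A" "set (letters u) \<subseteq> X" "P (letters u) = p"
        using wc by (auto simp: P_def word_parity_def)
      from h' show ?case
      proof (induction h rule: poly_mapping_keys_induct)
        case zero
        then show ?case using u by (simp add: word)
      next
        case (single v b)
        then have v: "w (letters v) \<in> carrier A" "set (letters v) \<subseteq> X" "P (letters v) = q"
          using wc by (auto simp: P_def word_parity_def)
        then show ?case using u ww[OF u(2) v(2)] by (simp add: word mult_ac)
      next
        case (add h1 h2)
        have "lin A (word_prod A g) (Poly_Mapping.single u a) \<in> carrier A"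
          using u by (simp add: word)
        then show ?case using add l[OF add(1)] l[OF add(2)]
          by (simp add: lin_add[OF wf] l_distr r_distr smult_add_right del: lin_single)
      qed
    next
      case (add f1 f2)
      then show ?case using eh l[OF add(1)] l[OF add(2)]
        by (simp add: lin_add[OF wf] l_distr r_distr smult_add_right free_eval_def)
    qed
  qed
  have evs: "free_eval A g f \<otimes> free_eval A g f = \<zero>" if f: "f \<in> part (free_superalg X par) 1" for f
  proof -
    have "Poly_Mapping.keys f \<subseteq> {w. set (letters w) \<subseteq> X \<and> word_parity par w = 1}" using f by simp
    then show ?thesis
    proof (induction f rule: poly_mapping_keys_induct)
      case zero
      then show ?case by (simp add: free_eval_def)
    next
      case (single u a)
      then have u: "w (letters u) \<in> carrier A" "set (letters u) \<subseteq> X" "P (letters u) = 1"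
        using wc by (auto simp: P_def word_parity_def)
      then show ?case using wsq[OF u(2,3)] by (simp add: free_eval_def word)
    next
      case (add f1 f2)
      have p: "f1 \<in> part (free_superalg X par) 1" "f2 \<in> part (free_superalg X par) 1"
        using add(1,2) by simp_all
      have c: "free_eval A g f1 \<in> carrier A" "free_eval A g f2 \<in> carrier A"
        using ev[OF p(1)] ev[OF p(2)] by (auto intro: part_closed)
      have sum: "free_eval A g (f1 + f2) = free_eval A g f1 \<oplus> free_eval A g f2"
        unfolding free_eval_def by (rule lin_add[OF wf add(1,2)])
      have "free_eval A g f1 \<otimes> free_eval A g f2 = \<ominus> (free_eval A g f2 \<otimes> free_eval A g f1)"
        using evc[OF p] c by (simp add: koszul_sign_def uminus_smult)
      then show ?case unfolding sum using add c by (simp add: l_distr r_distr r_neg)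
    qed
  qed
  show ?thesis
  proof (intro strict_salg.intro strict_salg_axioms.intro salg_axioms)
    show "x \<otimes> y = koszul_sign p q \<odot> (y \<otimes> x)" if "x \<in> part A p" "y \<in> part A q" for x y p q
      using gen[OF that(1)] gen[OF that(2)] evc by blast
    show "x \<otimes> x = \<zero>" if "x \<in> part A 1" for x
      using gen[OF that] evs by blast
  qed
qed

end

section \<open>The presentation of k[GL(m|n)] and its universal property\<close>

lemma free_minus:
  fixes x y :: "'x word \<Rightarrow>\<^sub>0 'k::field"
  assumes "x \<in> carrier (free_superalg X par)" "y \<in> carrier (free_superalg X par)"
  shows "x \<ominus>\<^bsub>free_superalg X par\<^esub> y = x - y"
proof -
  have c: "- y \<in> carrier (free_superalg X par)" using assms by simp
  have "\<ominus>\<^bsub>free_superalg X par\<^esub> y = - y"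
    using assms c by (intro free.minus_equality) simp_all
  then show ?thesis by (simp add: a_minus_def)
qed

lemma gl_free_eq: "gl_free m n = free_superalg (gl_gens m n) (gl_parity m)"
  by (simp add: gl_free_def)

global_interpretation gl_free: salg "gl_free m n"
  unfolding gl_free_eq by (rule free.salg_axioms)

lemma letter_gl_part: "x \<in> gl_gens m n \<Longrightarrow> letter x \<in> part (gl_free m n) (gl_parity m x)"
  unfolding gl_free_eq by (rule letter_part)

lemma letter_gl_carrier: "x \<in> gl_gens m n \<Longrightarrow> letter x \<in> carrier (gl_free m n)"
  by (rule gl_free.part_closed[OF letter_gl_part])

lemma gl_free_simps:
  "mult (gl_free m n) = (*)" "one (gl_free m n) = 1" "smult (gl_free m n) = fscale"
  by (simp_all add: gl_free_eq)

lemma gl_free_minus: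
  "x \<in> carrier (gl_free m n) \<Longrightarrow> y \<in> carrier (gl_free m n) \<Longrightarrow> x \<ominus>\<^bsub>gl_free m n\<^esub> y = x - y"
  unfolding gl_free_eq by (rule free_minus)

lemma Var_gl_gens [simp]: "Var i j \<in> gl_gens m n \<longleftrightarrow> i \<in> {1..m+n} \<and> j \<in> {1..m+n}"
  and DInv_gl_gens [simp]: "DInv1 \<in> gl_gens m n" "DInv2 \<in> gl_gens m n"
  by (auto simp: gl_gens_def)

lemma gl_det_part:
  fixes m n :: nat
  shows "mat_det (gl_free m n :: ('k::field, _) superalg) {1..m} (\<lambda>i j. letter (Var i j)) \<in> part (gl_free m n) 0"
    and "mat_det (gl_free m n :: ('k::field, _) superalg) {m+1..m+n} (\<lambda>i j. letter (Var i j)) \<in> part (gl_free m n) 0"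
proof -
  show "mat_det (gl_free m n :: ('k::field, _) superalg) {1..m} (\<lambda>i j. letter (Var i j)) \<in> part (gl_free m n) 0"
  proof (rule gl_free.mat_det_part)
    fix i j assume "i \<in> {1..m}" "j \<in> {1..m}"
    then show "letter (Var i j) \<in> part (gl_free m n :: ('k, _) superalg) 0"
      using letter_gl_part[of "Var i j" m n] by simp
  qed simp
  show "mat_det (gl_free m n :: ('k::field, _) superalg) {m+1..m+n} (\<lambda>i j. letter (Var i j)) \<in> part (gl_free m n) 0"
  proof (rule gl_free.mat_det_part)
    fix i j assume "i \<in> {m+1..m+n}" "j \<in> {m+1..m+n}"
    then show "letter (Var i j) \<in> part (gl_free m n :: ('k, _) superalg) 0"
      using letter_gl_part[of "Var i j" m n] by simp
  qed simp
qed

text \<open>Homogeneity of the relators is what gives the quotient a grading; the determinants in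
  the last two are even because their entries are.\<close>

lemma gl_relators_homogeneous:
  assumes "r \<in> (gl_relators m n :: (gl_gen word \<Rightarrow>\<^sub>0 'k::field) set)"
  shows "\<exists>p. r \<in> part (gl_free m n) p"
proof -
  note mult = gl_free.part_mult[of _ m n, unfolded gl_free_simps]
  note minus = gl_free.part_minus[of _ m n]
  have one: "1 \<in> part (gl_free m n :: ('k, _) superalg) 0"
    using gl_free.part_one[of m n] by (simp add: gl_free_simps)
  have pm: "x - y \<in> part (gl_free m n) p" if "x \<in> part (gl_free m n) p" "y \<in> part (gl_free m n) p" for x y :: "gl_gen word \<Rightarrow>\<^sub>0 'k" and p
    using minus[OF that] gl_free_minus[OF gl_free.part_closed[OF that(1)] gl_free.part_closed[OF that(2)]] by simp
  from assms show ?thesis unfolding gl_relators_def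
  proof (elim UnE)
    assume "r \<in> {letter g * letter h
        - fscale (koszul_sign (gl_parity m g) (gl_parity m h)) (letter h * letter g) | g h.
        g \<in> gl_gens m n \<and> h \<in> gl_gens m n}"
    then obtain g h where r: "r = letter g * letter h
        - fscale (koszul_sign (gl_parity m g) (gl_parity m h)) (letter h * letter g)"
      and gh: "g \<in> gl_gens m n" "h \<in> gl_gens m n" by blast
    have "letter g * letter h \<in> part (gl_free m n :: ('k, _) superalg) (gl_parity m g + gl_parity m h)"
      by (rule mult[OF letter_gl_part[OF gh(1)] letter_gl_part[OF gh(2)]])
    moreover have "fscale c (letter h * letter g) \<in> part (gl_free m n :: ('k, _) superalg) (gl_parity m h + gl_parity m g)" for c
      using gl_free.part_smult[OF mult[OF letter_gl_part[OF gh(2)] letter_gl_part[OF gh(1)]]]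
      by (simp add: gl_free_simps)
    ultimately have "r \<in> part (gl_free m n) (gl_parity m g + gl_parity m h)"
      unfolding r by (intro pm) (simp_all add: add.commute)
    then show ?thesis ..
  next
    assume "r \<in> {letter g * letter g | g. g \<in> gl_gens m n \<and> gl_parity m g = 1}"
    then obtain g where r: "r = letter g * letter g" and g: "g \<in> gl_gens m n" by blast
    show ?thesis unfolding r using mult[OF letter_gl_part[OF g] letter_gl_part[OF g]] ..
  next
    assume "r \<in> {letter DInv1 * mat_det (gl_free m n) {1..m} (\<lambda>i j. letter (Var i j)) - 1,
      letter DInv2 * mat_det (gl_free m n) {m+1..m+n} (\<lambda>i j. letter (Var i j)) - 1}"
    moreover have "letter DInv1 * mat_det (gl_free m n) {1..m} (\<lambda>i j. letter (Var i j)) - 1 \<in>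
        part (gl_free m n :: ('k, _) superalg) 0"
      using mult[OF letter_gl_part[OF DInv_gl_gens(1)] gl_det_part(1)] by (intro pm one) simp
    moreover have "letter DInv2 * mat_det (gl_free m n) {m+1..m+n} (\<lambda>i j. letter (Var i j)) - 1 \<in>
        part (gl_free m n :: ('k, _) superalg) 0"
      using mult[OF letter_gl_part[OF DInv_gl_gens(2)] gl_det_part(2)] by (intro pm one) simp
    ultimately show ?thesis by blast
  qed
qed

lemma gl_relators_closed: "(gl_relators m n :: (gl_gen word \<Rightarrow>\<^sub>0 'k::field) set) \<subseteq> carrier (gl_free m n)"
  using gl_relators_homogeneous gl_free.part_closed by blast

lemma gl_homogeneous_ideal:
  "homogeneous_ideal (gl_free m n :: ('k::field, _) superalg) (gl_ideal m n)"
  unfolding gl_ideal_def using gl_relators_homogeneous by (rule gl_free.homogeneous_genideal)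

text \<open>The features common to k[GL(m|n)] and k[SL(m|n)]: generation by the prescribed elements
  and invertibility of both determinants. They suffice for uniqueness of homomorphisms and for the
  bialgebra axioms; existence of \<Delta> and \<epsilon> is established separately for each of the
  two.\<close>

locale gl_generated = strict_salg A for A :: "('k::field, 'a) superalg" (structure) +
  fixes m n :: nat and gen :: "gl_gen \<Rightarrow> 'a"
  assumes gen_part: "x \<in> gl_gens m n \<Longrightarrow> gen x \<in> part A (gl_parity m x)"
    and generated: "y \<in> carrier A \<Longrightarrow> \<exists>f\<in>carrier (gl_free m n). y = free_eval A gen f"
    and inv1: "gen DInv1 \<otimes> mat_det A {1..m} (\<lambda>i j. gen (Var i j)) = \<one>"
    and inv2: "gen DInv2 \<otimes> mat_det A {m+1..m+n} (\<lambda>i j. gen (Var i j)) = \<one>"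

text \<open>In the quotient each relator becomes an identity between classes of generators;
  \<open>strict_salgI\<close> extends the supercommutators and the vanishing odd squares to all
  elements.\<close>

lemma kGL_generated: "gl_generated (kGL m n :: ('k::field, _) superalg) m n (gl_gen_class m n)"
proof -
  interpret H: homogeneous_ideal "gl_free m n :: ('k, _) superalg" "gl_ideal m n"
    by (rule gl_homogeneous_ideal)
  have Q: "H.Q = kGL m n" by (simp add: kGL_def)
  have cls: "gl_gen_class m n = (\<lambda>x. gl_ideal m n +>\<^bsub>gl_free m n :: ('k, _) superalg\<^esub> letter x)"
    by (simp add: gl_gen_class_def fun_eq_iff)
  let ?c = "\<lambda>x. gl_ideal m n +>\<^bsub>gl_free m n :: ('k, _) superalg\<^esub> x"
  have eval: "?c f = free_eval H.Q (gl_gen_class m n) f" if "f \<in> carrier (gl_free m n)" for f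
    unfolding cls
    by (rule free_hom_eq_eval[OF H.coset.salg_hom_axioms[unfolded gl_free_eq], folded gl_free_eq]) (rule that)
  have zero: "?c r = \<zero>\<^bsub>H.Q\<^esub>" if "r \<in> gl_relators m n" for r
  proof -
    have "r \<in> gl_ideal m n"
      unfolding gl_ideal_def using gl_free.genideal_self[OF gl_relators_closed] that by blast
    moreover have "r \<in> carrier (gl_free m n)" using that gl_relators_closed by blast
    ultimately have "?c r = ?c \<zero>\<^bsub>gl_free m n\<^esub>" by (subst H.coset_eq_iff) (simp_all add: a_minus_def)
    then show ?thesis by simp
  qed
  have diff: "?c x = ?c y" if "x - y \<in> gl_relators m n" "x \<in> carrier (gl_free m n)" "y \<in> carrier (gl_free m n)" for x y
  proof -
    have "?c x \<ominus>\<^bsub>H.Q\<^esub> ?c y = \<zero>\<^bsub>H.Q\<^esub>"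
      using zero[OF that(1)] gl_free_minus[OF that(2,3)] H.coset.hom_minus[OF that(2,3)] by simp
    then show ?thesis using that by (simp add: H.Q.minus_eq_zero_iff)
  qed
  have lc: "letter x \<in> carrier (gl_free m n :: ('k, _) superalg)" if "x \<in> gl_gens m n" for x
    using letter_gl_carrier[OF that] .
  note fm = gl_free.m_closed[of _ m n, unfolded gl_free_simps]
  have gp: "gl_gen_class m n x \<in> part H.Q (gl_parity m x)" if "x \<in> gl_gens m n" for x
    unfolding cls using letter_gl_part[OF that] by (rule H.coset.hom_part)
  have cm: "?c (x * y) = ?c x \<otimes>\<^bsub>H.Q\<^esub> ?c y"
    if "x \<in> carrier (gl_free m n)" "y \<in> carrier (gl_free m n)" for x y
    using H.coset.hom_mult[OF that] by (simp add: gl_free_simps)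
  have strict: "strict_salg H.Q"
  proof (rule H.Q.strict_salgI[of "gl_gens m n" "gl_gen_class m n" "gl_parity m"])
    fix x y assume xy: "x \<in> gl_gens m n" "y \<in> gl_gens m n"
    have s: "fscale c (letter y * letter x) \<in> carrier (gl_free m n :: ('k, _) superalg)" for c
      using gl_free.smult_closed[OF fm[OF lc[OF xy(2)] lc[OF xy(1)]]] by (simp add: gl_free_simps)
    have "?c (letter x * letter y) =
        ?c (fscale (koszul_sign (gl_parity m x) (gl_parity m y)) (letter y * letter x))"
      using xy by (intro diff s fm lc) (auto simp: gl_relators_def)
    also have "\<dots> = koszul_sign (gl_parity m x) (gl_parity m y) \<odot>\<^bsub>H.Q\<^esub> ?c (letter y * letter x)"
      using H.coset.hom_smult[OF fm[OF lc[OF xy(2)] lc[OF xy(1)]]] by (simp add: gl_free_simps)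
    finally show "gl_gen_class m n x \<otimes>\<^bsub>H.Q\<^esub> gl_gen_class m n y =
        koszul_sign (gl_parity m x) (gl_parity m y) \<odot>\<^bsub>H.Q\<^esub> (gl_gen_class m n y \<otimes>\<^bsub>H.Q\<^esub> gl_gen_class m n x)"
      unfolding cls cm[OF lc[OF xy(1)] lc[OF xy(2)]] cm[OF lc[OF xy(2)] lc[OF xy(1)]] .
  next
    fix x assume x: "x \<in> gl_gens m n" "gl_parity m x = 1"
    then have "?c (letter x * letter x) = \<zero>\<^bsub>H.Q\<^esub>" by (intro zero) (auto simp: gl_relators_def)
    then show "gl_gen_class m n x \<otimes>\<^bsub>H.Q\<^esub> gl_gen_class m n x = \<zero>\<^bsub>H.Q\<^esub>"
      unfolding cls cm[OF lc[OF x(1)] lc[OF x(1)]] .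
  next
    fix p y assume "y \<in> part H.Q p"
    then obtain f where f: "f \<in> part (gl_free m n) p" "y = ?c f" by (auto simp: H.part_quotient)
    then show "\<exists>f\<in>part (free_superalg (gl_gens m n) (gl_parity m)) p. y = free_eval H.Q (gl_gen_class m n) f"
      using eval[OF gl_free.part_closed[OF f(1)]] by (auto simp: gl_free_eq)
  qed (rule gp)
  have det: "gl_gen_class m n x \<otimes>\<^bsub>H.Q\<^esub> mat_det H.Q I (\<lambda>i j. gl_gen_class m n (Var i j)) = \<one>\<^bsub>H.Q\<^esub>"
    if "letter x * mat_det (gl_free m n) I (\<lambda>i j. letter (Var i j)) - 1 \<in>
        (gl_relators m n :: (gl_gen word \<Rightarrow>\<^sub>0 'k) set)"
      "x \<in> gl_gens m n" "I \<subseteq> {1..m+n}"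
      "mat_det (gl_free m n) I (\<lambda>i j. letter (Var i j)) \<in> part (gl_free m n :: ('k, _) superalg) 0" for x I
  proof -
    let ?d = "mat_det (gl_free m n :: ('k, _) superalg) I (\<lambda>i j. letter (Var i j))"
    have d: "?d \<in> carrier (gl_free m n)" using that(4) by (rule gl_free.part_closed)
    have one: "1 \<in> carrier (gl_free m n :: ('k, _) superalg)"
      using gl_free.one_closed[of m n] by (simp add: gl_free_simps)
    have "?c (letter x * ?d) = ?c 1" by (rule diff[OF that(1) fm[OF lc[OF that(2)] d] one])
    moreover have "?c 1 = \<one>\<^bsub>H.Q\<^esub>" using H.coset.hom_one by (simp add: gl_free_simps)
    moreover have "?c ?d = mat_det H.Q I (\<lambda>i j. ?c (letter (Var i j)))"
      using that(3) finite_subset[OF that(3)] by (intro H.coset.hom_mat_det lc) auto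
    ultimately show ?thesis unfolding cls using cm[OF lc[OF that(2)] d] by simp
  qed
  show ?thesis
    unfolding Q[symmetric]
  proof (intro gl_generated.intro gl_generated_axioms.intro strict gp)
    fix y assume "y \<in> carrier H.Q"
    then obtain f where "f \<in> carrier (gl_free m n)" "y = ?c f" by (auto simp: H.carrier_quotient)
    then show "\<exists>f\<in>carrier (gl_free m n). y = free_eval H.Q (gl_gen_class m n) f"
      using eval by blast
  next
    show "gl_gen_class m n DInv1 \<otimes>\<^bsub>H.Q\<^esub> mat_det H.Q {1..m} (\<lambda>i j. gl_gen_class m n (Var i j)) = \<one>\<^bsub>H.Q\<^esub>"
      using gl_det_part(1)[of m n] by (intro det) (auto simp: gl_relators_def)
    show "gl_gen_class m n DInv2 \<otimes>\<^bsub>H.Q\<^esub> mat_det H.Q {m+1..m+n} (\<lambda>i j. gl_gen_class m n (Var i j)) = \<one>\<^bsub>H.Q\<^esub>"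
      using gl_det_part(2)[of m n] by (intro det) (auto simp: gl_relators_def)
  qed
qed

text \<open>Evaluation at \<open>g\<close> kills the relators, hence the ideal: supercommutators and
  odd squares vanish since \<open>B\<close> is strict, the remaining two relators by the hypothesis
  \<open>inv\<close>.\<close>

lemma kGL_universal:
  fixes B :: "('k::field, 'b) superalg"
  assumes "strict_salg B"
    and g: "\<And>x. x \<in> gl_gens m n \<Longrightarrow> g x \<in> part B (gl_parity m x)"
    and inv: "g DInv1 \<otimes>\<^bsub>B\<^esub> mat_det B {1..m} (\<lambda>i j. g (Var i j)) = \<one>\<^bsub>B\<^esub>"
      "g DInv2 \<otimes>\<^bsub>B\<^esub> mat_det B {m+1..m+n} (\<lambda>i j. g (Var i j)) = \<one>\<^bsub>B\<^esub>"
  obtains h where "h \<in> superalg_hom (kGL m n) B"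
    "\<And>x. x \<in> gl_gens m n \<Longrightarrow> h (gl_gen_class m n x) = g x"
proof -
  interpret B: strict_salg B by fact
  interpret H: homogeneous_ideal "gl_free m n :: ('k, _) superalg" "gl_ideal m n"
    by (rule gl_homogeneous_ideal)
  define F where "F = free_eval B g"
  have Fh: "F \<in> superalg_hom (gl_free m n) B"
    unfolding F_def gl_free_eq using g by (rule B.free_eval_hom)
  interpret F: salg_hom "gl_free m n" B F by unfold_locales (rule Fh)
  have gc: "g x \<in> carrier B" if "x \<in> gl_gens m n" for x using g[OF that] by (rule B.part_closed)
  have Fl: "F (letter x) = g x" if "x \<in> gl_gens m n" for x
    unfolding F_def by (rule B.free_eval_letter) (rule gc[OF that])
  have lc: "letter x \<in> carrier (gl_free m n :: ('k, _) superalg)" if "x \<in> gl_gens m n" for x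
    using letter_gl_carrier[OF that] .
  note fm = gl_free.m_closed[of _ m n, unfolded gl_free_simps]
  have Fm: "F (x * y) = F x \<otimes>\<^bsub>B\<^esub> F y" if "x \<in> carrier (gl_free m n)" "y \<in> carrier (gl_free m n)" for x y
    using F.hom_mult[OF that] by (simp add: gl_free_simps)
  have Fs: "F (fscale c x) = c \<odot>\<^bsub>B\<^esub> F x" if "x \<in> carrier (gl_free m n)" for c x
    using F.hom_smult[OF that] by (simp add: gl_free_simps)
  have sc: "fscale c x \<in> carrier (gl_free m n)" if "x \<in> carrier (gl_free m n :: ('k, _) superalg)" for c x
    using gl_free.smult_closed[OF that] by (simp add: gl_free_simps)
  have Fd: "F (x - y) = \<zero>\<^bsub>B\<^esub>" if "x \<in> carrier (gl_free m n)" "y \<in> carrier (gl_free m n)" "F x = F y" for x y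
    using F.hom_minus[OF that(1,2)] gl_free_minus[OF that(1,2)] that F.closed[OF that(2)]
    by (simp add: B.minus_eq B.r_neg)
  have Fdet: "F (letter x * mat_det (gl_free m n) I (\<lambda>i j. letter (Var i j)) - 1) = \<zero>\<^bsub>B\<^esub>"
    if "x \<in> gl_gens m n" "I \<subseteq> {1..m+n}"
      "mat_det (gl_free m n) I (\<lambda>i j. letter (Var i j)) \<in> part (gl_free m n :: ('k, _) superalg) 0"
      "g x \<otimes>\<^bsub>B\<^esub> mat_det B I (\<lambda>i j. g (Var i j)) = \<one>\<^bsub>B\<^esub>"
      "\<And>i j. i \<in> I \<Longrightarrow> j \<in> I \<Longrightarrow> gl_parity m (Var i j) = 0" for x I
  proof -
    let ?d = "mat_det (gl_free m n :: ('k, _) superalg) I (\<lambda>i j. letter (Var i j))"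
    have fI: "finite I" using that(2) by (rule finite_subset) simp
    have d: "?d \<in> carrier (gl_free m n)" using that(3) by (rule gl_free.part_closed)
    have one: "1 \<in> carrier (gl_free m n :: ('k, _) superalg)" "F 1 = \<one>\<^bsub>B\<^esub>"
      using gl_free.one_closed[of m n] F.hom_one by (simp_all add: gl_free_simps)
    have "F ?d = mat_det B I (\<lambda>i j. F (letter (Var i j)))"
      using that(2) fI by (intro F.hom_mat_det lc) auto
    also have "\<dots> = mat_det B I (\<lambda>i j. g (Var i j))"
    proof (rule B.mat_det_cong[OF fI])
      fix i j assume ij: "i \<in> I" "j \<in> I"
      then have v: "Var i j \<in> gl_gens m n" using that(2) by auto
      show "F (letter (Var i j)) = g (Var i j)" by (rule Fl[OF v])
      show "g (Var i j) \<in> part B 0" using g[OF v] that(5)[OF ij] by simp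
    qed
    finally show ?thesis
      using that(4) by (intro Fd fm lc that d one) (simp add: Fm lc that d Fl one)
  qed
  have van: "F r = \<zero>\<^bsub>B\<^esub>" if "r \<in> gl_relators m n" for r
    using that unfolding gl_relators_def
  proof (elim UnE)
    assume "r \<in> {letter g * letter h
        - fscale (koszul_sign (gl_parity m g) (gl_parity m h)) (letter h * letter g) | g h.
        g \<in> gl_gens m n \<and> h \<in> gl_gens m n}"
    then obtain x y where r: "r = letter x * letter y
        - fscale (koszul_sign (gl_parity m x) (gl_parity m y)) (letter y * letter x)"
      and xy: "x \<in> gl_gens m n" "y \<in> gl_gens m n" by blast
    show ?thesis unfolding r
      by (intro Fd fm sc lc xy)
        (simp add: Fm Fs fm lc xy Fl B.supercomm[OF g[OF xy(1)] g[OF xy(2)]])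
  next
    assume "r \<in> {letter g * letter g | g. g \<in> gl_gens m n \<and> gl_parity m g = 1}"
    then obtain x where "r = letter x * letter x" and x: "x \<in> gl_gens m n" "gl_parity m x = 1" by blast
    then show ?thesis using B.odd_square[of "g x"] g[OF x(1)] by (simp add: Fm lc Fl)
  next
    assume "r \<in> {letter DInv1 * mat_det (gl_free m n) {1..m} (\<lambda>i j. letter (Var i j)) - 1,
      letter DInv2 * mat_det (gl_free m n) {m+1..m+n} (\<lambda>i j. letter (Var i j)) - 1}"
    moreover have "F (letter DInv1 * mat_det (gl_free m n) {1..m} (\<lambda>i j. letter (Var i j)) - 1) = \<zero>\<^bsub>B\<^esub>"
      by (rule Fdet[OF _ _ gl_det_part(1) inv(1)]) auto
    moreover have "F (letter DInv2 * mat_det (gl_free m n) {m+1..m+n} (\<lambda>i j. letter (Var i j)) - 1) = \<zero>\<^bsub>B\<^esub>"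
      by (rule Fdet[OF _ _ gl_det_part(2) inv(2)]) auto
    ultimately show ?thesis by blast
  qed
  have "F x = \<zero>\<^bsub>B\<^esub>" if "x \<in> gl_ideal m n" for x
    using F.vanishes_on_genideal[OF gl_relators_closed van, of x] that unfolding gl_ideal_def by blast
  then interpret q: quotient_hom "gl_free m n" "gl_ideal m n" B F by unfold_locales
  show ?thesis
  proof (rule that)
    show "quotient_lift F \<in> superalg_hom (kGL m n) B" unfolding kGL_def by (rule q.lift_hom)
    show "quotient_lift F (gl_gen_class m n x) = g x" if "x \<in> gl_gens m n" for x
      unfolding gl_gen_class_def using q.lift_coset[OF lc[OF that]] Fl[OF that] by simp
  qed
qed

section \<open>Homomorphisms are determined by their values at the a_ij\<close>

context gl_generated
begin

lemma gen_closed: "x \<in> gl_gens m n \<Longrightarrow> gen x \<in> carrier A"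
  using gen_part by (rule part_closed)

abbreviation a where "a i j \<equiv> gen (Var i j)"

sublocale interval_blocks A m n ..

lemma supermatrix_gen: "supermatrix a"
  unfolding supermatrix_def by (intro ballI gen_part) simp

definition d1 where "d1 = mat_det A {1..m} a"
definition d2 where "d2 = mat_det A {m+1..m+n} a"

lemma d_even: "d1 \<in> part A 0" "d2 \<in> part A 0"
  unfolding d1_def d2_def using supermatrix_even[OF supermatrix_gen] by (auto intro!: mat_det_even)

lemma inv_even: "gen DInv1 \<in> part A 0" "gen DInv2 \<in> part A 0"
  using gen_part[of DInv1] gen_part[of DInv2] by simp_all

lemma inv_d: "gen DInv1 \<otimes> d1 = \<one>" "gen DInv2 \<otimes> d2 = \<one>" "d1 \<otimes> gen DInv1 = \<one>" "d2 \<otimes> gen DInv2 = \<one>"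
  using inv1 inv2 E.m_comm[of d1 "gen DInv1"] E.m_comm[of d2 "gen DInv2"] d_even inv_even
  by (simp_all add: d1_def d2_def)

text \<open>Values at the a_ij determine those at d1 and d2, and a homomorphism has no choice at the
  inverse of an element whose value is known. Uniqueness of \<Delta> and \<epsilon>, coassociativity
  and the counit laws all follow from this.\<close>

lemma homs_agree:
  assumes "salg B" "h \<in> superalg_hom A B" "k \<in> superalg_hom A B"
    and ag: "\<And>i j. i \<in> {1..m+n} \<Longrightarrow> j \<in> {1..m+n} \<Longrightarrow> h (a i j) = k (a i j)"
    and x: "x \<in> carrier A"
  shows "h x = k x"
proof -
  interpret B: salg B by fact
  interpret h: salg_hom A B h by unfold_locales (rule assms(2))
  interpret k: salg_hom A B k by unfold_locales (rule assms(3))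
  have det: "h (mat_det A I a) = k (mat_det A I a)" if "I \<subseteq> {1..m+n}" for I
  proof -
    have fI: "finite I" using that by (rule finite_subset) simp
    have ac: "a i j \<in> carrier A" if "i \<in> I" "j \<in> I" for i j
      using that \<open>I \<subseteq> _\<close> by (intro gen_closed) auto
    have "h (foldr (\<lambda>i y. a i (\<sigma> i) \<otimes> y) xs \<one>) = k (foldr (\<lambda>i y. a i (\<sigma> i) \<otimes> y) xs \<one>) \<and>
        foldr (\<lambda>i y. a i (\<sigma> i) \<otimes> y) xs \<one> \<in> carrier A"
      if "\<sigma> permutes I" "set xs \<subseteq> I" for \<sigma> xs
      using that(2)
    proof (induction xs)
      case (Cons x xs)
      then have "x \<in> I" "\<sigma> x \<in> I" using that(1) by (auto simp: permutes_in_image)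
      then have "a x (\<sigma> x) \<in> carrier A" "h (a x (\<sigma> x)) = k (a x (\<sigma> x))"
        using ac \<open>I \<subseteq> _\<close> by (blast, blast intro: ag)
      with Cons show ?case by simp
    qed simp
    then have t: "h (foldr (\<lambda>i y. a i (\<sigma> i) \<otimes> y) (sorted_list_of_set I) \<one>) =
        k (foldr (\<lambda>i y. a i (\<sigma> i) \<otimes> y) (sorted_list_of_set I) \<one>)"
      "foldr (\<lambda>i y. a i (\<sigma> i) \<otimes> y) (sorted_list_of_set I) \<one> \<in> carrier A" if "\<sigma> permutes I" for \<sigma>
      using that fI by simp_all
    have fp: "finite {\<sigma>. \<sigma> permutes I}" using fI by (rule finite_permutations)
    show ?thesis unfolding mat_det_def
      using t fp by (subst h.hom_finsum, simp, simp add: Pi_iff, subst k.hom_finsum, simp, simp add: Pi_iff)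
        (auto intro!: B.finsum_cong')
  qed
  \<comment> \<open>Both h y and k y invert the common value of h and k at d.\<close>
  have inv: "h y = k y" if "y \<in> carrier A" "d \<in> carrier A" "y \<otimes> d = \<one>" "d \<otimes> y = \<one>" "h d = k d" for y d
  proof -
    have 1: "h y \<otimes>\<^bsub>B\<^esub> h d = \<one>\<^bsub>B\<^esub>" "k d \<otimes>\<^bsub>B\<^esub> k y = \<one>\<^bsub>B\<^esub>"
      using h.hom_mult[OF that(1,2)] k.hom_mult[OF that(2,1)] that by simp_all
    have "h y = h y \<otimes>\<^bsub>B\<^esub> (h d \<otimes>\<^bsub>B\<^esub> k y)" using 1(2) that by simp
    also have "\<dots> = (h y \<otimes>\<^bsub>B\<^esub> h d) \<otimes>\<^bsub>B\<^esub> k y" using that by (simp only: B.m_assoc h.closed k.closed)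
    also have "\<dots> = k y" using 1(1) that by simp
    finally show ?thesis .
  qed
  have gens: "h (gen y) = k (gen y)" if "y \<in> gl_gens m n" for y
  proof (cases y)
    case (Var i j)
    then show ?thesis using ag that by simp
  next
    case DInv1
    have "h d1 = k d1" unfolding d1_def by (rule det) auto
    then show ?thesis unfolding DInv1
      by (rule inv[OF part_closed[OF inv_even(1)] part_closed[OF d_even(1)] inv_d(1) inv_d(3)])
  next
    case DInv2
    have "h d2 = k d2" unfolding d2_def by (rule det) auto
    then show ?thesis unfolding DInv2
      by (rule inv[OF part_closed[OF inv_even(2)] part_closed[OF d_even(2)] inv_d(2) inv_d(4)])
  qed
  obtain f where f: "f \<in> carrier (gl_free m n)" "x = free_eval A gen f" using generated[OF x] by blast
  have kf: "Poly_Mapping.keys f \<subseteq> {w. set (letters w) \<subseteq> gl_gens m n}" using f(1) by (simp add: gl_free_eq)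
  have "word_prod B (\<lambda>y. h (gen y)) w = word_prod B (\<lambda>y. k (gen y)) w" if "set (letters w) \<subseteq> gl_gens m n" for w
    unfolding word_prod_def using gens that by (intro foldr_cong) auto
  moreover have "word_prod B (\<lambda>y. k (gen y)) w \<in> carrier B" if "set (letters w) \<subseteq> gl_gens m n" for w
  proof -
    have "\<And>y. y \<in> set (letters w) \<Longrightarrow> gen y \<in> carrier A" using that gen_closed by blast
    note w = k.hom_word_prod[of w gen, OF this]
    show ?thesis using k.closed[OF w(1)] w(2) by simp
  qed
  ultimately have "free_eval B (\<lambda>y. h (gen y)) f = free_eval B (\<lambda>y. k (gen y)) f"
    unfolding free_eval_def using kf by (intro B.lin_cong) blast+
  then show ?thesis
    unfolding f(2) using h.hom_free_eval[of "gl_gens m n" gen, OF gen_closed, of f "gl_parity m"]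
      k.hom_free_eval[of "gl_gens m n" gen, OF gen_closed, of f "gl_parity m"] f(1)
    by (simp add: gl_free_eq)
qed

end

section \<open>Comultiplication and counit\<close>

lemma (in salg) add_diff_cancel:
  assumes "x \<in> carrier A" "y \<in> carrier A"
  shows "(x \<oplus> y) \<ominus> x = y" "x \<oplus> (y \<ominus> x) = y"
proof -
  have "(x \<oplus> y) \<ominus> x = (x \<oplus> \<ominus> x) \<oplus> y" "x \<oplus> (y \<ominus> x) = (x \<oplus> \<ominus> x) \<oplus> y"
    using assms by (simp_all add: minus_eq a_ac)
  then show "(x \<oplus> y) \<ominus> x = y" "x \<oplus> (y \<ominus> x) = y" using assms by (simp_all add: r_neg)
qed

section \<open>The embeddings of the factors into a tensor product\<close>

context tensor_product
begin

lemma tens_mult_left_even: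
  assumes "a \<in> carrier A" "b \<in> part B 0" "c \<in> carrier A" "d \<in> carrier B"
  shows "tens A B a b \<otimes>\<^bsub>T\<^esub> tens A B c d = tens A B (a \<otimes>\<^bsub>A\<^esub> c) (b \<otimes>\<^bsub>B\<^esub> d)"
proof -
  have b: "b \<in> carrier B" using assms(2) by (rule B.part_closed)
  from assms(3) show ?thesis
  proof (induction c rule: A.homogeneous_induct)
    case (part p c)
    then show ?case using tens_mult[OF assms(1,2) part assms(4)] A.part_closed[OF part] assms b by simp
  next
    case (add x y)
    then show ?case using assms b by (simp add: tens_add_left mult_add_right A.r_distr)
  qed
qed

lemma tens_mult_right_even:
  assumes "a \<in> carrier A" "b \<in> carrier B" "c \<in> part A 0" "d \<in> carrier B"
  shows "tens A B a b \<otimes>\<^bsub>T\<^esub> tens A B c d = tens A B (a \<otimes>\<^bsub>A\<^esub> c) (b \<otimes>\<^bsub>B\<^esub> d)"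
proof -
  have c: "c \<in> carrier A" using assms(3) by (rule A.part_closed)
  from assms(2) show ?thesis
  proof (induction b rule: B.homogeneous_induct)
    case (part p b)
    then show ?case using tens_mult[OF assms(1) part assms(3,4)] B.part_closed[OF part] assms c by simp
  next
    case (add x y)
    then show ?case using assms c by (simp add: tens_add_right mult_add_left B.l_distr)
  qed
qed

lemma tens_left_hom: "(\<lambda>x. tens A B x \<one>\<^bsub>B\<^esub>) \<in> superalg_hom A T"
  by (rule superalg_homI)
    (simp_all add: tens_add_left tens_smult_left tens_mult_left_even tensor_one tens_part'[where q = 0])

lemma tens_right_hom: "(\<lambda>y. tens A B \<one>\<^bsub>A\<^esub> y) \<in> superalg_hom B T"
  by (rule superalg_homI)
    (simp_all add: tens_add_right tens_smult_right tens_mult_right_even tensor_one tens_part'[where p = 0])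

lemma tens_pow:
  assumes "x \<in> carrier A" "y \<in> part B 0"
  shows "tens A B (x [^]\<^bsub>A\<^esub> k) (y [^]\<^bsub>B\<^esub> k) = tens A B x y [^]\<^bsub>T\<^esub> (k::nat)"
proof (induction k)
  case (Suc k)
  have "y \<in> carrier B" using assms(2) by (rule B.part_closed)
  then show ?case
    using Suc tens_mult_left_even[of "x [^]\<^bsub>A\<^esub> k" "y [^]\<^bsub>B\<^esub> k" x y] assms B.part_pow[OF assms(2)]
    by simp
qed (simp add: tensor_one)

lemma tens_finsum_left:
  assumes "finite S" "\<And>s. s \<in> S \<Longrightarrow> x s \<in> carrier A" "b \<in> carrier B"
  shows "tens A B (finsum A x S) b = finsum T (\<lambda>s. tens A B (x s) b) S"
  using assms(1,2)
proof (induction S)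
  case (insert s S)
  then have "x \<in> S \<rightarrow> carrier A" "x s \<in> carrier A" "(\<lambda>s. tens A B (x s) b) \<in> S \<rightarrow> carrier T"
    using assms(3) by auto
  with insert show ?case using assms(3) by (simp add: tens_add_left)
qed (use assms(3) in simp)

lemma tens_finsum_right:
  assumes "finite S" "\<And>s. s \<in> S \<Longrightarrow> y s \<in> carrier B" "a \<in> carrier A"
  shows "tens A B a (finsum B y S) = finsum T (\<lambda>s. tens A B a (y s)) S"
  using assms(1,2)
proof (induction S)
  case (insert s S)
  then have "y \<in> S \<rightarrow> carrier B" "y s \<in> carrier B" "(\<lambda>s. tens A B a (y s)) \<in> S \<rightarrow> carrier T"
    using assms(3) by auto
  with insert show ?case using assms(3) by (simp add: tens_add_right)
qed (use assms(3) in simp)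

end

lemma (in strict_salg) odd_span_finsum:
  assumes "finite S" "\<And>s. s \<in> S \<Longrightarrow> \<eta> s \<in> part A 1" "finite L" "\<And>l. l \<in> L \<Longrightarrow> x l \<in> odd_span S \<eta>"
  shows "finsum A x L \<in> odd_span S \<eta>"
proof -
  interpret J: ideal "odd_span S \<eta>" E by (rule ideal_odd_span[OF assms(1,2)])
  have e: "odd_span S \<eta> \<subseteq> part A 0" by (rule odd_span_even[OF assms(1,2)])
  from assms(3,4) show ?thesis
  proof (induction L)
    case empty
    then show ?case using J.zero_closed by simp
  next
    case (insert l L)
    have "x l \<in> part A 0" "x l' \<in> part A 0" if "l' \<in> L" for l' using insert.prems e that by blast+
    then have "x \<in> L \<rightarrow> carrier A" by (auto intro: part_closed)
    moreover have "x l \<in> carrier A" using insert.prems e part_closed by blast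
    ultimately show ?case using insert J.a_closed[of "x l" "finsum A x L"] by simp
  qed
qed

sublocale gl_generated \<subseteq> TT: strict_tensor_product A A ..

context gl_generated
begin

abbreviation T where "T \<equiv> tensor A A"

text \<open>The matrix product of the copies a \<otimes> 1 and 1 \<otimes> a of the generic matrix,
  prescribed as the matrix of values of \<Delta>.\<close>

definition gamma :: "nat \<Rightarrow> nat \<Rightarrow> ('a \<times> 'a \<Rightarrow>\<^sub>0 'k) set" where
  "gamma i j = (\<Oplus>\<^bsub>T\<^esub>l\<in>{1..m+n}. tens A A (a i l) (a l j))"

text \<open>The series prescribed for \<Delta>(d^{-1}), with \<Delta>(d) replaced by the determinant
  of \<open>gamma\<close>, so that it makes sense before \<Delta> exists. Here \<open>y\<close>
  stands for the generator inverse to the determinant of block I.\<close>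

definition gamma_inverse :: "nat set \<Rightarrow> 'a \<Rightarrow> ('a \<times> 'a \<Rightarrow>\<^sub>0 'k) set" where
  "gamma_inverse I y = (\<Oplus>\<^bsub>T\<^esub>i\<in>{1..2*m*n+2}. (- 1) ^ (i - 1) \<odot>\<^bsub>T\<^esub>
     (tens A A (y [^] i) (y [^] i) \<otimes>\<^bsub>T\<^esub>
       ((mat_det T I gamma \<ominus>\<^bsub>T\<^esub> tens A A (mat_det A I a) (mat_det A I a)) [^]\<^bsub>T\<^esub> (i - 1))))"

lemma gen_entry: "i \<in> {1..m+n} \<Longrightarrow> j \<in> {1..m+n} \<Longrightarrow> a i j \<in> carrier A"
  by (rule supermatrix_entry[OF supermatrix_gen])

text \<open>I is one block and J the other, so that the same argument serves d1 and d2. It inverts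
  the determinant of \<open>gamma\<close> before any \<Delta> is available.\<close>

lemma gamma_det_inverse:
  fixes I J :: "nat set"
  assumes IJ: "I \<union> J = {1..m+n}" "I \<inter> J = {}" "card I * card J = m * n"
    and ev: "\<And>i j. i \<in> I \<Longrightarrow> j \<in> I \<Longrightarrow> a i j \<in> part A 0"
    and od: "\<And>i j. i \<in> I \<Longrightarrow> j \<in> J \<Longrightarrow> a i j \<in> part A 1" "\<And>i j. i \<in> I \<Longrightarrow> j \<in> J \<Longrightarrow> a j i \<in> part A 1"
    and e: "y \<in> part A 0" "y \<otimes> mat_det A I a = \<one>"
  shows "gamma_inverse I y \<in> part T 0" "mat_det T I gamma \<otimes>\<^bsub>T\<^esub> gamma_inverse I y = \<one>\<^bsub>T\<^esub>"
proof -
  define d where "d = mat_det A I a"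
  have sub: "I \<subseteq> {1..m+n}" "J \<subseteq> {1..m+n}" using IJ by auto
  have fin: "finite I" "finite J" using sub finite_subset by blast+
  have ac: "a i j \<in> carrier A" if "i \<in> I \<union> J" "j \<in> I \<union> J" for i j
    using that unfolding IJ(1) by (rule gen_entry)
  have d: "d \<in> part A 0" unfolding d_def using ev by (intro mat_det_even fin)
  then have dc: "d \<in> carrier A" by (rule part_closed)
  have yc: "y \<in> carrier A" using e(1) by (rule part_closed)
  interpret l: salg_hom A T "\<lambda>x. tens A A x \<one>" by unfold_locales (rule TT.tens_left_hom)
  interpret r: salg_hom A T "\<lambda>x. tens A A \<one> x" by unfold_locales (rule TT.tens_right_hom)
  \<comment> \<open>\<open>M0\<close> keeps the terms of \<open>gamma\<close> with l in I. It is the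
    product of the I-blocks of a \<otimes> 1 and 1 \<otimes> a, whose determinants are d \<otimes> 1
    and 1 \<otimes> d.\<close>
  define \<alpha> \<beta> M0 where "\<alpha> i j = tens A A (a i j) \<one>" and "\<beta> i j = tens A A \<one> (a i j)"
    and "M0 i j = (\<Oplus>\<^bsub>T\<^esub>l\<in>I. \<alpha> i l \<otimes>\<^bsub>T\<^esub> \<beta> l j)" for i j
  have \<alpha>\<beta>: "\<alpha> i l \<otimes>\<^bsub>T\<^esub> \<beta> l j = tens A A (a i l) (a l j)" if "i \<in> I" "l \<in> I \<union> J" "j \<in> I" for i l j
    unfolding \<alpha>_def \<beta>_def using ac[of i l] ac[of l j] that by (subst TT.tens_mult_left_even) auto
  have ab0: "\<alpha> i j \<in> part T 0" "\<beta> i j \<in> part T 0" if "i \<in> I" "j \<in> I" for i j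
    unfolding \<alpha>_def \<beta>_def using l.hom_part[OF ev[OF that]] r.hom_part[OF ev[OF that]] by auto
  have \<alpha>1: "\<alpha> i j \<in> part T 1" if "i \<in> I" "j \<in> J" for i j
    unfolding \<alpha>_def using l.hom_part[OF od(1)[OF that]] .
  have \<beta>1: "\<beta> j i \<in> part T 1" if "i \<in> I" "j \<in> J" for i j
    unfolding \<beta>_def using r.hom_part[OF od(2)[OF that]] .
  have "mat_det T I M0 = mat_det T I \<alpha> \<otimes>\<^bsub>T\<^esub> mat_det T I \<beta>"
    unfolding M0_def using ab0 by (intro TT.T.mat_det_mult fin)
  also have "mat_det T I \<alpha> = tens A A d \<one>"
    unfolding d_def \<alpha>_def using ac by (intro l.hom_mat_det[symmetric] fin) auto
  also have "mat_det T I \<beta> = tens A A \<one> d"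
    unfolding d_def \<beta>_def using ac by (intro r.hom_mat_det[symmetric] fin) auto
  also have "tens A A d \<one> \<otimes>\<^bsub>T\<^esub> tens A A \<one> d = tens A A d d"
    using dc by (subst TT.tens_mult_left_even) auto
  finally have det0: "mat_det T I M0 = tens A A d d" .
  have te: "tens A A (a i l) (a l j) \<in> part T 0" if "i \<in> I" "j \<in> I" "l \<in> I \<union> J" for i j l
    using that TT.tens_part[OF ev[of i l] ev[of l j]] TT.tens_part[OF od(1)[of i l] od(2)[of j l]] by auto
  have tc: "tens A A (a i l) (a l j) \<in> carrier T" if "i \<in> I" "j \<in> I" "l \<in> I \<union> J" for i j l
    using te[OF that] by (rule TT.T.part_closed)
  have g0: "gamma i j \<in> part T 0" if "i \<in> I" "j \<in> I" for i j
    unfolding gamma_def IJ(1)[symmetric] using te that fin by (intro TT.T.part_finsum) auto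
  have M00: "M0 i j \<in> part T 0" if "i \<in> I" "j \<in> I" for i j
    unfolding M0_def using te that fin \<alpha>\<beta> by (intro TT.T.part_finsum) auto
  \<comment> \<open>The left copies with row in I and column in J suffice as odd generators, because
    each term left out of \<open>M0\<close> ends in one of them after a sign change.\<close>
  let ?\<eta> = "\<lambda>s. \<alpha> (fst s) (snd s)"
  have \<eta>: "?\<eta> s \<in> part T 1" if "s \<in> I \<times> J" for s using \<alpha>1 that by auto
  have fS: "finite (I \<times> J)" using fin by simp
  have diff: "gamma i j \<ominus>\<^bsub>T\<^esub> M0 i j \<in> TT.T.odd_span (I \<times> J) ?\<eta>" if ij: "i \<in> I" "j \<in> I" for i j
  proof -
    let ?t = "\<lambda>l. tens A A (a i l) (a l j)"
    have M0t: "M0 i j = finsum T ?t I"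
      unfolding M0_def using \<alpha>\<beta> ij tc by (intro TT.V.finsum_cong') auto
    have s: "finsum T ?t I \<in> carrier T" "finsum T ?t J \<in> carrier T"
      using tc ij by (auto intro!: TT.V.finsum_closed)
    have "gamma i j = finsum T ?t I \<oplus>\<^bsub>T\<^esub> finsum T ?t J"
      unfolding gamma_def IJ(1)[symmetric] using fin IJ(2) tc ij by (intro TT.V.finsum_Un_disjoint) auto
    then have "gamma i j \<ominus>\<^bsub>T\<^esub> M0 i j = finsum T ?t J"
      unfolding M0t using s by (simp add: TT.T.add_diff_cancel)
    moreover have "finsum T ?t J \<in> TT.T.odd_span (I \<times> J) ?\<eta>"
    proof (rule TT.T.odd_span_finsum[OF fS \<eta> fin(2)])
      fix l assume l: "l \<in> J"
      note p = \<alpha>1[OF ij(1) l] \<beta>1[OF ij(2) l]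
      have c: "\<alpha> i l \<in> carrier T" "\<beta> l j \<in> carrier T" using p by (auto intro: TT.T.part_closed)
      have "?t l = \<alpha> i l \<otimes>\<^bsub>T\<^esub> \<beta> l j" using \<alpha>\<beta>[of i l j] ij l by simp
      also have "\<dots> = (\<ominus>\<^bsub>T\<^esub> \<beta> l j) \<otimes>\<^bsub>T\<^esub> \<alpha> i l"
        using TT.T.supercomm[OF p] c by (simp add: koszul_sign_def TT.V.uminus_smult TT.T.l_minus)
      finally show "?t l \<in> TT.T.odd_span (I \<times> J) ?\<eta>"
        using TT.T.odd_span_generator[of "I \<times> J" ?\<eta> "(i, l)" "\<ominus>\<^bsub>T\<^esub> \<beta> l j", OF fS \<eta>] ij l TT.T.part_uminus[OF p(2)] by simp
    qed
    ultimately show ?thesis by simp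
  qed
  define z where "z = mat_det T I gamma \<ominus>\<^bsub>T\<^esub> tens A A d d"
  have det_g: "mat_det T I gamma \<in> part T 0" using g0 by (intro TT.T.mat_det_even fin)
  have w: "tens A A d d \<in> part T 0" using TT.tens_part[OF d d] by simp
  have z: "z \<in> part T 0" unfolding z_def by (rule TT.T.part_minus[OF det_g w])
  \<comment> \<open>There are card I times card J = mn generators, so every power beyond mn
    vanishes; the exponent used is the number of terms in the series.\<close>
  have nil: "z [^]\<^bsub>T\<^esub> (2*m*n+2) = \<zero>\<^bsub>T\<^esub>"
    unfolding z_def det0[symmetric] using g0 M00 diff IJ(3)
    by (intro TT.T.det_diff_nilpotent[OF fS \<eta> fin(1)]) (auto simp: card_cartesian_product)
  define u where "u = tens A A y y"
  have u: "u \<in> part T 0" unfolding u_def using TT.tens_part[OF e(1) e(1)] by simp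
  have uw: "u \<otimes>\<^bsub>T\<^esub> tens A A d d = \<one>\<^bsub>T\<^esub>"
    unfolding u_def using TT.tens_mult_left_even[OF yc e(1) dc dc] e(2) by (simp add: d_def TT.tensor_one)
  have G: "gamma_inverse I y = (\<Oplus>\<^bsub>T\<^esub>i\<in>{1..2*m*n+2}. (- 1) ^ (i - 1) \<odot>\<^bsub>T\<^esub> (u [^]\<^bsub>T\<^esub> i \<otimes>\<^bsub>T\<^esub> z [^]\<^bsub>T\<^esub> (i - 1)))"
    unfolding gamma_inverse_def d_def u_def z_def TT.tens_pow[OF yc e(1)] ..
  have wz: "tens A A d d \<oplus>\<^bsub>T\<^esub> z = mat_det T I gamma"
    unfolding z_def using TT.T.part_closed[OF det_g] TT.T.part_closed[OF w]
    by (simp add: TT.T.add_diff_cancel)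
  show "gamma_inverse I y \<in> part T 0" "mat_det T I gamma \<otimes>\<^bsub>T\<^esub> gamma_inverse I y = \<one>\<^bsub>T\<^esub>"
    using TT.T.geometric_inverse[OF u w z uw nil] unfolding G wz by simp_all
qed

lemma gamma_det_inverse1:
  "gamma_inverse {1..m} (gen DInv1) \<in> part T 0"
  "mat_det T {1..m} gamma \<otimes>\<^bsub>T\<^esub> gamma_inverse {1..m} (gen DInv1) = \<one>\<^bsub>T\<^esub>"
proof -
  have "{1..m} \<union> {m+1..m+n} = {1..m+n}" "{1..m} \<inter> {m+1..m+n} = {}" by auto
  note * = gamma_det_inverse[OF this _ supermatrix_even(1)[OF supermatrix_gen]
      supermatrix_odd[OF supermatrix_gen] inv_even(1) inv1]
  show "gamma_inverse {1..m} (gen DInv1) \<in> part T 0" by (rule *(1)) simp_all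
  show "mat_det T {1..m} gamma \<otimes>\<^bsub>T\<^esub> gamma_inverse {1..m} (gen DInv1) = \<one>\<^bsub>T\<^esub>"
    by (rule *(2)) simp_all
qed

lemma gamma_det_inverse2:
  "gamma_inverse {m+1..m+n} (gen DInv2) \<in> part T 0"
  "mat_det T {m+1..m+n} gamma \<otimes>\<^bsub>T\<^esub> gamma_inverse {m+1..m+n} (gen DInv2) = \<one>\<^bsub>T\<^esub>"
proof -
  have "{m+1..m+n} \<union> {1..m} = {1..m+n}" "{m+1..m+n} \<inter> {1..m} = {}" by auto
  note * = gamma_det_inverse[OF this _ supermatrix_even(2)[OF supermatrix_gen]
      supermatrix_odd(2,1)[OF supermatrix_gen] inv_even(2) inv2]
  show "gamma_inverse {m+1..m+n} (gen DInv2) \<in> part T 0" by (rule *(1)) simp_all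
  show "mat_det T {m+1..m+n} gamma \<otimes>\<^bsub>T\<^esub> gamma_inverse {m+1..m+n} (gen DInv2) = \<one>\<^bsub>T\<^esub>"
    by (rule *(2)) simp_all
qed

end

text \<open>Both Berezinians are expressed by the padded matrix, and padding only sees entries in
  the index range.\<close>

lemma (in interval_blocks) berezinian_cong:
  assumes a: "supermatrix a" and b: "supermatrix b"
    and eq: "\<And>i j. i \<in> {1..m+n} \<Longrightarrow> j \<in> {1..m+n} \<Longrightarrow> a i j = b i j"
    and u: "u \<in> part A 0" "u \<otimes> mat_det A {m+1..m+n} a = \<one>"
  shows "berezinian m n A a = berezinian m n A b"
proof -
  have p: "pad a = pad b" using eq by (intro ext) (simp add: pad_def)
  obtain Y where Y: "inverse_block (pad a) Y" using inverse_block_exists[OF a u] .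
  show ?thesis unfolding berezinian_eq_schur[OF a Y] berezinian_eq_schur[OF b Y[unfolded p]] p ..
qed

lemma id_superalg_hom: "(\<lambda>x. x) \<in> superalg_hom A A"
  by (rule superalg_homI) simp_all

section \<open>The formulas for the inverses and the bialgebra axioms\<close>

context gl_generated
begin

lemma salg_hom_comult: "\<Delta> \<in> superalg_hom A T \<Longrightarrow> salg_hom A T \<Delta>"
  by unfold_locales

lemma gamma_even:
  "i \<in> {1..m} \<Longrightarrow> j \<in> {1..m} \<Longrightarrow> gamma i j \<in> part T 0"
  "i \<in> {m+1..m+n} \<Longrightarrow> j \<in> {m+1..m+n} \<Longrightarrow> gamma i j \<in> part T 0"
proof -
  have "tens A A (a i l) (a l j) \<in> part T (index_parity i + index_parity j)"
    if "i \<in> {1..m+n}" "j \<in> {1..m+n}" "l \<in> {1..m+n}" for i j l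
    using supermatrix_part[OF supermatrix_gen, of i l] supermatrix_part[OF supermatrix_gen, of l j] that
    by (intro TT.tens_part'[of _ "index_parity i + index_parity l" _ "index_parity l + index_parity j"])
      (simp_all only: add.assoc bit_add_self)
  then have g: "gamma i j \<in> part T (index_parity i + index_parity j)"
    if "i \<in> {1..m+n}" "j \<in> {1..m+n}" for i j
    using that unfolding gamma_def by (intro TT.T.part_finsum) simp_all
  show "i \<in> {1..m} \<Longrightarrow> j \<in> {1..m} \<Longrightarrow> gamma i j \<in> part T 0"
    "i \<in> {m+1..m+n} \<Longrightarrow> j \<in> {m+1..m+n} \<Longrightarrow> gamma i j \<in> part T 0"
    using g[of i j] by simp_all
qed

text \<open>\<Delta>(y) and \<open>gamma_inverse\<close> are both inverse to \<Delta>(d), which is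
  the determinant of \<open>gamma\<close>. So the two series formulas hold for every homomorphism
  with the right values at the a_ij.\<close>

lemma is_gl_comultI:
  assumes \<Delta>: "\<Delta> \<in> superalg_hom A T"
    and var: "\<And>i j. i \<in> {1..m+n} \<Longrightarrow> j \<in> {1..m+n} \<Longrightarrow> \<Delta> (a i j) = gamma i j"
  shows "is_gl_comult m n A gen \<Delta>"
proof -
  interpret \<Delta>: salg_hom A T \<Delta> using \<Delta> by (rule salg_hom_comult)
  have det: "\<Delta> (mat_det A I a) = mat_det T I gamma"
    if "I \<subseteq> {1..m+n}" "\<And>i j. i \<in> I \<Longrightarrow> j \<in> I \<Longrightarrow> gamma i j \<in> part T 0" for I
  proof -
    have fI: "finite I" using that(1) by (rule finite_subset) simp
    have "\<Delta> (mat_det A I a) = mat_det T I (\<lambda>i j. \<Delta> (a i j))"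
      using that(1) by (intro \<Delta>.hom_mat_det fI gen_entry) auto
    also have "\<dots> = mat_det T I gamma"
      by (rule TT.T.mat_det_cong[OF fI var that(2)]) (use that(1) in auto)
    finally show ?thesis .
  qed
  have inv: "\<Delta> y = gamma_inverse I y"
    if "y \<in> carrier A" "mat_det A I a \<in> carrier A" "y \<otimes> mat_det A I a = \<one>"
      "\<Delta> (mat_det A I a) = mat_det T I gamma"
      "gamma_inverse I y \<in> part T 0" "mat_det T I gamma \<otimes>\<^bsub>T\<^esub> gamma_inverse I y = \<one>\<^bsub>T\<^esub>" for y I
  proof -
    have c: "\<Delta> y \<in> carrier T" "mat_det T I gamma \<in> carrier T" "gamma_inverse I y \<in> carrier T"
      using \<Delta>.closed[OF that(1)] \<Delta>.closed[OF that(2)] TT.T.part_closed[OF that(5)] that(4) by simp_all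
    have 1: "\<Delta> y \<otimes>\<^bsub>T\<^esub> mat_det T I gamma = \<one>\<^bsub>T\<^esub>"
      using \<Delta>.hom_mult[OF that(1,2)] that(3,4) by simp
    have "\<Delta> y = \<Delta> y \<otimes>\<^bsub>T\<^esub> (mat_det T I gamma \<otimes>\<^bsub>T\<^esub> gamma_inverse I y)" using c that(6) by simp
    also have "\<dots> = \<Delta> y \<otimes>\<^bsub>T\<^esub> mat_det T I gamma \<otimes>\<^bsub>T\<^esub> gamma_inverse I y"
      by (rule TT.T.m_assoc[OF c, symmetric])
    also have "\<dots> = gamma_inverse I y" using 1 c by simp
    finally show ?thesis .
  qed
  have det1: "\<Delta> (mat_det A {1..m} a) = mat_det T {1..m} gamma"
    by (rule det) (auto intro: gamma_even)
  have det2: "\<Delta> (mat_det A {m+1..m+n} a) = mat_det T {m+1..m+n} gamma"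
    by (rule det) (auto intro: gamma_even)
  have 1: "\<Delta> (gen DInv1) = gamma_inverse {1..m} (gen DInv1)"
    by (rule inv[OF part_closed[OF inv_even(1)] part_closed[OF d_even(1)[unfolded d1_def]] inv1 det1
        gamma_det_inverse1])
  have 2: "\<Delta> (gen DInv2) = gamma_inverse {m+1..m+n} (gen DInv2)"
    by (rule inv[OF part_closed[OF inv_even(2)] part_closed[OF d_even(2)[unfolded d2_def]] inv2 det2
        gamma_det_inverse2])
  show ?thesis
    unfolding is_gl_comult_def dinv_comult_def det1 det2
    using \<Delta> var 1 2 unfolding gamma_def gamma_inverse_def by blast
qed

lemma counit_det:
  assumes \<epsilon>: "\<epsilon> \<in> superalg_hom A ground"
    and var: "\<And>i j. i \<in> {1..m+n} \<Longrightarrow> j \<in> {1..m+n} \<Longrightarrow> \<epsilon> (a i j) = (if i = j then 1 else 0)"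
    and I: "I \<subseteq> {1..m+n}"
  shows "\<epsilon> (mat_det A I a) = 1"
proof -
  interpret G: strict_salg "ground :: ('k, 'k) superalg" by (rule strict_salg_ground)
  interpret \<epsilon>: salg_hom A ground \<epsilon> by unfold_locales (rule \<epsilon>)
  have fI: "finite I" using I by (rule finite_subset) simp
  have "\<epsilon> (mat_det A I a) = mat_det ground I (\<lambda>i j. \<epsilon> (a i j))"
    using I by (intro \<epsilon>.hom_mat_det fI gen_entry) auto
  also have "\<dots> = mat_det ground I (\<lambda>i j. if i = j then \<one>\<^bsub>ground\<^esub> else \<zero>\<^bsub>ground\<^esub>)"
    by (rule G.mat_det_cong[OF fI]) (simp_all add: var[OF subsetD[OF I] subsetD[OF I]])
  also have "\<dots> = 1" using G.mat_det_one[OF fI] by simp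
  finally show ?thesis .
qed

lemma is_gl_counitI:
  assumes \<epsilon>: "\<epsilon> \<in> superalg_hom A ground"
    and var: "\<And>i j. i \<in> {1..m+n} \<Longrightarrow> j \<in> {1..m+n} \<Longrightarrow> \<epsilon> (a i j) = (if i = j then 1 else 0)"
  shows "is_gl_counit m n A gen \<epsilon>"
proof -
  interpret G: strict_salg "ground :: ('k, 'k) superalg" by (rule strict_salg_ground)
  interpret \<epsilon>: salg_hom A ground \<epsilon> by unfold_locales (rule \<epsilon>)
  have "\<epsilon> d1 = 1" "\<epsilon> d2 = 1"
    unfolding d1_def d2_def by (rule counit_det[OF \<epsilon> var]; auto)+
  moreover have "\<epsilon> (gen DInv1) * \<epsilon> d1 = 1" "\<epsilon> (gen DInv2) * \<epsilon> d2 = 1"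
    using \<epsilon>.hom_mult[OF part_closed[OF inv_even(1)] part_closed[OF d_even(1)]]
      \<epsilon>.hom_mult[OF part_closed[OF inv_even(2)] part_closed[OF d_even(2)]] inv_d by simp_all
  ultimately show ?thesis unfolding is_gl_counit_def using \<epsilon> var by simp
qed

text \<open>By \<open>homs_agree\<close> each axiom is checked at a_ij. Both iterated coproducts are
  the sum of a_ik \<otimes> a_kl \<otimes> a_lj, with the two summations in either order; in the
  counit laws a Kronecker delta leaves a single term.\<close>

lemma superbialgebra:
  assumes \<Delta>: "\<Delta> \<in> superalg_hom A T"
    and var: "\<And>i j. i \<in> {1..m+n} \<Longrightarrow> j \<in> {1..m+n} \<Longrightarrow> \<Delta> (a i j) = gamma i j"
    and \<epsilon>: "\<epsilon> \<in> superalg_hom A ground"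
    and var\<epsilon>: "\<And>i j. i \<in> {1..m+n} \<Longrightarrow> j \<in> {1..m+n} \<Longrightarrow> \<epsilon> (a i j) = (if i = j then 1 else 0)"
  shows "superbialgebra A \<Delta> \<epsilon>"
proof (intro superbialgebra.intro superbialgebra_axioms.intro superalgebra_axioms \<Delta> \<epsilon>)
  interpret \<Delta>: salg_hom A T \<Delta> using \<Delta> by (rule salg_hom_comult)
  have idh: "salg_hom A A (\<lambda>x. x)" by unfold_locales (rule id_superalg_hom)
  interpret U: tensor_product A T ..
  interpret W: tensor_product T A ..
  let ?U = "tensor A T" and ?W = "tensor T A"
  let ?t = "\<lambda>i l j. tens A A (a i l) (a l j)"
  have tc: "?t i l j \<in> carrier T" if "i \<in> {1..m+n}" "l \<in> {1..m+n}" "j \<in> {1..m+n}" for i l j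
    using that gen_entry by simp
  let ?f = "tensor_map T A \<Delta> (\<lambda>y. y)" and ?g = "tensor_map A T (\<lambda>y. y) \<Delta>" and ?s = "tensor_assoc A A A"
  interpret f: salg_hom T ?W ?f
    by unfold_locales (rule tensor_map_hom[OF \<Delta>.salg_hom_axioms idh])
  interpret g: salg_hom T ?U ?g
    by unfold_locales (rule tensor_map_hom[OF idh \<Delta>.salg_hom_axioms])
  interpret s: salg_hom ?W ?U ?s
    by unfold_locales (rule tensor_assoc_hom[OF salg_axioms salg_axioms salg_axioms])
  fix x assume x: "x \<in> carrier A"
  show "?s (?f (\<Delta> x)) = ?g (\<Delta> x)"
  proof (rule homs_agree[OF U.T.salg_axioms _ _ _ x])
    show "(\<lambda>x. ?s (?f (\<Delta> x))) \<in> superalg_hom A ?U"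
      by (rule \<Delta>.comp[OF f.comp[OF s.superalg_hom]])
    show "(\<lambda>x. ?g (\<Delta> x)) \<in> superalg_hom A ?U"
      by (rule \<Delta>.comp[OF g.superalg_hom])
    fix i j assume ij: "i \<in> {1..m+n}" "j \<in> {1..m+n}"
    let ?K = "{1..m+n}"
    \<comment> \<open>The common summand, bracketed to the right as it is after applying the
      associator.\<close>
    let ?z = "\<lambda>l k. tens A T (a i k) (tens A A (a k l) (a l j))"
    have z: "?z l k \<in> carrier ?U" if "l \<in> ?K" "k \<in> ?K" for l k using that ij gen_entry by simp
    have sf: "?s (?f (?t i l j)) = (\<Oplus>\<^bsub>?U\<^esub>k\<in>?K. ?z l k)" if l: "l \<in> ?K" for l
    proof -
      have "?f (?t i l j) = tens T A (gamma i l) (a l j)"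
        using tensor_map_tens[OF \<Delta>.salg_hom_axioms idh, of "a i l" "a l j"]
          gen_entry ij l var by simp
      also have "\<dots> = (\<Oplus>\<^bsub>?W\<^esub>k\<in>?K. tens T A (?t i k l) (a l j))"
        unfolding gamma_def using tc ij l gen_entry by (intro W.tens_finsum_left) auto
      finally have "?s (?f (?t i l j)) = ?s (\<Oplus>\<^bsub>?W\<^esub>k\<in>?K. tens T A (?t i k l) (a l j))" by simp
      also have "\<dots> = (\<Oplus>\<^bsub>?U\<^esub>k\<in>?K. ?s (tens T A (?t i k l) (a l j)))"
        using tc ij l gen_entry by (intro s.hom_finsum) auto
      also have "\<dots> = (\<Oplus>\<^bsub>?U\<^esub>k\<in>?K. ?z l k)"
        using ij l gen_entry z tensor_assoc_tens[OF salg_axioms salg_axioms salg_axioms]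
        by (intro U.V.finsum_cong') auto
      finally show ?thesis .
    qed
    have zs: "(\<Oplus>\<^bsub>?U\<^esub>k\<in>?K. ?z l k) \<in> carrier ?U" if "l \<in> ?K" for l
      using z that by (intro U.V.finsum_closed) auto
    have "?s (?f (\<Delta> (a i j))) = ?s (?f (\<Oplus>\<^bsub>T\<^esub>l\<in>?K. ?t i l j))"
      using var[OF ij] by (simp add: gamma_def)
    also have "\<dots> = ?s (\<Oplus>\<^bsub>?W\<^esub>l\<in>?K. ?f (?t i l j))"
      using tc ij by (subst f.hom_finsum) auto
    also have "\<dots> = (\<Oplus>\<^bsub>?U\<^esub>l\<in>?K. ?s (?f (?t i l j)))"
      using tc ij by (intro s.hom_finsum) auto
    also have "\<dots> = (\<Oplus>\<^bsub>?U\<^esub>l\<in>?K. \<Oplus>\<^bsub>?U\<^esub>k\<in>?K. ?z l k)"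
      using sf zs by (intro U.V.finsum_cong') auto
    also have "\<dots> = (\<Oplus>\<^bsub>?U\<^esub>k\<in>?K. \<Oplus>\<^bsub>?U\<^esub>l\<in>?K. ?z l k)"
      using z by (intro U.V.finsum_swap) auto
    also have "\<dots> = (\<Oplus>\<^bsub>?U\<^esub>k\<in>?K. ?g (?t i k j))"
    proof (rule U.V.finsum_cong'[OF refl])
      show "(\<lambda>k. ?g (?t i k j)) \<in> ?K \<rightarrow> carrier ?U" using tc ij by auto
      fix k assume k: "k \<in> ?K"
      have "?g (?t i k j) = tens A T (a i k) (gamma k j)"
        using tensor_map_tens[OF idh \<Delta>.salg_hom_axioms, of "a i k" "a k j"]
          gen_entry ij k var by simp
      also have "\<dots> = (\<Oplus>\<^bsub>?U\<^esub>l\<in>?K. ?z l k)"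
        unfolding gamma_def using tc ij k gen_entry by (intro U.tens_finsum_right) auto
      finally show "(\<Oplus>\<^bsub>?U\<^esub>l\<in>?K. ?z l k) = ?g (?t i k j)" by simp
    qed
    also have "\<dots> = ?g (\<Oplus>\<^bsub>T\<^esub>k\<in>?K. ?t i k j)"
      using tc ij by (intro g.hom_finsum[symmetric]) auto
    also have "\<dots> = ?g (\<Delta> (a i j))" using var[OF ij] by (simp add: gamma_def)
    finally show "?s (?f (\<Delta> (a i j))) = ?g (\<Delta> (a i j))" .
  qed
  interpret G: strict_salg "ground :: ('k, 'k) superalg" by (rule strict_salg_ground)
  interpret l: salg_hom T A "tensor_lift A (\<lambda>a b. \<epsilon> a \<odot> b)"
    by unfold_locales (rule counit_left_hom[OF salg_axioms \<epsilon>])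
  interpret r: salg_hom T A "tensor_lift A (\<lambda>a b. \<epsilon> b \<odot> a)"
    by unfold_locales (rule counit_right_hom[OF salg_axioms \<epsilon>])
  show "tensor_lift A (\<lambda>a b. \<epsilon> a \<odot> b) (\<Delta> x) = x"
  proof (rule homs_agree[OF salg_axioms _ id_superalg_hom _ x])
    show "(\<lambda>x. tensor_lift A (\<lambda>a b. \<epsilon> a \<odot> b) (\<Delta> x)) \<in> superalg_hom A A"
      by (rule \<Delta>.comp[OF l.superalg_hom])
    fix i j assume ij: "i \<in> {1..m+n}" "j \<in> {1..m+n}"
    have "tensor_lift A (\<lambda>a b. \<epsilon> a \<odot> b) (\<Delta> (a i j)) =
        (\<Oplus>l\<in>{1..m+n}. tensor_lift A (\<lambda>a b. \<epsilon> a \<odot> b) (?t i l j))"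
      unfolding var[OF ij] gamma_def using tc ij by (intro l.hom_finsum) auto
    also have "\<dots> = (\<Oplus>l\<in>{1..m+n}. (if i = l then 1 else 0) \<odot> a l j)"
    proof (rule finsum_cong'[OF refl])
      fix l assume l: "l \<in> {1..m+n}"
      show "tensor_lift A (\<lambda>a b. \<epsilon> a \<odot> b) (?t i l j) = (if i = l then 1 else 0) \<odot> a l j"
        unfolding counit_left_tens[OF salg_axioms \<epsilon> gen_entry[OF ij(1) l] gen_entry[OF l ij(2)]]
          var\<epsilon>[OF ij(1) l] ..
    qed (rule funcsetI, rule smult_closed, rule gen_entry[OF _ ij(2)])
    also have "\<dots> = (if i = i then 1 else 0) \<odot> a i j"
    proof (rule finsum_delta_left[OF finite_atLeastAtMost ij(1)])
      fix l assume l: "l \<in> {1..m+n}"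
      note c = gen_entry[OF l ij(2)]
      show "(if i = l then 1 else 0) \<odot> a l j \<in> carrier A" using c by (rule smult_closed)
      show "(if i = l then 1 else 0) \<odot> a l j = \<zero>" if "l \<noteq> i" using c that by simp
    qed
    finally show "tensor_lift A (\<lambda>a b. \<epsilon> a \<odot> b) (\<Delta> (a i j)) = a i j" using gen_entry[OF ij] by simp
  qed
  show "tensor_lift A (\<lambda>a b. \<epsilon> b \<odot> a) (\<Delta> x) = x"
  proof (rule homs_agree[OF salg_axioms _ id_superalg_hom _ x])
    show "(\<lambda>x. tensor_lift A (\<lambda>a b. \<epsilon> b \<odot> a) (\<Delta> x)) \<in> superalg_hom A A"
      by (rule \<Delta>.comp[OF r.superalg_hom])
    fix i j assume ij: "i \<in> {1..m+n}" "j \<in> {1..m+n}"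
    have "tensor_lift A (\<lambda>a b. \<epsilon> b \<odot> a) (\<Delta> (a i j)) =
        (\<Oplus>l\<in>{1..m+n}. tensor_lift A (\<lambda>a b. \<epsilon> b \<odot> a) (?t i l j))"
      unfolding var[OF ij] gamma_def using tc ij by (intro r.hom_finsum) auto
    also have "\<dots> = (\<Oplus>l\<in>{1..m+n}. (if l = j then 1 else 0) \<odot> a i l)"
    proof (rule finsum_cong'[OF refl])
      fix l assume l: "l \<in> {1..m+n}"
      show "tensor_lift A (\<lambda>a b. \<epsilon> b \<odot> a) (?t i l j) = (if l = j then 1 else 0) \<odot> a i l"
        unfolding counit_right_tens[OF salg_axioms \<epsilon> gen_entry[OF ij(1) l] gen_entry[OF l ij(2)]]
          var\<epsilon>[OF l ij(2)] ..
    qed (rule funcsetI, rule smult_closed, rule gen_entry[OF ij(1)])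
    also have "\<dots> = (if j = j then 1 else 0) \<odot> a i j"
    proof (rule finsum_delta_left[OF finite_atLeastAtMost ij(2)])
      fix l assume l: "l \<in> {1..m+n}"
      note c = gen_entry[OF ij(1) l]
      show "(if l = j then 1 else 0) \<odot> a i l \<in> carrier A" using c by (rule smult_closed)
      show "(if l = j then 1 else 0) \<odot> a i l = \<zero>" if "l \<noteq> j" using c that by simp
    qed
    finally show "tensor_lift A (\<lambda>a b. \<epsilon> b \<odot> a) (\<Delta> (a i j)) = a i j" using gen_entry[OF ij] by simp
  qed
qed

lemma gl_bialgebra:
  assumes \<Delta>: "\<Delta> \<in> superalg_hom A T"
    and var: "\<And>i j. i \<in> {1..m+n} \<Longrightarrow> j \<in> {1..m+n} \<Longrightarrow> \<Delta> (a i j) = gamma i j"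
    and \<epsilon>: "\<epsilon> \<in> superalg_hom A ground"
    and var\<epsilon>: "\<And>i j. i \<in> {1..m+n} \<Longrightarrow> j \<in> {1..m+n} \<Longrightarrow> \<epsilon> (a i j) = (if i = j then 1 else 0)"
  shows "is_gl_comult m n A gen \<Delta> \<and> is_gl_counit m n A gen \<epsilon> \<and> superbialgebra A \<Delta> \<epsilon> \<and>
    (\<forall>\<Delta>'. is_gl_comult m n A gen \<Delta>' \<longrightarrow> (\<forall>x\<in>carrier A. \<Delta>' x = \<Delta> x)) \<and>
    (\<forall>\<epsilon>'. is_gl_counit m n A gen \<epsilon>' \<longrightarrow> (\<forall>x\<in>carrier A. \<epsilon>' x = \<epsilon> x))"
proof (intro conjI allI impI ballI)
  interpret G: strict_salg "ground :: ('k, 'k) superalg" by (rule strict_salg_ground)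
  show "is_gl_comult m n A gen \<Delta>" by (rule is_gl_comultI[OF \<Delta> var])
  show "is_gl_counit m n A gen \<epsilon>" by (rule is_gl_counitI[OF \<epsilon> var\<epsilon>])
  show "superbialgebra A \<Delta> \<epsilon>" by (rule superbialgebra[OF assms])
  fix x assume x: "x \<in> carrier A"
  show "\<Delta>' x = \<Delta> x" if "is_gl_comult m n A gen \<Delta>'" for \<Delta>'
    using that var unfolding is_gl_comult_def gamma_def
    by (intro homs_agree[OF TT.T.salg_axioms _ \<Delta> _ x]) auto
  show "\<epsilon>' x = \<epsilon> x" if "is_gl_counit m n A gen \<epsilon>'" for \<epsilon>'
    using that var\<epsilon> unfolding is_gl_counit_def
    by (intro homs_agree[OF G.salg_axioms _ \<epsilon> _ x]) auto
qed

end

text \<open>The images chosen for the two inverse generators are the series themselves;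
  \<open>gamma_det_inverse1\<close> and \<open>gamma_det_inverse2\<close> provide the parity and
  invertibility that \<open>kGL_universal\<close> asks for.\<close>

lemma kGL_comult_exists:
  fixes m n :: nat
  obtains \<Delta> where
    "\<Delta> \<in> superalg_hom (kGL m n :: ('k::field, _) superalg) (tensor (kGL m n) (kGL m n))"
    "\<And>i j. i \<in> {1..m+n} \<Longrightarrow> j \<in> {1..m+n} \<Longrightarrow>
      \<Delta> (gl_gen_class m n (Var i j)) = gl_generated.gamma (kGL m n) m n (gl_gen_class m n) i j"
proof -
  interpret gl_generated "kGL m n :: ('k, _) superalg" m n "gl_gen_class m n" by (rule kGL_generated)
  define g where "g x = (case x of Var i j \<Rightarrow> gamma i j
    | DInv1 \<Rightarrow> gamma_inverse {1..m} (gl_gen_class m n DInv1)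
    | DInv2 \<Rightarrow> gamma_inverse {m+1..m+n} (gl_gen_class m n DInv2))" for x
  have gp: "gamma i j \<in> part T (gl_parity m (Var i j))" if "i \<in> {1..m+n}" "j \<in> {1..m+n}" for i j
    unfolding gamma_def gl_parity_index
  proof (rule TT.T.part_finsum)
    fix l assume l: "l \<in> {1..m+n}"
    show "tens (kGL m n) (kGL m n) (a i l) (a l j) \<in> part T (index_parity i + index_parity j)"
      using supermatrix_part[OF supermatrix_gen, of i l] supermatrix_part[OF supermatrix_gen, of l j] that l
      by (intro TT.tens_part'[of _ "index_parity i + index_parity l" _ "index_parity l + index_parity j"])
        (simp_all only: add.assoc bit_add_self)
  qed simp
  have part: "g x \<in> part T (gl_parity m x)" if "x \<in> gl_gens m n" for x
    using that gp gamma_det_inverse1(1) gamma_det_inverse2(1) by (cases x) (simp_all add: g_def)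
  \<comment> \<open>The universal property asks for the inverse on the left, while the series was
    obtained as a right inverse; even elements commute.\<close>
  have comm: "x \<otimes>\<^bsub>T\<^esub> y = \<one>\<^bsub>T\<^esub>" if "x \<in> part T 0" "y \<in> part T 0" "y \<otimes>\<^bsub>T\<^esub> x = \<one>\<^bsub>T\<^esub>" for x y
    using TT.T.E.m_comm[of x y] that by simp
  have "g DInv1 \<otimes>\<^bsub>T\<^esub> mat_det T {1..m} (\<lambda>i j. g (Var i j)) = \<one>\<^bsub>T\<^esub>"
    unfolding g_def gl_gen.case
    by (rule comm[OF gamma_det_inverse1(1) TT.T.mat_det_even gamma_det_inverse1(2)])
      (simp_all only: finite_atLeastAtMost gamma_even)
  moreover have "g DInv2 \<otimes>\<^bsub>T\<^esub> mat_det T {m+1..m+n} (\<lambda>i j. g (Var i j)) = \<one>\<^bsub>T\<^esub>"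
    unfolding g_def gl_gen.case
    by (rule comm[OF gamma_det_inverse2(1) TT.T.mat_det_even gamma_det_inverse2(2)])
      (simp_all only: finite_atLeastAtMost gamma_even)
  ultimately obtain h where h: "h \<in> superalg_hom (kGL m n) T"
    "\<And>x. x \<in> gl_gens m n \<Longrightarrow> h (gl_gen_class m n x) = g x"
    using kGL_universal[OF TT.T.strict_salg_axioms part] by blast
  show ?thesis
    by (rule that[OF h(1)]) (simp add: h(2) g_def)
qed

lemma kGL_counit_exists:
  fixes m n :: nat
  obtains \<epsilon> where "\<epsilon> \<in> superalg_hom (kGL m n :: ('k::field, _) superalg) ground"
    "\<And>i j. i \<in> {1..m+n} \<Longrightarrow> j \<in> {1..m+n} \<Longrightarrow>
      \<epsilon> (gl_gen_class m n (Var i j)) = (if i = j then 1 else 0)"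
proof -
  interpret G: strict_salg "ground :: ('k, 'k) superalg" by (rule strict_salg_ground)
  define g :: "gl_gen \<Rightarrow> 'k" where "g x = (case x of Var i j \<Rightarrow> if i = j then 1 else 0 | _ \<Rightarrow> 1)" for x
  have part: "g x \<in> part ground (gl_parity m x)" for x by (cases x) (auto simp: g_def)
  have det: "mat_det ground I (\<lambda>i j. g (Var i j)) = 1" if "finite I" for I
    using G.mat_det_one[OF that] unfolding g_def gl_gen.case ground_simps .
  obtain h where h: "h \<in> superalg_hom (kGL m n) (ground :: ('k, 'k) superalg)"
    "\<And>x. x \<in> gl_gens m n \<Longrightarrow> h (gl_gen_class m n x) = g x"
  proof (rule kGL_universal[OF G.strict_salg_axioms part])
    show "g DInv1 \<otimes>\<^bsub>ground\<^esub> mat_det ground {1..m} (\<lambda>i j. g (Var i j)) = \<one>\<^bsub>ground\<^esub>"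
      "g DInv2 \<otimes>\<^bsub>ground\<^esub> mat_det ground {m+1..m+n} (\<lambda>i j. g (Var i j)) = \<one>\<^bsub>ground\<^esub>"
      by (simp_all add: det) (simp_all add: g_def)
  qed (rule that)
  show ?thesis by (rule that[OF h(1)]) (simp add: h(2) g_def)
qed

section \<open>The quotient by the Berezinian relation\<close>

lemma (in homogeneous_ideal) strict_quotient:
  assumes "strict_salg A"
  shows "strict_salg Q"
proof (intro strict_salg.intro strict_salg_axioms.intro Q.salg_axioms)
  interpret S: strict_salg A by fact
  fix x y p q assume "x \<in> part Q p" "y \<in> part Q q"
  then obtain a b where ab: "a \<in> part A p" "b \<in> part A q" "x = I +> a" "y = I +> b"
    by (auto simp: part_quotient)
  have c: "a \<in> carrier A" "b \<in> carrier A" using part_closed ab(1,2) by blast+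
  have "x \<otimes>\<^bsub>Q\<^esub> y = I +> (a \<otimes> b)" using coset_mult[OF c] ab(3,4) by simp
  also have "\<dots> = koszul_sign p q \<odot>\<^bsub>Q\<^esub> (y \<otimes>\<^bsub>Q\<^esub> x)"
    unfolding S.supercomm[OF ab(1,2)] ab(3,4) coset_mult[OF c(2,1)] coset_smult[OF m_closed[OF c(2,1)]] ..
  finally show "x \<otimes>\<^bsub>Q\<^esub> y = koszul_sign p q \<odot>\<^bsub>Q\<^esub> (y \<otimes>\<^bsub>Q\<^esub> x)" .
next
  interpret S: strict_salg A by fact
  fix x assume "x \<in> part Q 1"
  then obtain a where a: "a \<in> part A 1" "x = I +> a" by (auto simp: part_quotient)
  have "a \<in> carrier A" using a(1) by (rule part_closed)
  then show "x \<otimes>\<^bsub>Q\<^esub> x = \<zero>\<^bsub>Q\<^esub>"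
    unfolding a(2) by (simp only: coset_mult S.odd_square[OF a(1)] coset_zero)
qed

context gl_generated
begin

text \<open>Every clause of \<open>gl_generated\<close> passes to a graded quotient, since the
  quotient map is a surjective homomorphism and commutes with determinants. In this way k[SL(m|n)]
  becomes an instance.\<close>

lemma quotient_generated:
  assumes "homogeneous_ideal A I"
  shows "gl_generated (quotient_superalg A I) m n (\<lambda>x. I +> gen x)"
proof -
  interpret H: homogeneous_ideal A I by fact
  have det: "(I +> y) \<otimes>\<^bsub>H.Q\<^esub> mat_det H.Q K (\<lambda>i j. I +> a i j) = \<one>\<^bsub>H.Q\<^esub>"
    if "y \<in> part A 0" "K \<subseteq> {1..m+n}" "y \<otimes> mat_det A K a = \<one>" "mat_det A K a \<in> part A 0" for y K
  proof -
    have fK: "finite K" using that(2) by (rule finite_subset) simp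
    have e: "a i j \<in> carrier A" if "i \<in> K" "j \<in> K" for i j
      using that \<open>K \<subseteq> _\<close> by (intro gen_entry) blast+
    have d: "mat_det H.Q K (\<lambda>i j. I +> a i j) = I +> mat_det A K a"
      using H.coset.hom_mat_det[of K a, OF fK e] by (rule sym)
    show ?thesis
      unfolding d H.coset.hom_mult[OF part_closed[OF that(1)] part_closed[OF that(4)], symmetric] that(3)
      by (rule H.coset.hom_one)
  qed
  show ?thesis
  proof (intro gl_generated.intro gl_generated_axioms.intro H.strict_quotient strict_salg_axioms)
    fix y assume "y \<in> carrier H.Q"
    then obtain x where x: "x \<in> carrier A" "y = I +> x" by (auto simp: H.carrier_quotient)
    obtain f where f: "f \<in> carrier (gl_free m n)" "x = free_eval A gen f" using generated[OF x(1)] by blast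
    have "y = free_eval H.Q (\<lambda>x. I +> gen x) f"
      unfolding x(2) f(2)
      by (rule H.coset.hom_free_eval[of "gl_gens m n" gen f "gl_parity m", OF gen_closed])
        (use f(1) in \<open>simp_all only: gl_free_eq\<close>)
    then show "\<exists>f\<in>carrier (gl_free m n). y = free_eval H.Q (\<lambda>x. I +> gen x) f" using f(1) by blast
  next
    show "(I +> gen DInv1) \<otimes>\<^bsub>H.Q\<^esub> mat_det H.Q {1..m} (\<lambda>i j. I +> a i j) = \<one>\<^bsub>H.Q\<^esub>"
      by (rule det[OF inv_even(1) _ inv1 d_even(1)[unfolded d1_def]]) auto
    show "(I +> gen DInv2) \<otimes>\<^bsub>H.Q\<^esub> mat_det H.Q {m+1..m+n} (\<lambda>i j. I +> a i j) = \<one>\<^bsub>H.Q\<^esub>"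
      by (rule det[OF inv_even(2) _ inv2 d_even(2)[unfolded d2_def]]) auto
  qed (rule H.coset.hom_part[OF gen_part])
qed

lemma berezinian_gen_even: "berezinian m n A a \<in> part A 0"
proof -
  obtain Y where "inverse_block (pad a) Y"
    using inverse_block_exists[OF supermatrix_gen inv_even(2) inv2] .
  note Y = inverse_block_mat_inv[OF supermatrix_gen this]
  show ?thesis by (rule berezinian_even[OF supermatrix_gen Y])
qed

text \<open>Applied entrywise, \<Delta> turns the generic matrix into the product of a \<otimes> 1
  and 1 \<otimes> a. Multiplicativity of the Berezinian in the tensor square then gives (Ber
  \<otimes> 1)(1 \<otimes> Ber).\<close>

lemma comult_berezinian:
  assumes \<Delta>: "\<Delta> \<in> superalg_hom A T"
    and var: "\<And>i j. i \<in> {1..m+n} \<Longrightarrow> j \<in> {1..m+n} \<Longrightarrow> \<Delta> (a i j) = gamma i j"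
  shows "\<Delta> (berezinian m n A a) = tens A A (berezinian m n A a) (berezinian m n A a)"
proof -
  interpret \<Delta>: salg_hom A T \<Delta> using \<Delta> by (rule salg_hom_comult)
  interpret l: salg_hom A T "\<lambda>x. tens A A x \<one>" by unfold_locales (rule TT.tens_left_hom)
  interpret r: salg_hom A T "\<lambda>x. tens A A \<one> x" by unfold_locales (rule TT.tens_right_hom)
  interpret IT: interval_blocks T m n by (rule interval_blocks.intro) (rule TT.T.strict_salg_axioms)
  let ?b = "berezinian m n A a"
  \<comment> \<open>These facts hold for any homomorphism into the tensor square; they are used for
    the two embeddings and for \<Delta>.\<close>
  have unit: "h (gen DInv2) \<in> part T 0" "h (gen DInv2) \<otimes>\<^bsub>T\<^esub> mat_det T {m+1..m+n} (\<lambda>i j. h (a i j)) = \<one>\<^bsub>T\<^esub>"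
      "IT.supermatrix (\<lambda>i j. h (a i j))"
      "h ?b = berezinian m n T (\<lambda>i j. h (a i j))"
    if "salg_hom A T h" for h
  proof -
    interpret h: salg_hom A T h by fact
    show "h (gen DInv2) \<in> part T 0" by (rule h.hom_part[OF inv_even(2)])
    have "h (mat_det A {m+1..m+n} a) = mat_det T {m+1..m+n} (\<lambda>i j. h (a i j))"
      by (rule h.hom_mat_det[OF _ gen_entry]) auto
    then show "h (gen DInv2) \<otimes>\<^bsub>T\<^esub> mat_det T {m+1..m+n} (\<lambda>i j. h (a i j)) = \<one>\<^bsub>T\<^esub>"
      using h.hom_mult[OF part_closed[OF inv_even(2)] part_closed[OF d_even(2)[unfolded d2_def]]] inv2 by simp
    show "IT.supermatrix (\<lambda>i j. h (a i j))"
      unfolding IT.supermatrix_def by (intro ballI h.hom_part gen_part) simp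
    show "h ?b = berezinian m n T (\<lambda>i j. h (a i j))"
      by (rule hom_berezinian[OF strict_salg_axioms TT.T.strict_salg_axioms that supermatrix_gen inv_even(2) inv2])
  qed
  let ?\<alpha> = "\<lambda>i j. tens A A (a i j) \<one>" and ?\<beta> = "\<lambda>i j. tens A A \<one> (a i j)"
  note \<alpha> = unit[OF l.salg_hom_axioms] and \<beta> = unit[OF r.salg_hom_axioms] and \<delta> = unit[OF \<Delta>.salg_hom_axioms]
  have b: "?b \<in> part A 0" "?b \<in> carrier A" using berezinian_gen_even part_closed by blast+
  have eq: "\<Delta> (a i j) = (\<Oplus>\<^bsub>T\<^esub>l\<in>{1..m+n}. ?\<alpha> i l \<otimes>\<^bsub>T\<^esub> ?\<beta> l j)"
    if ij: "i \<in> {1..m+n}" "j \<in> {1..m+n}" for i j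
    unfolding var[OF ij] gamma_def
  proof (rule TT.V.finsum_cong'[OF refl funcsetI])
    fix l assume l: "l \<in> {1..m+n}"
    have c: "a i l \<in> carrier A" "a l j \<in> carrier A" using gen_entry ij l by blast+
    show "tens A A (a i l) (a l j) = ?\<alpha> i l \<otimes>\<^bsub>T\<^esub> ?\<beta> l j"
      using TT.tens_mult_left_even[OF c(1) part_one one_closed c(2)] c by simp
    show "?\<alpha> i l \<otimes>\<^bsub>T\<^esub> ?\<beta> l j \<in> carrier T" using c by simp
  qed
  have sm: "IT.supermatrix (\<lambda>i j. \<Oplus>\<^bsub>T\<^esub>l\<in>{1..m+n}. ?\<alpha> i l \<otimes>\<^bsub>T\<^esub> ?\<beta> l j)"
    using \<delta>(3) eq unfolding IT.supermatrix_def by simp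
  have "\<Delta> ?b = berezinian m n T (\<lambda>i j. \<Oplus>\<^bsub>T\<^esub>l\<in>{1..m+n}. ?\<alpha> i l \<otimes>\<^bsub>T\<^esub> ?\<beta> l j)"
    unfolding \<delta>(4) by (rule IT.berezinian_cong[OF \<delta>(3) sm eq \<delta>(1,2)])
  also have "\<dots> = tens A A ?b \<one> \<otimes>\<^bsub>T\<^esub> tens A A \<one> ?b"
    unfolding \<alpha>(4) \<beta>(4) by (rule IT.berezinian_mult[OF \<alpha>(3) \<beta>(3) \<alpha>(1,2) \<beta>(1,2)])
  also have "\<dots> = tens A A ?b ?b"
    using TT.tens_mult_left_even[OF b(2) part_one one_closed b(2)] b by simp
  finally show ?thesis .
qed

text \<open>The counit maps the generic matrix to the identity matrix, and the Berezinian commutes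
  with homomorphisms.\<close>

lemma counit_berezinian:
  assumes \<epsilon>: "\<epsilon> \<in> superalg_hom A ground"
    and var: "\<And>i j. i \<in> {1..m+n} \<Longrightarrow> j \<in> {1..m+n} \<Longrightarrow> \<epsilon> (a i j) = (if i = j then 1 else 0)"
  shows "\<epsilon> (berezinian m n A a) = 1"
proof -
  have G: "strict_salg (ground :: ('k, 'k) superalg)" by (rule strict_salg_ground)
  interpret IG: interval_blocks "ground :: ('k, 'k) superalg" m n by (rule interval_blocks.intro[OF G])
  have \<epsilon>': "salg_hom A ground \<epsilon>" by unfold_locales (rule \<epsilon>)
  interpret \<epsilon>: salg_hom A ground \<epsilon> by fact
  have s: "IG.supermatrix (\<lambda>i j. \<epsilon> (a i j))"
    unfolding IG.supermatrix_def by (intro ballI \<epsilon>.hom_part gen_part) simp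
  have eq: "\<epsilon> (a i j) = (if i = j then \<one>\<^bsub>ground\<^esub> else \<zero>\<^bsub>ground\<^esub>)"
    if "i \<in> {1..m+n}" "j \<in> {1..m+n}" for i j
    unfolding var[OF that] ground_simps ..
  have s1: "IG.supermatrix (\<lambda>i j. if i = j then \<one>\<^bsub>ground\<^esub> else \<zero>\<^bsub>ground\<^esub>)"
    unfolding IG.supermatrix_def by simp
  have "\<epsilon> (mat_det A {m+1..m+n} a) = mat_det ground {m+1..m+n} (\<lambda>i j. \<epsilon> (a i j))"
    by (rule \<epsilon>.hom_mat_det[OF _ gen_entry]) auto
  moreover have "\<epsilon> (mat_det A {m+1..m+n} a) = 1" by (rule counit_det[OF \<epsilon> var]) auto
  ultimately have u: "1 \<otimes>\<^bsub>ground\<^esub> mat_det ground {m+1..m+n} (\<lambda>i j. \<epsilon> (a i j)) = \<one>\<^bsub>ground\<^esub>" by simp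
  have u0: "1 \<in> part (ground :: ('k, 'k) superalg) 0" by simp
  have "\<epsilon> (berezinian m n A a) = berezinian m n ground (\<lambda>i j. \<epsilon> (a i j))"
    by (rule hom_berezinian[OF strict_salg_axioms G \<epsilon>' supermatrix_gen inv_even(2) inv2])
  also have "\<dots> = berezinian m n ground (\<lambda>i j. if i = j then \<one>\<^bsub>ground\<^esub> else \<zero>\<^bsub>ground\<^esub>)"
    by (rule IG.berezinian_cong[OF s s1 eq u0 u])
  also have "\<dots> = 1" using IG.berezinian_one by simp
  finally show ?thesis .
qed

lemma berezinian_homogeneous_ideal: "homogeneous_ideal A (Idl {berezinian m n A a \<ominus> \<one>})"
  using part_minus[OF berezinian_gen_even part_one] by (intro homogeneous_genideal) auto

text \<open>Followed by the projection in both tensor factors, \<Delta> sends Ber to 1 \<otimes> 1.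
  Hence it kills Ber - 1 together with the ideal generated by it, and descends.\<close>

lemma sl_comult_exists:
  assumes \<Delta>: "\<Delta> \<in> superalg_hom A T"
    and var: "\<And>i j. i \<in> {1..m+n} \<Longrightarrow> j \<in> {1..m+n} \<Longrightarrow> \<Delta> (a i j) = gamma i j"
    and I: "I = Idl {berezinian m n A a \<ominus> \<one>}"
  obtains \<Delta>' where
    "\<Delta>' \<in> superalg_hom (quotient_superalg A I) (tensor (quotient_superalg A I) (quotient_superalg A I))"
    "\<And>i j. i \<in> {1..m+n} \<Longrightarrow> j \<in> {1..m+n} \<Longrightarrow>
      \<Delta>' (I +> a i j) = gl_generated.gamma (quotient_superalg A I) m n (\<lambda>x. I +> gen x) i j"
proof -
  let ?b = "berezinian m n A a"
  have H: "homogeneous_ideal A I" unfolding I by (rule berezinian_homogeneous_ideal)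
  interpret H: homogeneous_ideal A I by (rule H)
  interpret Q: gl_generated H.Q m n "\<lambda>x. I +> gen x" by (rule quotient_generated[OF H])
  interpret \<Delta>: salg_hom A T \<Delta> using \<Delta> by (rule salg_hom_comult)
  define \<pi> where "\<pi> x = I +> x" for x
  interpret \<pi>: salg_hom A H.Q \<pi> unfolding \<pi>_def by (rule H.coset.salg_hom_axioms)
  let ?p = "tensor_map H.Q H.Q \<pi> \<pi>"
  interpret p: salg_hom T Q.T ?p
    by unfold_locales (rule tensor_map_hom[OF \<pi>.salg_hom_axioms \<pi>.salg_hom_axioms])
  note pt = tensor_map_tens[OF \<pi>.salg_hom_axioms \<pi>.salg_hom_axioms]
  define F where "F x = ?p (\<Delta> x)" for x
  interpret F: salg_hom A Q.T F unfolding F_def by unfold_locales (rule \<Delta>.comp[OF p.superalg_hom])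
  have b: "?b \<in> carrier A" "?b \<ominus> \<one> \<in> carrier A" using part_closed[OF berezinian_gen_even] by simp_all
  have "?b \<ominus> \<one> \<in> I" unfolding I using b by (intro genideal_self') simp
  then have \<pi>b: "\<pi> ?b = \<one>\<^bsub>H.Q\<^esub>" unfolding \<pi>_def H.coset_one using b by (subst H.coset_eq_iff) simp_all
  have \<Delta>b: "\<Delta> ?b = tens A A ?b ?b" by (rule comult_berezinian[OF \<Delta> var])
  have "F ?b = \<one>\<^bsub>Q.T\<^esub>"
    unfolding F_def \<Delta>b pt[OF b(1) b(1)] \<pi>b by (simp add: Q.TT.tensor_one)
  then have "F (?b \<ominus> \<one>) = \<zero>\<^bsub>Q.T\<^esub>" using b(1) by (simp add: Q.TT.V.minus_eq Q.TT.V.r_neg)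
  then have "F x = \<zero>\<^bsub>Q.T\<^esub>" if "x \<in> I" for x
    using F.vanishes_on_genideal[of "{?b \<ominus> \<one>}" x] that b(2) unfolding I by simp
  then interpret q: quotient_hom A I Q.T F by unfold_locales
  show ?thesis
  proof (rule that)
    show "quotient_lift F \<in> superalg_hom H.Q Q.T" by (rule q.lift_hom)
    fix i j assume ij: "i \<in> {1..m+n}" "j \<in> {1..m+n}"
    have c: "tens A A (a i l) (a l j) \<in> carrier T" if "l \<in> {1..m+n}" for l
      using gen_entry[OF ij(1) that] gen_entry[OF that ij(2)] by simp
    have "quotient_lift F (I +> a i j) = ?p (gamma i j)"
      unfolding q.lift_coset[OF gen_entry[OF ij]] F_def var[OF ij] ..
    also have "\<dots> = (\<Oplus>\<^bsub>Q.T\<^esub>l\<in>{1..m+n}. ?p (tens A A (a i l) (a l j)))"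
      unfolding gamma_def by (intro p.hom_finsum) (simp_all add: c)
    also have "\<dots> = Q.gamma i j"
      unfolding Q.gamma_def
    proof (rule Q.TT.V.finsum_cong'[OF refl funcsetI])
      fix l assume l: "l \<in> {1..m+n}"
      show "?p (tens A A (a i l) (a l j)) = tens H.Q H.Q (I +> a i l) (I +> a l j)"
        unfolding pt[OF gen_entry[OF ij(1) l] gen_entry[OF l ij(2)]] \<pi>_def ..
      show "tens H.Q H.Q (I +> a i l) (I +> a l j) \<in> carrier Q.T"
        by (rule Q.TT.tens_closed[OF Q.gen_entry[OF ij(1) l] Q.gen_entry[OF l ij(2)]])
    qed
    finally show "quotient_lift F (I +> a i j) = Q.gamma i j" .
  qed
qed

lemma sl_counit_exists:
  assumes \<epsilon>: "\<epsilon> \<in> superalg_hom A ground"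
    and var: "\<And>i j. i \<in> {1..m+n} \<Longrightarrow> j \<in> {1..m+n} \<Longrightarrow> \<epsilon> (a i j) = (if i = j then 1 else 0)"
    and I: "I = Idl {berezinian m n A a \<ominus> \<one>}"
  obtains \<epsilon>' where "\<epsilon>' \<in> superalg_hom (quotient_superalg A I) ground"
    "\<And>i j. i \<in> {1..m+n} \<Longrightarrow> j \<in> {1..m+n} \<Longrightarrow> \<epsilon>' (I +> a i j) = (if i = j then 1 else 0)"
proof -
  let ?b = "berezinian m n A a"
  have H: "homogeneous_ideal A I" unfolding I by (rule berezinian_homogeneous_ideal)
  interpret H: homogeneous_ideal A I by (rule H)
  interpret G: strict_salg "ground :: ('k, 'k) superalg" by (rule strict_salg_ground)
  interpret \<epsilon>: salg_hom A ground \<epsilon> by unfold_locales (rule \<epsilon>)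
  have b: "?b \<in> carrier A" "?b \<ominus> \<one> \<in> carrier A" using part_closed[OF berezinian_gen_even] by simp_all
  have "\<epsilon> (?b \<ominus> \<one>) = \<one>\<^bsub>ground\<^esub> \<ominus>\<^bsub>ground\<^esub> \<one>\<^bsub>ground\<^esub>"
    using \<epsilon>.hom_minus[OF b(1) one_closed] counit_berezinian[OF \<epsilon> var] by simp
  also have "\<dots> = \<zero>\<^bsub>ground\<^esub>" unfolding G.minus_eq by (rule G.r_neg[OF G.one_closed])
  finally have "\<epsilon> x = \<zero>\<^bsub>ground\<^esub>" if "x \<in> I" for x
    using \<epsilon>.vanishes_on_genideal[of "{?b \<ominus> \<one>}" x] that b(2) unfolding I by simp
  then interpret q: quotient_hom A I ground \<epsilon> by unfold_locales
  show ?thesis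
  proof (rule that[OF q.lift_hom])
    fix i j assume ij: "i \<in> {1..m+n}" "j \<in> {1..m+n}"
    show "quotient_lift \<epsilon> (I +> a i j) = (if i = j then 1 else 0)"
      unfolding q.lift_coset[OF gen_entry[OF ij]] by (rule var[OF ij])
  qed
qed

end

text \<open>The maps are described by their values on generators, so the statement also asserts that
  these values determine them. Equality is claimed on the carrier, since off the carrier the maps
  are arbitrary functions.\<close>

theorem proposition3p4:
  fixes m n :: nat
  assumes "m \<ge> 1" and "n \<ge> 1"
  shows
    "commutative_superalgebra
       (kGL m n :: ('k::alg_closed_field, (gl_gen word \<Rightarrow>\<^sub>0 'k) set) superalg) \<and>
     (\<exists>\<Delta> \<epsilon>.
        is_gl_comult m n (kGL m n :: ('k, (gl_gen word \<Rightarrow>\<^sub>0 'k) set) superalg) (gl_gen_class m n) \<Delta> \<and>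
        is_gl_counit m n (kGL m n :: ('k, (gl_gen word \<Rightarrow>\<^sub>0 'k) set) superalg) (gl_gen_class m n) \<epsilon> \<and>
        superbialgebra (kGL m n) \<Delta> \<epsilon> \<and>
        (\<forall>\<Delta>'. is_gl_comult m n (kGL m n) (gl_gen_class m n) \<Delta>' \<longrightarrow>
           (\<forall>x \<in> carrier (kGL m n). \<Delta>' x = \<Delta> x)) \<and>
        (\<forall>\<epsilon>'. is_gl_counit m n (kGL m n) (gl_gen_class m n) \<epsilon>' \<longrightarrow>
           (\<forall>x \<in> carrier (kGL m n). \<epsilon>' x = \<epsilon> x))) \<and>
     commutative_superalgebra
       (kSL m n :: ('k, (gl_gen word \<Rightarrow>\<^sub>0 'k) set set) superalg) \<and>
     (\<exists>\<Delta> \<epsilon>.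
        is_gl_comult m n (kSL m n :: ('k, (gl_gen word \<Rightarrow>\<^sub>0 'k) set set) superalg) (sl_gen_class m n) \<Delta> \<and>
        is_gl_counit m n (kSL m n :: ('k, (gl_gen word \<Rightarrow>\<^sub>0 'k) set set) superalg) (sl_gen_class m n) \<epsilon> \<and>
        superbialgebra (kSL m n) \<Delta> \<epsilon> \<and>
        (\<forall>\<Delta>'. is_gl_comult m n (kSL m n) (sl_gen_class m n) \<Delta>' \<longrightarrow>
           (\<forall>x \<in> carrier (kSL m n). \<Delta>' x = \<Delta> x)) \<and>
        (\<forall>\<epsilon>'. is_gl_counit m n (kSL m n) (sl_gen_class m n) \<epsilon>' \<longrightarrow>
           (\<forall>x \<in> carrier (kSL m n). \<epsilon>' x = \<epsilon> x)))"
proof -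
  interpret A: gl_generated "kGL m n :: ('k, _) superalg" m n "gl_gen_class m n" by (rule kGL_generated)
  let ?I = "sl_ideal m n :: (gl_gen word \<Rightarrow>\<^sub>0 'k) set set"
  have var: "gl_var m n = (\<lambda>i j. gl_gen_class m n (Var i j) :: (gl_gen word \<Rightarrow>\<^sub>0 'k) set)"
    by (simp add: gl_var_def fun_eq_iff)
  have I: "?I = Idl\<^bsub>kGL m n\<^esub> {berezinian m n (kGL m n) A.a \<ominus>\<^bsub>kGL m n\<^esub> \<one>\<^bsub>kGL m n\<^esub>}"
    unfolding sl_ideal_def var ..
  have H: "homogeneous_ideal (kGL m n) ?I" unfolding I by (rule A.berezinian_homogeneous_ideal)
  have cls: "sl_gen_class m n = (\<lambda>x. ?I +>\<^bsub>kGL m n\<^esub> gl_gen_class m n x)"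
    by (simp add: sl_gen_class_def fun_eq_iff)
  \<comment> \<open>With k[SL(m|n)] as a second instance of the same locale, the bialgebra argument
    is not repeated; only the existence of \<Delta> and \<epsilon> remains to be
    transferred.\<close>
  interpret S: gl_generated "kSL m n :: ('k, _) superalg" m n "sl_gen_class m n"
    unfolding kSL_def cls by (rule A.quotient_generated[OF H])
  obtain \<Delta> where \<Delta>: "\<Delta> \<in> superalg_hom (kGL m n) A.T"
    "\<And>i j. i \<in> {1..m+n} \<Longrightarrow> j \<in> {1..m+n} \<Longrightarrow> \<Delta> (A.a i j) = A.gamma i j"
    by (rule kGL_comult_exists[of m n]) (rule that)
  obtain \<epsilon> where \<epsilon>: "\<epsilon> \<in> superalg_hom (kGL m n :: ('k, _) superalg) ground"
    "\<And>i j. i \<in> {1..m+n} \<Longrightarrow> j \<in> {1..m+n} \<Longrightarrow> \<epsilon> (A.a i j) = (if i = j then 1 else 0)"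
    by (rule kGL_counit_exists[of m n]) (rule that)
  obtain \<Delta>' where \<Delta>': "\<Delta>' \<in> superalg_hom (kSL m n) S.T"
    "\<And>i j. i \<in> {1..m+n} \<Longrightarrow> j \<in> {1..m+n} \<Longrightarrow> \<Delta>' (S.a i j) = S.gamma i j"
    by (rule A.sl_comult_exists[OF \<Delta> I, folded kSL_def sl_gen_class_def]) (assumption | rule that)+
  obtain \<epsilon>' where \<epsilon>': "\<epsilon>' \<in> superalg_hom (kSL m n :: ('k, _) superalg) ground"
    "\<And>i j. i \<in> {1..m+n} \<Longrightarrow> j \<in> {1..m+n} \<Longrightarrow> \<epsilon>' (S.a i j) = (if i = j then 1 else 0)"
    by (rule A.sl_counit_exists[OF \<epsilon> I, folded kSL_def sl_gen_class_def]) (assumption | rule that)+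
  show ?thesis
    by (intro conjI[OF A.commutative_superalgebra conjI[OF _ conjI[OF S.commutative_superalgebra]]] exI)
      (rule A.gl_bialgebra[OF \<Delta> \<epsilon>] S.gl_bialgebra[OF \<Delta>' \<epsilon>']; assumption)+
qed

end
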